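(* Let $G$ be a finitely generated Demushkin pro-$p$ group. Then the algebras $H^\bullet(G,\mathbb{F}_p)$ and $\mathrm{gr}\,\mathbb{F}_p[\![G]\!]$ are quadratic dual to each other and both are PBW algebras (hence Koszul).
   Context: A Demushkin group is a pro-$p$ group $G$ with $\dim_{\mathbb{F}_p}H^1(G,\mathbb{F}_p)<\infty$, $H^2(G,\mathbb{F}_p)\cong\mathbb{F}_p$, and such that the cup product $H^1(G,\mathbb{F}_p)\times H^1(G,\mathbb{F}_p)\to H^2(G,\mathbb{F}_p)\cong\mathbb{F}_p$ is a non-degenerate pairing (no assumption is made on the associated cyclotomic character; the group of order $2$ is included). $\mathrm{gr}\,\mathbb{F}_p[\![G]\!]=\bigoplus_{n\ge0}\widehat I^n/\widehat I^{n+1}$ where $\widehat I$ is the augmentation ideal of the complete group algebra $\mathbb{F}_p[\![G]\!]=\varprojlim_U\mathbb{F}_p[G/U]$. Quadratic dual of $T_\bullet(V)/(\Omega)$: $T_\bullet(V^* )/(\Omega^\perp)$. PBW: there exist an ordered basis of generators, an admissible monomial order and a normalized basis of the quadratic relations such that every critical degree-3 monomial is confluent under rewriting of leading monomials; Koszul: the trivial module has a linear graded free resolution. *)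

theory Defs
  imports
    "HOL-Analysis.Analysis"
    "HOL-Algebra.Coset"
    "HOL-Algebra.Generated_Groups"
    "HOL-Library.Function_Algebras"
    "HOL-Library.Set_Algebras"
    "Berlekamp_Zassenhaus.Finite_Field"
begin

section \<open>Graded algebras\<close>

text \<open>
  A graded algebra is given externally: one vector space per degree, with the multiplication maps
  between the degrees.  All operations carry the degrees of their arguments.
\<close>

record ('k, 'a) graded_algebra =
  gcomp :: "nat \<Rightarrow> 'a set"
  gzero :: "nat \<Rightarrow> 'a"
  gadd :: "nat \<Rightarrow> 'a \<Rightarrow> 'a \<Rightarrow> 'a"
  gsmult :: "nat \<Rightarrow> 'k \<Rightarrow> 'a \<Rightarrow> 'a"
  gone :: "'a"
  gmult :: "nat \<Rightarrow> nat \<Rightarrow> 'a \<Rightarrow> 'a \<Rightarrow> 'a"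

locale connected_graded_algebra =
  fixes A :: "('k::field, 'a) graded_algebra"
  assumes zero_closed: "gzero A n \<in> gcomp A n"
    and add_closed: "x \<in> gcomp A n \<Longrightarrow> y \<in> gcomp A n \<Longrightarrow> gadd A n x y \<in> gcomp A n"
    and add_assoc: "x \<in> gcomp A n \<Longrightarrow> y \<in> gcomp A n \<Longrightarrow> z \<in> gcomp A n \<Longrightarrow>
      gadd A n (gadd A n x y) z = gadd A n x (gadd A n y z)"
    and add_comm: "x \<in> gcomp A n \<Longrightarrow> y \<in> gcomp A n \<Longrightarrow> gadd A n x y = gadd A n y x"
    and add_zero: "x \<in> gcomp A n \<Longrightarrow> gadd A n (gzero A n) x = x"
    and add_neg: "x \<in> gcomp A n \<Longrightarrow> gadd A n x (gsmult A n (- 1) x) = gzero A n"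
    and smult_closed: "x \<in> gcomp A n \<Longrightarrow> gsmult A n c x \<in> gcomp A n"
    and smult_one: "x \<in> gcomp A n \<Longrightarrow> gsmult A n 1 x = x"
    and smult_smult: "x \<in> gcomp A n \<Longrightarrow> gsmult A n b (gsmult A n c x) = gsmult A n (b * c) x"
    and smult_add_left: "x \<in> gcomp A n \<Longrightarrow>
      gsmult A n (b + c) x = gadd A n (gsmult A n b x) (gsmult A n c x)"
    and smult_add_right: "x \<in> gcomp A n \<Longrightarrow> y \<in> gcomp A n \<Longrightarrow>
      gsmult A n c (gadd A n x y) = gadd A n (gsmult A n c x) (gsmult A n c y)"
    and mult_closed: "x \<in> gcomp A m \<Longrightarrow> y \<in> gcomp A n \<Longrightarrow> gmult A m n x y \<in> gcomp A (m + n)"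
    and mult_assoc: "x \<in> gcomp A l \<Longrightarrow> y \<in> gcomp A m \<Longrightarrow> z \<in> gcomp A n \<Longrightarrow>
      gmult A (l + m) n (gmult A l m x y) z = gmult A l (m + n) x (gmult A m n y z)"
    and mult_add_left: "x \<in> gcomp A m \<Longrightarrow> x' \<in> gcomp A m \<Longrightarrow> y \<in> gcomp A n \<Longrightarrow>
      gmult A m n (gadd A m x x') y = gadd A (m + n) (gmult A m n x y) (gmult A m n x' y)"
    and mult_add_right: "x \<in> gcomp A m \<Longrightarrow> y \<in> gcomp A n \<Longrightarrow> y' \<in> gcomp A n \<Longrightarrow>
      gmult A m n x (gadd A n y y') = gadd A (m + n) (gmult A m n x y) (gmult A m n x y')"
    and mult_smult_left: "x \<in> gcomp A m \<Longrightarrow> y \<in> gcomp A n \<Longrightarrow>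
      gmult A m n (gsmult A m c x) y = gsmult A (m + n) c (gmult A m n x y)"
    and mult_smult_right: "x \<in> gcomp A m \<Longrightarrow> y \<in> gcomp A n \<Longrightarrow>
      gmult A m n x (gsmult A n c y) = gsmult A (m + n) c (gmult A m n x y)"
    and one_closed: "gone A \<in> gcomp A 0"
    and one_mult: "x \<in> gcomp A n \<Longrightarrow> gmult A 0 n (gone A) x = x"
    and mult_one: "x \<in> gcomp A n \<Longrightarrow> gmult A n 0 x (gone A) = x"
    and one_neq_zero: "gone A \<noteq> gzero A 0"
    and connected: "gcomp A 0 = range (\<lambda>c. gsmult A 0 c (gone A))"

definition galg_iso ::
    "('k, 'a) graded_algebra \<Rightarrow> ('k, 'b) graded_algebra \<Rightarrow> (nat \<Rightarrow> 'a \<Rightarrow> 'b) \<Rightarrow> bool" where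
  "galg_iso A B \<phi> \<longleftrightarrow>
     (\<forall>n. bij_betw (\<phi> n) (gcomp A n) (gcomp B n)) \<and>
     (\<forall>n. \<forall>x\<in>gcomp A n. \<forall>y\<in>gcomp A n. \<phi> n (gadd A n x y) = gadd B n (\<phi> n x) (\<phi> n y)) \<and>
     (\<forall>n c. \<forall>x\<in>gcomp A n. \<phi> n (gsmult A n c x) = gsmult B n c (\<phi> n x)) \<and>
     (\<forall>m n. \<forall>x\<in>gcomp A m. \<forall>y\<in>gcomp A n.
        \<phi> (m + n) (gmult A m n x y) = gmult B m n (\<phi> m x) (\<phi> n y)) \<and>
     \<phi> 0 (gone A) = gone B"

definition galg_isomorphic ::
    "('k, 'a) graded_algebra \<Rightarrow> ('k, 'b) graded_algebra \<Rightarrow> bool" where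
  "galg_isomorphic A B \<longleftrightarrow> (\<exists>\<phi>. galg_iso A B \<phi>)"


section \<open>Graded algebras of the form \<open>\<Oplus> Z n / B n\<close>\<close>

definition fscale :: "'k::field \<Rightarrow> ('x \<Rightarrow> 'k) \<Rightarrow> 'x \<Rightarrow> 'k" where
  "fscale c f = (\<lambda>x. c * f x)"

global_interpretation fscale: vector_space "fscale :: 'k::field \<Rightarrow> ('x \<Rightarrow> 'k) \<Rightarrow> 'x \<Rightarrow> 'k"
  by unfold_locales (auto simp: fscale_def fun_eq_iff algebra_simps)

text \<open>
  The elements of degree \<open>n\<close> are the cosets of the subspace \<open>B n\<close> in the subspace \<open>Z n\<close> of a common
  function space; the multiplication is induced by a bilinear multiplication \<open>mul\<close> on representatives.
  It is meaningful when \<open>mul\<close> maps \<open>Z m \<times> Z n\<close> into \<open>Z (m + n)\<close> and \<open>Z m \<times> B n\<close> and \<open>B m \<times> Z n\<close> into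
  \<open>B (m + n)\<close>, as in all uses below.
\<close>

definition subquotient_algebra ::
    "(('x \<Rightarrow> 'k) \<Rightarrow> ('x \<Rightarrow> 'k) \<Rightarrow> 'x \<Rightarrow> 'k) \<Rightarrow> ('x \<Rightarrow> 'k) \<Rightarrow> (nat \<Rightarrow> ('x \<Rightarrow> 'k) set) \<Rightarrow>
     (nat \<Rightarrow> ('x \<Rightarrow> 'k) set) \<Rightarrow> ('k::field, ('x \<Rightarrow> 'k) set) graded_algebra" where
  "subquotient_algebra mul e Z B =
     \<lparr> gcomp = (\<lambda>n. (\<lambda>z. z +o B n) ` Z n),
       gzero = B,
       gadd = (\<lambda>n X Y. X + Y),
       gsmult = (\<lambda>n c X. fscale c ` X + B n),
       gone = e +o B 0,
       gmult = (\<lambda>m n X Y. \<Union>x\<in>X. \<Union>y\<in>Y. mul x y +o B (m + n)) \<rparr>"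


section \<open>Quadratic algebras and quadratic duality\<close>

text \<open>
  The tensor algebra of \<open>V = k^d\<close> is the free associative algebra on letters \<open>0, \<dots>, d - 1\<close>: a tensor
  is the function of its coefficients, indexed by words.
\<close>

definition conc :: "('x list \<Rightarrow> 'k::field) \<Rightarrow> ('x list \<Rightarrow> 'k) \<Rightarrow> 'x list \<Rightarrow> 'k" where
  "conc f g = (\<lambda>w. \<Sum>i\<le>length w. f (take i w) * g (drop i w))"

definition monomial :: "'x list \<Rightarrow> 'x list \<Rightarrow> 'k::field" where
  "monomial u = (\<lambda>w. if w = u then 1 else 0)"

definition tensors :: "nat \<Rightarrow> nat \<Rightarrow> (nat list \<Rightarrow> 'k::field) set" where
  "tensors d n = {f. \<forall>w. f w \<noteq> 0 \<longrightarrow> length w = n \<and> set w \<subseteq> {..<d}}"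

definition relation_space :: "nat \<Rightarrow> (nat list \<Rightarrow> 'k::field) set \<Rightarrow> bool" where
  "relation_space d \<Omega> \<longleftrightarrow> \<Omega> \<subseteq> tensors d 2 \<and> fscale.subspace \<Omega>"

definition ideal_comp ::
    "nat \<Rightarrow> (nat list \<Rightarrow> 'k::field) set \<Rightarrow> nat \<Rightarrow> (nat list \<Rightarrow> 'k) set" where
  "ideal_comp d \<Omega> n = fscale.span
     {conc f (conc \<omega> g) | f \<omega> g i j.
        f \<in> tensors d i \<and> \<omega> \<in> \<Omega> \<and> g \<in> tensors d j \<and> i + 2 + j = n}"

definition quadratic_algebra ::
    "nat \<Rightarrow> (nat list \<Rightarrow> 'k::field) set \<Rightarrow> ('k, (nat list \<Rightarrow> 'k) set) graded_algebra" where
  "quadratic_algebra d \<Omega> = subquotient_algebra conc (monomial []) (tensors d) (ideal_comp d \<Omega>)"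

text \<open>
  \<open>V*\<close> is identified with \<open>k^d\<close> through the dual basis, and \<open>V* \<otimes> V*\<close> with \<open>(V \<otimes> V)*\<close> by
  \<open>(\<alpha> \<otimes> \<beta>) (v \<otimes> w) = \<alpha> v * \<beta> w\<close>.
\<close>

definition orth :: "nat \<Rightarrow> (nat list \<Rightarrow> 'k::field) set \<Rightarrow> (nat list \<Rightarrow> 'k) set" where
  "orth d \<Omega> = {\<eta> \<in> tensors d 2. \<forall>\<omega>\<in>\<Omega>. (\<Sum>i<d. \<Sum>j<d. \<eta> [i, j] * \<omega> [i, j]) = 0}"

definition is_quadratic_dual_of ::
    "('k::field, 'b) graded_algebra \<Rightarrow> ('k, 'a) graded_algebra \<Rightarrow> bool" where
  "is_quadratic_dual_of B A \<longleftrightarrow>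
     (\<exists>d \<Omega>. relation_space d \<Omega> \<and> galg_isomorphic A (quadratic_algebra d \<Omega>) \<and>
            galg_isomorphic B (quadratic_algebra d (orth d \<Omega>)))"


section \<open>PBW algebras\<close>

definition admissible_order :: "nat \<Rightarrow> nat list rel \<Rightarrow> bool" where
  "admissible_order d r \<longleftrightarrow>
     r \<subseteq> lists {..<d} \<times> lists {..<d} \<and> trans r \<and> total_on (lists {..<d}) r \<and> wf r \<and>
     (\<forall>i j. i < j \<and> j < d \<longrightarrow> ([i], [j]) \<in> r) \<and>
     (\<forall>w\<in>lists {..<d}. w \<noteq> [] \<longrightarrow> ([], w) \<in> r) \<and>
     (\<forall>u\<in>lists {..<d}. \<forall>v\<in>lists {..<d}. \<forall>x y. (x, y) \<in> r \<longrightarrow> (u @ x @ v, u @ y @ v) \<in> r)"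

definition leading_monomial ::
    "nat list rel \<Rightarrow> (nat list \<Rightarrow> 'k::field) \<Rightarrow> nat list \<Rightarrow> bool" where
  "leading_monomial r f w \<longleftrightarrow> f w \<noteq> 0 \<and> (\<forall>v. f v \<noteq> 0 \<and> v \<noteq> w \<longrightarrow> (v, w) \<in> r)"

definition normalized_basis ::
    "nat list rel \<Rightarrow> (nat list \<Rightarrow> 'k::field) set \<Rightarrow> (nat list \<Rightarrow> 'k) set \<Rightarrow> bool" where
  "normalized_basis r \<Omega> S \<longleftrightarrow>
     S \<subseteq> \<Omega> \<and> \<not> fscale.dependent S \<and> fscale.span S = \<Omega> \<and>
     (\<forall>\<omega>\<in>S. \<forall>w. leading_monomial r \<omega> w \<longrightarrow> \<omega> w = 1 \<and> (\<forall>\<omega>'\<in>S. \<omega>' \<noteq> \<omega> \<longrightarrow> \<omega>' w = 0))"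

text \<open>
  One rewriting step replaces, in a linear combination of words, an occurrence of a leading monomial
  \<open>w\<close> of \<open>\<omega>\<close> by \<open>w - \<omega>\<close>.
\<close>

definition rewrite_step ::
    "nat list rel \<Rightarrow> (nat list \<Rightarrow> 'k::field) set \<Rightarrow> (nat list \<Rightarrow> 'k) \<Rightarrow> (nat list \<Rightarrow> 'k) \<Rightarrow> bool" where
  "rewrite_step r S f g \<longleftrightarrow>
     (\<exists>\<omega>\<in>S. \<exists>u w v. leading_monomial r \<omega> w \<and> f (u @ w @ v) \<noteq> 0 \<and>
        g = f - fscale (f (u @ w @ v)) (conc (monomial u) (conc \<omega> (monomial v))))"

definition critical_monomial ::
    "nat list rel \<Rightarrow> (nat list \<Rightarrow> 'k::field) set \<Rightarrow> nat list \<Rightarrow> bool" where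
  "critical_monomial r S w \<longleftrightarrow>
     (\<exists>i j l. w = [i, j, l] \<and>
        (\<exists>\<omega>\<in>S. leading_monomial r \<omega> [i, j]) \<and> (\<exists>\<omega>\<in>S. leading_monomial r \<omega> [j, l]))"

definition confluent_monomial ::
    "nat list rel \<Rightarrow> (nat list \<Rightarrow> 'k::field) set \<Rightarrow> nat list \<Rightarrow> bool" where
  "confluent_monomial r S w \<longleftrightarrow>
     (\<forall>f g. (rewrite_step r S)\<^sup>*\<^sup>* (monomial w) f \<and> (rewrite_step r S)\<^sup>*\<^sup>* (monomial w) g \<longrightarrow>
        (\<exists>h. (rewrite_step r S)\<^sup>*\<^sup>* f h \<and> (rewrite_step r S)\<^sup>*\<^sup>* g h))"

text \<open>The ordered basis of generators consists of the preimages of the letters \<open>0 < \<dots> < d - 1\<close>.\<close>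

definition PBW_algebra :: "('k::field, 'a) graded_algebra \<Rightarrow> bool" where
  "PBW_algebra A \<longleftrightarrow>
     (\<exists>d \<Omega> r S. relation_space d \<Omega> \<and> galg_isomorphic A (quadratic_algebra d \<Omega>) \<and>
        admissible_order d r \<and> normalized_basis r \<Omega> S \<and>
        (\<forall>w. critical_monomial r S w \<longrightarrow> confluent_monomial r S w))"


section \<open>Koszul algebras\<close>

record ('a, 'm) graded_module =
  mcomp :: "nat \<Rightarrow> 'm set"
  mzero :: "nat \<Rightarrow> 'm"
  madd :: "nat \<Rightarrow> 'm \<Rightarrow> 'm \<Rightarrow> 'm"
  mact :: "nat \<Rightarrow> nat \<Rightarrow> 'a \<Rightarrow> 'm \<Rightarrow> 'm"

text \<open>\<open>A(-s)^r\<close>, the free left module of rank \<open>r\<close> generated in degree \<open>s\<close>.\<close>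

definition free_module ::
    "('k, 'a) graded_algebra \<Rightarrow> nat \<Rightarrow> nat \<Rightarrow> ('a, nat \<Rightarrow> 'a) graded_module" where
  "free_module A r s =
     \<lparr> mcomp = (\<lambda>n. if s \<le> n then {..<r} \<rightarrow>\<^sub>E gcomp A (n - s) else {\<lambda>j\<in>{..<r}. gzero A 0}),
       mzero = (\<lambda>n. \<lambda>j\<in>{..<r}. gzero A (n - s)),
       madd = (\<lambda>n v w. \<lambda>j\<in>{..<r}. if s \<le> n then gadd A (n - s) (v j) (w j) else gzero A 0),
       mact = (\<lambda>m n a v. \<lambda>j\<in>{..<r}.
                 if s \<le> n then gmult A m (n - s) a (v j) else gzero A (m + n - s)) \<rparr>"

text \<open>The trivial module is \<open>A / A\<^sub>+\<close>, which is \<open>gcomp A 0\<close> in degree \<open>0\<close> and zero elsewhere.\<close>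

definition trivial_module :: "('k, 'a) graded_algebra \<Rightarrow> ('a, 'a) graded_module" where
  "trivial_module A =
     \<lparr> mcomp = (\<lambda>n. if n = 0 then gcomp A 0 else {gzero A 0}),
       mzero = (\<lambda>n. gzero A 0),
       madd = (\<lambda>n. gadd A 0),
       mact = (\<lambda>m n a x. if m = 0 \<and> n = 0 then gmult A 0 0 a x else gzero A 0) \<rparr>"

definition module_map ::
    "('k, 'a) graded_algebra \<Rightarrow> ('a, 'm) graded_module \<Rightarrow> ('a, 'n) graded_module \<Rightarrow>
     (nat \<Rightarrow> 'm \<Rightarrow> 'n) \<Rightarrow> bool" where
  "module_map A M N \<phi> \<longleftrightarrow>
     (\<forall>n. \<phi> n ` mcomp M n \<subseteq> mcomp N n) \<and>
     (\<forall>n. \<forall>x\<in>mcomp M n. \<forall>y\<in>mcomp M n. \<phi> n (madd M n x y) = madd N n (\<phi> n x) (\<phi> n y)) \<and>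
     (\<forall>m n. \<forall>a\<in>gcomp A m. \<forall>x\<in>mcomp M n.
        \<phi> (m + n) (mact M m n a x) = mact N m n a (\<phi> n x))"

definition map_kernel ::
    "('a, 'm) graded_module \<Rightarrow> ('a, 'n) graded_module \<Rightarrow> (nat \<Rightarrow> 'm \<Rightarrow> 'n) \<Rightarrow> nat \<Rightarrow> 'm set" where
  "map_kernel M N \<phi> n = {x \<in> mcomp M n. \<phi> n x = mzero N n}"

text \<open>
  A linear resolution
  \<open>\<dots> \<rightarrow> A(-2)^(rk 2) \<rightarrow> A(-1)^(rk 1) \<rightarrow> A^(rk 0) \<rightarrow> k \<rightarrow> 0\<close>,
  where \<open>D i\<close> is the map out of the module generated in degree \<open>i + 1\<close>.
\<close>

definition koszul_algebra :: "('k::field, 'a) graded_algebra \<Rightarrow> bool" where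
  "koszul_algebra A \<longleftrightarrow> connected_graded_algebra A \<and>
     (\<exists>(rk :: nat \<Rightarrow> nat) \<epsilon> D.
        let P = (\<lambda>i. free_module A (rk i) i) in
        module_map A (P 0) (trivial_module A) \<epsilon> \<and>
        (\<forall>i. module_map A (P (Suc i)) (P i) (D i)) \<and>
        (\<forall>n. \<epsilon> n ` mcomp (P 0) n = mcomp (trivial_module A) n) \<and>
        (\<forall>n. D 0 n ` mcomp (P 1) n = map_kernel (P 0) (trivial_module A) \<epsilon> n) \<and>
        (\<forall>i n. D (Suc i) n ` mcomp (P (i + 2)) n = map_kernel (P (i + 1)) (P i) (D i) n))"


section \<open>Pro-p groups\<close>

definition topological_group :: "('g, 'm) monoid_scheme \<Rightarrow> 'g topology \<Rightarrow> bool" where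
  "topological_group G T \<longleftrightarrow> group G \<and> topspace T = carrier G \<and>
     continuous_map (prod_topology T T) T (\<lambda>(x, y). x \<otimes>\<^bsub>G\<^esub> y) \<and>
     continuous_map T T (\<lambda>x. inv\<^bsub>G\<^esub> x)"

definition profinite_group :: "('g, 'm) monoid_scheme \<Rightarrow> 'g topology \<Rightarrow> bool" where
  "profinite_group G T \<longleftrightarrow> topological_group G T \<and> compact_space T \<and> Hausdorff_space T \<and>
     (\<forall>S. connectedin T S \<longrightarrow> (\<exists>a. S \<subseteq> {a}))"

definition open_normal :: "('g, 'm) monoid_scheme \<Rightarrow> 'g topology \<Rightarrow> 'g set set" where
  "open_normal G T = {U. U \<lhd> G \<and> openin T U}"

definition pro_p_group :: "nat \<Rightarrow> ('g, 'm) monoid_scheme \<Rightarrow> 'g topology \<Rightarrow> bool" where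
  "pro_p_group p G T \<longleftrightarrow> profinite_group G T \<and>
     (\<forall>U\<in>open_normal G T. \<exists>k. card (rcosets\<^bsub>G\<^esub> U) = p ^ k)"

definition topologically_fin_gen :: "('g, 'm) monoid_scheme \<Rightarrow> 'g topology \<Rightarrow> bool" where
  "topologically_fin_gen G T \<longleftrightarrow>
     (\<exists>S. finite S \<and> S \<subseteq> carrier G \<and> T closure_of (generate G S) = carrier G)"


section \<open>Continuous cohomology with trivial coefficients\<close>

text \<open>
  A cochain of degree \<open>n\<close> is a function on lists that vanishes outside the lists of length \<open>n\<close> over
  \<open>carrier G\<close>; the coefficient field is discrete.  With this convention \<open>conc f g\<close> is the cup product
  \<open>(g\<^sub>1, \<dots>, g\<^sub>m\<^sub>+\<^sub>n) \<mapsto> f (g\<^sub>1, \<dots>, g\<^sub>m) * g (g\<^sub>m\<^sub>+\<^sub>1, \<dots>, g\<^sub>m\<^sub>+\<^sub>n)\<close>.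
\<close>

definition cochains ::
    "('g, 'm) monoid_scheme \<Rightarrow> 'g topology \<Rightarrow> nat \<Rightarrow> ('g list \<Rightarrow> 'k::field) set" where
  "cochains G T n = {f.
     (\<forall>xs. f xs \<noteq> 0 \<longrightarrow> length xs = n \<and> set xs \<subseteq> carrier G) \<and>
     continuous_map (product_topology (\<lambda>_. T) {..<n}) (discrete_topology UNIV)
       (\<lambda>x. f (map x [0..<n]))}"

definition coboundary ::
    "('g, 'm) monoid_scheme \<Rightarrow> ('g list \<Rightarrow> 'k::field) \<Rightarrow> 'g list \<Rightarrow> 'k" where
  "coboundary G f = (\<lambda>xs. if xs = [] \<or> \<not> set xs \<subseteq> carrier G then 0 else
     f (tl xs)
     + (\<Sum>i<length xs - 1.
          (- 1) ^ Suc i * f (take i xs @ [xs ! i \<otimes>\<^bsub>G\<^esub> xs ! Suc i] @ drop (i + 2) xs))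
     + (- 1) ^ length xs * f (butlast xs))"

definition cocycles ::
    "('g, 'm) monoid_scheme \<Rightarrow> 'g topology \<Rightarrow> nat \<Rightarrow> ('g list \<Rightarrow> 'k::field) set" where
  "cocycles G T n = {f \<in> cochains G T n. coboundary G f = 0}"

definition coboundaries ::
    "('g, 'm) monoid_scheme \<Rightarrow> 'g topology \<Rightarrow> nat \<Rightarrow> ('g list \<Rightarrow> 'k::field) set" where
  "coboundaries G T n = (case n of 0 \<Rightarrow> {0} | Suc m \<Rightarrow> coboundary G ` cochains G T m)"

definition cohomology_algebra ::
    "'k::field itself \<Rightarrow> ('g, 'm) monoid_scheme \<Rightarrow> 'g topology \<Rightarrow>
     ('k, ('g list \<Rightarrow> 'k) set) graded_algebra" where
  "cohomology_algebra _ G T =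
     subquotient_algebra conc (monomial []) (cocycles G T) (coboundaries G T)"


section \<open>Demushkin groups\<close>

definition comp_dim :: "('k::field, 'a) graded_algebra \<Rightarrow> nat \<Rightarrow> nat \<Rightarrow> bool" where
  "comp_dim A n d \<longleftrightarrow>
     (\<exists>\<phi> :: 'a \<Rightarrow> nat \<Rightarrow> 'k. bij_betw \<phi> (gcomp A n) {v. \<forall>i\<ge>d. v i = 0} \<and>
        (\<forall>x\<in>gcomp A n. \<forall>y\<in>gcomp A n. \<phi> (gadd A n x y) = \<phi> x + \<phi> y) \<and>
        (\<forall>c. \<forall>x\<in>gcomp A n. \<phi> (gsmult A n c x) = fscale c (\<phi> x)))"

text \<open>The prime is \<open>CARD('p)\<close> and \<open>'p mod_ring\<close> is the field with \<open>CARD('p)\<close> elements.\<close>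

definition demushkin_group ::
    "'p::prime_card itself \<Rightarrow> ('g, 'm) monoid_scheme \<Rightarrow> 'g topology \<Rightarrow> bool" where
  "demushkin_group _ G T \<longleftrightarrow> pro_p_group CARD('p) G T \<and>
     (let H = cohomology_algebra TYPE('p mod_ring) G T in
        (\<exists>d. comp_dim H 1 d) \<and>
        (\<exists>\<phi>. bij_betw \<phi> (gcomp H 2) (UNIV :: 'p mod_ring set) \<and>
           (\<forall>x\<in>gcomp H 2. \<forall>y\<in>gcomp H 2. \<phi> (gadd H 2 x y) = \<phi> x + \<phi> y) \<and>
           (\<forall>c. \<forall>x\<in>gcomp H 2. \<phi> (gsmult H 2 c x) = c * \<phi> x) \<and>
           (\<forall>a\<in>gcomp H 1. (\<forall>b\<in>gcomp H 1. \<phi> (gmult H 1 1 a b) = 0) \<longrightarrow> a = gzero H 1) \<and>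
           (\<forall>b\<in>gcomp H 1. (\<forall>a\<in>gcomp H 1. \<phi> (gmult H 1 1 a b) = 0) \<longrightarrow> b = gzero H 1)))"


section \<open>The complete group algebra and its associated graded algebra\<close>

text \<open>
  An element of \<open>k[[G]]\<close> is a compatible family of elements of the group algebras \<open>k[G/U]\<close>, stored as
  the function sending \<open>(U, C)\<close> to the coefficient of the coset \<open>C \<in> G/U\<close> in the \<open>U\<close>-th member.
\<close>

definition complete_group_algebra ::
    "('g, 'm) monoid_scheme \<Rightarrow> 'g topology \<Rightarrow> ('g set \<times> 'g set \<Rightarrow> 'k::field) set" where
  "complete_group_algebra G T = {x.
     (\<forall>U C. x (U, C) \<noteq> 0 \<longrightarrow> U \<in> open_normal G T \<and> C \<in> carrier (G Mod U)) \<and>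
     (\<forall>U\<in>open_normal G T. \<forall>V\<in>open_normal G T. U \<subseteq> V \<longrightarrow>
        (\<forall>C\<in>carrier (G Mod V). x (V, C) = (\<Sum>B\<in>{B \<in> carrier (G Mod U). B \<subseteq> C}. x (U, B))))}"

definition cga_mult ::
    "('g, 'm) monoid_scheme \<Rightarrow> ('g set \<times> 'g set \<Rightarrow> 'k::field) \<Rightarrow> ('g set \<times> 'g set \<Rightarrow> 'k) \<Rightarrow>
     'g set \<times> 'g set \<Rightarrow> 'k" where
  "cga_mult G x y = (\<lambda>(U, C). \<Sum>A\<in>carrier (G Mod U). \<Sum>B\<in>carrier (G Mod U).
     if A \<otimes>\<^bsub>G Mod U\<^esub> B = C then x (U, A) * y (U, B) else 0)"

definition cga_one ::
    "('g, 'm) monoid_scheme \<Rightarrow> 'g topology \<Rightarrow> 'g set \<times> 'g set \<Rightarrow> 'k::field" where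
  "cga_one G T = (\<lambda>(U, C). if U \<in> open_normal G T \<and> C = \<one>\<^bsub>G Mod U\<^esub> then 1 else 0)"

definition augmentation_ideal ::
    "('g, 'm) monoid_scheme \<Rightarrow> 'g topology \<Rightarrow> ('g set \<times> 'g set \<Rightarrow> 'k::field) set" where
  "augmentation_ideal G T = {x \<in> complete_group_algebra G T.
     \<forall>U\<in>open_normal G T. (\<Sum>C\<in>carrier (G Mod U). x (U, C)) = 0}"

primrec augmentation_power ::
    "('g, 'm) monoid_scheme \<Rightarrow> 'g topology \<Rightarrow> nat \<Rightarrow> ('g set \<times> 'g set \<Rightarrow> 'k::field) set" where
  "augmentation_power G T 0 = complete_group_algebra G T"
| "augmentation_power G T (Suc n) = fscale.span
     {cga_mult G x y | x y. x \<in> augmentation_power G T n \<and> y \<in> augmentation_ideal G T}"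

text \<open>
  The powers of the augmentation ideal are the algebraic ones; they are closed when \<open>G\<close> is
  topologically finitely generated.
\<close>

definition gr_complete_group_algebra ::
    "'k::field itself \<Rightarrow> ('g, 'm) monoid_scheme \<Rightarrow> 'g topology \<Rightarrow>
     ('k, ('g set \<times> 'g set \<Rightarrow> 'k) set) graded_algebra" where
  "gr_complete_group_algebra _ G T =
     subquotient_algebra (cga_mult G) (cga_one G T)
       (augmentation_power G T) (\<lambda>n. augmentation_power G T (Suc n))"

end

(*
  Let k be the field with p elements, C the space of locally constant functions G -> k and L = k[[G]],
  its linear dual; L acts on C through (x f)(y) = <x, f(y _)>.  Take a basis psi_i of H^1(G, k) and
  elements x_j of the augmentation ideal I dual to it, and let b_ij be the matrix of the cup product.
  Since a pro-p group acts unipotently on C, an f with x_j f = 0 for all j is constant; dualizing,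
  I = sum_j L x_j.  The same argument one step further, with the one-dimensional H^2, yields
  elements r_j with r_j = sum_i b_ij x_i modulo I^2 that generate the relations sum_j v_j x_j = 0, so that
  0 -> k -> C -> C^d -> C is exact.  In T(V)/(omega), omega = sum b_ij x_i x_j, right multiplication by
  a linear form y with nonzero coefficient at an isotropic letter m (b_mm = 0) is injective; comparing
  coefficients then shows that T(V)/(omega) -> gr L is an isomorphism and that C^d -> C is onto.  The
  resolution by C kills H^n for n >= 3, so H = T(V')/(omega^perp).  An isotropic letter exists unless
  d = 1, because u -> u cup u is additive up to Frobenius; putting it last (for gr L) or first (for H)
  makes every critical word of degree 3 reduce to 0.  The remaining case d = 1 is the group of order 2,
  where C is spanned by 1 and psi_0.
*)

theory Submission
  imports Defs "HOL-Algebra.Group_Action" "HOL-Algebra.Elementary_Groups"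
begin

section \<open>Linear functionals on function spaces\<close>

text \<open>Duality is used in discrete form: every linear functional on C is pairing with an
  element of L, so a statement about L becomes the computation of a kernel or an image among spaces
  of locally constant functions. L carries no topology here, and the powers of I remain the
  algebraic ones: an element of I^n annihilates the n-th step of the unipotent filtration of C,
  these steps exhaust C, and so the powers of I meet in 0. The obstacle is that r_j is a linear form
  in the x_i only modulo I^2. From v_j = a r_j with v_j deep in the filtration nothing follows
  formally about a. Cancellation in T(V)/(omega) bounds the depth of a, but it can be applied in gr
  L only in degrees where the comparison map is already known to be injective; hence the induction
  on the degree. The isotropic letter makes this elementary: it reduces cancellation to one
  coefficient, kills degree three of the dual algebra and makes the syzygies there linear. The
  Koszul property is not derived from the PBW bases: linear resolutions are written down over the
  two quadratic algebras and carried along the isomorphisms.\<close>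

definition lin_on :: "('x => 'k::field) set => (('x => 'k) => 'k) => bool" where
 "lin_on V f \<longleftrightarrow> (\<forall>x\<in>V. \<forall>y\<in>V. f (x + y) = f x + f y) \<and> (\<forall>c. \<forall>x\<in>V. f (fscale c x) = c * f x)"

lemma lin_onI:
 "[|\<And>x y. x : V ==> y : V ==> f (x + y) = f x + f y; \<And>c x. x : V ==> f (fscale c x) = c * f x|]
  ==> lin_on V f"
 unfolding lin_on_def by blast

lemma lin_on_add: "lin_on V f ==> x : V ==> y : V ==> f (x + y) = f x + f y"
 and lin_on_scale: "lin_on V f ==> x : V ==> f (fscale c x) = c * f x"
 unfolding lin_on_def by blast+

lemma lin_on_0: "lin_on V f ==> 0 : V ==> f 0 = 0"
 using lin_on_scale[of V f 0 0] by simp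

lemma fscale_apply [simp]: "fscale c f x = c * f x"
 by (simp add: fscale_def)

lemma fscale_minus_one: "fscale (- 1) x = - x"
 by (simp add: fun_eq_iff)

lemma lin_on_neg: "lin_on V f ==> x : V ==> f (- x) = - f x"
 using lin_on_scale[of V f x "- 1"] by (simp add: fscale_minus_one)

lemma lin_on_diff:
 "fscale.subspace V ==> lin_on V f ==> x : V ==> y : V ==> f (x - y) = f x - f y"
 using lin_on_add[of V f x "- y"] lin_on_neg[of V f y] fscale.subspace_neg[of V y] by simp

lemma lin_on_sum:
 assumes "fscale.subspace V" "lin_on V f" "\<And>i. i : I ==> x i : V"
 shows "f (\<Sum>i\<in>I. x i) = (\<Sum>i\<in>I. f (x i))"
 using assms(3)
proof (induction I rule: infinite_finite_induct)
 case (insert i I)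
 then have "f (x i + (\<Sum>i\<in>I. x i)) = f (x i) + f (\<Sum>i\<in>I. x i)"
  using assms by (intro lin_on_add[of V]) (auto intro: fscale.subspace_sum)
 moreover have "f (\<Sum>i\<in>I. x i) = (\<Sum>i\<in>I. f (x i))" using insert by blast
 ultimately have "f (\<Sum>i\<in>insert i I. x i) = (\<Sum>i\<in>insert i I. f (x i))"
  unfolding sum.insert[OF insert(1,2)] by simp
 then show ?case .
qed (simp_all add: lin_on_0[OF assms(2)] fscale.subspace_0[OF assms(1)])

lemma vector_space_pair_fscale: "vector_space_pair (fscale :: 'k::field => ('x => 'k) => _) ((*) :: 'k => 'k => 'k)"
 by unfold_locales (auto simp: algebra_simps)

lemma linear_on_basis_extend:
 fixes f :: "('x => 'k::field) => 'k"
 assumes "\<not> fscale.dependent B"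
 shows "\<exists>g. lin_on UNIV g \<and> (\<forall>x\<in>B. g x = f x)"
proof -
 interpret vp: vector_space_pair "fscale :: 'k => ('x => 'k) => _" "(*) :: 'k => 'k => 'k"
  by (rule vector_space_pair_fscale)
 from vp.linear_independent_extend[OF assms, of f] obtain g
  where g: "Vector_Spaces.linear fscale (*) g" "\<forall>x\<in>B. g x = f x" by blast
 have "lin_on UNIV g"
  by (rule lin_onI) (simp_all add: linear.axioms vp.linear_add[OF g(1)] vp.linear_scale[OF g(1)])
 with g show ?thesis by blast
qed

lemma linear_extend:
 fixes f :: "('x => 'k::field) => 'k"
 assumes "fscale.subspace V" "lin_on V f"
 obtains g where "lin_on UNIV g" "\<And>x. x : V ==> g x = f x"
proof -
 obtain B where B: "B <= V" "\<not> fscale.dependent B" "V <= fscale.span B"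
  using fscale.maximal_independent_subset by metis
 obtain g where g: "lin_on UNIV g" "\<forall>x\<in>B. g x = f x"
  using linear_on_basis_extend[OF B(2)] by blast
 have "x : V \<and> g x = f x" if "x : fscale.span B" for x
  using that
 proof (induction rule: fscale.span_induct_alt)
  case base
  have "0 : V \<and> g 0 = f 0"
   using lin_on_0[OF g(1)] lin_on_0[OF assms(2)] fscale.subspace_0[OF assms(1)] by simp
  then show ?case .
 next
  case (step c x y)
  then have "x : V" "fscale c x : V" using B assms(1) fscale.subspace_scale by blast+
  with step g have "fscale c x + y : V \<and> g (fscale c x + y) = f (fscale c x + y)"
   using assms by (simp add: lin_on_add[OF g(1)] lin_on_add[OF assms(2)] lin_on_scale[OF g(1)]
     lin_on_scale[OF assms(2)] fscale.subspace_add)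
  then show ?case .
 qed
 then show ?thesis using that g B(3) by blast
qed

text \<open>A functional that kills the kernel of \<open>A\<close> descends to the image of
  \<open>A\<close> and extends from there. This is the device that dualizes exactness: knowing a
  kernel among function spaces produces an element of the group algebra.\<close>

lemma linear_factor:
 fixes A :: "('x => 'k::field) => 'y => 'k" and f :: "('x => 'k) => 'k"
 assumes V: "fscale.subspace V" and f: "lin_on V f"
  and A: "\<And>x y. x : V ==> y : V ==> A (x + y) = A x + A y"
   "\<And>c x. x : V ==> A (fscale c x) = fscale c (A x)"
  and ker: "\<And>x. x : V ==> A x = 0 ==> f x = 0"
 obtains g where "lin_on UNIV g" "\<And>x. x : V ==> g (A x) = f x"
proof -
 have diff: "A (x - y) = A x - A y" if "x : V" "y : V" for x y
  using A(1)[of x "- y"] A(2)[of y "- 1"] that V by (simp add: fscale_minus_one fscale.subspace_neg)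
 define h where "h w = f (SOME v. v : V \<and> A v = w)" for w
 have h: "h (A v) = f v" if "v : V" for v
 proof -
  let ?u = "SOME u. u : V \<and> A u = A v"
  have u: "?u : V \<and> A ?u = A v" by (rule someI[of _ v]) (use that in auto)
  then have "f (?u - v) = 0" using that V diff by (intro ker fscale.subspace_diff) auto
  then show ?thesis using u that by (simp add: h_def lin_on_diff[OF V f])
 qed
 have sub: "fscale.subspace (A ` V)"
  unfolding fscale.subspace_def
 proof (intro conjI ballI allI)
  show "0 : A ` V" using diff[of 0 0] V fscale.subspace_0 by (metis diff_self imageI)
 next
  fix x y assume "x : A ` V" "y : A ` V"
  then obtain u v where "u : V" "v : V" "x = A u" "y = A v" by blast
  then show "x + y : A ` V" using A(1) V fscale.subspace_add by (metis imageI)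
 next
  fix c x assume "x : A ` V"
  then obtain u where "u : V" "x = A u" by blast
  then show "fscale c x : A ` V" using A(2) V fscale.subspace_scale by (metis imageI)
 qed
 have "lin_on (A ` V) h"
 proof (rule lin_onI)
  fix x y assume "x : A ` V" "y : A ` V"
  then obtain u v where "u : V" "v : V" "x = A u" "y = A v" by blast
  then show "h (x + y) = h x + h y"
   using h V f by (metis A(1) fscale.subspace_add lin_on_add)
 next
  fix c x assume "x : A ` V"
  then obtain u where "u : V" "x = A u" by blast
  then show "h (fscale c x) = c * h x"
   using h V f by (metis A(2) fscale.subspace_scale lin_on_scale)
 qed
 from linear_extend[OF sub this] obtain g where "lin_on UNIV g" "\<And>x. x : A ` V ==> g x = h x"
  by blast
 with that h show ?thesis by (metis imageI)
qed

text \<open>A basis of \<open>S\<close> stays independent when \<open>f\<close> is added, so values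
  on it may be prescribed. It serves to prove surjectivity by excluding nonzero functionals that
  vanish on an image.\<close>

lemma separating_functional:
 fixes f :: "'x => 'k::field"
 assumes S: "fscale.subspace S" and "f \<notin> S"
 obtains g where "lin_on UNIV g" "\<And>x. x : S ==> g x = 0" "g f = 1"
proof -
 obtain B where B: "B <= S" "\<not> fscale.dependent B" "S <= fscale.span B"
  using fscale.maximal_independent_subset by metis
 have span: "fscale.span B = S" using B S by (metis fscale.span_minimal subset_antisym)
 with assms have "f \<notin> fscale.span B" "f \<notin> B" using B by auto
 then have "\<not> fscale.dependent (insert f B)" using B(2) fscale.independent_insertI by blast
 from linear_on_basis_extend[OF this, of "%x. if x = f then 1 else 0"] obtain g
  where g: "lin_on UNIV g" "\<forall>x\<in>insert f B. g x = (if x = f then 1 else 0)" by blast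
 have "g x = 0" if "x : fscale.span B" for x
  using that
 proof (induction rule: fscale.span_induct_alt)
  case (step c x y)
  then have "g x = 0" using g(2) \<open>f \<notin> B\<close> by auto
  with step have "g (fscale c x + y) = 0" by (simp add: lin_on_add[OF g(1)] lin_on_scale[OF g(1)])
  then show ?case .
 next
  case base
  have "g 0 = 0" by (simp add: lin_on_0[OF g(1)])
  then show ?case .
 qed
 with that g span show ?thesis by auto
qed


section \<open>Subquotient algebras\<close>

text \<open>Cohomology, the graded group algebra and the quadratic algebras are all instances, so
  algebra axioms, resolutions and isomorphisms are treated once and on representatives.
  \<open>e_B\<close> and \<open>Z_0\<close> say that degree 0 is exactly the ground field, which is
  connectedness.\<close>

locale subquotient =
 fixes mul :: "('x => 'k::field) => ('x => 'k) => 'x => 'k" and e :: "'x => 'k"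
  and Z B :: "nat => ('x => 'k) set"
 assumes Z: "fscale.subspace (Z n)" and B: "fscale.subspace (B n)" and B_Z: "B n <= Z n"
  and mul_Z: "x : Z m ==> y : Z n ==> mul x y : Z (m + n)"
  and mul_B_left: "x : B m ==> y : Z n ==> mul x y : B (m + n)"
  and mul_B_right: "x : Z m ==> y : B n ==> mul x y : B (m + n)"
  and assoc: "x : Z l ==> y : Z m ==> z : Z n ==> mul (mul x y) z = mul x (mul y z)"
  and mul_add_left: "x : Z m ==> x' : Z m ==> y : Z n ==> mul (x + x') y = mul x y + mul x' y"
  and mul_add_right: "x : Z m ==> y : Z n ==> y' : Z n ==> mul x (y + y') = mul x y + mul x y'"
  and mul_scale_left: "x : Z m ==> y : Z n ==> mul (fscale c x) y = fscale c (mul x y)"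
  and mul_scale_right: "x : Z m ==> y : Z n ==> mul x (fscale c y) = fscale c (mul x y)"
  and e_Z: "e : Z 0" and e_mul: "x : Z n ==> mul e x = x" and mul_e: "x : Z n ==> mul x e = x"
  and e_B: "e \<notin> B 0" and Z_0: "x : Z 0 ==> \<exists>c. x - fscale c e : B 0"
begin

abbreviation "alg \<equiv> subquotient_algebra mul e Z B"

lemmas Zs = fscale.subspace_add[OF Z] fscale.subspace_diff[OF Z] fscale.subspace_scale[OF Z]
 fscale.subspace_neg[OF Z] fscale.subspace_0[OF Z] fscale.subspace_sum[OF Z]
lemmas Bs = fscale.subspace_add[OF B] fscale.subspace_diff[OF B] fscale.subspace_scale[OF B]
 fscale.subspace_neg[OF B] fscale.subspace_0[OF B] fscale.subspace_sum[OF B]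

lemma BZ: "x : B n ==> x : Z n"
 using B_Z by blast

lemma mul_diff_left: "x : Z m ==> x' : Z m ==> y : Z n ==> mul (x - x') y = mul x y - mul x' y"
 using mul_add_left[of "x - x'" m x' y n] by (simp add: Zs algebra_simps)

lemma mul_diff_right: "x : Z m ==> y : Z n ==> y' : Z n ==> mul x (y - y') = mul x y - mul x y'"
 using mul_add_right[of x m "y - y'" n y'] by (simp add: Zs algebra_simps)

lemma mul_0_left: "y : Z n ==> mul 0 y = 0"
 using mul_diff_left[of 0 n 0 y n] by (simp add: Zs)

lemma mul_0_right: "x : Z n ==> mul x 0 = 0"
 using mul_diff_right[of x n 0 n 0] by (simp add: Zs)

lemma mul_sum_left:
 "(\<And>i. i : I ==> x i : Z m) ==> y : Z n ==> mul (\<Sum>i\<in>I. x i) y = (\<Sum>i\<in>I. mul (x i) y)"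
proof (induction I rule: infinite_finite_induct)
 case (insert i I)
 then have "(\<Sum>i\<in>I. x i) : Z m" "x i : Z m" by (auto intro: Zs(6))
 with insert have "mul (\<Sum>i\<in>insert i I. x i) y = (\<Sum>i\<in>insert i I. mul (x i) y)"
  unfolding sum.insert[OF insert(1,2)] by (subst mul_add_left[of _ m _ _ n]) simp_all
 then show ?case .
qed (simp_all add: mul_0_left)

lemma mul_sum_right:
 "x : Z m ==> (\<And>i. i : I ==> y i : Z n) ==> mul x (\<Sum>i\<in>I. y i) = (\<Sum>i\<in>I. mul x (y i))"
proof (induction I rule: infinite_finite_induct)
 case (insert i I)
 then have "(\<Sum>i\<in>I. y i) : Z n" "y i : Z n" by (auto intro: Zs(6))
 with insert have "mul x (\<Sum>i\<in>insert i I. y i) = (\<Sum>i\<in>insert i I. mul x (y i))"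
  unfolding sum.insert[OF insert(1,2)] by (subst mul_add_right[of _ m _ n]) simp_all
 then show ?case .
qed (simp_all add: mul_0_right)

lemma mul_cong_B:
 assumes "x : Z m" "x' : Z m" "y : Z n" "y' : Z n" "x - x' : B m" "y - y' : B n"
 shows "mul x y - mul x' y' : B (m + n)"
proof -
 have "mul x y - mul x' y' = mul (x - x') y + mul x' (y - y')"
  using assms by (simp add: mul_diff_left[of x m x' y n] mul_diff_right[of x' m y n y'])
 then show ?thesis using assms mul_B_left mul_B_right Bs by simp
qed

lemma mem_coset_iff: "y : x +o B n \<longleftrightarrow> y - x : B n"
 unfolding elt_set_plus_def by (auto intro!: bexI[of _ "y - x"])

lemma coset_eq_iff: "x +o B n = y +o B n \<longleftrightarrow> x - y : B n"
proof
 assume eq: "x +o B n = y +o B n"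
 have "x : x +o B n" using Bs(5)[of n] by (simp add: mem_coset_iff)
 then have "x : y +o B n" by (simp only: eq)
 then show "x - y : B n" by (simp only: mem_coset_iff)
next
 assume d: "x - y : B n"
 have "z - x : B n \<longleftrightarrow> z - y : B n" for z
  using Bs(1)[OF _ d, of "z - x"] Bs(2)[OF _ d, of "z - y"] by auto
 then show "x +o B n = y +o B n" by (simp add: set_eq_iff mem_coset_iff)
qed

lemma coset_0: "0 +o B n = B n"
 by (simp add: elt_set_plus_def)

lemma coset_add: "(x +o B n) + (y +o B n) = (x + y) +o B n"
proof -
 have "B n + B n = B n"
 proof
  show "B n + B n <= B n" using Bs(1)[of _ n] by (auto simp: set_plus_def)
  show "B n <= B n + B n" using Bs(5)[of n] by (force simp: set_plus_def)
 qed
 then show ?thesis by (simp add: set_plus_rearrange)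
qed

text \<open>For \<open>c = 0\<close> the scaled coset is the single point 0; adding
  \<open>B n\<close> restores a full coset.\<close>

lemma coset_scale: "fscale c ` (x +o B n) + B n = fscale c x +o B n"
proof
 show "fscale c ` (x +o B n) + B n <= fscale c x +o B n"
 proof
  fix z assume "z : fscale c ` (x +o B n) + B n"
  then obtain b b' where b: "b : B n" "b' : B n" and z: "z = fscale c (x + b) + b'"
   unfolding elt_set_plus_def set_plus_def by blast
  have "z - fscale c x = fscale c b + b'" unfolding z by (simp add: fscale.scale_right_distrib)
  then show "z : fscale c x +o B n" using b Bs by (simp add: mem_coset_iff)
 qed
 show "fscale c x +o B n <= fscale c ` (x +o B n) + B n"
 proof
  fix z assume "z : fscale c x +o B n"
  then obtain b where "b : B n" "z = fscale c x + b" unfolding elt_set_plus_def by blast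
  moreover have "x : x +o B n" using Bs by (simp add: mem_coset_iff)
  ultimately show "z : fscale c ` (x +o B n) + B n" unfolding set_plus_def by blast
 qed
qed

text \<open>By \<open>mul_cong_B\<close> all products of representatives lie in one coset, so the
  union runs over copies of a single set.\<close>

lemma coset_mul:
 assumes "x : Z m" "y : Z n"
 shows "(\<Union>x'\<in>x +o B m. \<Union>y'\<in>y +o B n. mul x' y' +o B (m + n)) = mul x y +o B (m + n)"
  (is "?L = ?R")
proof -
 have eq: "mul x' y' +o B (m + n) = ?R" if "x' : x +o B m" "y' : y +o B n" for x' y'
 proof -
  have d: "x' - x : B m" "y' - y : B n" using that by (simp_all add: mem_coset_iff)
  then have "x' - x : Z m" "y' - y : Z n" using BZ by blast+
  from Zs(1)[OF this(1) assms(1)] Zs(1)[OF this(2) assms(2)] have "x' : Z m" "y' : Z n" by simp_all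
  from mul_cong_B[OF this(1) assms(1) this(2) assms(2) d] show ?thesis by (simp only: coset_eq_iff)
 qed
 have mem: "x : x +o B m" "y : y +o B n" using Bs by (simp_all add: mem_coset_iff)
 show ?thesis
 proof
  show "?L <= ?R" by (intro UN_least) (simp only: eq subset_refl)
  show "?R <= ?L"
   by (rule subset_trans[OF _ UN_upper[OF mem(1)]], rule UN_upper[OF mem(2)])
 qed
qed

end

context subquotient begin

lemma alg_comp: "gcomp alg n = (%z. z +o B n) ` Z n"
 and alg_zero: "gzero alg n = B n"
 and alg_one: "gone alg = e +o B 0"
 and alg_add: "gadd alg n (x +o B n) (y +o B n) = (x + y) +o B n"
 and alg_scale: "gsmult alg n c (x +o B n) = fscale c x +o B n"
 by (simp_all add: subquotient_algebra_def coset_add coset_scale)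

lemma alg_mult: "x : Z m ==> y : Z n ==> gmult alg m n (x +o B m) (y +o B n) = mul x y +o B (m + n)"
 by (simp add: subquotient_algebra_def coset_mul)

lemma compE:
 assumes "X : gcomp alg n"
 obtains x where "x : Z n" "X = x +o B n"
 using assms by (auto simp: alg_comp)

lemma comp_coset: "x : Z n ==> x +o B n : gcomp alg n"
 by (auto simp: alg_comp)

theorem connected_graded_algebra: "connected_graded_algebra alg"
proof
 show "gone alg ~= gzero alg 0"
  using e_B coset_eq_iff[of e 0 0] by (simp add: alg_one alg_zero coset_0)
 show "gcomp alg 0 = range (%c. gsmult alg 0 c (gone alg))"
 proof (intro subset_antisym subsetI)
  fix X assume "X : gcomp alg 0"
  then obtain x where x: "x : Z 0" "X = x +o B 0" by (rule compE)
  then obtain c where "x - fscale c e : B 0" using Z_0 by blast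
  then show "X : range (%c. gsmult alg 0 c (gone alg))"
   using x by (auto simp: alg_one alg_scale coset_eq_iff)
 qed (auto simp: alg_one alg_scale intro!: comp_coset Zs e_Z)
 fix n show "gzero alg n : gcomp alg n"
  using comp_coset[OF Zs(5)] by (simp only: alg_zero coset_0)
 show "gone alg : gcomp alg 0"
  by (simp only: alg_one comp_coset e_Z)
next
 fix x m y n assume "x : gcomp alg m" "y : gcomp alg n"
 then show "gmult alg m n x y : gcomp alg (m + n)"
  by (auto elim!: compE simp: alg_mult intro!: comp_coset mul_Z)
next
 fix x l y m z n assume "x : gcomp alg l" "y : gcomp alg m" "z : gcomp alg n"
 then obtain x' y' z' where "x' : Z l" "y' : Z m" "z' : Z n"
  and "x = x' +o B l" "y = y' +o B m" "z = z' +o B n"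
  by (elim compE)
 then show "gmult alg (l + m) n (gmult alg l m x y) z = gmult alg l (m + n) x (gmult alg m n y z)"
  using alg_mult[of "mul x' y'" "l + m" z' n] alg_mult[of x' l "mul y' z'" "m + n"]
  by (simp add: alg_mult mul_Z assoc[of x' l y' m z' n] add.assoc)
next
 fix x x' y m n assume "x : gcomp alg m" "x' : gcomp alg m" "y : gcomp alg n"
 then show "gmult alg m n (gadd alg m x x') y = gadd alg (m + n) (gmult alg m n x y) (gmult alg m n x' y)"
  by (auto elim!: compE simp: alg_add alg_mult Zs mul_add_left[of _ m _ _ n])
next
 fix x y y' m n assume "x : gcomp alg m" "y : gcomp alg n" "y' : gcomp alg n"
 then show "gmult alg m n x (gadd alg n y y') = gadd alg (m + n) (gmult alg m n x y) (gmult alg m n x y')"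
  by (auto elim!: compE simp: alg_add alg_mult Zs mul_add_right[of _ m _ n])
next
 fix x y m n c assume "x : gcomp alg m" "y : gcomp alg n"
 then show "gmult alg m n (gsmult alg m c x) y = gsmult alg (m + n) c (gmult alg m n x y)"
  and "gmult alg m n x (gsmult alg n c y) = gsmult alg (m + n) c (gmult alg m n x y)"
  by (auto elim!: compE simp: alg_scale alg_mult Zs mul_scale_left[of _ m _ n] mul_scale_right[of _ m _ n])
next
 fix x n assume "x : gcomp alg n"
 then obtain x' where x': "x' : Z n" "x = x' +o B n" by (rule compE)
 then show "gmult alg 0 n (gone alg) x = x" "gmult alg n 0 x (gone alg) = x"
  using alg_mult[of e 0 x' n] alg_mult[of x' n e 0] by (simp_all add: alg_one e_Z e_mul mul_e)
 show "gadd alg n (gzero alg n) x = x"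
  using alg_add[of n 0 x'] x' by (simp add: alg_zero coset_0)
 show "gadd alg n x (gsmult alg n (- 1) x) = gzero alg n"
  using x' alg_add[of n x' "- x'"] by (simp add: alg_zero alg_scale fscale_minus_one coset_0)
 fix c show "gsmult alg n c x : gcomp alg n"
  using x' comp_coset Zs by (simp add: alg_scale)
 fix b show "gsmult alg n b (gsmult alg n c x) = gsmult alg n (b * c) x"
  and "gsmult alg n (b + c) x = gadd alg n (gsmult alg n b x) (gsmult alg n c x)"
  using x' by (simp_all add: alg_scale alg_add fscale.scale_left_distrib)
next
 fix x n assume "x : gcomp alg n"
 then show "gsmult alg n 1 x = x" by (auto elim!: compE simp: alg_scale)
next
 fix x y n assume "x : gcomp alg n" "y : gcomp alg n"
 then obtain x' y' where "x' : Z n" "x = x' +o B n" "y' : Z n" "y = y' +o B n" by (elim compE)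
 then show "gadd alg n x y : gcomp alg n" "gadd alg n x y = gadd alg n y x"
  and "gsmult alg n c (gadd alg n x y) = gadd alg n (gsmult alg n c x) (gsmult alg n c y)" for c
  by (simp_all add: alg_add alg_scale fscale.scale_right_distrib comp_coset Zs add.commute)
next
 fix x y z n assume "x : gcomp alg n" "y : gcomp alg n" "z : gcomp alg n"
 then obtain x' y' z' where "x = x' +o B n" "y = y' +o B n" "z = z' +o B n" by (elim compE)
 then show "gadd alg n (gadd alg n x y) z = gadd alg n x (gadd alg n y z)"
  by (simp add: alg_add add.assoc)
qed

text \<open>Differentials act on tuples of cosets but are computed with representatives, so a choice
  is made here; \<open>D_coset\<close> shows that it does not matter.\<close>

definition rep :: "('x => 'k) set => 'x => 'k" where
 "rep X = (SOME x. x : X)"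

lemma rep_coset: "rep (x +o B n) - x : B n"
proof -
 have "x : x +o B n" using Bs by (simp add: mem_coset_iff)
 then have "rep (x +o B n) : x +o B n" unfolding rep_def some_in_eq by blast
 then show ?thesis by (simp only: mem_coset_iff)
qed

lemma rep_Z: "X : gcomp alg n ==> rep X : Z n"
proof (elim compE)
 fix x assume x: "x : Z n" "X = x +o B n"
 have "rep (x +o B n) - x : Z n" by (rule BZ[OF rep_coset])
 from Zs(1)[OF this x(1)] show "rep X : Z n" unfolding x(2) by (simp only: diff_add_cancel)
qed

lemma coset_rep: "X : gcomp alg n ==> rep X +o B n = X"
 by (elim compE) (simp only: coset_eq_iff rep_coset)

lemma coset_eqI: "x - y : B n ==> x +o B n = y +o B n"
 by (simp only: coset_eq_iff)

end

section \<open>Linear resolutions read on representatives\<close>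

context subquotient begin

text \<open>Row vectors are multiplied on the right by matrices \<open>c i\<close> of elements of
  degree 1, and membership in \<open>B\<close> replaces vanishing. The fifth clause is exactness in
  the degree where the generators of the source lie: the next module is zero there, so the kernel
  must be zero. The last clause is exactness in higher degrees, indexed by the degree
  \<open>n\<close> of the coefficients \<open>w\<close> of the preimage.\<close>

definition linear_resolution :: "(nat => nat) => (nat => nat => nat => 'x => 'k) => bool" where
 "linear_resolution rk c \<longleftrightarrow> rk 0 = 1 \<and>
   (\<forall>i. \<forall>a<rk (Suc i). \<forall>b<rk i. c i a b : Z 1) \<and>
   (\<forall>n. \<forall>z\<in>Z (Suc n). \<exists>v. (\<forall>a. v a : Z n) \<and> z - (\<Sum>a<rk 1. mul (v a) (c 0 a 0)) : B (Suc n)) \<and>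
   (\<forall>i. \<forall>h<rk (Suc (Suc i)). \<forall>b<rk i.
    (\<Sum>a<rk (Suc i). mul (c (Suc i) h a) (c i a b)) : B 2) \<and>
   (\<forall>i v. (\<forall>a. v a : Z 0) --> (\<forall>b<rk i. (\<Sum>a<rk (Suc i). mul (v a) (c i a b)) : B 1) -->
    (\<forall>a<rk (Suc i). v a : B 0)) \<and>
   (\<forall>i n v. (\<forall>a. v a : Z (Suc n)) -->
    (\<forall>b<rk i. (\<Sum>a<rk (Suc i). mul (v a) (c i a b)) : B (Suc (Suc n))) -->
    (\<exists>w. (\<forall>h. w h : Z n) \<and>
      (\<forall>a<rk (Suc i). v a - (\<Sum>h<rk (Suc (Suc i)). mul (w h) (c (Suc i) h a)) : B (Suc n))))"

lemma mul_Z_Suc: "x : Z m ==> y : Z 1 ==> mul x y : Z (Suc m)"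
 using mul_Z[of x m y 1] by simp

lemma alg_mult_Suc: "x : Z m ==> y : Z n ==> k = m + n ==>
  gmult alg m n (x +o B m) (y +o B n) = mul x y +o B k"
 by (simp only: alg_mult)

context
 fixes rk :: "nat => nat" and c :: "nat => nat => nat => 'x => 'k"
 assumes res: "linear_resolution rk c"
begin

private lemma rk_0: "rk 0 = 1"
 using res unfolding linear_resolution_def by blast

private lemma c_Z: "a < rk (Suc i) ==> b < rk i ==> c i a b : Z 1"
 using res unfolding linear_resolution_def by blast

private lemma gen: "z : Z (Suc n) ==>
  \<exists>v. (\<forall>a. v a : Z n) \<and> z - (\<Sum>a<rk 1. mul (v a) (c 0 a 0)) : B (Suc n)"
 using res unfolding linear_resolution_def by blast

private lemma complex: "h < rk (Suc (Suc i)) ==> b < rk i ==>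
  (\<Sum>a<rk (Suc i). mul (c (Suc i) h a) (c i a b)) : B 2"
 using res unfolding linear_resolution_def by blast

private lemma exact_0: "(\<And>a. v a : Z 0) ==>
  (\<And>b. b < rk i ==> (\<Sum>a<rk (Suc i). mul (v a) (c i a b)) : B 1) ==> a < rk (Suc i) ==> v a : B 0"
 using res unfolding linear_resolution_def by blast

private lemma exact_Suc: "(\<And>a. v a : Z (Suc n)) ==>
  (\<And>b. b < rk i ==> (\<Sum>a<rk (Suc i). mul (v a) (c i a b)) : B (Suc (Suc n))) ==>
  \<exists>w. (\<forall>h. w h : Z n) \<and>
   (\<forall>a<rk (Suc i). v a - (\<Sum>h<rk (Suc (Suc i)). mul (w h) (c (Suc i) h a)) : B (Suc n))"
 using res unfolding linear_resolution_def by blast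

text \<open>Degree \<open>n\<close> of \<open>P i\<close> is degree \<open>n - i\<close> of the
  algebra. For \<open>n \<le> i\<close> the source is zero and the value must be the zero of the
  target, which is built from the coset \<open>B 0\<close> for \<open>n = i\<close> and, by
  truncated subtraction, also below.\<close>

private definition D :: "nat => nat => (nat => ('x => 'k) set) => nat => ('x => 'k) set" where
 "D i n v = (\<lambda>b\<in>{..<rk i}. if i < n
   then (\<Sum>a<rk (Suc i). mul (rep (v a)) (c i a b)) +o B (n - i) else B 0)"

private abbreviation "P i \<equiv> free_module alg (rk i) i"

private lemma D_coset:
 assumes "\<And>a. a < rk (Suc i) ==> v a = x a +o B m" "\<And>a. a < rk (Suc i) ==> x a : Z m"
  and n: "n = Suc (i + m)"
 shows "D i n v = (\<lambda>b\<in>{..<rk i}. (\<Sum>a<rk (Suc i). mul (x a) (c i a b)) +o B (Suc m))"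
proof (unfold D_def, rule restrict_ext)
 fix b assume b: "b : {..<rk i}"
 have "(\<Sum>a<rk (Suc i). mul (rep (v a)) (c i a b)) - (\<Sum>a<rk (Suc i). mul (x a) (c i a b)) : B (Suc m)"
  unfolding sum_subtractf[symmetric]
 proof (rule Bs(6))
  fix a assume a: "a : {..<rk (Suc i)}"
  have d: "rep (v a) - x a : B m" using assms a rep_coset by simp
  have "rep (v a) : Z m" using a by (intro rep_Z) (simp add: assms comp_coset)
  then have "mul (rep (v a)) (c i a b) - mul (x a) (c i a b) = mul (rep (v a) - x a) (c i a b)"
   using a b assms(2) c_Z by (intro mul_diff_left[of _ m _ _ 1, symmetric]) auto
  also have "... : B (m + 1)" using a b c_Z by (intro mul_B_left d) auto
  finally show "mul (rep (v a)) (c i a b) - mul (x a) (c i a b) : B (Suc m)" by simp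
 qed
 moreover have "n - i = Suc m" "i < n" using n by simp_all
 ultimately show "(if i < n then (\<Sum>a<rk (Suc i). mul (rep (v a)) (c i a b)) +o B (n - i) else B 0) =
   (\<Sum>a<rk (Suc i). mul (x a) (c i a b)) +o B (Suc m)"
  by (simp only: if_True coset_eq_iff)
qed

private lemma D_zero: "n \<le> i ==> D i n v = (\<lambda>b\<in>{..<rk i}. B 0)"
 unfolding D_def by (rule restrict_ext) simp

private lemma P_compE:
 assumes "v : mcomp (P i) n" "i \<le> n"
 obtains x where "\<And>a. x a : Z (n - i)" "v = (\<lambda>a\<in>{..<rk i}. x a +o B (n - i))"
proof -
 have v: "v : {..<rk i} \<rightarrow>\<^sub>E gcomp alg (n - i)" using assms by (simp add: free_module_def)
 show thesis
 proof (rule that[of "%a. if a < rk i then rep (v a) else 0"])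
  show "(if a < rk i then rep (v a) else 0) : Z (n - i)" for a
   using v rep_Z Zs(5) by (auto simp: PiE_iff)
  show "v = (\<lambda>a\<in>{..<rk i}. (if a < rk i then rep (v a) else 0) +o B (n - i))"
   using v coset_rep by (auto simp: PiE_iff extensional_def restrict_def fun_eq_iff)
 qed
qed

private lemma P_compI: "(\<And>a. a < rk i ==> x a : Z m) ==> n = i + m ==>
  (\<lambda>a\<in>{..<rk i}. x a +o B m) : mcomp (P i) n"
 by (auto simp: free_module_def comp_coset)

private lemma P_comp_zero: "n < i ==> mcomp (P i) n = {\<lambda>a\<in>{..<rk i}. B 0}"
 by (simp add: free_module_def alg_zero)

private lemma P_zero: "mzero (P i) n = (\<lambda>a\<in>{..<rk i}. 0 +o B (n - i))"
 by (simp add: free_module_def alg_zero coset_0)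

private lemma P_act:
 assumes "i \<le> n" "y : Z l" "\<And>a. x a : Z (n - i)"
 shows "mact (P i) l n (y +o B l) (\<lambda>a\<in>{..<rk i}. x a +o B (n - i)) =
  (\<lambda>a\<in>{..<rk i}. mul y (x a) +o B (l + n - i))"
 using assms unfolding free_module_def
 by (simp only: graded_module.simps if_True, intro restrict_ext)
  (simp add: alg_mult)

private lemma P_act_zero:
 assumes "n < i"
 shows "mact (P i) l n y v = (\<lambda>a\<in>{..<rk i}. 0 +o B (l + n - i))"
 using assms by (simp add: free_module_def alg_zero coset_0)

private lemma D_map: "module_map alg (P (Suc i)) (P i) (D i)"
 unfolding module_map_def
proof (intro conjI allI ballI subsetI)
 fix n u assume "u : D i n ` mcomp (P (Suc i)) n"
 then obtain v where v: "v : mcomp (P (Suc i)) n" "u = D i n v" by blast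
 show "u : mcomp (P i) n"
 proof (cases "Suc i \<le> n")
  case True
  then obtain m where m: "n = Suc (i + m)" by (auto simp: le_iff_add)
  from v(1) True obtain x where x: "\<And>a. x a : Z (n - Suc i)" "v = (\<lambda>a\<in>{..<rk (Suc i)}. x a +o B (n - Suc i))"
   by (rule P_compE) blast
  then have "u = (\<lambda>b\<in>{..<rk i}. (\<Sum>a<rk (Suc i). mul (x a) (c i a b)) +o B (Suc m))"
   unfolding v(2) using m by (intro D_coset) simp_all
  then show ?thesis using x c_Z m by (simp only:) (intro P_compI Zs(6) mul_Z_Suc, auto)
 next
  case False
  then have "u = (\<lambda>b\<in>{..<rk i}. 0 +o B 0)" unfolding v(2) by (simp add: D_zero coset_0)
  then show ?thesis using False P_compI[of i "%_. 0" 0 n] P_comp_zero[of n i] Zs(5)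
   by (cases "n = i") (simp_all add: coset_0)
 qed
next
 fix n v w assume v: "v : mcomp (P (Suc i)) n" and w: "w : mcomp (P (Suc i)) n"
 show "D i n (madd (P (Suc i)) n v w) = madd (P i) n (D i n v) (D i n w)"
 proof (cases "Suc i \<le> n")
  case True
  then obtain m where m: "n = Suc (i + m)" by (auto simp: le_iff_add)
  from v True obtain x where x: "\<And>a. x a : Z (n - Suc i)" "v = (\<lambda>a\<in>{..<rk (Suc i)}. x a +o B (n - Suc i))"
   by (rule P_compE) blast
  from w True obtain y where y: "\<And>a. y a : Z (n - Suc i)" "w = (\<lambda>a\<in>{..<rk (Suc i)}. y a +o B (n - Suc i))"
   by (rule P_compE) blast
  have add: "a < rk (Suc i) ==> madd (P (Suc i)) n v w a = (x a + y a) +o B m" for a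
   using True m by (simp add: free_module_def x y alg_add)
  have "D i n (madd (P (Suc i)) n v w) = (\<lambda>b\<in>{..<rk i}. (\<Sum>a<rk (Suc i). mul (x a + y a) (c i a b)) +o B (Suc m))"
   using x y m by (intro D_coset add Zs) simp_all
  moreover have "D i n v = (\<lambda>b\<in>{..<rk i}. (\<Sum>a<rk (Suc i). mul (x a) (c i a b)) +o B (Suc m))"
   using x m by (intro D_coset) simp_all
  moreover have "D i n w = (\<lambda>b\<in>{..<rk i}. (\<Sum>a<rk (Suc i). mul (y a) (c i a b)) +o B (Suc m))"
   using y m by (intro D_coset) simp_all
  moreover have "(\<Sum>a<rk (Suc i). mul (x a + y a) (c i a b)) =
    (\<Sum>a<rk (Suc i). mul (x a) (c i a b)) + (\<Sum>a<rk (Suc i). mul (y a) (c i a b))" if "b < rk i" for b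
   unfolding sum.distrib[symmetric] using x y m c_Z that
   by (intro sum.cong refl mul_add_left[of _ m _ _ 1]) auto
  moreover have "n - i = Suc m" using m by simp
  ultimately show ?thesis using m
   by (auto simp: free_module_def alg_add intro!: restrict_ext)
 next
  case False
  then have D0: "D i n u = (\<lambda>b\<in>{..<rk i}. B 0)" for u by (simp add: D_zero)
  have "(if i \<le> n then gadd alg (n - i) (B 0) (B 0) else gzero alg 0) = B 0"
   using alg_add[of 0 0 0] False by (cases "n = i") (simp_all add: coset_0 alg_zero)
  then show ?thesis unfolding D0 unfolding free_module_def
   by (simp only: graded_module.simps, intro restrict_ext) (simp split: if_splits)
 qed
next
 fix l n y v assume y: "y : gcomp alg l" and v: "v : mcomp (P (Suc i)) n"
 from y obtain y' where y': "y' : Z l" "y = y' +o B l" by (rule compE)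
 show "D i (l + n) (mact (P (Suc i)) l n y v) = mact (P i) l n y (D i n v)"
 proof (cases "Suc i \<le> n")
  case True
  then obtain m where m: "n = Suc (i + m)" by (auto simp: le_iff_add)
  from v True obtain x where x: "\<And>a. x a : Z (n - Suc i)" "v = (\<lambda>a\<in>{..<rk (Suc i)}. x a +o B (n - Suc i))"
   by (rule P_compE) blast
  have "mact (P (Suc i)) l n y v = (\<lambda>a\<in>{..<rk (Suc i)}. mul y' (x a) +o B (l + n - Suc i))"
   unfolding x(2) y'(2) using True y' x by (intro P_act) auto
  then have "D i (l + n) (mact (P (Suc i)) l n y v) =
    (\<lambda>b\<in>{..<rk i}. (\<Sum>a<rk (Suc i). mul (mul y' (x a)) (c i a b)) +o B (Suc (l + m)))"
   using x y' m by (intro D_coset mul_Z) auto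
  moreover have "(\<Sum>a<rk (Suc i). mul (mul y' (x a)) (c i a b)) =
    mul y' (\<Sum>a<rk (Suc i). mul (x a) (c i a b))" if "b < rk i" for b
   using that x y' m c_Z
   by (subst mul_sum_right[of _ l _ _ "m + 1"])
    (auto intro!: sum.cong assoc[of _ l _ m _ 1] mul_Z_Suc)
  moreover have "D i n v = (\<lambda>b\<in>{..<rk i}. (\<Sum>a<rk (Suc i). mul (x a) (c i a b)) +o B (Suc m))"
   using x m by (intro D_coset) simp_all
  moreover have "gmult alg l (n - i) y ((\<Sum>a<rk (Suc i). mul (x a) (c i a b)) +o B (Suc m)) =
    mul y' (\<Sum>a<rk (Suc i). mul (x a) (c i a b)) +o B (Suc (l + m))" if "b < rk i" for b
  proof -
   have "n - i = Suc m" using m by simp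
   then show ?thesis unfolding y'(2) using that y' x m c_Z
    by (simp only:) (rule alg_mult_Suc, auto intro!: Zs(6) mul_Z_Suc)
  qed
  moreover have "i \<le> n" using m by simp
  ultimately show ?thesis unfolding free_module_def
   by (simp only: graded_module.simps if_True, intro restrict_ext) simp
 next
  case False
  \<comment> \<open>Here \<open>v\<close> is zero, but \<open>l + n\<close> may exceed
    \<open>i\<close>, so the zero of degree \<open>l + n - i\<close> has to appear on both
    sides.\<close>
  have 1: "mact (P (Suc i)) l n y v = (\<lambda>a\<in>{..<rk (Suc i)}. 0 +o B (l + n - Suc i))"
   using False by (intro P_act_zero) simp
  have "D i (l + n) (mact (P (Suc i)) l n y v) = (\<lambda>b\<in>{..<rk i}. 0 +o B (l + n - i))"
  proof (cases "i < l + n")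
   case True
   then obtain m where m: "l + n = Suc (i + m)" by (auto simp: less_iff_Suc_add)
   have "D i (l + n) (mact (P (Suc i)) l n y v) =
     (\<lambda>b\<in>{..<rk i}. (\<Sum>a<rk (Suc i). mul 0 (c i a b)) +o B (Suc m))"
    unfolding 1 using m by (intro D_coset[of _ _ "%_. 0"] Zs) auto
   moreover have "(\<Sum>a<rk (Suc i). mul 0 (c i a b)) = 0" if "b < rk i" for b
    using c_Z that by (intro sum.neutral ballI mul_0_left[of _ 1]) auto
   moreover have "l + n - i = Suc m" using m by simp
   ultimately show ?thesis by (auto intro!: restrict_ext)
  next
   case False
   then show ?thesis by (simp add: D_zero coset_0)
  qed
  moreover have "mact (P i) l n y (D i n v) = (\<lambda>b\<in>{..<rk i}. 0 +o B (l + n - i))"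
  proof (cases "n < i")
   case False
   with \<open>\<not> Suc i \<le> n\<close> have "n = i" by simp
   moreover have "D i i v = (\<lambda>b\<in>{..<rk i}. 0 +o B (i - i))" by (simp add: D_zero coset_0)
   moreover have "mul y' 0 = 0" using mul_0_right y'(1) by blast
   ultimately show ?thesis using P_act[of i i y' l "%_. 0"] y' Zs(5) by (simp only:)
  qed (rule P_act_zero)
  ultimately show ?thesis by simp
 qed
qed

private definition eps :: "nat => (nat => ('x => 'k) set) => ('x => 'k) set" where
 "eps n v = (if n = 0 then v 0 else B 0)"

private lemma eps_map: "module_map alg (P 0) (trivial_module alg) eps"
 using alg_add[of 0 0 0]
 by (auto simp: module_map_def eps_def free_module_def trivial_module_def alg_zero rk_0 coset_0 PiE_iff)

private lemma eps_surj: "eps n ` mcomp (P 0) n = mcomp (trivial_module alg) n"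
proof (cases "n = 0")
 case True
 have "\<exists>v\<in>mcomp (P 0) 0. X = eps 0 v" if "X : gcomp alg 0" for X
  using that by (intro bexI[of _ "\<lambda>a\<in>{..<1}. X"]) (auto simp: eps_def free_module_def rk_0)
 with True show ?thesis
  by (auto simp: eps_def trivial_module_def free_module_def rk_0 PiE_iff)
next
 case False
 have "(\<lambda>a\<in>{..<rk 0}. 0 +o B n) : mcomp (P 0) n" by (intro P_compI Zs) simp
 with False show ?thesis by (auto simp: eps_def trivial_module_def alg_zero)
qed

private lemma eps_exact: "D 0 n ` mcomp (P 1) n = map_kernel (P 0) (trivial_module alg) eps n"
proof (cases n)
 case 0
 have z: "(\<lambda>a\<in>{..<1::nat}. B 0) : mcomp (P 0) 0"
  using P_compI[of 0 "%_. 0" 0 0] Zs(5) by (simp add: coset_0 rk_0)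
 have uniq: "v = (\<lambda>a\<in>{..<1::nat}. B 0)" if "v : mcomp (P 0) 0" "v 0 = B 0" for v
  using that by (auto simp: free_module_def rk_0 PiE_iff extensional_def fun_eq_iff)
 have ker: "map_kernel (P 0) (trivial_module alg) eps 0 = {v : mcomp (P 0) 0. v 0 = B 0}"
  by (simp add: map_kernel_def eps_def trivial_module_def alg_zero)
 have "map_kernel (P 0) (trivial_module alg) eps 0 = {\<lambda>a\<in>{..<1::nat}. B 0}"
  unfolding ker
 proof (intro subset_antisym subsetI)
  fix v assume "v : {v : mcomp (P 0) 0. v 0 = B 0}"
  with uniq[of v] show "v : {\<lambda>a\<in>{..<1::nat}. B 0}" by blast
 next
  fix v :: "nat => ('x => 'k) set" assume "v : {\<lambda>a\<in>{..<1::nat}. B 0}"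
  then have "v = (\<lambda>a\<in>{..<1::nat}. B 0)" by blast
  with z show "v : {v : mcomp (P 0) 0. v 0 = B 0}" by simp
 qed
 moreover have "D 0 0 ` mcomp (P 1) 0 = {\<lambda>a\<in>{..<1::nat}. B 0}"
  using P_comp_zero[of 0 1] by (simp add: D_zero rk_0)
 ultimately show ?thesis unfolding 0 by simp
next
 case (Suc m)
 have ker: "map_kernel (P 0) (trivial_module alg) eps n = mcomp (P 0) n"
  by (auto simp: Suc map_kernel_def eps_def trivial_module_def alg_zero)
 show ?thesis unfolding ker
 proof
  show "D 0 n ` mcomp (P 1) n <= mcomp (P 0) n"
   using D_map[of 0] unfolding module_map_def by simp
  show "mcomp (P 0) n <= D 0 n ` mcomp (P 1) n"
  proof
   fix u assume "u : mcomp (P 0) n"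
   then obtain x where x: "\<And>a. x a : Z (n - 0)" "u = (\<lambda>a\<in>{..<rk 0}. x a +o B (n - 0))"
    by (rule P_compE) auto
   from gen[of "x 0" m] x(1)[of 0] Suc obtain v where v: "\<And>a. v a : Z m"
    and d: "x 0 - (\<Sum>a<rk 1. mul (v a) (c 0 a 0)) : B (Suc m)" by auto
   have "D 0 n (\<lambda>a\<in>{..<rk 1}. v a +o B m) =
     (\<lambda>b\<in>{..<rk 0}. (\<Sum>a<rk (Suc 0). mul (v a) (c 0 a b)) +o B (Suc m))"
    using v Suc by (intro D_coset) auto
   also have "... = u" unfolding x(2)
    using Suc coset_eqI[OF d] by (auto simp: rk_0 intro!: restrict_ext)
   finally have eq: "D 0 n (\<lambda>a\<in>{..<rk 1}. v a +o B m) = u" .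
   have "(\<lambda>a\<in>{..<rk 1}. v a +o B m) : mcomp (P 1) n"
    using v Suc by (intro P_compI) simp_all
   with eq show "u : D 0 n ` mcomp (P 1) n" by auto
  qed
 qed
qed

private lemma D_exact: "D (Suc i) n ` mcomp (P (i + 2)) n = map_kernel (P (i + 1)) (P i) (D i) n"
proof
 show "D (Suc i) n ` mcomp (P (i + 2)) n <= map_kernel (P (i + 1)) (P i) (D i) n"
 proof
  fix u assume "u : D (Suc i) n ` mcomp (P (i + 2)) n"
  then obtain v where v: "v : mcomp (P (Suc (Suc i))) n" "u = D (Suc i) n v" by auto
  have u: "u : mcomp (P (Suc i)) n" using D_map[of "Suc i"] v unfolding module_map_def by blast
  have "D i n u = mzero (P i) n"
  proof (cases "Suc (Suc i) \<le> n")
   case True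
   then obtain m where m: "n = Suc (Suc (i + m))" by (auto simp: le_iff_add)
   from v True obtain x where x: "\<And>a. x a : Z (n - Suc (Suc i))"
     "v = (\<lambda>a\<in>{..<rk (Suc (Suc i))}. x a +o B (n - Suc (Suc i)))"
    by (elim P_compE) blast+
   define y where "y a = (\<Sum>h<rk (Suc (Suc i)). mul (x h) (c (Suc i) h a))" for a
   have yZ: "a < rk (Suc i) ==> y a : Z (Suc m)" for a
    unfolding y_def using x m c_Z by (intro Zs(6) mul_Z_Suc) auto
   have "u = (\<lambda>a\<in>{..<rk (Suc i)}. y a +o B (Suc m))"
    unfolding v(2) y_def using x m by (intro D_coset) simp_all
   then have "D i n u = (\<lambda>b\<in>{..<rk i}. (\<Sum>a<rk (Suc i). mul (y a) (c i a b)) +o B (Suc (Suc m)))"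
    using yZ m by (intro D_coset) simp_all
   also have "... = (\<lambda>b\<in>{..<rk i}. 0 +o B (Suc (Suc m)))"
   proof (rule restrict_ext, rule coset_eqI)
    fix b assume b: "b : {..<rk i}"
    have "(\<Sum>a<rk (Suc i). mul (y a) (c i a b)) =
      (\<Sum>a<rk (Suc i). \<Sum>h<rk (Suc (Suc i)). mul (x h) (mul (c (Suc i) h a) (c i a b)))"
     unfolding y_def using x m b c_Z
     by (intro sum.cong refl trans[OF mul_sum_left[of _ _ "m + 1" _ 1]])
      (auto intro!: sum.cong assoc[of _ m _ 1 _ 1] mul_Z_Suc)
    also have "... = (\<Sum>h<rk (Suc (Suc i)). mul (x h) (\<Sum>a<rk (Suc i). mul (c (Suc i) h a) (c i a b)))"
     unfolding sum.swap[of _ "{..<rk (Suc (Suc i))}"] using x m b c_Z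
     by (intro sum.cong refl mul_sum_right[of _ m _ _ 2, symmetric])
      (use mul_Z[of _ 1 _ 1] in \<open>auto simp: numeral_2_eq_2\<close>)
    also have "... : B (m + 2)"
     using x m b by (intro Bs(6)[of "{..<rk (Suc (Suc i))}"] mul_B_right complex) auto
    finally show "(\<Sum>a<rk (Suc i). mul (y a) (c i a b)) - 0 : B (Suc (Suc m))" by simp
   qed
   also have "n - i = Suc (Suc m)" using m by simp
   then have "(\<lambda>b\<in>{..<rk i}. 0 +o B (Suc (Suc m))) = mzero (P i) n" by (simp add: P_zero)
   finally show ?thesis .
  next
   case False
   then have u0: "u = (\<lambda>b\<in>{..<rk (Suc i)}. 0 +o B 0)" unfolding v(2) by (simp add: D_zero coset_0)
   show ?thesis
   proof (cases "n = Suc i")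
    case True
    have "D i n u = (\<lambda>b\<in>{..<rk i}. (\<Sum>a<rk (Suc i). mul 0 (c i a b)) +o B (Suc 0))"
     unfolding u0 using True by (intro D_coset[of _ _ "%_. 0"] Zs) auto
    moreover have "(\<Sum>a<rk (Suc i). mul 0 (c i a b)) = 0" if "b < rk i" for b
     using c_Z that by (intro sum.neutral ballI mul_0_left[of _ 1]) auto
    ultimately show ?thesis using True by (auto simp: P_zero intro!: restrict_ext)
   next
    case False
    with \<open>\<not> Suc (Suc i) \<le> n\<close> have "n \<le> i" by simp
    then show ?thesis by (simp add: D_zero P_zero coset_0)
   qed
  qed
  with u show "u : map_kernel (P (i + 1)) (P i) (D i) n" by (simp add: map_kernel_def)
 qed
 show "map_kernel (P (i + 1)) (P i) (D i) n <= D (Suc i) n ` mcomp (P (i + 2)) n"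
 proof
  fix u assume "u : map_kernel (P (i + 1)) (P i) (D i) n"
  then have u: "u : mcomp (P (Suc i)) n" and ker: "D i n u = mzero (P i) n"
   by (simp_all add: map_kernel_def)
  consider "n \<le> i" | "n = Suc i" | m where "n = Suc (Suc (i + m))"
   using le_Suc_ex[of "Suc (Suc i)" n] by fastforce
  then show "u : D (Suc i) n ` mcomp (P (i + 2)) n"
  proof cases
   case 1
   then have "u = (\<lambda>a\<in>{..<rk (Suc i)}. B 0)" using u P_comp_zero[of n "Suc i"] by simp
   then show ?thesis using 1 by (simp add: P_comp_zero D_zero)
  next
   case 2
   from u 2 obtain x where x: "\<And>a. x a : Z (n - Suc i)" "u = (\<lambda>a\<in>{..<rk (Suc i)}. x a +o B (n - Suc i))"
    by (elim P_compE) auto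
   have "D i n u = (\<lambda>b\<in>{..<rk i}. (\<Sum>a<rk (Suc i). mul (x a) (c i a b)) +o B (Suc 0))"
    using x 2 by (intro D_coset) simp_all
   moreover have "n - i = Suc 0" using 2 by simp
   ultimately have eq: "(\<lambda>b\<in>{..<rk i}. (\<Sum>a<rk (Suc i). mul (x a) (c i a b)) +o B (Suc 0)) =
     (\<lambda>b\<in>{..<rk i}. 0 +o B (Suc 0))" by (simp only: ker P_zero)
   have "(\<Sum>a<rk (Suc i). mul (x a) (c i a b)) : B 1" if "b < rk i" for b
   proof -
    have "(\<Sum>a<rk (Suc i). mul (x a) (c i a b)) +o B (Suc 0) = 0 +o B (Suc 0)"
     using fun_cong[OF eq, of b] that by (simp only: restrict_apply lessThan_iff if_True)
    then show ?thesis unfolding coset_eq_iff by simp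
   qed
   then have "a < rk (Suc i) ==> x a : B 0" for a using x 2 by (intro exact_0) auto
   then have "u = (\<lambda>a\<in>{..<rk (Suc i)}. 0 +o B 0)"
    unfolding x(2) 2 diff_self_eq_0 by (intro restrict_ext coset_eqI) simp
   then show ?thesis using 2 by (simp add: P_comp_zero D_zero coset_0)
  next
   case (3 m)
   from u 3 obtain x where x: "\<And>a. x a : Z (n - Suc i)" "u = (\<lambda>a\<in>{..<rk (Suc i)}. x a +o B (n - Suc i))"
    by (elim P_compE) auto
   have nm: "n - Suc i = Suc m" "n - i = Suc (Suc m)" using 3 by simp_all
   have "D i n u = (\<lambda>b\<in>{..<rk i}. (\<Sum>a<rk (Suc i). mul (x a) (c i a b)) +o B (Suc (Suc m)))"
    using x nm 3 by (intro D_coset) simp_all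
   then have eq: "(\<lambda>b\<in>{..<rk i}. (\<Sum>a<rk (Suc i). mul (x a) (c i a b)) +o B (Suc (Suc m))) =
     (\<lambda>b\<in>{..<rk i}. 0 +o B (Suc (Suc m)))" by (simp only: ker P_zero nm)
   have "(\<Sum>a<rk (Suc i). mul (x a) (c i a b)) : B (Suc (Suc m))" if "b < rk i" for b
   proof -
    have "(\<Sum>a<rk (Suc i). mul (x a) (c i a b)) +o B (Suc (Suc m)) = 0 +o B (Suc (Suc m))"
     using fun_cong[OF eq, of b] that by (simp only: restrict_apply lessThan_iff if_True)
    then show ?thesis unfolding coset_eq_iff by simp
   qed
   from exact_Suc[OF _ this] x nm obtain w where w: "\<And>h. w h : Z m"
    and d: "\<And>a. a < rk (Suc i) ==>
     x a - (\<Sum>h<rk (Suc (Suc i)). mul (w h) (c (Suc i) h a)) : B (Suc m)" by auto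
   have "D (Suc i) n (\<lambda>h\<in>{..<rk (Suc (Suc i))}. w h +o B m) =
     (\<lambda>a\<in>{..<rk (Suc i)}. (\<Sum>h<rk (Suc (Suc i)). mul (w h) (c (Suc i) h a)) +o B (Suc m))"
    using w 3 by (intro D_coset) auto
   also have "... = u" unfolding x(2)
    using nm coset_eqI[OF d] by (auto intro!: restrict_ext)
   finally have eq: "D (Suc i) n (\<lambda>h\<in>{..<rk (Suc (Suc i))}. w h +o B m) = u" .
   have "(\<lambda>h\<in>{..<rk (Suc (Suc i))}. w h +o B m) : mcomp (P (Suc (Suc i))) n"
    using w 3 by (intro P_compI) simp_all
   with eq show ?thesis by auto
  qed
 qed
qed

theorem koszul: "koszul_algebra alg"
proof -
 define K where "K = (%(rk :: nat => nat) \<epsilon> D. let P = (%i. free_module alg (rk i) i) in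
   module_map alg (P 0) (trivial_module alg) \<epsilon> \<and>
   (\<forall>i. module_map alg (P (Suc i)) (P i) (D i)) \<and>
   (\<forall>n. \<epsilon> n ` mcomp (P 0) n = mcomp (trivial_module alg) n) \<and>
   (\<forall>n. D 0 n ` mcomp (P 1) n = map_kernel (P 0) (trivial_module alg) \<epsilon> n) \<and>
   (\<forall>i n. D (Suc i) n ` mcomp (P (i + 2)) n = map_kernel (P (i + 1)) (P i) (D i) n))"
 have "K rk eps D"
  unfolding K_def Let_def by (intro conjI allI eps_map D_map eps_surj eps_exact D_exact)
 then have "\<exists>rk \<epsilon> D. K rk \<epsilon> D" by blast
 with connected_graded_algebra show ?thesis unfolding koszul_algebra_def K_def by (rule conjI)
qed

end

end

section \<open>Isomorphisms of graded algebras and transport of resolutions\<close>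

lemma galg_isomorphic_sym:
 assumes "connected_graded_algebra A" "galg_isomorphic A B"
 shows "galg_isomorphic B A"
proof -
 interpret A: connected_graded_algebra A by fact
 obtain \<phi> where iso: "galg_iso A B \<phi>" using assms(2) unfolding galg_isomorphic_def by blast
 have bij: "bij_betw (\<phi> n) (gcomp A n) (gcomp B n)" for n using iso unfolding galg_iso_def by blast
 define \<psi> where "\<psi> n = inv_into (gcomp A n) (\<phi> n)" for n
 have surj: "\<exists>x\<in>gcomp A n. y = \<phi> n x" if "y : gcomp B n" for n y
  using bij_betw_imp_surj_on[OF bij] that by blast
 have \<psi>: "\<psi> n (\<phi> n x) = x" if "x : gcomp A n" for n x
  unfolding \<psi>_def by (rule inv_into_f_f[OF bij_betw_imp_inj_on[OF bij] that])
 have add: "gadd B n (\<phi> n x) (\<phi> n y) = \<phi> n (gadd A n x y)"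
  and sc: "gsmult B n c (\<phi> n x) = \<phi> n (gsmult A n c x)"
  if "x : gcomp A n" "y : gcomp A n" for n x y c
  using iso that unfolding galg_iso_def by simp_all
 have mul: "gmult B m n (\<phi> m x) (\<phi> n y) = \<phi> (m + n) (gmult A m n x y)"
  if "x : gcomp A m" "y : gcomp A n" for m n x y
  using iso that unfolding galg_iso_def by simp
 have one: "gone B = \<phi> 0 (gone A)" using iso unfolding galg_iso_def by simp
 have "galg_iso B A \<psi>"
  unfolding galg_iso_def
 proof (intro conjI allI ballI)
  fix n show "bij_betw (\<psi> n) (gcomp B n) (gcomp A n)"
   unfolding \<psi>_def by (rule bij_betw_inv_into[OF bij])
 next
  fix n x y assume "x : gcomp B n" "y : gcomp B n"
  then obtain x' y' where "x' : gcomp A n" "x = \<phi> n x'" "y' : gcomp A n" "y = \<phi> n y'"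
   using surj by metis
  then show "\<psi> n (gadd B n x y) = gadd A n (\<psi> n x) (\<psi> n y)"
   by (simp add: add \<psi> A.add_closed)
 next
  fix n c x assume "x : gcomp B n"
  then obtain x' where "x' : gcomp A n" "x = \<phi> n x'" using surj by metis
  then show "\<psi> n (gsmult B n c x) = gsmult A n c (\<psi> n x)"
   by (simp add: sc[of x' n x'] \<psi> A.smult_closed)
 next
  fix m n x y assume "x : gcomp B m" "y : gcomp B n"
  then obtain x' y' where "x' : gcomp A m" "x = \<phi> m x'" "y' : gcomp A n" "y = \<phi> n y'"
   using surj by metis
  then show "\<psi> (m + n) (gmult B m n x y) = gmult A m n (\<psi> m x) (\<psi> n y)"
   by (simp add: mul \<psi> A.mult_closed)
 next
  show "\<psi> 0 (gone B) = gone A" by (simp add: one \<psi> A.one_closed)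
 qed
 then show ?thesis unfolding galg_isomorphic_def by blast
qed

text \<open>An isomorphism of subquotients given on representatives: \<open>map_B\<close> read in
  one direction is well-definedness and in the other injectivity, while surjectivity is asked only
  modulo \<open>B'\<close>.\<close>

locale subquotient_morphism =
 S: subquotient mul e Z B + S': subquotient mul' e' Z' B'
 for mul :: "('x => 'k::field) => ('x => 'k) => 'x => 'k" and e Z B
  and mul' :: "('y => 'k) => ('y => 'k) => 'y => 'k" and e' Z' B' +
 fixes \<Psi> :: "nat => ('x => 'k) => 'y => 'k"
 assumes map_Z: "x : Z n ==> \<Psi> n x : Z' n"
  and map_add: "x : Z n ==> y : Z n ==> \<Psi> n (x + y) = \<Psi> n x + \<Psi> n y"
  and map_scale: "x : Z n ==> \<Psi> n (fscale c x) = fscale c (\<Psi> n x)"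
  and map_mul: "x : Z m ==> y : Z n ==> \<Psi> (m + n) (mul x y) = mul' (\<Psi> m x) (\<Psi> n y)"
  and map_e: "\<Psi> 0 e = e'"
  and map_B: "x : Z n ==> \<Psi> n x : B' n \<longleftrightarrow> x : B n"
  and surj: "z : Z' n ==> \<exists>x\<in>Z n. z - \<Psi> n x : B' n"
begin

lemma map_diff: "x : Z n ==> y : Z n ==> \<Psi> n (x - y) = \<Psi> n x - \<Psi> n y"
 using map_add[of "x - y" n y] S.Zs(2) by (simp add: algebra_simps)

lemma map_0: "\<Psi> n 0 = 0"
 using map_diff[of 0 n 0] S.Zs(5) by simp

lemma map_sum: "(\<And>i. i : I ==> x i : Z n) ==> \<Psi> n (\<Sum>i\<in>I. x i) = (\<Sum>i\<in>I. \<Psi> n (x i))"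
proof (induction I rule: infinite_finite_induct)
 case (insert i I)
 then have "x i : Z n" "(\<Sum>i\<in>I. x i) : Z n" by (auto intro: S.Zs(6))
 then have "\<Psi> n (x i + (\<Sum>i\<in>I. x i)) = \<Psi> n (x i) + \<Psi> n (\<Sum>i\<in>I. x i)" by (rule map_add)
 moreover have "\<Psi> n (\<Sum>i\<in>I. x i) = (\<Sum>i\<in>I. \<Psi> n (x i))" using insert by blast
 ultimately have "\<Psi> n (\<Sum>i\<in>insert i I. x i) = (\<Sum>i\<in>insert i I. \<Psi> n (x i))"
  unfolding sum.insert[OF insert(1,2)] by simp
 then show ?case .
qed (simp_all add: map_0)

theorem isomorphic: "galg_isomorphic S.alg S'.alg"
proof -
 define \<phi> where "\<phi> n X = \<Psi> n (S.rep X) +o B' n" for n X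
 have \<phi>: "\<phi> n (x +o B n) = \<Psi> n x +o B' n" if x: "x : Z n" for n x
 proof -
  have r: "S.rep (x +o B n) : Z n" by (rule S.rep_Z[OF S.comp_coset[OF x]])
  have "\<Psi> n (S.rep (x +o B n) - x) : B' n"
   using map_B[OF S.Zs(2)[OF r x]] S.rep_coset by blast
  then show ?thesis unfolding \<phi>_def map_diff[OF r x] by (rule S'.coset_eqI)
 qed
 have "galg_iso S.alg S'.alg \<phi>"
  unfolding galg_iso_def
 proof (intro conjI allI ballI)
  fix n show "bij_betw (\<phi> n) (gcomp S.alg n) (gcomp S'.alg n)"
   unfolding bij_betw_def
  proof (rule conjI, rule inj_onI, rule_tac [2] subset_antisym, rule_tac [2] subsetI, rule_tac [3] subsetI)
   fix X Y assume "X : gcomp S.alg n" "Y : gcomp S.alg n" and eq: "\<phi> n X = \<phi> n Y"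
   then obtain x y where xy: "x : Z n" "X = x +o B n" "y : Z n" "Y = y +o B n"
    by (elim S.compE)
   with eq have "\<Psi> n x +o B' n = \<Psi> n y +o B' n" by (simp only: \<phi>)
   then have "\<Psi> n (x - y) : B' n" using xy by (simp only: S'.coset_eq_iff map_diff)
   then have "x - y : B n" using xy map_B S.Zs(2) by blast
   then show "X = Y" unfolding xy by (rule S.coset_eqI)
  next
   fix Y assume "Y : \<phi> n ` gcomp S.alg n"
   then obtain X where "X : gcomp S.alg n" "Y = \<phi> n X" by blast
   then obtain x where "x : Z n" "X = x +o B n" by (elim S.compE)
   then show "Y : gcomp S'.alg n" using \<open>Y = \<phi> n X\<close> by (simp only: \<phi> S'.comp_coset map_Z)
  next
   fix Y assume "Y : gcomp S'.alg n"
   then obtain y where y: "y : Z' n" "Y = y +o B' n" by (rule S'.compE)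
   then obtain x where x: "x : Z n" "y - \<Psi> n x : B' n" using surj by blast
   have "Y = \<phi> n (x +o B n)" unfolding y(2) \<phi>[OF x(1)] by (rule S'.coset_eqI[OF x(2)])
   then show "Y : \<phi> n ` gcomp S.alg n" using S.comp_coset[OF x(1)] by blast
  qed
 next
  fix n X Y assume "X : gcomp S.alg n" "Y : gcomp S.alg n"
  then obtain x y where "x : Z n" "X = x +o B n" "y : Z n" "Y = y +o B n"
   by (elim S.compE)
  then show "\<phi> n (gadd S.alg n X Y) = gadd S'.alg n (\<phi> n X) (\<phi> n Y)"
   by (simp only: S.alg_add \<phi> S'.alg_add S.Zs map_add)
 next
  fix n c X assume "X : gcomp S.alg n"
  then obtain x where "x : Z n" "X = x +o B n" by (elim S.compE)
  then show "\<phi> n (gsmult S.alg n c X) = gsmult S'.alg n c (\<phi> n X)"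
   by (simp only: S.alg_scale \<phi> S'.alg_scale S.Zs map_scale)
 next
  fix m n X Y assume "X : gcomp S.alg m" "Y : gcomp S.alg n"
  then obtain x y where "x : Z m" "X = x +o B m" "y : Z n" "Y = y +o B n"
   by (elim S.compE)
  then show "\<phi> (m + n) (gmult S.alg m n X Y) = gmult S'.alg m n (\<phi> m X) (\<phi> n Y)"
   by (simp only: S.alg_mult \<phi> S'.alg_mult S.mul_Z map_mul map_Z)
 next
  show "\<phi> 0 (gone S.alg) = gone S'.alg"
   by (simp only: S.alg_one S'.alg_one \<phi> S.e_Z map_e)
 qed
 then show ?thesis unfolding galg_isomorphic_def by blast
qed

theorem isomorphic_sym: "galg_isomorphic S'.alg S.alg"
 by (rule galg_isomorphic_sym[OF S.connected_graded_algebra isomorphic])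

lemma lift:
 assumes "\<And>a. v a : Z' n"
 obtains x where "\<And>a. x a : Z n" "\<And>a. v a - \<Psi> n (x a) : B' n"
proof -
 have "\<forall>a. \<exists>x. x : Z n \<and> v a - \<Psi> n x : B' n" using assms surj by blast
 from choice[OF this] that show ?thesis by blast
qed

text \<open>Resolutions are constructed over the quadratic algebras, where tensors can be handled
  explicitly; this carries them, matrix entry by matrix entry, to cohomology and to the graded group
  algebra.\<close>

lemma linear_resolution_map:
 assumes res: "S.linear_resolution rk c"
 shows "S'.linear_resolution rk (%i a b. \<Psi> 1 (c i a b))"
proof -
 have rk: "rk 0 = 1" and cZ: "\<And>i a b. a < rk (Suc i) ==> b < rk i ==> c i a b : Z 1"
  and gen: "\<And>n z. z : Z (Suc n) ==>
   \<exists>v. (\<forall>a. v a : Z n) \<and> z - (\<Sum>a<rk 1. mul (v a) (c 0 a 0)) : B (Suc n)"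
  and complex: "\<And>i h b. h < rk (Suc (Suc i)) ==> b < rk i ==>
   (\<Sum>a<rk (Suc i). mul (c (Suc i) h a) (c i a b)) : B 2"
  and ex0: "\<And>i v a. (\<And>a. v a : Z 0) ==>
   (\<And>b. b < rk i ==> (\<Sum>a<rk (Suc i). mul (v a) (c i a b)) : B 1) ==> a < rk (Suc i) ==> v a : B 0"
  and exS: "\<And>i v n. (\<And>a. v a : Z (Suc n)) ==>
   (\<And>b. b < rk i ==> (\<Sum>a<rk (Suc i). mul (v a) (c i a b)) : B (Suc (Suc n))) ==>
   \<exists>w. (\<forall>h. w h : Z n) \<and>
    (\<forall>a<rk (Suc i). v a - (\<Sum>h<rk (Suc (Suc i)). mul (w h) (c (Suc i) h a)) : B (Suc n))"
  using res unfolding S.linear_resolution_def by blast+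
 have sumZ: "(\<Sum>a<r. mul (x a) (y a)) : Z (Suc n)"
  and sum_map: "\<Psi> (Suc n) (\<Sum>a<r. mul (x a) (y a)) = (\<Sum>a<r. mul' (\<Psi> n (x a)) (\<Psi> 1 (y a)))"
  if xy: "\<And>a. x a : Z n" "\<And>a. a < r ==> y a : Z 1" for r x y n
 proof -
  have z: "\<And>a. a < r ==> mul (x a) (y a) : Z (Suc n)" using S.mul_Z_Suc xy by blast
  then show "(\<Sum>a<r. mul (x a) (y a)) : Z (Suc n)" by (intro S.Zs(6)) simp
  have "\<Psi> (Suc n) (\<Sum>a<r. mul (x a) (y a)) = (\<Sum>a<r. \<Psi> (Suc n) (mul (x a) (y a)))"
   using z by (intro map_sum) simp
  also have "... = (\<Sum>a<r. mul' (\<Psi> n (x a)) (\<Psi> 1 (y a)))"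
   using map_mul[of _ n _ 1] xy by (intro sum.cong refl) simp
  finally show "\<Psi> (Suc n) (\<Sum>a<r. mul (x a) (y a)) = (\<Sum>a<r. mul' (\<Psi> n (x a)) (\<Psi> 1 (y a)))" .
 qed
 have sum_cong': "(\<Sum>a<r. mul' (v a) (y a)) - (\<Sum>a<r. mul' (v' a) (y a)) : B' (Suc n)"
  if "\<And>a. v a : Z' n" "\<And>a. v' a : Z' n" "\<And>a. v a - v' a : B' n" "\<And>a. a < r ==> y a : Z' 1" for r v v' y n
  unfolding sum_subtractf[symmetric]
 proof (rule S'.Bs(6))
  fix a assume "a : {..<r}"
  then have "mul' (v a) (y a) - mul' (v' a) (y a) = mul' (v a - v' a) (y a)"
   using that by (intro S'.mul_diff_left[of _ n _ _ 1, symmetric]) auto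
  also have "... : B' (n + 1)" using that \<open>a : {..<r}\<close> by (intro S'.mul_B_left) auto
  finally show "mul' (v a) (y a) - mul' (v' a) (y a) : B' (Suc n)" by simp
 qed
 \<comment> \<open>A syzygy over the target lifts to one over the source: changing representatives
   alters the sum only within \<open>B'\<close>, and \<open>map_B\<close> reflects
   membership.\<close>
 have pull: "(\<Sum>a<r. mul (x a) (y a)) : B (Suc n)"
  if v: "\<And>a. v a : Z' n" and x: "\<And>a. x a : Z n" and d: "\<And>a. v a - \<Psi> n (x a) : B' n"
   and y: "\<And>a. a < r ==> y a : Z 1"
   and s: "(\<Sum>a<r. mul' (v a) (\<Psi> 1 (y a))) : B' (Suc n)" for r v x y n
 proof -
  have "(\<Sum>a<r. mul' (v a) (\<Psi> 1 (y a))) - (\<Sum>a<r. mul' (\<Psi> n (x a)) (\<Psi> 1 (y a))) : B' (Suc n)"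
   using v x d y map_Z by (intro sum_cong') auto
  from S'.Bs(2)[OF s this] have "\<Psi> (Suc n) (\<Sum>a<r. mul (x a) (y a)) : B' (Suc n)"
   using sum_map[of x n r y] x y by simp
  then show ?thesis using map_B sumZ[of x n r y] x y by blast
 qed
 show ?thesis unfolding S'.linear_resolution_def
 proof (intro conjI allI impI ballI)
  show "rk 0 = 1" by (rule rk)
  show "\<Psi> 1 (c i a b) : Z' 1" if "a < rk (Suc i)" "b < rk i" for i a b
   using that cZ map_Z by blast
  show "\<exists>v. (\<forall>a. v a : Z' n) \<and> z - (\<Sum>a<rk 1. mul' (v a) (\<Psi> 1 (c 0 a 0))) : B' (Suc n)"
   if z: "z : Z' (Suc n)" for n z
  proof -
   obtain x where x: "x : Z (Suc n)" "z - \<Psi> (Suc n) x : B' (Suc n)" using surj[OF z] by blast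
   obtain v where v: "\<And>a. v a : Z n" "x - (\<Sum>a<rk 1. mul (v a) (c 0 a 0)) : B (Suc n)"
    using gen[OF x(1)] by blast
   have c0: "\<And>a. a < rk 1 ==> c 0 a 0 : Z 1" using cZ rk by simp
   have "\<Psi> (Suc n) (x - (\<Sum>a<rk 1. mul (v a) (c 0 a 0))) : B' (Suc n)"
    using v map_B[OF S.BZ[OF v(2)]] by blast
   then have "\<Psi> (Suc n) x - (\<Sum>a<rk 1. mul' (\<Psi> n (v a)) (\<Psi> 1 (c 0 a 0))) : B' (Suc n)"
    using map_diff[OF x(1) sumZ[of v n "rk 1" "%a. c 0 a 0"]] sum_map[of v n "rk 1" "%a. c 0 a 0"] v(1) c0
    by simp
   from S'.Bs(1)[OF x(2) this] show ?thesis
    using v(1) map_Z by (intro exI[of _ "%a. \<Psi> n (v a)"]) simp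
  qed
  show "(\<Sum>a<rk (Suc i). mul' (\<Psi> 1 (c (Suc i) h a)) (\<Psi> 1 (c i a b))) : B' 2"
   if hb: "h < rk (Suc (Suc i))" "b < rk i" for i h b
  proof -
   have z: "mul (c (Suc i) h a) (c i a b) : Z 2" if "a < rk (Suc i)" for a
    using S.mul_Z[OF cZ[OF hb(1) that] cZ[OF that hb(2)]] by (simp add: numeral_2_eq_2)
   have "(\<Sum>a<rk (Suc i). mul' (\<Psi> 1 (c (Suc i) h a)) (\<Psi> 1 (c i a b))) =
     (\<Sum>a<rk (Suc i). \<Psi> 2 (mul (c (Suc i) h a) (c i a b)))"
    using map_mul[of _ 1 _ 1] cZ hb by (intro sum.cong refl) (simp add: numeral_2_eq_2)
   also have "... = \<Psi> 2 (\<Sum>a<rk (Suc i). mul (c (Suc i) h a) (c i a b))"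
    using z by (intro map_sum[symmetric]) simp
   also have "... : B' 2" using complex[OF hb] map_B S.BZ by blast
   finally show ?thesis .
  qed
  show "v a : B' 0" if v: "\<forall>a. v a : Z' 0"
   and s: "\<forall>b<rk i. (\<Sum>a<rk (Suc i). mul' (v a) (\<Psi> 1 (c i a b))) : B' 1" and a: "a < rk (Suc i)" for i v a
  proof -
   obtain x where x: "\<And>a. x a : Z 0" "\<And>a. v a - \<Psi> 0 (x a) : B' 0" using lift[of v 0] v by blast
   have "(\<Sum>a<rk (Suc i). mul (x a) (c i a b)) : B (Suc 0)" if "b < rk i" for b
    using v x s that cZ by (intro pull[of v 0 x]) auto
   then have "x a : B 0" using x(1) a by (intro ex0[of x i]) auto
   then have "\<Psi> 0 (x a) : B' 0" using map_B x(1) by blast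
   from S'.Bs(1)[OF x(2)[of a] this] show ?thesis by simp
  qed
  show "\<exists>w. (\<forall>h. w h : Z' n) \<and> (\<forall>a<rk (Suc i).
    v a - (\<Sum>h<rk (Suc (Suc i)). mul' (w h) (\<Psi> 1 (c (Suc i) h a))) : B' (Suc n))"
   if v: "\<forall>a. v a : Z' (Suc n)"
   and s: "\<forall>b<rk i. (\<Sum>a<rk (Suc i). mul' (v a) (\<Psi> 1 (c i a b))) : B' (Suc (Suc n))" for i n v
  proof -
   obtain x where x: "\<And>a. x a : Z (Suc n)" "\<And>a. v a - \<Psi> (Suc n) (x a) : B' (Suc n)"
    using lift[of v "Suc n"] v by blast
   have "(\<Sum>a<rk (Suc i). mul (x a) (c i a b)) : B (Suc (Suc n))" if "b < rk i" for b
    using v x s that cZ by (intro pull[of v "Suc n" x]) auto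
   then obtain w where w: "\<And>h. w h : Z n"
    and d: "\<And>a. a < rk (Suc i) ==>
     x a - (\<Sum>h<rk (Suc (Suc i)). mul (w h) (c (Suc i) h a)) : B (Suc n)"
    using exS[of x n i] x(1) by blast
   have "v a - (\<Sum>h<rk (Suc (Suc i)). mul' (\<Psi> n (w h)) (\<Psi> 1 (c (Suc i) h a))) : B' (Suc n)"
    if a: "a < rk (Suc i)" for a
   proof -
    have c: "\<And>h. h < rk (Suc (Suc i)) ==> c (Suc i) h a : Z 1" using cZ a by blast
    have "\<Psi> (Suc n) (x a - (\<Sum>h<rk (Suc (Suc i)). mul (w h) (c (Suc i) h a))) : B' (Suc n)"
     using d[OF a] map_B[OF S.BZ[OF d[OF a]]] by blast
    then have "\<Psi> (Suc n) (x a) - (\<Sum>h<rk (Suc (Suc i)). mul' (\<Psi> n (w h)) (\<Psi> 1 (c (Suc i) h a))) : B' (Suc n)"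
     using map_diff[OF x(1)[of a] sumZ[of w n "rk (Suc (Suc i))" "%h. c (Suc i) h a"]]
      sum_map[of w n "rk (Suc (Suc i))" "%h. c (Suc i) h a"] w c by simp
    from S'.Bs(1)[OF x(2)[of a] this] show ?thesis by simp
   qed
   then show ?thesis using w map_Z by (intro exI[of _ "%h. \<Psi> n (w h)"]) blast
  qed
 qed
qed

end

section \<open>Tensors\<close>

lemma conc_Nil: "conc f g [] = f [] * g []"
 by (simp add: conc_def)

lemma conc_Cons: "conc f g (x # w) = f [] * g (x # w) + conc (%u. f (x # u)) g w"
proof -
 have "conc f g (x # w) = (\<Sum>i\<le>Suc (length w). f (take i (x # w)) * g (drop i (x # w)))"
  by (simp add: conc_def)
 also have "... = f [] * g (x # w) + conc (%u. f (x # u)) g w"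
  by (subst sum.atMost_Suc_shift) (simp add: conc_def)
 finally show ?thesis .
qed

lemma conc_add_left: "conc (f + f') g = conc f g + conc f' g"
 by (simp add: conc_def fun_eq_iff distrib_right sum.distrib)

lemma conc_add_right: "conc f (g + g') = conc f g + conc f g'"
 by (simp add: conc_def fun_eq_iff distrib_left sum.distrib)

lemma conc_scale_left: "conc (fscale c f) g = fscale c (conc f g)"
 by (simp add: conc_def fun_eq_iff sum_distrib_left mult.assoc)

lemma conc_scale_right: "conc f (fscale c g) = fscale c (conc f g)"
 by (simp add: conc_def fun_eq_iff sum_distrib_left mult.left_commute)

lemma conc_0_left [simp]: "conc 0 g = 0" and conc_0_right [simp]: "conc f 0 = 0"
 by (simp_all add: conc_def fun_eq_iff)

lemma conc_minus_left: "conc (f - f') g = conc f g - conc f' g"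
 using conc_add_left[of "f - f'" f' g] by (simp add: algebra_simps)

lemma conc_minus_right: "conc f (g - g') = conc f g - conc f g'"
 using conc_add_right[of f "g - g'" g'] by (simp add: algebra_simps)

lemma sum_apply: "(\<Sum>i\<in>I. f i) x = (\<Sum>i\<in>I. f i x)"
 by (induction I rule: infinite_finite_induct) simp_all

lemma conc_sum_left: "conc (\<Sum>i\<in>I. f i) g = (\<Sum>i\<in>I. conc (f i) g)"
proof
 fix w show "conc (\<Sum>i\<in>I. f i) g w = (\<Sum>i\<in>I. conc (f i) g) w"
  unfolding sum_apply conc_def sum_distrib_right by (rule sum.swap)
qed

lemma conc_sum_right: "conc f (\<Sum>i\<in>I. g i) = (\<Sum>i\<in>I. conc f (g i))"
proof
 fix w show "conc f (\<Sum>i\<in>I. g i) w = (\<Sum>i\<in>I. conc f (g i)) w"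
  unfolding sum_apply conc_def sum_distrib_left by (rule sum.swap)
qed

lemma conc_assoc: "conc (conc f g) h = conc f (conc g h)"
proof
 fix w show "conc (conc f g) h w = conc f (conc g h) w"
 proof (induction w arbitrary: f)
  case (Cons x w)
  have "(%u. conc f g (x # u)) = fscale (f []) (%u. g (x # u)) + conc (%u. f (x # u)) g"
   by (simp add: conc_Cons fun_eq_iff)
  then show ?case
   using Cons[of "%u. f (x # u)"]
   by (simp add: conc_Cons[of "conc f g"] conc_Cons[of f "conc g h"] conc_Cons[of g h] conc_Nil
     conc_add_left conc_scale_left algebra_simps)
 qed (simp add: conc_Nil mult.assoc)
qed

lemma conc_one_left [simp]:
 fixes f :: "'x list => 'k::field"
 shows "conc (monomial []) f = f"
proof
 fix w show "conc (monomial []) f w = f w"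
 proof (cases w)
  case (Cons x v)
  have "(%u. monomial [] (x # u)) = (0 :: 'x list => 'k)" by (simp add: monomial_def fun_eq_iff)
  with Cons show ?thesis by (simp add: conc_Cons monomial_def)
 qed (simp add: conc_Nil monomial_def)
qed

lemma conc_monomial_append:
 fixes f :: "'x list => 'k::field"
 shows "conc f (monomial v) w = (if \<exists>u. w = u @ v then f (take (length w - length v) w) else 0)"
proof (cases "\<exists>u. w = u @ v")
 case True
 then obtain u where u: "w = u @ v" by blast
 have eq: "f (take i w) * monomial v (drop i w) = (if i = length u then f u else 0)" if "i \<le> length w" for i
 proof -
  have "drop i w = v \<longleftrightarrow> i = length u"
  proof
   assume "drop i w = v"
   then have "length (drop i w) = length v" by simp
   then show "i = length u" using that u by auto
  qed (simp add: u)
  then show ?thesis using u by (auto simp: monomial_def)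
 qed
 have "conc f (monomial v) w = (\<Sum>i\<le>length w. if i = length u then f u else 0)"
  unfolding conc_def using eq by (intro sum.cong) auto
 also have "... = f u" using u by simp
 finally show ?thesis using True u by simp
next
 case False
 have "monomial v (drop i w) = (0 :: 'k)" for i
 proof -
  have "drop i w ~= v" using False append_take_drop_id[of i w] by metis
  then show ?thesis by (simp add: monomial_def)
 qed
 then show ?thesis using False by (simp add: conc_def)
qed

lemma conc_one_right [simp]: "conc f (monomial []) = f"
 by (simp add: fun_eq_iff conc_monomial_append)

lemma conc_letter: "conc f (monomial [j]) (w @ [x]) = (if x = j then f w else 0)"
 and conc_letter_Nil: "conc f (monomial [j]) [] = 0"
 by (auto simp: conc_monomial_append)

lemma monomial_conc: "conc (monomial u) (monomial v) = monomial (u @ v)"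
proof
 fix w show "conc (monomial u) (monomial v) w = monomial (u @ v) w"
  by (subst conc_monomial_append) (auto simp: monomial_def)
qed

lemma tensors_subspace: "fscale.subspace (tensors d n)"
proof (rule fscale.subspaceI)
 fix f g :: "nat list => 'a" and c
 show "0 : tensors d n" by (simp add: tensors_def)
 assume f: "f : tensors d n"
 then show "fscale c f : tensors d n" by (simp add: tensors_def)
 assume g: "g : tensors d n"
 have "length w = n \<and> set w <= {..<d}" if "f w + g w ~= 0" for w
 proof (cases "f w = 0")
  case True
  with that have "g w ~= 0" by simp
  then show ?thesis using g by (simp add: tensors_def)
 qed (use f in \<open>simp add: tensors_def\<close>)
 then show "f + g : tensors d n" by (simp add: tensors_def)
qed

lemma tensor_nonzero: "f : tensors d n ==> f w ~= 0 ==> length w = n \<and> set w <= {..<d}"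
 by (simp add: tensors_def)

lemma tensor_zero: "f : tensors d n ==> length w ~= n ==> f w = 0"
 using tensor_nonzero by blast

lemma conc_homogeneous:
 assumes "\<And>u. f u ~= 0 ==> length u = m"
 shows "conc f g w = (if m \<le> length w then f (take m w) * g (drop m w) else 0)"
proof -
 have "f (take i w) * g (drop i w) = (if i = m then f (take m w) * g (drop m w) else 0)"
  if "i \<le> length w" for i
  using assms[of "take i w"] that by (cases "f (take i w) = 0") auto
 then have "conc f g w = (\<Sum>i\<le>length w. if i = m then f (take m w) * g (drop m w) else 0)"
  unfolding conc_def by (intro sum.cong) auto
 then show ?thesis by simp
qed

lemma conc_tensors: "f : tensors d m ==> g : tensors d n ==> conc f g : tensors d (m + n)"
proof -
 assume f: "f : tensors d m" and g: "g : tensors d n"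
 have eq: "conc f g w = (if m \<le> length w then f (take m w) * g (drop m w) else 0)" for w
  using tensor_nonzero[OF f] by (intro conc_homogeneous) blast
 have "length w = m + n \<and> set w <= {..<d}" if "conc f g w ~= 0" for w
 proof -
  have nz: "m \<le> length w" "f (take m w) ~= 0" "g (drop m w) ~= 0"
   using that unfolding eq by (auto split: if_splits)
  have "set w = set (take m w) \<union> set (drop m w)" by (metis append_take_drop_id set_append)
  then show ?thesis using tensor_nonzero[OF f nz(2)] tensor_nonzero[OF g nz(3)] nz(1) by auto
 qed
 then show ?thesis by (simp add: tensors_def)
qed

lemma monomial_tensors: "length w = n ==> set w <= {..<d} ==> monomial w : tensors d n"
 by (simp add: tensors_def monomial_def)

lemmas tensors_intros = fscale.subspace_add[OF tensors_subspace] fscale.subspace_diff[OF tensors_subspace]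
 fscale.subspace_scale[OF tensors_subspace] fscale.subspace_neg[OF tensors_subspace]
 fscale.subspace_0[OF tensors_subspace] fscale.subspace_sum[OF tensors_subspace]

lemma tensors_0: "f : tensors d 0 ==> f = fscale (f []) (monomial [])"
 by (auto simp: tensors_def monomial_def fun_eq_iff)

text \<open>The coefficient \<open>f_j\<close> in \<open>f = \<Sum> f_j x_j\<close>. Cutting on the
  right fits left modules, since the augmentation ideal will be generated by the \<open>x_j\<close>
  as a left ideal.\<close>

definition last_cut :: "'x => ('x list => 'k) => 'x list => 'k" where
 "last_cut j f = (%w. f (w @ [j]))"

lemma last_cut_tensors: "f : tensors d (Suc n) ==> last_cut j f : tensors d n"
 unfolding last_cut_def tensors_def by fastforce

lemma sum_last_cut:
 assumes f: "f : tensors d (Suc n)"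
 shows "f = (\<Sum>j<d. conc (last_cut j f) (monomial [j]))"
proof
 fix w
 note ap = sum_apply[of "%j. conc (last_cut j f) (monomial [j])" "{..<d}" w]
 show "f w = (\<Sum>j<d. conc (last_cut j f) (monomial [j])) w"
 proof (cases w rule: rev_cases)
  case Nil
  then show ?thesis unfolding ap using tensor_zero[OF f, of "[]"] by (simp add: conc_letter_Nil)
 next
  case (snoc u x)
  have "(\<Sum>j<d. conc (last_cut j f) (monomial [j]) w) = (\<Sum>j<d. if x = j then f w else 0)"
   unfolding snoc conc_letter by (intro sum.cong refl) (simp add: last_cut_def)
  also have "... = (if x < d then f w else 0)" by (simp add: sum.delta'[of "{..<d}" x "%_. f w"])
  also have "... = f w" using tensor_nonzero[OF f, of w] snoc by auto
  finally show ?thesis unfolding ap by simp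
 qed
qed

lemma last_cut_conc_sum:
 fixes d :: nat
 assumes "j < d"
 shows "last_cut j (\<Sum>i<d. conc (u i) (monomial [i])) = u j"
proof
 fix w
 show "last_cut j (\<Sum>i<d. conc (u i) (monomial [i])) w = u j w"
 proof -
  have "last_cut j (\<Sum>i<d. conc (u i) (monomial [i])) w = (\<Sum>i<d. if j = i then u i w else 0)"
   unfolding last_cut_def sum_apply conc_letter ..
  also have "... = (\<Sum>i\<in>{j}. u i w)" using assms by (intro sum.mono_neutral_cong_right) auto
  finally show ?thesis by simp
 qed
qed

lemma ideal_comp_subspace: "fscale.subspace (ideal_comp d \<Omega> n)"
 unfolding ideal_comp_def by (rule fscale.subspace_span)

lemma ideal_comp_gen:
 "f : tensors d i ==> \<omega> : \<Omega> ==> g : tensors d j ==> n = i + 2 + j ==> conc f (conc \<omega> g) : ideal_comp d \<Omega> n"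
 unfolding ideal_comp_def
 by (rule fscale.span_base, rule CollectI, rule exI[of _ f], rule exI[of _ \<omega>], rule exI[of _ g],
   rule exI[of _ i], rule exI[of _ j]) simp

lemma ideal_comp_least:
 fixes \<Omega> W :: "(nat list => 'k::field) set"
 assumes W: "fscale.subspace W"
  and gen: "\<And>f \<omega> g i j. f : tensors d i ==> \<omega> : \<Omega> ==> g : tensors d j ==> n = i + 2 + j ==>
   conc f (conc \<omega> g) : W"
 shows "ideal_comp d \<Omega> n <= W"
 unfolding ideal_comp_def
proof (rule fscale.span_minimal[OF _ W], rule subsetI)
 fix x assume "x : {conc f (conc \<omega> g) | f \<omega> g i j.
    f : tensors d i \<and> \<omega> : \<Omega> \<and> g : tensors d j \<and> i + 2 + j = n}"
 then obtain f \<omega> g i j where x: "x = conc f (conc \<omega> g)" "f : tensors d i" "\<omega> : \<Omega>" "g : tensors d j"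
  "i + 2 + j = n" by blast
 then show "x : W" unfolding x(1) by (intro gen[of f i \<omega> g j]) simp_all
qed

lemma ideal_comp_low:
 assumes "n < 2"
 shows "ideal_comp d \<Omega> n = {0}"
proof (rule subset_antisym)
 show "ideal_comp d \<Omega> n <= {0}"
  by (rule ideal_comp_least[OF fscale.subspace_single_0]) (use assms in simp)
 show "{0} <= ideal_comp d \<Omega> n"
  using fscale.subspace_0[OF ideal_comp_subspace, of d \<Omega> n] by simp
qed

lemma ideal_comp_tensors:
 fixes \<Omega> :: "(nat list => 'k::field) set"
 assumes "\<Omega> <= tensors d 2"
 shows "ideal_comp d \<Omega> n <= tensors d n"
proof (rule ideal_comp_least[OF tensors_subspace])
 fix f \<omega> g :: "nat list => 'k" and i j assume *: "f : tensors d i" "\<omega> : \<Omega>" "g : tensors d j" "n = i + 2 + j"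
 then have "conc f (conc \<omega> g) : tensors d (i + (2 + j))" using assms by (intro conc_tensors) auto
 then show "conc f (conc \<omega> g) : tensors d n" using * by (simp add: add.assoc)
qed

lemma ideal_comp_conc_left:
 fixes \<Omega> :: "(nat list => 'k::field) set"
 assumes x: "x : tensors d m" and h: "h : ideal_comp d \<Omega> n"
 shows "conc x h : ideal_comp d \<Omega> (m + n)"
proof -
 have "ideal_comp d \<Omega> n <= {h. conc x h : ideal_comp d \<Omega> (m + n)}"
 proof (rule ideal_comp_least)
  show "fscale.subspace {h. conc x h : ideal_comp d \<Omega> (m + n)}"
  proof (rule fscale.subspaceI)
   show "0 : {h. conc x h : ideal_comp d \<Omega> (m + n)}"
    using fscale.subspace_0[OF ideal_comp_subspace] by (simp only: mem_Collect_eq conc_0_right)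
   fix u assume "u : {h. conc x h : ideal_comp d \<Omega> (m + n)}"
   then have u: "conc x u : ideal_comp d \<Omega> (m + n)" by (rule CollectD)
   from fscale.subspace_scale[OF ideal_comp_subspace u]
   show "fscale c u : {h. conc x h : ideal_comp d \<Omega> (m + n)}" for c
    by (simp only: mem_Collect_eq conc_scale_right)
   fix v assume "v : {h. conc x h : ideal_comp d \<Omega> (m + n)}"
   then have v: "conc x v : ideal_comp d \<Omega> (m + n)" by (rule CollectD)
   from fscale.subspace_add[OF ideal_comp_subspace u v]
   show "u + v : {h. conc x h : ideal_comp d \<Omega> (m + n)}"
    by (simp only: mem_Collect_eq conc_add_right)
  qed
  fix f \<omega> g :: "nat list => 'k" and i j assume *: "f : tensors d i" "\<omega> : \<Omega>" "g : tensors d j" "n = i + 2 + j"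
  have "conc (conc x f) (conc \<omega> g) : ideal_comp d \<Omega> (m + n)"
   by (rule ideal_comp_gen[OF conc_tensors[OF x *(1)] *(2,3)]) (simp add: *)
  then show "conc f (conc \<omega> g) : {h. conc x h : ideal_comp d \<Omega> (m + n)}" by (simp add: conc_assoc)
 qed
 with h show ?thesis by blast
qed

lemma ideal_comp_conc_right:
 fixes \<Omega> :: "(nat list => 'k::field) set"
 assumes h: "h : ideal_comp d \<Omega> m" and x: "x : tensors d n"
 shows "conc h x : ideal_comp d \<Omega> (m + n)"
proof -
 have "ideal_comp d \<Omega> m <= {h. conc h x : ideal_comp d \<Omega> (m + n)}"
 proof (rule ideal_comp_least)
  show "fscale.subspace {h. conc h x : ideal_comp d \<Omega> (m + n)}"
  proof (rule fscale.subspaceI)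
   show "0 : {h. conc h x : ideal_comp d \<Omega> (m + n)}"
    using fscale.subspace_0[OF ideal_comp_subspace] by (simp only: mem_Collect_eq conc_0_left)
   fix u assume "u : {h. conc h x : ideal_comp d \<Omega> (m + n)}"
   then have u: "conc u x : ideal_comp d \<Omega> (m + n)" by (rule CollectD)
   from fscale.subspace_scale[OF ideal_comp_subspace u]
   show "fscale c u : {h. conc h x : ideal_comp d \<Omega> (m + n)}" for c
    by (simp only: mem_Collect_eq conc_scale_left)
   fix v assume "v : {h. conc h x : ideal_comp d \<Omega> (m + n)}"
   then have v: "conc v x : ideal_comp d \<Omega> (m + n)" by (rule CollectD)
   from fscale.subspace_add[OF ideal_comp_subspace u v]
   show "u + v : {h. conc h x : ideal_comp d \<Omega> (m + n)}"
    by (simp only: mem_Collect_eq conc_add_left)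
  qed
  fix f \<omega> g :: "nat list => 'k" and i j assume *: "f : tensors d i" "\<omega> : \<Omega>" "g : tensors d j" "m = i + 2 + j"
  have "conc f (conc \<omega> (conc g x)) : ideal_comp d \<Omega> (m + n)"
   by (rule ideal_comp_gen[OF *(1,2) conc_tensors[OF *(3) x]]) (simp add: *)
  then show "conc f (conc \<omega> g) : {h. conc h x : ideal_comp d \<Omega> (m + n)}" by (simp add: conc_assoc)
 qed
 with h show ?thesis by blast
qed

lemma ideal_comp_relation: "\<omega> : \<Omega> ==> \<omega> : ideal_comp d \<Omega> 2"
 using ideal_comp_gen[of "monomial []" d 0 \<omega> \<Omega> "monomial []" 0 2] by (simp add: monomial_tensors)

lemma quadratic_subquotient:
 assumes "relation_space d (\<Omega> :: (nat list => 'k::field) set)"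
 shows "subquotient conc (monomial []) (tensors d) (ideal_comp d \<Omega>)"
proof
 have \<Omega>: "\<Omega> <= tensors d 2" using assms by (simp add: relation_space_def)
 show "fscale.subspace (tensors d n :: (nat list => 'k) set)" for n by (rule tensors_subspace)
 show "fscale.subspace (ideal_comp d \<Omega> n)" for n by (rule ideal_comp_subspace)
 show "ideal_comp d \<Omega> n <= tensors d n" for n by (rule ideal_comp_tensors[OF \<Omega>])
 show "monomial [] \<notin> ideal_comp d \<Omega> 0"
  by (auto simp: ideal_comp_low fun_eq_iff monomial_def)
 show "\<exists>c. x - fscale c (monomial []) : ideal_comp d \<Omega> 0" if "x : tensors d 0" for x
  using tensors_0[OF that] by (intro exI[of _ "x []"]) (simp add: ideal_comp_low)
qed (simp_all add: conc_tensors ideal_comp_conc_left ideal_comp_conc_right conc_assoc conc_add_left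
  conc_add_right conc_scale_left conc_scale_right monomial_tensors)

section \<open>The quadratic algebras attached to a bilinear form\<close>

definition form_tensor :: "nat => (nat => nat => 'k::field) => nat list => 'k" where
 "form_tensor d b = (%w. if length w = 2 \<and> set w <= {..<d} then b (w ! 0) (w ! 1) else 0)"

definition form_eval :: "nat => (nat => nat => 'k::field) => (nat list => 'k) => 'k" where
 "form_eval d b \<eta> = (\<Sum>i<d. \<Sum>j<d. \<eta> [i, j] * b i j)"

abbreviation form_rel :: "nat => (nat => nat => 'k::field) => (nat list => 'k) set" where
 "form_rel d b \<equiv> fscale.span {form_tensor d b}"

lemma form_tensor_tensors: "form_tensor d b : tensors d 2"
 by (simp add: form_tensor_def tensors_def)

lemma form_tensor_pair: "i < d ==> j < d ==> form_tensor d b [i, j] = b i j"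
 by (simp add: form_tensor_def)

lemma form_rel_iff: "x : form_rel d b \<longleftrightarrow> (\<exists>c. x = fscale c (form_tensor d b))"
 by (auto simp: fscale.span_singleton)

lemma form_rel_relation_space: "relation_space d (form_rel d b)"
 unfolding relation_space_def
 by (intro conjI fscale.subspace_span fscale.span_minimal tensors_subspace) (simp add: form_tensor_tensors)

lemma tensor_2_cases:
 assumes "\<eta> : tensors d 2" "\<eta> w ~= 0"
 obtains i j where "w = [i, j]" "i < d" "j < d"
proof -
 from tensor_nonzero[OF assms] have l: "length w = 2" and s: "set w <= {..<d}" by auto
 from l obtain i j where w: "w = [i, j]"
  by (auto simp: numeral_2_eq_2 length_Suc_conv)
 with s that show ?thesis by auto
qed

lemma tensor_2_eqI:
 assumes "\<eta> : tensors d 2" "\<theta> : tensors d 2" "\<And>i j. i < d ==> j < d ==> \<eta> [i, j] = \<theta> [i, j]"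
 shows "\<eta> = \<theta>"
proof
 fix w show "\<eta> w = \<theta> w"
  using assms(3) tensor_2_cases[OF assms(1), of w] tensor_2_cases[OF assms(2), of w] by metis
qed

lemma form_eval_add: "form_eval d b (\<eta> + \<theta>) = form_eval d b \<eta> + form_eval d b \<theta>"
 by (simp add: form_eval_def distrib_right sum.distrib)

lemma form_eval_scale: "form_eval d b (fscale c \<eta>) = c * form_eval d b \<eta>"
 by (simp add: form_eval_def sum_distrib_left mult.assoc)

lemma form_eval_lin: "lin_on UNIV (form_eval d b)"
 by (intro lin_onI form_eval_add form_eval_scale)

lemmas form_eval_diff = lin_on_diff[OF fscale.subspace_UNIV form_eval_lin, simplified]
lemmas form_eval_sum = lin_on_sum[OF fscale.subspace_UNIV form_eval_lin, simplified]

lemma form_eval_monomial: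
 assumes "i < d" "j < d"
 shows "form_eval d b (monomial [i, j]) = b i j"
proof -
 have "(\<Sum>j'<d. monomial [i, j] [i', j'] * b i' j') = (if i' = i then b i j else 0)" for i'
 proof (cases "i' = i")
  case True
  then have "(\<Sum>j'<d. monomial [i, j] [i', j'] * b i' j') = (\<Sum>j'<d. if j' = j then b i j else 0)"
   by (intro sum.cong refl) (simp add: monomial_def)
  then show ?thesis using True assms by simp
 qed (simp add: monomial_def)
 then show ?thesis using assms by (simp add: form_eval_def)
qed

lemma orth_form_rel: "orth d (form_rel d b) = {\<eta> : tensors d 2. form_eval d b \<eta> = 0}"
proof -
 have e: "(\<Sum>i<d. \<Sum>j<d. \<eta> [i, j] * fscale c (form_tensor d b) [i, j]) = c * form_eval d b \<eta>" for c \<eta>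
  by (simp add: form_eval_def form_tensor_pair sum_distrib_left mult.left_commute)
 show ?thesis unfolding orth_def
 proof (intro subset_antisym subsetI)
  fix \<eta> assume "\<eta> : {\<eta> : tensors d 2. \<forall>\<omega>\<in>form_rel d b. (\<Sum>i<d. \<Sum>j<d. \<eta> [i, j] * \<omega> [i, j]) = 0}"
  moreover have "fscale 1 (form_tensor d b) : form_rel d b" unfolding form_rel_iff by blast
  ultimately show "\<eta> : {\<eta> : tensors d 2. form_eval d b \<eta> = 0}" using e[of \<eta> 1] by auto
 next
  fix \<eta> assume "\<eta> : {\<eta> : tensors d 2. form_eval d b \<eta> = 0}"
  then show "\<eta> : {\<eta> : tensors d 2. \<forall>\<omega>\<in>form_rel d b. (\<Sum>i<d. \<Sum>j<d. \<eta> [i, j] * \<omega> [i, j]) = 0}"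
   using e[of \<eta>] by (auto simp: form_rel_iff simp del: fscale_apply)
 qed
qed

lemma orth_relation_space: "relation_space d (orth d (form_rel d b))"
 unfolding relation_space_def orth_form_rel fscale.subspace_def
 by (auto intro: tensors_intros simp: form_eval_add form_eval_scale) (simp add: form_eval_def)

text \<open>A functional vanishing on the kernel of a nonzero functional is a multiple of it. The
  factor is read off at one entry of \<open>b\<close> that is not zero.\<close>

lemma orth_orth_form_rel:
 assumes "i < d" "j < d" "b i j ~= 0"
 shows "orth d (orth d (form_rel d b)) = form_rel d b"
proof (intro subset_antisym subsetI)
 fix \<theta> assume "\<theta> : orth d (orth d (form_rel d b))"
 then have \<theta>: "\<theta> : tensors d 2"
  and o: "\<And>\<eta>. \<eta> : tensors d 2 ==> form_eval d b \<eta> = 0 ==> (\<Sum>i<d. \<Sum>j<d. \<theta> [i, j] * \<eta> [i, j]) = 0"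
  unfolding orth_form_rel unfolding orth_def by auto
 have p: "(\<Sum>i<d. \<Sum>j<d. \<theta> [i, j] * \<eta> [i, j]) = form_eval d (%i j. \<theta> [i, j]) \<eta>" for \<eta>
  by (simp add: form_eval_def mult.commute)
 define c where "c = \<theta> [i, j] / b i j"
 have "\<theta> = fscale c (form_tensor d b)"
 proof (rule tensor_2_eqI[OF \<theta>])
  show "fscale c (form_tensor d b) : tensors d 2" by (intro tensors_intros form_tensor_tensors)
  fix k l assume kl: "k < d" "l < d"
  \<comment> \<open>The form takes the value \<open>b i j * b k l - b k l * b i j = 0\<close> on
    this tensor, so it lies in the kernel and compares two entries of
    \<open>\<theta>\<close>.\<close>
  define \<eta> :: "nat list => 'a" where "\<eta> = fscale (b i j) (monomial [k, l]) - fscale (b k l) (monomial [i, j])"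
  have "\<eta> : tensors d 2" unfolding \<eta>_def using assms kl by (intro tensors_intros monomial_tensors) auto
  moreover have ev: "form_eval d b' \<eta> = b i j * b' k l - b k l * b' i j" for b'
   unfolding \<eta>_def using assms kl by (simp only: form_eval_diff form_eval_scale form_eval_monomial)
  ultimately have "b i j * \<theta> [k, l] - b k l * \<theta> [i, j] = 0" using o[of \<eta>] unfolding p ev by simp
  then show "\<theta> [k, l] = fscale c (form_tensor d b) [k, l]"
   using assms kl by (simp add: form_tensor_pair c_def field_simps)
 qed
 then show "\<theta> : form_rel d b" unfolding form_rel_iff by blast
next
 fix \<theta> assume "\<theta> : form_rel d b"
 then obtain c where c: "\<theta> = fscale c (form_tensor d b)" unfolding form_rel_iff by blast
 have "(\<Sum>i<d. \<Sum>j<d. \<theta> [i, j] * \<eta> [i, j]) = c * form_eval d b \<eta>" for \<eta>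
  by (simp add: c form_eval_def form_tensor_pair sum_distrib_left mult.assoc mult.left_commute mult.commute)
 then show "\<theta> : orth d (orth d (form_rel d b))"
  unfolding orth_form_rel unfolding orth_def
  using c by (auto intro: tensors_intros form_tensor_tensors)
qed

section \<open>The algebra defined by a single quadratic relation\<close>

lemma last_cut_add: "last_cut j (f + g) = last_cut j f + last_cut j g"
 and last_cut_0: "last_cut j 0 = 0"
 by (simp_all add: last_cut_def fun_eq_iff)

lemma last_cut_conc: "g [] = 0 ==> last_cut j (conc f g) = conc f (last_cut j g)"
 by (simp add: last_cut_def conc_def fun_eq_iff)

lemma form_tensor_decomp: "form_tensor d b = (\<Sum>j<d. conc (last_cut j (form_tensor d b)) (monomial [j]))"
 using form_tensor_tensors[of d b] by (intro sum_last_cut[of _ _ 1]) (simp add: numeral_2_eq_2)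

text \<open>A product \<open>f \<omega> g\<close> either ends in a letter of \<open>g\<close>, and
  then contributes to some \<open>u j\<close> in the ideal one degree lower, or \<open>g\<close> is
  a scalar and it contributes to \<open>t \<omega>\<close>.\<close>

lemma principal_ideal_comp:
 fixes \<omega> :: "nat list => 'k::field" and d :: nat
 defines "I \<equiv> ideal_comp d (fscale.span {\<omega>})"
 assumes "f : I (Suc (Suc n))"
 obtains u t where "\<And>j. u j : I (Suc n)" "t : tensors d n"
  "f = (\<Sum>j<d. conc (u j) (monomial [j])) + conc t \<omega>"
proof -
 note Is = fscale.subspace_add[OF ideal_comp_subspace] fscale.subspace_scale[OF ideal_comp_subspace]
  fscale.subspace_0[OF ideal_comp_subspace]
 define W where "W = {f. \<exists>u t. (\<forall>j. u j : I (Suc n)) \<and> t : tensors d n \<and>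
  f = (\<Sum>j<d. conc (u j) (monomial [j])) + conc t \<omega>}"
 have WI: "(\<Sum>j<d. conc (u j) (monomial [j])) + conc t \<omega> : W"
  if "\<And>j. u j : I (Suc n)" "t : tensors d n" for u t
  unfolding W_def using that by blast
 have WE: "\<exists>u t. (\<forall>j. u j : I (Suc n)) \<and> t : tensors d n \<and>
  f = (\<Sum>j<d. conc (u j) (monomial [j])) + conc t \<omega>" if "f : W" for f
  using that unfolding W_def by blast
 have "I (Suc (Suc n)) <= W" unfolding I_def
 proof (rule ideal_comp_least)
  show "fscale.subspace W"
   unfolding fscale.subspace_def
  proof (intro conjI ballI allI)
   have "(\<Sum>j<d. conc 0 (monomial [j])) + conc 0 \<omega> : W"
    by (rule WI) (simp_all only: I_def Is tensors_intros)
   then show "0 : W" by simp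
   fix x assume "x : W"
   then obtain u t where ut: "\<And>j. u j : I (Suc n)" "t : tensors d n"
    and x: "x = (\<Sum>j<d. conc (u j) (monomial [j])) + conc t \<omega>" using WE by blast
   have "fscale c x = (\<Sum>j<d. conc (fscale c (u j)) (monomial [j])) + conc (fscale c t) \<omega>" for c
    unfolding x conc_scale_left by (simp add: fun_eq_iff sum_apply sum_distrib_left distrib_left)
   moreover have "(\<Sum>j<d. conc (fscale c (u j)) (monomial [j])) + conc (fscale c t) \<omega> : W" for c
    using ut unfolding I_def by (intro WI[unfolded I_def] Is tensors_intros)
   ultimately show "fscale c x : W" for c by (simp only:)
   fix y assume "y : W"
   then obtain u' t' where ut': "\<And>j. u' j : I (Suc n)" "t' : tensors d n"
    and y: "y = (\<Sum>j<d. conc (u' j) (monomial [j])) + conc t' \<omega>" using WE by blast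
   have "x + y = (\<Sum>j<d. conc (u j + u' j) (monomial [j])) + conc (t + t') \<omega>"
    unfolding x y conc_add_left sum.distrib by (simp add: algebra_simps)
   moreover have "(\<Sum>j<d. conc (u j + u' j) (monomial [j])) + conc (t + t') \<omega> : W"
    using ut ut' unfolding I_def by (intro WI[unfolded I_def] Is tensors_intros)
   ultimately show "x + y : W" by (simp only:)
  qed
  fix f \<omega>' g :: "nat list => 'k" and i j
  assume f: "f : tensors d i" and "\<omega>' : fscale.span {\<omega>}" and g: "g : tensors d j"
   and n: "Suc (Suc n) = i + 2 + j"
  then obtain c where c: "\<omega>' = fscale c \<omega>" by (auto simp: fscale.span_singleton)
  show "conc f (conc \<omega>' g) : W"
  proof (cases j)
   case 0
   then have "g = fscale (g []) (monomial [])" using g tensors_0 by blast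
   then have "conc f (conc \<omega>' g) = conc (fscale (g [] * c) f) \<omega>"
    unfolding c by (metis conc_one_right conc_scale_left conc_scale_right fscale.scale_scale)
   moreover have "fscale (g [] * c) f : tensors d n" using f n 0 by (intro tensors_intros) simp
   moreover from this have "(\<Sum>j<d. conc 0 (monomial [j])) + conc (fscale (g [] * c) f) \<omega> : W"
    unfolding I_def by (intro WI[unfolded I_def] Is)
   ultimately show ?thesis by simp
  next
   case (Suc k)
   have gs: "g = (\<Sum>l<d. conc (last_cut l g) (monomial [l]))" using g Suc sum_last_cut by blast
   have "conc f (conc \<omega>' g) = (\<Sum>l<d. conc (conc f (conc \<omega>' (last_cut l g))) (monomial [l]))"
    by (subst gs) (simp only: conc_sum_right conc_assoc)
   moreover have "conc f (conc \<omega>' (last_cut l g)) : I (Suc n)" for l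
    unfolding I_def
    using f \<open>\<omega>' : fscale.span {\<omega>}\<close> last_cut_tensors[of g d k l] g n Suc
    by (intro ideal_comp_gen[of f d i \<omega>' _ _ k]) simp_all
   then have "(\<Sum>l<d. conc (conc f (conc \<omega>' (last_cut l g))) (monomial [l])) + conc 0 \<omega> : W"
    by (intro WI tensors_intros)
   ultimately show ?thesis by simp
  qed
 qed
 then have "f : W" using assms(2) by blast
 from WE[OF this] obtain u t where "\<forall>j. u j : I (Suc n)" "t : tensors d n"
  "f = (\<Sum>j<d. conc (u j) (monomial [j])) + conc t \<omega>" by blast
 then show ?thesis by (intro that[of u t]) blast+
qed

text \<open>\<open>m\<close> is the isotropic letter and \<open>l\<close> a letter that pairs
  nontrivially with it; the entry \<open>b m l\<close> is where nondegeneracy of the form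
  enters.\<close>

locale isotropic_form =
 fixes d :: nat and b :: "nat => nat => 'k::field" and m l :: nat
 assumes m: "m < d" and l: "l < d" and iso: "b m m = 0" and nonzero: "b m l ~= 0"
begin

abbreviation \<omega> where "\<omega> \<equiv> form_tensor d b"
abbreviation \<rho> where "\<rho> j \<equiv> last_cut j \<omega>"
abbreviation I where "I \<equiv> ideal_comp d (form_rel d b)"
abbreviation J where "J \<equiv> ideal_comp d (orth d (form_rel d b))"

lemmas Is = fscale.subspace_add[OF ideal_comp_subspace] fscale.subspace_diff[OF ideal_comp_subspace]
 fscale.subspace_scale[OF ideal_comp_subspace] fscale.subspace_neg[OF ideal_comp_subspace]
 fscale.subspace_0[OF ideal_comp_subspace] fscale.subspace_sum[OF ideal_comp_subspace]

lemma \<rho>_tensors: "\<rho> j : tensors d 1"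
 using last_cut_tensors[of \<omega> d 1 j] form_tensor_tensors[of d b] by (simp add: numeral_2_eq_2)

lemma \<rho>_letter: "i < d ==> j < d ==> \<rho> j [i] = b i j"
 by (simp add: last_cut_def form_tensor_pair)

lemma last_cut_I:
 assumes "f : I (Suc (Suc n))"
 obtains u t where "\<And>j. u j : I (Suc n)" "t : tensors d n"
  "\<And>j. j < d ==> last_cut j f = u j + conc t (\<rho> j)"
proof -
 from assms obtain u t where ut: "\<And>j. u j : I (Suc n)" "t : tensors d n"
  and f: "f = (\<Sum>j<d. conc (u j) (monomial [j])) + conc t \<omega>" by (rule principal_ideal_comp) blast
 have "last_cut j f = u j + conc t (\<rho> j)" if "j < d" for j
  unfolding f last_cut_add last_cut_conc_sum[OF that]
  by (subst last_cut_conc) (simp_all add: form_tensor_def)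
 with ut that show ?thesis by blast
qed

text \<open>
 Right multiplication by a linear form \<open>y\<close> with \<open>y\<^sub>m ~= 0\<close> is injective on \<open>T(V)/(\<omega>)\<close>: if \<open>a y = \<Sum> u\<^sub>j x\<^sub>j + t \<omega>\<close>,
 then eliminating \<open>a\<close> shows that \<open>t\<close> times \<open>\<rho>\<^sub>l - (y\<^sub>l / y\<^sub>m) \<rho>\<^sub>m\<close> lies in the ideal, and the coefficient of
 that form at \<open>m\<close> is \<open>b\<^sub>m\<^sub>l\<close> because \<open>b\<^sub>m\<^sub>m = 0\<close>.
\<close>

lemma cancel_right:
 "a : tensors d n ==> y : tensors d 1 ==> y [m] ~= 0 ==> conc a y : I (Suc n) ==> a : I n"
proof (induction n arbitrary: a y)
 case 0
 have "y [] = 0" using tensor_zero[OF 0(2)] by simp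
 have "conc a y = 0" using 0 by (simp add: ideal_comp_low)
 then have "conc a y [m] = 0" by simp
 then have "a [] * y [m] = 0" using \<open>y [] = 0\<close> by (simp add: conc_Cons conc_Nil)
 then have "a [] = 0" using 0 by simp
 then have "fscale (a []) (monomial []) = 0" by (simp only: fscale.scale_zero_left)
 with tensors_0[OF 0(1)] have "a = 0" by (rule trans)
 then show ?case by (simp only: Is(5))
next
 case (Suc n)
 have y0: "y [] = 0" using tensor_zero[OF Suc(3)] by simp
 have yj: "last_cut j y = fscale (y [j]) (monomial [])" for j
  using tensors_0[OF last_cut_tensors[of y d 0 j]] Suc(3) by (simp add: last_cut_def)
 obtain u t where u: "\<And>j. u j : I (Suc n)" and t: "t : tensors d n"
  and "\<And>j. j < d ==> last_cut j (conc a y) = u j + conc t (\<rho> j)" using last_cut_I[OF Suc(5)] by blast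
 then have ej: "fscale (y [j]) a = u j + conc t (\<rho> j)" if "j < d" for j
  using that by (simp add: last_cut_conc y0 yj conc_scale_right)
 define s where "s = \<rho> l - fscale (y [l] / y [m]) (\<rho> m)"
 have "conc t s = conc t (\<rho> l) - fscale (y [l] / y [m]) (conc t (\<rho> m))"
  by (simp only: s_def conc_minus_right conc_scale_right)
 also have "... = (fscale (y [l]) a - u l) - fscale (y [l] / y [m]) (fscale (y [m]) a - u m)"
  by (simp only: ej[OF l] ej[OF m] add_diff_cancel_left')
 also have "... = fscale (y [l] / y [m]) (u m) - u l"
  using Suc(4) by (simp add: fun_eq_iff field_simps)
 also have "... : I (Suc n)" by (intro Is u)
 finally have "conc t s : I (Suc n)" .
 moreover have "s [m] ~= 0" using m l iso nonzero by (simp add: s_def \<rho>_letter)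
 moreover have "s : tensors d 1" unfolding s_def by (intro tensors_intros \<rho>_tensors)
 ultimately have "t : I n" using Suc.IH[OF t] by blast
 then have "conc t (\<rho> m) : I (n + 1)" by (intro ideal_comp_conc_right \<rho>_tensors)
 then have "conc t (\<rho> m) : I (Suc n)" by (simp only: Suc_eq_plus1)
 then have "fscale (y [m]) a : I (Suc n)" unfolding ej[OF m] by (intro Is(1) u)
 then have "fscale (1 / y [m]) (fscale (y [m]) a) : I (Suc n)" by (rule Is(3))
 moreover have "fscale (1 / y [m]) (fscale (y [m]) a) = a" using Suc(4) by (simp add: fun_eq_iff)
 ultimately show ?case by (simp only:)
qed

text \<open>The coefficient of \<open>\<rho> l\<close> at the isotropic letter is
  \<open>b m l\<close>, so this form is one of those that can be cancelled.\<close>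

lemma cancel_right_\<rho>: "a : tensors d n ==> conc a (\<rho> l) : I (Suc n) ==> a : I n"
 using m l nonzero \<rho>_tensors[of l] by (intro cancel_right[of a n "\<rho> l"]) (simp_all add: \<rho>_letter)

text \<open>By \<open>last_cut_I\<close> the last-letter coefficients of an element of the ideal
  are, modulo the ideal, left multiples of the one row of forms \<open>\<rho> a\<close>. This row
  therefore generates the syzygies of the letters.\<close>

lemma sum_letters_I:
 assumes "\<And>a. v a : tensors d n" "(\<Sum>a<d. conc (v a) (monomial [a])) : I (Suc n)"
 shows "n = 0 ==> a < d ==> v a = 0"
  and "n = Suc k ==> \<exists>t\<in>tensors d k. \<forall>a<d. v a - conc t (\<rho> a) : I n"
proof -
 assume "n = 0" "a < d"
 then show "v a = 0" using assms(2) last_cut_conc_sum[of a d v] by (simp add: ideal_comp_low last_cut_0)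
next
 assume n: "n = Suc k"
 from assms(2) obtain u t where u: "\<And>j. u j : I n" and t: "t : tensors d k"
  and e: "\<And>j. j < d ==> last_cut j (\<Sum>a<d. conc (v a) (monomial [a])) = u j + conc t (\<rho> j)"
  unfolding n by (rule last_cut_I) blast
 have "v a - conc t (\<rho> a) : I n" if "a < d" for a
  using e[OF that] u[of a] by (simp add: last_cut_conc_sum[OF that])
 with t show "\<exists>t\<in>tensors d k. \<forall>a<d. v a - conc t (\<rho> a) : I n" by blast
qed

sublocale R: subquotient conc "monomial []" "tensors d" I
 by (rule quadratic_subquotient[OF form_rel_relation_space])

text \<open>The resolution is
  \<open>0 \<rightarrow> A(-2) \<rightarrow> A(-1)^d \<rightarrow> A\<close>, with
  \<open>min i 3\<close> supplying zero ranks beyond it; its leftmost map is injective because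
  \<open>\<rho> l\<close> cancels on the right.\<close>

lemma R_linear_resolution:
 "R.linear_resolution (%i. [1, d, 1, 0] ! min i 3) (%i a c. if i = 0 then monomial [a] else \<rho> c)"
  (is "R.linear_resolution ?rk ?c")
 unfolding R.linear_resolution_def
proof (intro conjI allI impI ballI)
 show "?rk 0 = 1" by simp
 fix i
 show "?c i a c : tensors d 1" if "a < ?rk (Suc i)" "c < ?rk i" for a c
  using that \<rho>_tensors by (auto intro: monomial_tensors)
 show "(\<Sum>a<?rk (Suc i). conc (?c (Suc i) h a) (?c i a c)) : I 2"
  if "h < ?rk (Suc (Suc i))" "c < ?rk i" for h c
 proof (cases i)
  case 0
  have "\<omega> : form_rel d b" by (simp add: fscale.span_base)
  then have "\<omega> : I 2" by (rule ideal_comp_relation)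
  then show ?thesis using 0 form_tensor_decomp[of d b] by simp
 next
  case (Suc k)
  then show ?thesis using that by (cases k) (simp_all add: min_def)
 qed
 show "v a : I 0" if v: "\<forall>a. v a : tensors d 0"
  and s: "\<forall>c<?rk i. (\<Sum>a<?rk (Suc i). conc (v a) (?c i a c)) : I 1" and a: "a < ?rk (Suc i)" for v a
 proof -
  consider "i = 0" | "i = 1" | k where "i = Suc (Suc k)" by (metis One_nat_def old.nat.exhaust)
  then show ?thesis
  proof cases
   case 1
   then have "v a = 0" using sum_letters_I(1)[of v 0 a] v s a by auto
   then show ?thesis by (auto intro: Is(5))
  next
   case 2
   then have "conc (v 0) (\<rho> l) : I 1" using s l by simp
   then show ?thesis using cancel_right_\<rho>[of "v 0" 0] v a 2 by simp
  next
   case 3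
   then show ?thesis using a by (simp add: min_def)
  qed
 qed
 show "\<exists>w. (\<forall>h. w h : tensors d n) \<and> (\<forall>a<?rk (Suc i).
   v a - (\<Sum>h<?rk (Suc (Suc i)). conc (w h) (?c (Suc i) h a)) : I (Suc n))"
  if v: "\<forall>a. v a : tensors d (Suc n)"
  and s: "\<forall>c<?rk i. (\<Sum>a<?rk (Suc i). conc (v a) (?c i a c)) : I (Suc (Suc n))" for n v
 proof -
  consider "i = 0" | "i = 1" | k where "i = Suc (Suc k)" by (metis One_nat_def old.nat.exhaust)
  then show ?thesis
  proof cases
   case 1
   then obtain t where "t : tensors d n" "\<forall>a<d. v a - conc t (\<rho> a) : I (Suc n)"
    using sum_letters_I(2)[of v "Suc n" n] v s by auto
   then show ?thesis using 1 by (intro exI[of _ "%_. t"]) simp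
  next
   case 2
   then have "conc (v 0) (\<rho> l) : I (Suc (Suc n))" using s l by simp
   then have "v 0 : I (Suc n)" using cancel_right_\<rho>[of "v 0" "Suc n"] v by simp
   then show ?thesis using 2 by (intro exI[of _ "%_. 0"]) (simp add: tensors_intros(5))
  next
   case 3
   then show ?thesis by (intro exI[of _ "%_. 0"]) (simp add: tensors_intros(5) min_def)
  qed
 qed
next
 fix n and z :: "nat list => 'k" assume "z : tensors d (Suc n)"
 then have "z = (\<Sum>a<?rk 1. conc (last_cut a z) (?c 0 a 0))" using sum_last_cut[of z d n] by simp
 then have "z - (\<Sum>a<?rk 1. conc (last_cut a z) (?c 0 a 0)) : I (Suc n)" using Is(5) by simp
 with \<open>z : tensors d (Suc n)\<close> show "\<exists>v. (\<forall>a. v a : tensors d n) \<and>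
   z - (\<Sum>a<?rk 1. conc (v a) (?c 0 a 0)) : I (Suc n)"
  by (intro exI[of _ "%a. last_cut a z"]) (simp add: last_cut_tensors)
qed

end

section \<open>Low degrees and a linear resolution of the dual algebra\<close>

context isotropic_form begin

lemma orth_iff: "\<eta> : orth d (form_rel d b) \<longleftrightarrow> \<eta> : tensors d 2 \<and> form_eval d b \<eta> = 0"
 by (simp add: orth_form_rel)

lemma J_2: "J 2 = orth d (form_rel d b)"
proof (rule subset_antisym)
 show "orth d (form_rel d b) <= J 2" using ideal_comp_relation by blast
 have sub: "fscale.subspace (orth d (form_rel d b))"
  using orth_relation_space unfolding relation_space_def by blast
 show "J 2 <= orth d (form_rel d b)"
 proof (rule ideal_comp_least[OF sub])
  fix f \<eta> g :: "nat list => 'k" and i j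
  assume *: "f : tensors d i" "\<eta> : orth d (form_rel d b)" "g : tensors d j" "2 = i + 2 + j"
  then have "f = fscale (f []) (monomial [])" "g = fscale (g []) (monomial [])"
   using tensors_0[of f d] tensors_0[of g d] by simp_all
  then have "conc f (conc \<eta> g) = fscale (f []) (fscale (g []) \<eta>)"
   by (metis conc_one_left conc_one_right conc_scale_left conc_scale_right)
  moreover have "fscale (f []) (fscale (g []) \<eta>) : orth d (form_rel d b)"
   by (intro fscale.subspace_scale[OF sub] *)
  ultimately show "conc f (conc \<eta> g) : orth d (form_rel d b)" by (simp only:)
 qed
qed

lemma J_2_iff: "\<eta> : J 2 \<longleftrightarrow> \<eta> : tensors d 2 \<and> form_eval d b \<eta> = 0"
 by (simp only: J_2 orth_iff)

text \<open>\<open>J 2\<close> is a hyperplane and \<open>x_m x_l\<close> lies off it, so a tensor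
  is congruent to the multiple of \<open>x_m x_l\<close> with the same value of the form.\<close>

lemma reduce_2:
 assumes "\<eta> : tensors d 2"
 shows "\<eta> - fscale (form_eval d b \<eta> / b m l) (monomial [m, l]) : J 2"
proof -
 have "\<eta> - fscale (form_eval d b \<eta> / b m l) (monomial [m, l]) : tensors d 2"
  using assms m l by (intro tensors_intros monomial_tensors) simp_all
 moreover have "form_eval d b (\<eta> - fscale (form_eval d b \<eta> / b m l) (monomial [m, l])) = 0"
  using nonzero m l by (simp only: form_eval_diff form_eval_scale form_eval_monomial) simp
 ultimately show ?thesis by (simp only: J_2_iff)
qed

lemma letter_tensors: "i < d ==> monomial [i] : tensors d 1"
 by (simp add: monomial_tensors)

text \<open>The first two letters reduce to \<open>x_m x_l\<close>, then what follows
  \<open>x_m\<close> reduces to \<open>x_m x_l\<close> again, and the result begins with the square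
  \<open>x_m x_m\<close>, which vanishes in the dual algebra because \<open>m\<close> is
  isotropic.\<close>

lemma tensors_3_J:
 assumes f: "f : tensors d 3"
 shows "f : J 3"
proof -
 define c where "c j = form_eval d b (last_cut j f) / b m l" for j
 define g where "g = (\<Sum>j<d. fscale (c j) (monomial [j]))"
 have lc: "last_cut j f : tensors d 2" for j using last_cut_tensors[of f d 2 j] f by simp
 have g: "g : tensors d 1" unfolding g_def by (intro tensors_intros letter_tensors) simp
 have fs: "f = (\<Sum>j<d. conc (last_cut j f) (monomial [j]))" using f by (intro sum_last_cut[of _ _ 2]) simp
 have "conc (monomial [m, l]) g = (\<Sum>j<d. conc (fscale (c j) (monomial [m, l])) (monomial [j]))"
  unfolding g_def by (simp only: conc_sum_right conc_scale_left conc_scale_right)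
 then have "f - conc (monomial [m, l]) g =
   (\<Sum>j<d. conc (last_cut j f - fscale (c j) (monomial [m, l])) (monomial [j]))"
  unfolding conc_minus_left sum_subtractf using fs by (simp only:)
 also have "... : J 3"
 proof (rule Is(6))
  fix j assume "j : {..<d}"
  then have "conc (last_cut j f - fscale (c j) (monomial [m, l])) (monomial [j]) : J (2 + 1)"
   unfolding c_def by (intro ideal_comp_conc_right reduce_2 lc letter_tensors) simp
  then show "conc (last_cut j f - fscale (c j) (monomial [m, l])) (monomial [j]) : J 3" by simp
 qed
 finally have 1: "f - conc (monomial [m, l]) g : J 3" .
 define \<eta> where "\<eta> = conc (monomial [l]) g"
 have \<eta>: "\<eta> : tensors d 2"
  using conc_tensors[OF letter_tensors[OF l] g] by (simp add: \<eta>_def numeral_2_eq_2)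
 have eq: "conc (monomial [m, l]) g = conc (monomial [m]) \<eta>"
  unfolding \<eta>_def conc_assoc[symmetric] monomial_conc by simp
 have "conc (monomial [m]) (\<eta> - fscale (form_eval d b \<eta> / b m l) (monomial [m, l])) : J (1 + 2)"
  by (intro ideal_comp_conc_left reduce_2 \<eta> letter_tensors m)
 moreover have "1 + 2 = (3 :: nat)" by simp
 ultimately have 2: "conc (monomial [m]) (\<eta> - fscale (form_eval d b \<eta> / b m l) (monomial [m, l])) : J 3"
  by (simp only:)
 have "monomial [m, m] : J 2"
  unfolding J_2_iff using m iso by (simp add: monomial_tensors form_eval_monomial)
 then have "conc (monomial [m, m]) (monomial [l]) : J (2 + 1)"
  by (intro ideal_comp_conc_right letter_tensors l)
 then have "conc (monomial [m, m]) (monomial [l]) : J 3" by simp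
 then have 3: "fscale (form_eval d b \<eta> / b m l) (conc (monomial [m, m]) (monomial [l])) : J 3" by (rule Is(3))
 have mm: "conc (monomial [m]) (monomial [m, l]) = conc (monomial [m, m]) (monomial [l])"
  unfolding monomial_conc by simp
 have "f = (f - conc (monomial [m, l]) g) +
   (conc (monomial [m]) (\<eta> - fscale (form_eval d b \<eta> / b m l) (monomial [m, l])) +
    fscale (form_eval d b \<eta> / b m l) (conc (monomial [m, m]) (monomial [l])))"
  unfolding eq conc_minus_right conc_scale_right mm by simp
 moreover have "... : J 3" by (intro Is(1) 1 2 3)
 ultimately show ?thesis by metis
qed

lemma tensors_J: "f : tensors d (n + 3) ==> f : J (n + 3)"
proof (induction n arbitrary: f)
 case 0
 then show ?case using tensors_3_J[of f] by (simp only: add_0)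
next
 case (Suc n)
 have fs: "f = (\<Sum>j<d. conc (last_cut j f) (monomial [j]))"
  using Suc(2) by (intro sum_last_cut[of _ _ "n + 3"]) simp
 have "conc (last_cut j f) (monomial [j]) : J (Suc n + 3)" if "j < d" for j
 proof -
  have "last_cut j f : J (n + 3)" using Suc(2) by (intro Suc.IH last_cut_tensors) simp
  then have "conc (last_cut j f) (monomial [j]) : J (n + 3 + 1)"
   by (rule ideal_comp_conc_right[OF _ letter_tensors[OF that]])
  then show ?thesis by simp
 qed
 then have "(\<Sum>j<d. conc (last_cut j f) (monomial [j])) : J (Suc n + 3)" by (intro Is(6)) simp
 then show ?case using fs by metis
qed

sublocale H: subquotient conc "monomial []" "tensors d" J
 by (rule quadratic_subquotient[OF orth_relation_space])

text \<open>
 A stage of the resolution of the trivial module over \<open>T(V)/(\<omega>\<^sup>\<bottom>)\<close>: the rows of the matrix \<open>c\<close> of linear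
 forms are independent, and multiplication by the isotropic letter \<open>m\<close> maps their span onto the top
 degree.  The second property makes the syzygies linearly generated and passes on to them.
\<close>

definition stage :: "nat => nat => (nat => nat => nat list => 'k) => bool" where
 "stage r0 r1 c \<longleftrightarrow> (\<forall>a<r1. \<forall>q<r0. c a q : tensors d 1) \<and>
   (\<forall>s. (\<forall>q<r0. (\<Sum>a<r1. fscale (s a) (c a q)) = 0) --> (\<forall>a<r1. s a = 0)) \<and>
   (\<forall>\<mu>. \<exists>s. \<forall>q<r0. (\<Sum>a<r1. s a * form_eval d b (conc (monomial [m]) (c a q))) = \<mu> q)"

text \<open>The rows of \<open>c'\<close> are linear syzygies of the rows of \<open>c\<close> and
  span all of them. Independence of the new rows is part of \<open>stage\<close>.\<close>

definition next_stage where
 "next_stage r0 r1 c r2 c' \<longleftrightarrow>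
   (\<forall>h<r2. \<forall>q<r0. (\<Sum>a<r1. conc (c' h a) (c a q)) : J 2) \<and>
   (\<forall>v. (\<forall>a. v a : tensors d 1) --> (\<forall>q<r0. (\<Sum>a<r1. conc (v a) (c a q)) : J 2) -->
    (\<exists>s. \<forall>a<r1. v a = (\<Sum>h<r2. fscale (s h) (c' h a))))"

lemma stage_independent:
 assumes "stage r0 r1 c" "\<And>q. q < r0 ==> (\<Sum>a<r1. fscale (s a) (c a q)) = 0" "a < r1"
 shows "s a = 0"
proof -
 have "\<forall>s. (\<forall>q<r0. (\<Sum>a<r1. fscale (s a) (c a q)) = 0) --> (\<forall>a<r1. s a = 0)"
  using assms(1) unfolding stage_def by (elim conjE)
 from this[rule_format, OF assms(2,3)] show ?thesis .
qed

lemma stage_0: "stage 1 d (%a q. monomial [a])"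
 unfolding stage_def
proof (intro conjI allI impI)
 show "monomial [a] : tensors d 1" if "a < d" for a by (rule letter_tensors[OF that])
 fix s :: "nat => 'k" and a
 assume "\<forall>q<1::nat. (\<Sum>a<d. fscale (s a) (monomial [a])) = 0" and a: "a < d"
 then have "(\<Sum>a<d. fscale (s a) (monomial [a])) [a] = 0" by simp
 then have "(\<Sum>a'<d. s a' * (if [a] = [a'] then 1 else 0)) = 0"
  unfolding sum_apply by (simp only: fscale_apply monomial_def)
 moreover have "(\<Sum>a'<d. s a' * (if [a] = [a'] then 1 else 0)) = (\<Sum>a'<d. if a = a' then s a' else 0)"
  by (intro sum.cong) simp_all
 ultimately show "s a = 0" using a by simp
next
 fix \<mu> :: "nat => 'k"
 have "(\<Sum>a<d. (if a = l then \<mu> 0 / b m l else 0) * form_eval d b (conc (monomial [m]) (monomial [a]))) =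
   (\<Sum>a<d. if a = l then \<mu> 0 / b m l * form_eval d b (monomial [m, l]) else 0)"
  unfolding monomial_conc by (intro sum.cong refl) simp
 also have "... = \<mu> 0" using l m nonzero by (simp add: form_eval_monomial)
 finally show "\<exists>s. \<forall>q<1. (\<Sum>a<d. s a * form_eval d b (conc (monomial [m]) (monomial [a]))) = \<mu> q"
  by (intro exI[of _ "%a. if a = l then \<mu> 0 / b m l else 0"]) simp
qed

text \<open>The new rows are a basis of the space of linear syzygies. To prescribe
  \<open>\<mu>\<close>, take \<open>\<mu> a / b m l\<close> times \<open>x_l\<close> and correct it
  by multiples of \<open>x_m\<close> into a syzygy, which the old stage permits; after
  multiplication by \<open>x_m\<close> the correction contributes only
  \<open>b m m = 0\<close>.\<close>

lemma stage_step:
 assumes st: "stage r0 r1 c"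
 shows "\<exists>r2 c'. stage r1 r2 c' \<and> next_stage r0 r1 c r2 c'"
proof -
 have cT: "\<And>a q. a < r1 ==> q < r0 ==> c a q : tensors d 1"
  and onto: "\<And>\<mu>. \<exists>s. \<forall>q<r0. (\<Sum>a<r1. s a * form_eval d b (conc (monomial [m]) (c a q))) = \<mu> q"
  using st unfolding stage_def by blast+
 have T2: "conc x (c a q) : tensors d 2" if "x : tensors d 1" "a < r1" "q < r0" for x a q
  using conc_tensors[OF that(1) cT[OF that(2,3)]] by (simp add: numeral_2_eq_2)
 \<comment> \<open>A vector of tensors is encoded as one function on pairs, so that bases and spans
   in function spaces apply to the syzygies.\<close>
 define slice :: "(nat \<times> nat list => 'k) => nat => nat list => 'k" where "slice F a = (%w. F (a, w))" for F a
 have slice_add: "slice (F + G) a = slice F a + slice G a"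
  and slice_scale: "slice (fscale k F) a = fscale k (slice F a)"
  and slice_0: "slice 0 a = 0" for F G a k
  by (simp_all add: slice_def fun_eq_iff)
 have slice_sum: "slice (\<Sum>x\<in>X. F x) a = (\<Sum>x\<in>X. slice (F x) a)" for X :: "nat set" and F a
  by (rule ext) (simp add: slice_def sum_apply)
 define K where "K = {F. (\<forall>a. slice F a : tensors d 1) \<and> (\<forall>a\<ge>r1. slice F a = 0) \<and>
  (\<forall>q<r0. (\<Sum>a<r1. conc (slice F a) (c a q)) : J 2)}"
 have K: "fscale.subspace K"
 proof (rule fscale.subspaceI)
  show "0 : K" unfolding K_def by (simp add: slice_0 tensors_intros(5) Is(5) del: zero_fun_apply)
  fix F assume F: "F : K"
  have "(\<Sum>a<r1. conc (slice (fscale k F) a) (c a q)) : J 2" if "q < r0" for k q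
  proof -
   have "(\<Sum>a<r1. conc (slice (fscale k F) a) (c a q)) = fscale k (\<Sum>a<r1. conc (slice F a) (c a q))"
    unfolding slice_scale conc_scale_left by (simp add: fun_eq_iff sum_apply sum_distrib_left)
   also have "... : J 2" using F that by (intro Is(3)) (simp add: K_def)
   finally show ?thesis .
  qed
  moreover have "slice (fscale k F) a : tensors d 1" for k a
   unfolding slice_scale using F by (intro tensors_intros) (simp add: K_def)
  moreover have "slice (fscale k F) a = 0" if "a \<ge> r1" for k a
   unfolding slice_scale using F that by (simp add: K_def fun_eq_iff)
  ultimately show "fscale k F : K" for k unfolding K_def by blast
  fix G assume G: "G : K"
  have "(\<Sum>a<r1. conc (slice (F + G) a) (c a q)) : J 2" if "q < r0" for q
   unfolding slice_add conc_add_left sum.distrib using F G that by (intro Is(1)) (simp_all add: K_def)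
  moreover have "slice (F + G) a : tensors d 1" for a
   unfolding slice_add using F G by (intro tensors_intros) (simp_all add: K_def)
  moreover have "slice (F + G) a = 0" if "a \<ge> r1" for a
   unfolding slice_add using F G that by (simp add: K_def)
  ultimately show "F + G : K" unfolding K_def by blast
 qed
 obtain Bs where Bs: "Bs <= K" "\<not> fscale.dependent Bs" "K <= fscale.span Bs"
  using fscale.maximal_independent_subset by metis
 have spanBs: "fscale.span Bs = K" using Bs K by (metis fscale.span_minimal subset_antisym)
 \<comment> \<open>Unit vectors: finitely many of them span a space containing \<open>K\<close>,
   which makes a basis of \<open>K\<close> finite.\<close>
 define P where "P = {..<r1} \<times> (%i. [i]) ` {..<d}"
 define \<delta> :: "nat \<times> nat list => nat \<times> nat list => 'k" where "\<delta> p = (%x. if x = p then 1 else 0)" for p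
 have "K <= fscale.span (\<delta> ` P)"
 proof
  fix F assume F: "F : K"
  have "F = (\<Sum>p\<in>P. fscale (F p) (\<delta> p))"
  proof
   fix x
   have "(\<Sum>p\<in>P. fscale (F p) (\<delta> p)) x = (\<Sum>p\<in>P. if x = p then F p else 0)"
    unfolding sum_apply \<delta>_def by (intro sum.cong) simp_all
   also have "... = (if x : P then F x else 0)" by (simp add: P_def)
   also have "... = F x"
   proof (cases "F x = 0")
    case False
    obtain a w where x: "x = (a, w)" by fastforce
    have "slice F a w ~= 0" using False x by (simp add: slice_def)
    moreover from this have "a < r1" using F by (cases "a < r1") (auto simp: K_def)
    moreover have "slice F a : tensors d 1" using F by (simp add: K_def)
    ultimately show ?thesis
     using tensor_nonzero[of "slice F a" d 1 w] x by (auto simp: P_def length_Suc_conv)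
   qed simp
   finally show "F x = (\<Sum>p\<in>P. fscale (F p) (\<delta> p)) x" by simp
  qed
  moreover have "(\<Sum>p\<in>P. fscale (F p) (\<delta> p)) : fscale.span (\<delta> ` P)"
   by (intro fscale.span_sum fscale.span_scale fscale.span_base imageI)
  ultimately show "F : fscale.span (\<delta> ` P)" by metis
 qed
 moreover have "finite (\<delta> ` P)" by (simp add: P_def)
 ultimately have fin: "finite Bs" using fscale.independent_span_bound Bs by blast
 define r2 where "r2 = card Bs"
 obtain h where h: "bij_betw h {..<r2} Bs"
  using ex_bij_betw_nat_finite[OF fin] by (auto simp: r2_def atLeast0LessThan)
 define c' where "c' e a = slice (h e) a" for e a
 have hK: "e < r2 ==> h e : K" for e using h Bs(1) bij_betwE by fastforce
 have repr: "\<exists>s. \<forall>a<r1. v a = (\<Sum>e<r2. fscale (s e) (c' e a))"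
  if v: "\<And>a. a < r1 ==> v a : tensors d 1" and s: "\<And>q. q < r0 ==> (\<Sum>a<r1. conc (v a) (c a q)) : J 2" for v
 proof -
  define F where "F = (%(a, w). if a < r1 then v a w else 0)"
  have sF: "slice F a = (if a < r1 then v a else 0)" for a by (simp add: F_def slice_def fun_eq_iff)
  have "slice F a : tensors d 1" for a
   unfolding sF by (cases "a < r1") (simp_all only: if_True if_False v tensors_intros(5))
  moreover have "slice F a = 0" if "a \<ge> r1" for a unfolding sF using that by simp
  moreover have "(\<Sum>a<r1. conc (slice F a) (c a q)) : J 2" if "q < r0" for q
   using s[OF that] unfolding sF by simp
  ultimately have "F : fscale.span Bs" unfolding spanBs K_def by blast
  then obtain u where "F = (\<Sum>x\<in>Bs. fscale (u x) x)" unfolding fscale.span_finite[OF fin] by blast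
  also have "... = (\<Sum>e<r2. fscale (u (h e)) (h e))"
   by (rule sum.reindex_bij_betw[OF h, symmetric])
  finally have eq: "slice F a = (\<Sum>e<r2. fscale (u (h e)) (c' e a))" for a
   by (simp only: slice_sum slice_scale c'_def)
  show ?thesis
  proof (intro exI[of _ "%e. u (h e)"] allI impI)
   fix a assume "a < r1"
   then show "v a = (\<Sum>e<r2. fscale (u (h e)) (c' e a))"
    using eq[of a] sF[of a] by (simp only: if_True)
  qed
 qed
 have "stage r1 r2 c'"
  unfolding stage_def
 proof (intro conjI allI impI)
  show "c' e a : tensors d 1" if "e < r2" for e a using hK[OF that] by (simp add: c'_def K_def)
 next
  fix s :: "nat => 'k" and e
  assume z: "\<forall>a<r1. (\<Sum>e<r2. fscale (s e) (c' e a)) = 0" and e: "e < r2"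
  have "slice (\<Sum>e<r2. fscale (s e) (h e)) a = 0" for a
  proof (cases "a < r1")
   case True
   then show ?thesis using z by (simp only: slice_sum slice_scale c'_def)
  next
   case False
   then have "(\<Sum>e<r2. fscale (s e) (slice (h e) a)) = (\<Sum>e<r2. 0)"
    using hK by (intro sum.cong refl) (simp add: K_def fun_eq_iff)
   then show ?thesis by (simp only: slice_sum slice_scale) simp
  qed
  then have "(\<Sum>e<r2. fscale (s e) (h e)) = 0" by (simp add: slice_def fun_eq_iff)
  moreover have "(\<Sum>x\<in>Bs. fscale (s (the_inv_into {..<r2} h x)) x) = (\<Sum>e<r2. fscale (s (the_inv_into {..<r2} h (h e))) (h e))"
   by (rule sum.reindex_bij_betw[OF h, symmetric])
  moreover have "... = (\<Sum>e<r2. fscale (s e) (h e))"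
   using h by (intro sum.cong refl) (simp add: bij_betw_def the_inv_into_f_f)
  ultimately have z0: "(\<Sum>x\<in>Bs. fscale (s (the_inv_into {..<r2} h x)) x) = 0" by simp
  have "h e : Bs" using h e by (auto simp: bij_betw_def)
  from fscale.independentD[OF Bs(2) fin subset_refl z0 this]
  have "s (the_inv_into {..<r2} h (h e)) = 0" .
  then show "s e = 0" using h e by (simp add: bij_betw_def the_inv_into_f_f)
 next
  fix \<mu> :: "nat => 'k"
  \<comment> \<open>The old stage provides the multiples \<open>t a\<close> of \<open>x_m\<close>
    that match the values of the form on the chosen multiples of \<open>x_l\<close> times the
    rows.\<close>
  obtain t where t: "\<And>q. q < r0 ==> (\<Sum>a<r1. t a * form_eval d b (conc (monomial [m]) (c a q))) =
    (\<Sum>a<r1. \<mu> a / b m l * form_eval d b (conc (monomial [l]) (c a q)))"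
   using onto[of "%q. \<Sum>a<r1. \<mu> a / b m l * form_eval d b (conc (monomial [l]) (c a q))"] by blast
  define \<kappa> where "\<kappa> a = fscale (\<mu> a / b m l) (monomial [l]) - fscale (t a) (monomial [m])" for a
  have \<kappa>T: "\<kappa> a : tensors d 1" for a unfolding \<kappa>_def by (intro tensors_intros letter_tensors m l)
  have "(\<Sum>a<r1. conc (\<kappa> a) (c a q)) : J 2" if q: "q < r0" for q
   unfolding J_2_iff
  proof
   show "(\<Sum>a<r1. conc (\<kappa> a) (c a q)) : tensors d 2" using \<kappa>T q by (intro tensors_intros T2) simp_all
   show "form_eval d b (\<Sum>a<r1. conc (\<kappa> a) (c a q)) = 0"
    unfolding form_eval_sum \<kappa>_def conc_minus_left conc_scale_left form_eval_diff form_eval_scale sum_subtractf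
    using t[OF q] by simp
  qed
  from repr[OF \<kappa>T this] obtain s where s: "\<And>a. a < r1 ==> \<kappa> a = (\<Sum>e<r2. fscale (s e) (c' e a))" by blast
  have "(\<Sum>e<r2. s e * form_eval d b (conc (monomial [m]) (c' e a))) = \<mu> a" if a: "a < r1" for a
  proof -
   have "(\<Sum>e<r2. s e * form_eval d b (conc (monomial [m]) (c' e a))) = form_eval d b (conc (monomial [m]) (\<kappa> a))"
    unfolding s[OF a] conc_sum_right form_eval_sum conc_scale_right form_eval_scale ..
   also have "... = \<mu> a"
    unfolding \<kappa>_def conc_minus_right conc_scale_right monomial_conc form_eval_diff form_eval_scale
    using m l iso nonzero by (simp add: form_eval_monomial)
   finally show ?thesis .
  qed
  then show "\<exists>s. \<forall>a<r1. (\<Sum>e<r2. s e * form_eval d b (conc (monomial [m]) (c' e a))) = \<mu> a" by blast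
 qed
 moreover have "next_stage r0 r1 c r2 c'"
  unfolding next_stage_def
 proof (intro conjI allI impI)
  show "(\<Sum>a<r1. conc (c' e a) (c a q)) : J 2" if "e < r2" "q < r0" for e q
   using hK[OF that(1)] that(2) by (simp add: c'_def K_def)
  show "\<exists>s. \<forall>a<r1. v a = (\<Sum>h<r2. fscale (s h) (c' h a))"
   if "\<forall>a. v a : tensors d 1" "\<forall>q<r0. (\<Sum>a<r1. conc (v a) (c a q)) : J 2" for v
   using that by (intro repr) blast+
 qed
 ultimately show ?thesis by blast
qed

text \<open>Stages are chained by dependent choice. Exactness splits by the degree of the
  coefficients: linear syzygies are spanned by the next rows, degree 2 is already filled by
  \<open>x_m\<close> times those rows, and from degree 3 on the algebra is zero.\<close>

lemma H_linear_resolution: "\<exists>rk c. H.linear_resolution rk c"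
proof -
 \<comment> \<open>Index 0 is pinned to the column of letters, so that the chain starts by resolving
   the trivial module.\<close>
 define P where "P n st = ((n = 0 --> st = (1, d, %a q. monomial [a])) \<and> stage (fst st) (fst (snd st)) (snd (snd st)))"
  for n :: nat and st :: "nat \<times> nat \<times> (nat => nat => nat list => 'k)"
 define Q where "Q st st' = (fst st' = fst (snd st) \<and>
   next_stage (fst st) (fst (snd st)) (snd (snd st)) (fst (snd st')) (snd (snd st')))"
  for st st' :: "nat \<times> nat \<times> (nat => nat => nat list => 'k)"
 have "\<exists>f. \<forall>n. P n (f n) \<and> Q (f n) (f (Suc n))"
 proof (rule dependent_nat_choice)
  show "\<exists>st. P 0 st" using stage_0 by (intro exI[of _ "(1, d, %a q. monomial [a])"]) (simp add: P_def)
  fix st n assume "P n st"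
  then obtain r2 c' where "stage (fst (snd st)) r2 c'" "next_stage (fst st) (fst (snd st)) (snd (snd st)) r2 c'"
   using stage_step unfolding P_def by blast
  then show "\<exists>st'. P (Suc n) st' \<and> Q st st'"
   by (intro exI[of _ "(fst (snd st), r2, c')"]) (simp add: P_def Q_def)
 qed
 then obtain f where f: "\<And>n. P n (f n)" "\<And>n. Q (f n) (f (Suc n))" by blast
 define rk where "rk i = fst (f i)" for i
 define c where "c i = snd (snd (f i))" for i
 have rkS: "fst (snd (f i)) = rk (Suc i)" for i using f(2)[of i] by (simp add: Q_def rk_def)
 have st: "stage (rk i) (rk (Suc i)) (c i)" for i
  using f(1)[of i] rkS by (simp add: P_def rk_def c_def)
 have nx: "next_stage (rk i) (rk (Suc i)) (c i) (rk (Suc (Suc i))) (c (Suc i))" for i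
  using f(2)[of i] rkS by (simp add: Q_def rk_def c_def)
 have f0: "f 0 = (1, d, %a q. monomial [a])" using f(1)[of 0] by (simp add: P_def)
 have rk0: "rk 0 = 1" and c0: "c 0 = (%a q. monomial [a])" by (simp_all add: rk_def c_def f0)
 have rk1: "rk (Suc 0) = d" using rkS[of 0] f0 by simp
 have cT: "a < rk (Suc i) ==> q < rk i ==> c i a q : tensors d 1" for i a q
  using st[of i] unfolding stage_def by blast
 have "H.linear_resolution rk c"
  unfolding H.linear_resolution_def
 proof (intro conjI allI impI ballI)
  show "rk 0 = 1" by (rule rk0)
  show "c i a q : tensors d 1" if "a < rk (Suc i)" "q < rk i" for i a q by (rule cT[OF that])
  show "\<exists>v. (\<forall>a. v a : tensors d n) \<and> z - (\<Sum>a<rk 1. conc (v a) (c 0 a 0)) : J (Suc n)"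
   if z: "z : tensors d (Suc n)" for n and z :: "nat list => 'k"
  proof -
   have "z - (\<Sum>a<rk 1. conc (last_cut a z) (c 0 a 0)) = 0"
    using sum_last_cut[OF z] by (simp add: rk1 c0)
   then have "z - (\<Sum>a<rk 1. conc (last_cut a z) (c 0 a 0)) : J (Suc n)" by (simp only: Is(5))
   with last_cut_tensors[OF z] show ?thesis by (intro exI[of _ "%a. last_cut a z"]) simp
  qed
  show "(\<Sum>a<rk (Suc i). conc (c (Suc i) h a) (c i a q)) : J 2" if "h < rk (Suc (Suc i))" "q < rk i" for i h q
   using nx[of i] that unfolding next_stage_def by blast
  show "v a : J 0" if v: "\<forall>a. v a : tensors d 0"
   and s: "\<forall>q<rk i. (\<Sum>a<rk (Suc i). conc (v a) (c i a q)) : J 1" and a: "a < rk (Suc i)" for i a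
    and v :: "nat => nat list => 'k"
  proof -
   have va: "v a = fscale (v a []) (monomial [])" for a using v tensors_0 by blast
   have "(\<Sum>a<rk (Suc i). fscale (v a []) (c i a q)) = 0" if "q < rk i" for q
   proof -
    have e: "conc (v a) (c i a q) = fscale (v a []) (c i a q)" for a
     by (subst va) (simp only: conc_scale_left conc_one_left)
    have "(\<Sum>a<rk (Suc i). fscale (v a []) (c i a q)) : J 1"
     using s[rule_format, OF that] by (simp only: e)
    then show ?thesis by (simp add: ideal_comp_low)
   qed
   then have "v a [] = 0" by (rule stage_independent[OF st _ a])
   then have "fscale (v a []) (monomial []) = 0" by (simp only: fscale.scale_zero_left)
   with va[of a] have "v a = 0" by (rule trans)
   then show ?thesis by (simp only: Is(5))
  qed
  show "\<exists>w. (\<forall>h. w h : tensors d n) \<and> (\<forall>a<rk (Suc i).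
    v a - (\<Sum>h<rk (Suc (Suc i)). conc (w h) (c (Suc i) h a)) : J (Suc n))"
   if v: "\<forall>a. v a : tensors d (Suc n)"
   and s: "\<forall>q<rk i. (\<Sum>a<rk (Suc i). conc (v a) (c i a q)) : J (Suc (Suc n))" for i n
    and v :: "nat => nat list => 'k"
  proof -
   consider "n = 0" | "n = 1" | k where "n = k + 2" by (metis One_nat_def add_2_eq_Suc' old.nat.exhaust)
   then show ?thesis
   proof cases
    case 1
    have "\<exists>s. \<forall>a<rk (Suc i). v a = (\<Sum>h<rk (Suc (Suc i)). fscale (s h) (c (Suc i) h a))"
     using nx[of i] v s 1 unfolding next_stage_def by (simp add: numeral_2_eq_2)
    then obtain t where t: "\<And>a. a < rk (Suc i) ==> v a = (\<Sum>h<rk (Suc (Suc i)). fscale (t h) (c (Suc i) h a))" by blast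
    show ?thesis
    proof (intro exI[of _ "%h. fscale (t h) (monomial [])"] conjI allI impI)
     show "fscale (t h) (monomial []) : tensors d n" for h
      unfolding 1 by (intro tensors_intros monomial_tensors) simp_all
     fix a assume a: "a < rk (Suc i)"
     have "v a - (\<Sum>h<rk (Suc (Suc i)). conc (fscale (t h) (monomial [])) (c (Suc i) h a)) = 0"
      unfolding conc_scale_left conc_one_left t[OF a, symmetric] by simp
     then show "v a - (\<Sum>h<rk (Suc (Suc i)). conc (fscale (t h) (monomial [])) (c (Suc i) h a)) : J (Suc n)"
      by (simp only: Is(5))
    qed
   next
    case 2
    have "\<exists>t. \<forall>a<rk (Suc i). (\<Sum>h<rk (Suc (Suc i)). t h * form_eval d b (conc (monomial [m]) (c (Suc i) h a))) =
      form_eval d b (v a)"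
     using st[of "Suc i"] unfolding stage_def by (elim conjE) (erule allE)
    then obtain t where t: "\<And>a. a < rk (Suc i) ==>
      (\<Sum>h<rk (Suc (Suc i)). t h * form_eval d b (conc (monomial [m]) (c (Suc i) h a))) = form_eval d b (v a)" by blast
    have vJ: "v a - (\<Sum>h<rk (Suc (Suc i)). conc (fscale (t h) (monomial [m])) (c (Suc i) h a)) : J 2"
     if a: "a < rk (Suc i)" for a
     unfolding J_2_iff
    proof
     have "conc (fscale (t h) (monomial [m])) (c (Suc i) h a) : tensors d 2" if "h < rk (Suc (Suc i))" for h
      using conc_tensors[OF tensors_intros(3)[OF letter_tensors[OF m]] cT[OF that a]] by (simp add: numeral_2_eq_2)
     then show "v a - (\<Sum>h<rk (Suc (Suc i)). conc (fscale (t h) (monomial [m])) (c (Suc i) h a)) : tensors d 2"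
      using v 2 by (intro tensors_intros) (auto simp: numeral_2_eq_2)
     show "form_eval d b (v a - (\<Sum>h<rk (Suc (Suc i)). conc (fscale (t h) (monomial [m])) (c (Suc i) h a))) = 0"
      unfolding form_eval_diff form_eval_sum conc_scale_left form_eval_scale t[OF a] by simp
    qed
    have n2: "Suc n = 2" using 2 by simp
    show ?thesis unfolding n2
    proof (intro exI[of _ "%h. fscale (t h) (monomial [m])"] conjI allI impI)
     show "fscale (t h) (monomial [m]) : tensors d n" for h
      unfolding 2 by (intro tensors_intros letter_tensors m)
    qed (rule vJ)
   next
    case (3 k)
    have "v a - (\<Sum>h<rk (Suc (Suc i)). conc 0 (c (Suc i) h a)) : J (Suc n)" for a
    proof -
     have "k + 3 = Suc n" using 3 by simp
     with tensors_J[of "v a" k] v have "v a : J (Suc n)" by (simp only:)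
     then show ?thesis by simp
    qed
    then show ?thesis by (intro exI[of _ "%_. 0"]) (simp only: tensors_intros(5) simp_thms)
   qed
  qed
 qed
 then show ?thesis by blast
qed

end

section \<open>One generator: dual numbers and polynomials\<close>

lemma conc_unary:
 assumes "f : tensors 1 (Suc n)"
 shows "f = conc (last_cut 0 f) (monomial [0])"
 using sum_last_cut[OF assms] by simp

text \<open>With one letter and \<open>b 0 0 ~= 0\<close> the relation is \<open>x^2\<close>, so the
  two algebras are the dual numbers and the polynomial ring in one variable.\<close>

locale unary_form =
 fixes b :: "nat => nat => 'k::field"
 assumes nonzero: "b 0 0 ~= 0"
begin

abbreviation I where "I \<equiv> ideal_comp 1 (form_rel 1 b)"
abbreviation J where "J \<equiv> ideal_comp 1 (orth 1 (form_rel 1 b))"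

lemma form_tensor_unary: "form_tensor 1 b = fscale (b 0 0) (monomial [0, 0])"
proof (rule tensor_2_eqI[OF form_tensor_tensors])
 show "fscale (b 0 0) (monomial [0, 0]) : tensors 1 2"
  by (intro tensors_intros monomial_tensors) simp_all
qed (simp add: form_tensor_pair monomial_def)

lemma orth_unary: "orth 1 (form_rel 1 b) = {0}"
proof (intro subset_antisym subsetI)
 fix \<eta> assume "\<eta> : orth 1 (form_rel 1 b)"
 then have \<eta>: "\<eta> : tensors 1 2" "\<eta> [0, 0] = 0"
  using nonzero by (simp_all add: orth_form_rel form_eval_def)
 have "\<eta> = 0" by (rule tensor_2_eqI[OF \<eta>(1) tensors_intros(5)]) (use \<eta> in simp)
 then show "\<eta> : {0}" by simp
qed (simp add: orth_form_rel form_eval_def tensors_intros(5))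

lemma J_zero: "J n = {0}"
proof (rule subset_antisym)
 show "J n <= {0}" unfolding orth_unary by (rule ideal_comp_least[OF fscale.subspace_single_0]) simp
 show "{0} <= J n" using fscale.subspace_0[OF ideal_comp_subspace] by simp
qed

lemma tensors_I:
 assumes f: "f : tensors 1 (Suc (Suc n))"
 shows "f : I (Suc (Suc n))"
proof -
 define g where "g = fscale (1 / b 0 0) (last_cut 0 (last_cut 0 f))"
 have lc: "last_cut 0 f : tensors 1 (Suc n)" using last_cut_tensors[OF f] .
 have g: "g : tensors 1 n" unfolding g_def by (intro tensors_intros last_cut_tensors lc)
 have "f = conc (conc (last_cut 0 (last_cut 0 f)) (monomial [0])) (monomial [0])"
  using conc_unary[OF f] conc_unary[OF lc] by simp
 also have "... = conc (last_cut 0 (last_cut 0 f)) (monomial [0, 0])"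
  by (simp add: conc_assoc monomial_conc)
 also have "... = fscale (b 0 0 * (1 / b 0 0)) (conc (last_cut 0 (last_cut 0 f)) (monomial [0, 0]))"
  using nonzero by simp
 also have "... = conc g (conc (form_tensor 1 b) (monomial []))"
  unfolding g_def form_tensor_unary conc_one_right conc_scale_left conc_scale_right fscale.scale_scale ..
 also have "... : I (Suc (Suc n))"
  by (rule ideal_comp_gen[OF g fscale.span_base monomial_tensors[of "[]" 0]]) simp_all
 finally show ?thesis .
qed

sublocale R: subquotient conc "monomial []" "tensors 1" I
 by (rule quadratic_subquotient[OF form_rel_relation_space])

sublocale H: subquotient conc "monomial []" "tensors 1" J
 by (rule quadratic_subquotient[OF orth_relation_space])

lemma letter: "monomial [0] : tensors 1 1"
 by (simp add: monomial_tensors)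

lemma conc_letter_eq_0: "conc f (monomial [0]) = 0 ==> f = 0"
proof
 fix w assume "conc f (monomial [0]) = 0"
 then have "conc f (monomial [0]) (w @ [0]) = 0" by simp
 then show "f w = 0 w" by (simp add: conc_letter)
qed

text \<open>On the dual numbers the kernel of multiplication by \<open>x\<close> is its image, so
  the resolution is periodic with every rank 1.\<close>

lemma R_linear_resolution: "R.linear_resolution (%_. 1) (%_ _ _. monomial [0])"
 unfolding R.linear_resolution_def
proof (intro conjI allI impI ballI)
 show "\<exists>v. (\<forall>a. v a : tensors 1 n) \<and> z - (\<Sum>a<1::nat. conc (v a) (monomial [0])) : I (Suc n)"
  if z: "z : tensors 1 (Suc n)" for n and z :: "nat list => 'k"
 proof (intro exI[of _ "%_. last_cut 0 z"] conjI allI last_cut_tensors z)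
  have "z - (\<Sum>a<1::nat. conc (last_cut 0 z) (monomial [0])) = 0" using conc_unary[OF z] by simp
  then show "z - (\<Sum>a<1::nat. conc (last_cut 0 z) (monomial [0])) : I (Suc n)" by (simp only: R.Bs)
 qed
 have "(monomial [0, 0] :: nat list => 'k) : I (Suc (Suc 0))"
  by (rule tensors_I) (simp add: monomial_tensors)
 then show "(\<Sum>a<1::nat. conc (monomial [0]) (monomial [0])) : I 2"
  by (simp add: monomial_conc numeral_2_eq_2)
 show "v a : I 0" if v: "\<forall>a. v a : tensors 1 0"
  and s: "\<forall>q<1::nat. (\<Sum>a<1::nat. conc (v a) (monomial [0])) : I 1" and a: "a < 1"
  for a :: nat and v :: "nat => nat list => 'k"
 proof -
  have "conc (v 0) (monomial [0]) = 0" using s by (simp add: ideal_comp_low)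
  then have "v 0 = 0" by (rule conc_letter_eq_0)
  then show ?thesis using a by (simp add: ideal_comp_low)
 qed
 show "\<exists>w. (\<forall>h. w h : tensors 1 n) \<and> (\<forall>a<1::nat. v a - (\<Sum>h<1::nat. conc (w h) (monomial [0])) : I (Suc n))"
  if v: "\<forall>a. v a : tensors 1 (Suc n)" for n and v :: "nat => nat list => 'k"
 proof (intro exI[of _ "%_. last_cut 0 (v 0)"] conjI allI impI last_cut_tensors v[rule_format])
  fix a :: nat assume "a < 1"
  then have "v a - (\<Sum>h<1::nat. conc (last_cut 0 (v 0)) (monomial [0])) = 0"
   using conc_unary[of "v 0" n] v by simp
  then show "v a - (\<Sum>h<1::nat. conc (last_cut 0 (v 0)) (monomial [0])) : I (Suc n)" by (simp only: R.Bs)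
 qed
qed (simp_all only: letter)

text \<open>The letter is not a zero divisor in the polynomial ring, so the resolution stops after
  one step.\<close>

lemma H_linear_resolution: "H.linear_resolution (%i. if i \<le> 1 then 1 else 0) (%_ _ _. monomial [0])"
  (is "H.linear_resolution ?rk _")
 unfolding H.linear_resolution_def J_zero
proof (intro conjI allI impI ballI)
 show "?rk 0 = 1" by simp
 show "monomial [0] : tensors 1 1" by (rule letter)
 show "\<exists>v. (\<forall>a. v a : tensors 1 n) \<and> z - (\<Sum>a<?rk 1. conc (v a) (monomial [0])) : {0}"
  if z: "z : tensors 1 (Suc n)" for n and z :: "nat list => 'k"
  using conc_unary[OF z] last_cut_tensors[OF z] by (intro exI[of _ "%_. last_cut 0 z"]) simp
 show "(\<Sum>a<?rk (Suc i). conc (monomial [0]) (monomial [0])) : {0}" if "h < ?rk (Suc (Suc i))" for h i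
  using that by simp
 show "v a : {0}" if s: "\<forall>q<?rk i. (\<Sum>a<?rk (Suc i). conc (v a) (monomial [0])) : {0}" and a: "a < ?rk (Suc i)"
  for i a and v :: "nat => nat list => 'k"
 proof -
  have "i = 0" "a = 0" using a by (auto split: if_splits)
  then show ?thesis using s conc_letter_eq_0[of "v 0"] by simp
 qed
 show "\<exists>w. (\<forall>h. w h : tensors 1 n) \<and>
   (\<forall>a<?rk (Suc i). v a - (\<Sum>h<?rk (Suc (Suc i)). conc (w h) (monomial [0])) : {0})"
  if s: "\<forall>q<?rk i. (\<Sum>a<?rk (Suc i). conc (v a) (monomial [0])) : {0}"
  for i n and v :: "nat => nat list => 'k"
 proof (cases i)
  case 0
  then have "v 0 = 0" using s conc_letter_eq_0[of "v 0"] by simp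
  then show ?thesis using 0 by (intro exI[of _ "%_. 0"]) (simp add: tensors_intros(5))
 next
  case (Suc k)
  then show ?thesis by (intro exI[of _ "%_. 0"]) (simp add: tensors_intros(5))
 qed
qed

end


section \<open>Rewriting and PBW bases\<close>

definition deglex :: "nat => nat list rel" where
 "deglex d = lenlex less_than \<inter> lists {..<d} \<times> lists {..<d}"

lemma deglex_iff: "(u, v) : deglex d \<longleftrightarrow> (u, v) : lenlex less_than \<and> u : lists {..<d} \<and> v : lists {..<d}"
 by (auto simp: deglex_def)

lemma admissible_deglex: "admissible_order d (deglex d)"
 unfolding admissible_order_def
proof (intro conjI allI impI ballI)
 show "deglex d <= lists {..<d} \<times> lists {..<d}" by (auto simp: deglex_def)
 have "trans (lenlex less_than)" by (rule lenlex_transI) simp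
 then show "trans (deglex d)" unfolding trans_def deglex_iff by blast
 have "total (lenlex less_than)" by (rule total_lenlex) simp
 then show "total_on (lists {..<d}) (deglex d)" unfolding total_on_def deglex_iff by blast
 have "wf (lenlex less_than)" by (rule wf_lenlex) simp
 then show "wf (deglex d)" by (rule wf_subset) (simp add: deglex_def)
 show "([i], [j]) : deglex d" if "i < j \<and> j < d" for i j
  using that by (auto simp: deglex_iff Cons_lenlex_iff)
 show "([], w) : deglex d" if "w : lists {..<d}" "w ~= []" for w
  using that by (auto simp: deglex_iff Nil_lenlex_iff1)
 show "(u @ x @ v, u @ y @ v) : deglex d"
  if "u : lists {..<d}" "v : lists {..<d}" "(x, y) : deglex d" for u v x y
 proof -
  have "(x @ v, y @ v) : lenlex less_than" using that lenlex_append1[of x y less_than v v] by (simp add: deglex_iff)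
  then have "(u @ x @ v, u @ y @ v) : lenlex less_than" by (simp add: lenlex_append2 irrefl_def)
  then show ?thesis using that by (simp add: deglex_iff)
 qed
qed

lemma deglex_pair: "([i, j], [k, n]) : deglex d \<longleftrightarrow>
  (i < k \<or> i = k \<and> j < n) \<and> i < d \<and> j < d \<and> k < d \<and> n < d"
 by (auto simp: deglex_iff Cons_lenlex_iff)

lemma leading_unique:
 assumes "admissible_order d r" "leading_monomial r f w" "leading_monomial r f w'"
 shows "w = w'"
proof (rule ccontr)
 assume "w ~= w'"
 then have "(w, w') : r" "(w', w) : r" using assms unfolding leading_monomial_def by blast+
 moreover have "wf r" using assms(1) unfolding admissible_order_def by blast
 ultimately show False using wf_asym by metis
qed

lemma leading_exists:
 assumes r: "admissible_order d r" and f: "f : tensors d n" "f ~= 0"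
 obtains w where "leading_monomial r f w"
proof -
 have "trans r" "total_on (lists {..<d}) r" using r unfolding admissible_order_def by blast+
 have max: "finite A ==> A ~= {} ==> A <= lists {..<d} ==> \<exists>w\<in>A. \<forall>v\<in>A. v ~= w --> (v, w) : r" for A
 proof (induction A rule: finite_ne_induct)
  case (insert x A)
  then obtain w where w: "w : A" "\<And>v. v : A ==> v ~= w ==> (v, w) : r" by auto
  have "x ~= w" using insert w by blast
  then have "(x, w) : r \<or> (w, x) : r"
   using \<open>total_on _ r\<close> insert w(1) unfolding total_on_def by (metis insert_subset subsetD)
  then show ?case
  proof
   assume "(x, w) : r"
   then show ?thesis using w by (intro bexI[of _ w]) auto
  next
   assume wx: "(w, x) : r"
   have "(v, x) : r" if "v : A" for v
    using w(2)[OF that] wx \<open>trans r\<close> by (cases "v = w") (auto dest: transD)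
   then show ?thesis by (intro bexI[of _ x]) auto
  qed
 qed simp
 have "{w. f w ~= 0} <= {w. set w <= {..<d} \<and> length w = n}" using tensor_nonzero[OF f(1)] by blast
 then have "finite {w. f w ~= 0}" by (rule finite_subset) (rule finite_lists_length_eq, simp)
 moreover have "{w. f w ~= 0} ~= {}" using f(2) by (auto simp: fun_eq_iff)
 moreover have "{w. f w ~= 0} <= lists {..<d}" using tensor_nonzero[OF f(1)] by auto
 ultimately obtain w where "w : {w. f w ~= 0}" "\<forall>v\<in>{w. f w ~= 0}. v ~= w --> (v, w) : r"
  using max by metis
 then show ?thesis by (intro that[of w]) (simp add: leading_monomial_def)
qed

lemma conc_monomial_prepend:
 fixes g :: "'x list => 'k::field"
 shows "conc (monomial u) g w = (if \<exists>v. w = u @ v then g (drop (length u) w) else 0)"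
proof (induction u arbitrary: w)
 case (Cons a u)
 show ?case
 proof (cases w)
  case Nil
  then show ?thesis by (simp add: conc_Nil monomial_def)
 next
  case (Cons x v)
  have "(%z. monomial (a # u) (x # z) :: 'k) = (if x = a then monomial u else 0)"
   by (auto simp: monomial_def fun_eq_iff)
  then have "conc (monomial (a # u)) g w = (if x = a then conc (monomial u) g v else 0)"
   unfolding Cons conc_Cons by (simp add: monomial_def)
  then show ?thesis using Cons Cons.IH[of v] by auto
 qed
qed simp

lemma shift_apply: "conc (monomial u) (conc \<omega> (monomial v)) (u @ w @ v) = \<omega> w"
 by (simp add: conc_monomial_prepend conc_monomial_append)

lemma shift_nonzero: "conc (monomial u) (conc \<omega> (monomial v)) y ~= 0 ==> \<exists>w. y = u @ w @ v \<and> \<omega> w ~= 0"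
 by (auto simp: conc_monomial_prepend conc_monomial_append split: if_splits)

context
 fixes d n :: nat and r :: "nat list rel" and S :: "(nat list => 'k::field) set"
 assumes r: "admissible_order d r" and S: "S <= tensors d 2"
  and monic: "\<And>\<omega> w. \<omega> : S ==> leading_monomial r \<omega> w ==> \<omega> w = 1"
  and reducible: "\<And>w. length w = n ==> set w <= {..<d} ==>
   \<exists>\<omega>\<in>S. \<exists>u x v. leading_monomial r \<omega> x \<and> w = u @ x @ v"
begin

lemma shift_tensors:
 assumes "\<omega> : S" "length (u @ w @ v) = n" "set (u @ w @ v) <= {..<d}" "length w = 2"
 shows "conc (monomial u) (conc \<omega> (monomial v)) : tensors d n"
proof -
 have "conc (monomial u) (conc \<omega> (monomial v)) : tensors d (length u + (2 + length v))"
  using assms S by (intro conc_tensors monomial_tensors) auto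
 then show ?thesis using assms by (simp add: add.assoc)
qed

lemma rewrite_step_tensors:
 assumes "rewrite_step r S f g" "f : tensors d n"
 shows "g : tensors d n"
proof -
 obtain \<omega> u w v where \<omega>: "\<omega> : S" "leading_monomial r \<omega> w" "f (u @ w @ v) ~= 0"
  "g = f - fscale (f (u @ w @ v)) (conc (monomial u) (conc \<omega> (monomial v)))"
  using assms(1) unfolding rewrite_step_def by blast
 have "length w = 2" using \<omega> S tensor_nonzero[of \<omega> d 2 w] unfolding leading_monomial_def by blast
 then show ?thesis unfolding \<omega>(4)
  using tensor_nonzero[OF assms(2) \<omega>(3)] \<omega>(1) assms(2) by (intro tensors_intros shift_tensors[of \<omega> u w v]) auto
qed

lemma rewrite_steps_tensors:
 "(rewrite_step r S)\<^sup>*\<^sup>* f g ==> f : tensors d n ==> g : tensors d n"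
 by (induction rule: rtranclp_induct) (blast intro: rewrite_step_tensors)+

text \<open>Every word of this degree contains a leading monomial, so the leading word of
  \<open>f\<close> can always be rewritten. Monicity removes it, everything introduced is smaller by
  admissibility, and well-foundedness of the order ends the process at 0.\<close>

lemma rewrite_to_zero:
 assumes f: "f : tensors d n"
 shows "(rewrite_step r S)\<^sup>*\<^sup>* f 0"
proof (cases "f = 0")
 case False
 have "wf r" using r unfolding admissible_order_def by blast
 have "(rewrite_step r S)\<^sup>*\<^sup>* f 0" if "leading_monomial r f w" "f : tensors d n" for w f
  using \<open>wf r\<close> that
 proof (induction w arbitrary: f rule: wf_induct_rule)
  case (less w)
  have fw: "f w ~= 0" and fmax: "\<And>v. f v ~= 0 ==> v ~= w ==> (v, w) : r"
   using less.prems(1) unfolding leading_monomial_def by blast+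
  have w: "length w = n" "set w <= {..<d}" using tensor_nonzero[OF less.prems(2) fw] by auto
  obtain \<omega> u x v where \<omega>: "\<omega> : S" "leading_monomial r \<omega> x" and wx: "w = u @ x @ v"
   using reducible[OF w] by blast
  define g where "g = f - fscale (f w) (conc (monomial u) (conc \<omega> (monomial v)))"
  have step: "rewrite_step r S f g"
   unfolding rewrite_step_def g_def wx using \<omega> fw wx by blast
  have gT: "g : tensors d n" by (rule rewrite_step_tensors[OF step less.prems(2)])
  have gw: "g w = 0" unfolding g_def wx using monic[OF \<omega>] by (simp add: shift_apply)
  have small: "(y, w) : r" if "g y ~= 0" for y
  proof (cases "f y = 0")
   case True
   with that have "conc (monomial u) (conc \<omega> (monomial v)) y ~= 0" by (auto simp: g_def)
   then obtain z where z: "y = u @ z @ v" "\<omega> z ~= 0" using shift_nonzero by blast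
   have "z ~= x" using gw that z wx by auto
   then have "(z, x) : r" using \<omega>(2) z unfolding leading_monomial_def by blast
   moreover have "u : lists {..<d}" "v : lists {..<d}" using w wx by auto
   ultimately show ?thesis using r unfolding z wx admissible_order_def by blast
  next
   case False
   then show ?thesis using fmax gw that by metis
  qed
  show ?case
  proof (cases "g = 0")
   case True
   then show ?thesis using step by blast
  next
   case False
   then obtain w' where w': "leading_monomial r g w'" using leading_exists[OF r gT] by blast
   then have "(w', w) : r" using small unfolding leading_monomial_def by blast
   have "(rewrite_step r S)\<^sup>*\<^sup>* g 0" by (rule less.IH[OF \<open>(w', w) : r\<close> w' gT])
   with step show ?thesis using converse_rtranclp_into_rtranclp[of "rewrite_step r S" f g 0] by blast
  qed
 qed
 with leading_exists[OF r f False] f show ?thesis by blast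
qed simp

text \<open>Whatever two reductions have reached can be continued to 0, where they join.\<close>

lemma reducible_confluent:
 assumes "length w = n" "set w <= {..<d}"
 shows "confluent_monomial r S w"
 unfolding confluent_monomial_def
 using rewrite_to_zero rewrite_steps_tensors[OF _ monomial_tensors[OF assms]] by blast

end

text \<open>Meant for algebras that vanish in degree 3: critical words have length 3, and when all
  such words are reducible, confluence follows without computing any overlap.\<close>

lemma PBW_reducible:
 assumes "relation_space d \<Omega>" "galg_isomorphic A (quadratic_algebra d \<Omega>)"
  and nb: "normalized_basis (deglex d) \<Omega> S"
  and red: "\<And>w. length w = 3 ==> set w <= {..<d} ==>
   \<exists>\<omega>\<in>S. \<exists>u x v. leading_monomial (deglex d) \<omega> x \<and> w = u @ x @ v"
 shows "PBW_algebra A"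
proof -
 have S: "S <= tensors d 2" using nb assms(1) unfolding normalized_basis_def relation_space_def by blast
 have monic: "\<And>\<omega> w. \<omega> : S ==> leading_monomial (deglex d) \<omega> w ==> \<omega> w = 1"
  using nb unfolding normalized_basis_def by blast
 have "confluent_monomial (deglex d) S w" if cm: "critical_monomial (deglex d) S w" for w
 proof -
  obtain i j k \<omega> \<omega>' where w: "w = [i, j, k]" and *: "\<omega> : S" "leading_monomial (deglex d) \<omega> [i, j]"
   "\<omega>' : S" "leading_monomial (deglex d) \<omega>' [j, k]" using cm unfolding critical_monomial_def by blast
  have "\<omega> [i, j] ~= 0" "\<omega>' [j, k] ~= 0" using * unfolding leading_monomial_def by blast+
  then have "set w <= {..<d}"
   using tensor_nonzero[of \<omega> d 2 "[i, j]"] tensor_nonzero[of \<omega>' d 2 "[j, k]"] * S w by auto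
  then show ?thesis
   using w by (intro reducible_confluent[of d "deglex d" S 3] admissible_deglex S monic red) auto
 qed
 then show ?thesis unfolding PBW_algebra_def using assms admissible_deglex by blast
qed

text \<open>The only word of length 3 is \<open>x^3\<close>, and it rewrites to 0.\<close>

lemma (in unary_form) PBW_R:
 assumes "galg_isomorphic A (quadratic_algebra 1 (form_rel 1 b))"
 shows "PBW_algebra A"
proof (rule PBW_reducible[OF form_rel_relation_space assms])
 have lead: "leading_monomial (deglex 1) (monomial [0, 0] :: nat list => 'k) [0, 0]"
  by (simp add: leading_monomial_def monomial_def)
 show "normalized_basis (deglex 1) (form_rel 1 b) {monomial [0, 0]}"
  unfolding normalized_basis_def
 proof (intro conjI ballI allI impI)
  have e: "monomial [0, 0] = fscale (1 / b 0 0) (form_tensor 1 b)"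
   unfolding form_tensor_unary fscale.scale_scale using nonzero by simp
  show "{monomial [0, 0]} <= form_rel 1 b"
   unfolding e by (simp add: fscale.span_base fscale.span_scale del: fscale_apply)
  have "(monomial [0, 0] :: nat list => 'k) [0, 0] ~= 0 [0, 0]" by (simp add: monomial_def)
  then show "\<not> fscale.dependent {monomial [0, 0] :: nat list => 'k}"
   by (metis fscale.dependent_single)
  show "fscale.span {monomial [0, 0]} = form_rel 1 b"
  proof (rule subset_antisym)
   show "fscale.span {monomial [0, 0]} <= form_rel 1 b"
    by (rule fscale.span_minimal[OF \<open>{monomial [0, 0]} <= form_rel 1 b\<close> fscale.subspace_span])
   have "form_tensor 1 b : fscale.span {monomial [0, 0]}"
    unfolding form_tensor_unary by (intro fscale.span_scale fscale.span_base) simp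
   then show "form_rel 1 b <= fscale.span {monomial [0, 0]}"
    by (intro fscale.span_minimal fscale.subspace_span) simp
  qed
  fix \<omega> :: "nat list => 'k" and w assume \<omega>: "\<omega> : {monomial [0, 0]}" and "leading_monomial (deglex 1) \<omega> w"
  then have "w = [0, 0]" by (auto simp: leading_monomial_def monomial_def split: if_splits)
  then show "\<omega> w = 1" using \<omega> by (simp add: monomial_def)
  show "\<omega>' w = 0" if "\<omega>' : {monomial [0, 0]}" "\<omega>' ~= \<omega>" for \<omega>' using that \<omega> by blast
 qed
 fix w :: "nat list" assume w: "length w = 3" "set w <= {..<1}"
 then have "w = [] @ [0, 0] @ [0]" by (auto simp: numeral_3_eq_3 length_Suc_conv)
 then show "\<exists>\<omega>\<in>{monomial [0, 0] :: nat list => 'k}. \<exists>u x v. leading_monomial (deglex 1) \<omega> x \<and> w = u @ x @ v"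
  using lead by blast
qed

text \<open>The orthogonal space is zero, so there is nothing to rewrite.\<close>

lemma (in unary_form) PBW_H:
 assumes "galg_isomorphic A (quadratic_algebra 1 (orth 1 (form_rel 1 b)))"
 shows "PBW_algebra A"
proof -
 have "normalized_basis (deglex 1) (orth 1 (form_rel 1 b)) {}"
  unfolding normalized_basis_def orth_unary by (simp add: fscale.independent_empty)
 moreover have "\<not> critical_monomial (deglex 1) {} w" for w by (simp add: critical_monomial_def)
 ultimately show ?thesis
  unfolding PBW_algebra_def using assms orth_relation_space[of 1 b] admissible_deglex[of 1] by blast
qed

context isotropic_form begin

text \<open>With the isotropic letter largest, the leading word of the single relation is
  \<open>x_m x_n\<close> for the largest \<open>n\<close> with \<open>b m n ~= 0\<close>. Isotropy
  gives \<open>n ~= m\<close>, so this word does not overlap itself and there are no critical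
  monomials.\<close>

lemma PBW_R:
 assumes last: "m = d - 1" and A: "galg_isomorphic A (quadratic_algebra d (form_rel d b))"
 shows "PBW_algebra A"
proof -
 define n where "n = Max {j. j < d \<and> b m j ~= 0}"
 have fin: "finite {j. j < d \<and> b m j ~= 0}" by simp
 have "n : {j. j < d \<and> b m j ~= 0}" unfolding n_def using fin l nonzero by (intro Max_in) auto
 then have n: "n < d" "b m n ~= 0" by auto
 have nmax: "j \<le> n" if "j < d" "b m j ~= 0" for j unfolding n_def using that by (intro Max_ge) auto
 define s where "s = fscale (1 / b m n) \<omega>"
 have sT: "s : tensors d 2" unfolding s_def by (intro tensors_intros form_tensor_tensors)
 have sv: "s [i, j] = b i j / b m n" if "i < d" "j < d" for i j
  using that by (simp add: s_def form_tensor_pair)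
 have lead: "leading_monomial (deglex d) s [m, n]"
  unfolding leading_monomial_def
 proof (intro conjI allI impI)
  show "s [m, n] ~= 0" using m n by (simp add: sv)
  fix v assume v: "s v ~= 0 \<and> v ~= [m, n]"
  then obtain i j where ij: "v = [i, j]" "i < d" "j < d" using tensor_2_cases[OF sT] by metis
  then have "b i j ~= 0" using v by (auto simp: sv)
  then show "(v, [m, n]) : deglex d" unfolding ij(1) deglex_pair
   using ij m n nmax[of j] v last by (cases "i = m") auto
 qed
 have uniq: "w = [m, n]" if "leading_monomial (deglex d) s w" for w
  by (rule leading_unique[OF admissible_deglex that lead])
 have span: "fscale.span {s} = form_rel d b"
 proof (rule subset_antisym)
  show "fscale.span {s} <= form_rel d b"
   unfolding s_def by (intro fscale.span_minimal fscale.subspace_span) (simp add: fscale.span_base fscale.span_scale del: fscale_apply)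
  have "\<omega> = fscale (b m n) s" unfolding s_def fscale.scale_scale using n by simp
  also have "... : fscale.span {s}" by (intro fscale.span_scale fscale.span_base) simp
  finally show "form_rel d b <= fscale.span {s}" by (intro fscale.span_minimal fscale.subspace_span) simp
 qed
 have "normalized_basis (deglex d) (form_rel d b) {s}"
  unfolding normalized_basis_def
 proof (intro conjI ballI allI impI)
  show "{s} <= form_rel d b" unfolding span[symmetric] by (simp add: fscale.span_base)
  have "s [m, n] ~= 0 [m, n]" using m n by (simp add: sv)
  then show "\<not> fscale.dependent {s}" by (metis fscale.dependent_single)
  show "fscale.span {s} = form_rel d b" by (rule span)
  fix \<theta> w assume \<theta>: "\<theta> : {s}" "leading_monomial (deglex d) \<theta> w"
  then have "w = [m, n]" using uniq by blast
  then show "\<theta> w = 1" using \<theta> m n by (simp add: sv)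
  show "\<theta>' w = 0" if "\<theta>' : {s}" "\<theta>' ~= \<theta>" for \<theta>' using that \<theta> by blast
 qed
 moreover have "\<not> critical_monomial (deglex d) {s} w" for w
 proof
  assume "critical_monomial (deglex d) {s} w"
  then obtain i j k where "leading_monomial (deglex d) s [i, j]" "leading_monomial (deglex d) s [j, k]"
   unfolding critical_monomial_def by blast
  from uniq[OF this(1)] uniq[OF this(2)] n(2) iso show False by auto
 qed
 ultimately show ?thesis
  unfolding PBW_algebra_def using A form_rel_relation_space[of d b] admissible_deglex[of d] by blast
qed

text \<open>With the isotropic letter smallest, \<open>x_0 x_n\<close> for the least
  \<open>n\<close> with \<open>b 0 n ~= 0\<close> is the only irreducible word of length 2. Since
  \<open>n ~= 0\<close>, a word of length 3 that begins with it continues with a reducible pair, so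
  every word of length 3 is reducible.\<close>

lemma PBW_H:
 assumes first: "m = 0" and A: "galg_isomorphic A (quadratic_algebra d (orth d (form_rel d b)))"
 shows "PBW_algebra A"
proof -
 define n where "n = Min {j. j < d \<and> b 0 j ~= 0}"
 have fin: "finite {j. j < d \<and> b 0 j ~= 0}" by simp
 have "n : {j. j < d \<and> b 0 j ~= 0}" unfolding n_def using fin l nonzero first by (intro Min_in) auto
 then have n: "n < d" "b 0 n ~= 0" by auto
 have nmin: "n \<le> j" if "j < d" "b 0 j ~= 0" for j unfolding n_def using that by (intro Min_le) auto
 have n0: "n ~= 0" using n iso first by metis
 have d0: "0 < d" using m by simp
 define X where "X = {(i, j). i < d \<and> j < d \<and> (i, j) ~= (0, n)}"
 have finX: "finite X" by (rule finite_subset[of _ "{..<d} \<times> {..<d}"]) (auto simp: X_def)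
 define s where "s i j = monomial [i, j] - fscale (b i j / b 0 n) (monomial [0, n])" for i j
 have sT: "s i j : tensors d 2" if "i < d" "j < d" for i j
  unfolding s_def using that n d0 by (intro tensors_intros monomial_tensors) auto
 have s1: "s i j [i, j] = 1" if "(i, j) : X" for i j using that by (auto simp: s_def X_def monomial_def)
 have s0: "s i j [i', j'] = 0" if "(i, j) : X" "(i', j') : X" "(i', j') ~= (i, j)" for i j i' j'
  using that by (auto simp: s_def X_def monomial_def)
 have lead: "leading_monomial (deglex d) (s i j) [i, j]" if ij: "(i, j) : X" for i j
  unfolding leading_monomial_def
 proof (intro conjI allI impI)
  show "s i j [i, j] ~= 0" using s1[OF ij] by simp
  fix v assume v: "s i j v ~= 0 \<and> v ~= [i, j]"
  then have "v = [0, n]" "b i j ~= 0" by (auto simp: s_def monomial_def split: if_splits)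
  then show "(v, [i, j]) : deglex d"
   using ij n d0 nmin[of j] by (cases "i = 0") (auto simp: deglex_pair X_def)
 qed
 define S where "S = (%(i, j). s i j) ` X"
 have SI: "(i, j) : X ==> s i j : S" for i j by (force simp: S_def)
 have SE: "\<exists>i j. (i, j) : X \<and> \<theta> = s i j" if "\<theta> : S" for \<theta> using that by (auto simp: S_def)
 have others: "\<theta> [i, j] = 0" if "\<theta> : S" "\<theta> ~= s i j" "(i, j) : X" for \<theta> i j
  using SE[OF that(1)] s0 that(2,3) by (metis prod.inject)
 have S_orth: "S <= orth d (form_rel d b)"
 proof
  fix \<theta> assume "\<theta> : S"
  then obtain i j where "(i, j) : X" and \<theta>: "\<theta> = s i j" using SE by blast
  then have ij: "i < d" "j < d" by (auto simp: X_def)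
  have "form_eval d b (s i j) = 0"
   unfolding s_def using ij n d0 by (simp only: form_eval_diff form_eval_scale form_eval_monomial) simp
  then show "\<theta> : orth d (form_rel d b)" unfolding orth_iff \<theta> using sT[OF ij] by blast
 qed
 have subspace_orth: "fscale.subspace (orth d (form_rel d b))"
  using orth_relation_space unfolding relation_space_def by blast
 have "normalized_basis (deglex d) (orth d (form_rel d b)) S"
  unfolding normalized_basis_def
 proof (intro conjI ballI allI impI S_orth)
  show "\<not> fscale.dependent S"
  proof
   assume "fscale.dependent S"
   then obtain \<theta> where "\<theta> : S" and dep: "\<theta> : fscale.span (S - {\<theta>})" unfolding fscale.dependent_def by blast
   then obtain i j where ij: "(i, j) : X" and \<theta>: "\<theta> = s i j" using SE by blast
   have "fscale.span (S - {\<theta>}) <= {f. f [i, j] = 0}"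
    by (rule fscale.span_minimal) (auto simp: \<theta> others ij intro!: fscale.subspaceI)
   then show False using dep s1[OF ij] \<theta> by auto
  qed
  show "fscale.span S = orth d (form_rel d b)"
  proof (intro subset_antisym subsetI)
   show "\<theta> : orth d (form_rel d b)" if "\<theta> : fscale.span S" for \<theta>
    using fscale.span_minimal[OF S_orth subspace_orth] that by blast
   fix \<eta> assume \<eta>: "\<eta> : orth d (form_rel d b)"
   \<comment> \<open>Subtracting this combination clears every coefficient except the one at
     \<open>x_0 x_n\<close>, and the vanishing of the form forces that one to be 0.\<close>
   define \<zeta> where "\<zeta> = (\<Sum>q\<in>X. fscale (\<eta> [fst q, snd q]) (s (fst q) (snd q)))"
   have \<zeta>S: "\<zeta> : fscale.span S"
    unfolding \<zeta>_def by (intro fscale.span_sum fscale.span_scale fscale.span_base SI) simp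
   then have \<zeta>: "\<zeta> : orth d (form_rel d b)" using fscale.span_minimal[OF S_orth subspace_orth] by blast
   define \<theta> where "\<theta> = \<eta> - \<zeta>"
   have \<theta>: "\<theta> : tensors d 2" "form_eval d b \<theta> = 0"
    using fscale.subspace_diff[OF subspace_orth \<eta> \<zeta>] unfolding \<theta>_def orth_iff by blast+
   have z: "\<theta> [i, j] = 0" if ij: "(i, j) : X" for i j
   proof -
    have "\<zeta> [i, j] = (\<Sum>p\<in>X. if p = (i, j) then \<eta> [i, j] else 0)"
     unfolding \<zeta>_def sum_apply
    proof (intro sum.cong refl)
     fix q assume q: "q : X"
     show "fscale (\<eta> [fst q, snd q]) (s (fst q) (snd q)) [i, j] = (if q = (i, j) then \<eta> [i, j] else 0)"
     proof (cases "q = (i, j)")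
      case True
      then show ?thesis using s1[OF ij] by simp
     next
      case False
      then have "(i, j) ~= (fst q, snd q)" by auto
      then show ?thesis using s0[of "fst q" "snd q" i j] q ij False by simp
     qed
    qed
    also have "... = \<eta> [i, j]" using ij finX by simp
    finally show ?thesis by (simp add: \<theta>_def)
   qed
   have "form_eval d b \<theta> = (\<Sum>i<d. \<Sum>j<d. if j = n then (if i = 0 then \<theta> [0, n] * b 0 n else 0) else 0)"
    unfolding form_eval_def using z by (intro sum.cong refl) (auto simp: X_def)
   also have "... = \<theta> [0, n] * b 0 n" using n d0 by simp
   finally have "\<theta> [0, n] = 0" using \<theta>(2) n by simp
   have "\<theta> = 0"
   proof (rule tensor_2_eqI[OF \<theta>(1) tensors_intros(5)])
    show "\<theta> [i, j] = 0 [i, j]" if "i < d" "j < d" for i j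
     using z[of i j] \<open>\<theta> [0, n] = 0\<close> that by (cases "(i, j) = (0, n)") (simp_all add: X_def)
   qed
   then have "\<eta> = \<zeta>" by (simp add: \<theta>_def)
   with \<zeta>S show "\<eta> : fscale.span S" by (simp only:)
  qed
  fix \<theta> w assume "\<theta> : S" and lw: "leading_monomial (deglex d) \<theta> w"
  then obtain i j where ij: "(i, j) : X" and \<theta>: "\<theta> = s i j" using SE by blast
  have w: "w = [i, j]" using leading_unique[OF admissible_deglex lw] lead[OF ij] \<theta> by blast
  show "\<theta> w = 1" unfolding w \<theta> by (rule s1[OF ij])
  show "\<theta>' w = 0" if "\<theta>' : S" "\<theta>' ~= \<theta>" for \<theta>'
   unfolding w by (rule others[OF that(1) _ ij]) (use that \<theta> in blast)
 qed
 then show ?thesis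
 proof (rule PBW_reducible[OF orth_relation_space A])
  fix w :: "nat list" assume "length w = 3" "set w <= {..<d}"
  then obtain i j k where w: "w = [i, j, k]" "i < d" "j < d" "k < d"
   by (auto simp: numeral_3_eq_3 length_Suc_conv)
  show "\<exists>\<omega>\<in>S. \<exists>u x v. leading_monomial (deglex d) \<omega> x \<and> w = u @ x @ v"
  proof (cases "(i, j) : X")
   case True
   have "w = [] @ [i, j] @ [k]" by (simp add: w)
   then show ?thesis using lead[OF True] SI[OF True] by blast
  next
   case False
   then have "j = n" using w by (auto simp: X_def)
   then have jk: "(j, k) : X" using w n0 by (auto simp: X_def)
   have "w = [i] @ [j, k] @ []" by (simp add: w)
   then show ?thesis using lead[OF jk] SI[OF jk] by blast
  qed
 qed
qed

end

section \<open>Pro-p groups and uniformly locally constant cochains\<close>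

locale pro_p =
 fixes p :: nat and G :: "('g, 'm) monoid_scheme" (structure) and T :: "'g topology"
 assumes p: "prime p" and pro: "pro_p_group p G T"
begin

sublocale group G
 using pro by (simp add: pro_p_group_def profinite_group_def topological_group_def)

abbreviation "UU \<equiv> open_normal G T"

abbreviation over where "over zs \<equiv> set zs <= carrier G"
abbreviation "CG \<equiv> carrier G"
abbreviation "Ch \<equiv> cochains G T"
abbreviation "Cy \<equiv> cocycles G T"
abbreviation "Cb \<equiv> coboundaries G T"

lemma topspace_T: "topspace T = CG"
 and compact_T: "compact_space T"
 and mult_continuous: "continuous_map (prod_topology T T) T (%(x, y). x \<otimes> y)"
 using pro by (simp_all add: pro_p_group_def profinite_group_def topological_group_def)

lemma UU_normal: "U : UU ==> U \<lhd> G"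
 and UU_open: "U : UU ==> openin T U"
 by (simp_all add: open_normal_def)

lemma UU_subgroup: "U : UU ==> subgroup U G"
 by (rule normal_imp_subgroup[OF UU_normal])

lemma UU_subset: "U : UU ==> u : U ==> u : CG"
 by (rule subgroup.mem_carrier[OF UU_subgroup])

lemma UU_conj: "U : UU ==> x : CG ==> u : U ==> x \<otimes> u \<otimes> inv x : U"
 by (rule normal.inv_op_closed2[OF UU_normal])

lemma UU_I:
 assumes "subgroup U G" "\<And>x u. x : CG ==> u : U ==> x \<otimes> u \<otimes> inv x : U" "openin T U"
 shows "U : UU"
 using assms by (simp add: open_normal_def normal_inv_iff)

lemma UU_carrier: "CG : UU"
 using openin_topspace[of T] by (intro UU_I) (simp_all add: topspace_T subgroup_self)

lemma UU_Int: "U : UU ==> V : UU ==> U \<inter> V : UU"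
 by (rule UU_I) (simp_all add: subgroups_Inter_pair openin_Int UU_subgroup UU_open UU_conj)

lemma UU_finite_Int:
 "finite I ==> (\<And>i. i : I ==> N i : UU) ==> \<exists>U\<in>UU. \<forall>i\<in>I. U <= N i"
proof (induction I rule: finite_induct)
 case empty
 show ?case using UU_carrier by blast
next
 case (insert i I)
 then obtain U where "U : UU" "\<forall>i\<in>I. U <= N i" by blast
 then show ?case using insert UU_Int[of U "N i"] by (intro bexI[of _ "U \<inter> N i"]) auto
qed

lemma card_rcosets: "U : UU ==> \<exists>k. card (rcosets U) = p ^ k"
 using pro by (simp add: pro_p_group_def)

lemma finite_rcosets: "U : UU ==> finite (rcosets U)"
proof -
 assume "U : UU"
 then obtain k where "card (rcosets U) = p ^ k" using card_rcosets by blast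
 moreover have "0 < p ^ k" using p by (simp add: prime_gt_0_nat)
 ultimately show ?thesis using card_ge_0_finite by metis
qed

text \<open>Lying in the same coset of \<open>U\<close>. Lifted to lists by \<open>list_all2\<close>
  it measures uniform local constancy, and normality of \<open>U\<close> makes it compatible with
  multiplication.\<close>

definition E :: "'g set => 'g => 'g => bool" where
 "E U x y \<longleftrightarrow> x : CG \<and> (\<exists>u\<in>U. y = x \<otimes> u)"

lemma E_carrier: "U : UU ==> E U x y ==> x : CG \<and> y : CG"
 using UU_subset by (auto simp: E_def)

lemma E_refl: "U : UU ==> x : CG ==> E U x x"
 using UU_subgroup subgroup.one_closed by (force simp: E_def)

lemma E_sym: "U : UU ==> E U x y ==> E U y x"
proof -
 assume U: "U : UU" and "E U x y"
 then obtain u where u: "x : CG" "u : U" "y = x \<otimes> u" by (auto simp: E_def)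
 then have "x = y \<otimes> inv u" using U UU_subset by (simp add: m_assoc)
 moreover have "inv u : U" by (rule subgroup.m_inv_closed[OF UU_subgroup[OF U] u(2)])
 ultimately show ?thesis using u U UU_subset by (auto simp: E_def)
qed

lemma E_mult: "U : UU ==> E U x y ==> E U x' y' ==> E U (x \<otimes> x') (y \<otimes> y')"
proof -
 assume U: "U : UU" and "E U x y" "E U x' y'"
 then obtain u u' where *: "x : CG" "u : U" "y = x \<otimes> u" "x' : CG" "u' : U" "y' = x' \<otimes> u'"
  by (auto simp: E_def)
 have c: "u : CG" "u' : CG" using * U UU_subset by blast+
 have "inv x' \<otimes> u \<otimes> inv (inv x') : U" using * U by (intro UU_conj) simp_all
 then have w: "(inv x' \<otimes> u \<otimes> x') \<otimes> u' : U"
  using * subgroup.m_closed[OF UU_subgroup[OF U]] by simp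
 have "y \<otimes> y' = (x \<otimes> x') \<otimes> ((inv x' \<otimes> u \<otimes> x') \<otimes> u')"
  using * c by (simp add: m_assoc inv_solve_left')  (simp add: m_assoc[symmetric])
 with w * show ?thesis by (auto simp: E_def)
qed

lemma E_mono: "U <= V ==> E U x y ==> E V x y"
 by (auto simp: E_def)

lemma E_left: "U : UU ==> x : CG ==> u : U ==> E U x (u \<otimes> x)"
proof -
 assume U: "U : UU" and *: "x : CG" "u : U"
 have "inv x \<otimes> u \<otimes> inv (inv x) : U" using * U by (intro UU_conj) simp_all
 moreover have "u \<otimes> x = x \<otimes> (inv x \<otimes> u \<otimes> inv (inv x))"
  using * UU_subset[OF U *(2)] by (simp add: m_assoc[symmetric])
 ultimately show ?thesis using * by (auto simp: E_def)
qed

lemma E_rcoset: "U : UU ==> x : CG ==> y : CG ==> E U x y \<longleftrightarrow> U #> x = U #> y"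
proof -
 assume U: "U : UU" and x: "x : CG" and y: "y : CG"
 have c: "U #> x = x <# U" using UU_normal[OF U] x normal.coset_eq by fastforce
 have "E U x y \<longleftrightarrow> y : x <# U" using x by (auto simp: E_def l_coset_def)
 also have "... \<longleftrightarrow> y : U #> x" by (simp only: c)
 also have "... \<longleftrightarrow> U #> x = U #> y"
  using repr_independence[OF _ x UU_subgroup[OF U]] rcos_self[OF y UU_subgroup[OF U]] by auto
 finally show ?thesis .
qed

definition cochain_inv :: "'g set => ('g list => 'k) => bool" where
 "cochain_inv U f \<longleftrightarrow> (\<forall>xs ys. list_all2 (E U) xs ys --> f xs = f ys)"

lemma cochain_inv_mono: "U <= V ==> cochain_inv V f ==> cochain_inv U f"
 unfolding cochain_inv_def using E_mono list_all2_mono by metis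

lemma mult_cont:
 "continuous_map Z T f ==> continuous_map Z T g ==> continuous_map Z T (%z. f z \<otimes> g z)"
 using continuous_map_compose[of Z "prod_topology T T" "%z. (f z, g z)" T "%(x, y). x \<otimes> y"] mult_continuous
 by (simp add: continuous_map_pairwise o_def)

text \<open>Allowing an arbitrary \<open>y\<close> to the right of \<open>g\<close> makes the set
  closed under products and conjugation, hence a normal subgroup. Its complement is the projection
  of a closed set along the compact space of pairs \<open>(x, y)\<close>, so the set is open.
  Continuity is thus turned into invariance under an open normal subgroup.\<close>

lemma coordinate_stabilizer:
 fixes F :: "(nat => 'g) => 'k"
 defines "X n \<equiv> product_topology (%_. T) {..<n::nat}"
 assumes F: "continuous_map (X n) (discrete_topology UNIV) F" and i: "i < n"
 shows "{g : CG. \<forall>x\<in>topspace (X n). \<forall>y\<in>CG. F (x(i := x i \<otimes> g \<otimes> y)) = F (x(i := x i \<otimes> y))} : UU"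
  (is "?N : UU")
proof (rule UU_I)
 have tX: "topspace (X n) = PiE {..<n} (%_. CG)" by (simp add: X_def topspace_T)
 have xi: "x i : CG" if "x : topspace (X n)" for x using that i by (auto simp: tX)
 have upd: "x(i := y) : topspace (X n)" if "x : topspace (X n)" "y : CG" for x y
  using that i by (auto simp: tX PiE_iff extensional_def)
 have use: "F (x(i := x i \<otimes> g \<otimes> y)) = F (x(i := x i \<otimes> y))"
  if "g : ?N" "x : topspace (X n)" "y : CG" for g x y using that by blast
 show "subgroup ?N G"
 proof (rule subgroupI)
  show "?N <= CG" by blast
  show "?N ~= {}" using xi by (auto intro!: exI[of _ \<one>])
  fix g assume g: "g : ?N"
  then have gc: "g : CG" by blast
  show "inv g : ?N"
  proof (intro CollectI conjI ballI)
   show "inv g : CG" using gc by simp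
   fix x y assume x: "x : topspace (X n)" and y: "y : CG"
   have "x i \<otimes> inv g : CG" using xi[OF x] gc by simp
   from use[OF g upd[OF x this] y] show "F (x(i := x i \<otimes> inv g \<otimes> y)) = F (x(i := x i \<otimes> y))"
    using xi[OF x] gc y by (simp add: m_assoc)
  qed
  fix h assume h: "h : ?N"
  then have hc: "h : CG" by blast
  show "g \<otimes> h : ?N"
  proof (intro CollectI conjI ballI)
   show "g \<otimes> h : CG" using gc hc by simp
   fix x y assume x: "x : topspace (X n)" and y: "y : CG"
   have "F (x(i := x i \<otimes> (g \<otimes> h) \<otimes> y)) = F (x(i := x i \<otimes> g \<otimes> (h \<otimes> y)))"
    using xi[OF x] gc hc y by (simp add: m_assoc)
   also have "... = F (x(i := x i \<otimes> (h \<otimes> y)))" using hc y by (intro use[OF g x]) simp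
   also have "... = F (x(i := x i \<otimes> h \<otimes> y))" using xi[OF x] hc y by (simp add: m_assoc)
   also have "... = F (x(i := x i \<otimes> y))" by (rule use[OF h x y])
   finally show "F (x(i := x i \<otimes> (g \<otimes> h) \<otimes> y)) = F (x(i := x i \<otimes> y))" .
  qed
 qed
 fix a g assume a: "a : CG" and g: "g : ?N"
 then have gc: "g : CG" by blast
 show "a \<otimes> g \<otimes> inv a : ?N"
 proof (intro CollectI conjI ballI)
  show "a \<otimes> g \<otimes> inv a : CG" using a gc by simp
  fix x y assume x: "x : topspace (X n)" and y: "y : CG"
  have "x i \<otimes> a : CG" "inv a \<otimes> y : CG" using xi[OF x] a y by simp_all
  from use[OF g upd[OF x this(1)] this(2)]
  have "F (x(i := x i \<otimes> a \<otimes> g \<otimes> (inv a \<otimes> y))) = F (x(i := x i \<otimes> a \<otimes> (inv a \<otimes> y)))" by simp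
  moreover have "x i \<otimes> a \<otimes> (inv a \<otimes> y) = x i \<otimes> y"
   using xi[OF x] a y by (simp add: m_assoc[symmetric]) (simp add: m_assoc)
  moreover have "x i \<otimes> (a \<otimes> g \<otimes> inv a) \<otimes> y = x i \<otimes> a \<otimes> g \<otimes> (inv a \<otimes> y)"
   using xi[OF x] a gc y by (simp add: m_assoc)
  ultimately show "F (x(i := x i \<otimes> (a \<otimes> g \<otimes> inv a) \<otimes> y)) = F (x(i := x i \<otimes> y))" by simp
 qed
next
 have tX: "topspace (X n) = PiE {..<n} (%_. CG)" by (simp add: X_def topspace_T)
 define Y where "Y = prod_topology (X n) T"
 define Z where "Z = prod_topology Y T"
 have px: "continuous_map Z T (%z. fst (fst z) k)" if "k < n" for k
 proof -
  have "continuous_map Z Y fst" "continuous_map Y (X n) fst" unfolding Z_def Y_def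
   by (simp_all add: continuous_map_fst)
  moreover have "continuous_map (X n) T (%x. x k)"
   using continuous_map_product_projection[of k "{..<n}" "%_. T"] that by (simp add: X_def)
  ultimately show ?thesis
   using continuous_map_compose[of Z Y fst "X n" fst] continuous_map_compose[of Z "X n" "fst \<circ> fst" T "%x. x k"]
   by (simp add: o_def)
 qed
 have py: "continuous_map Z T (%z. snd (fst z))"
 proof -
  have "continuous_map Z Y fst" "continuous_map Y T snd" unfolding Z_def Y_def
   by (simp_all add: continuous_map_fst continuous_map_snd)
  then show ?thesis using continuous_map_compose[of Z Y fst T snd] by (simp add: o_def)
 qed
 have pg: "continuous_map Z T snd" unfolding Z_def by (rule continuous_map_snd)
 have upd: "continuous_map Z (X n) (%z. (fst (fst z))(i := f z))" if f: "continuous_map Z T f" for f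
  unfolding X_def continuous_map_componentwise
 proof (intro conjI ballI)
  show "(%z. (fst (fst z))(i := f z)) ` topspace Z <= extensional {..<n}"
   using i by (auto simp: Z_def Y_def tX PiE_iff extensional_def)
  show "continuous_map Z T (%z. ((fst (fst z))(i := f z)) k)" if "k : {..<n}" for k
   using px[of k] f that by (cases "k = i") simp_all
 qed
 have cF: "continuous_map Z (discrete_topology UNIV) (%z. F ((fst (fst z))(i := f z)))"
  if f: "continuous_map Z T f" for f
  using continuous_map_compose[OF upd[OF f] F] by (simp add: o_def)
 \<comment> \<open>The triples where inserting \<open>g\<close> changes the value: a preimage under
   a continuous map into a discrete space, hence closed.\<close>
 define D where "D = {z : topspace Z. (F ((fst (fst z))(i := fst (fst z) i \<otimes> snd z \<otimes> snd (fst z))),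
   F ((fst (fst z))(i := fst (fst z) i \<otimes> snd (fst z)))) : {(a, b). a ~= b}}"
 have "continuous_map Z (prod_topology (discrete_topology UNIV) (discrete_topology UNIV))
   (%z. (F ((fst (fst z))(i := fst (fst z) i \<otimes> snd z \<otimes> snd (fst z))),
   F ((fst (fst z))(i := fst (fst z) i \<otimes> snd (fst z)))))"
  using i by (simp add: continuous_map_pairwise o_def cF mult_cont px py pg)
 moreover have "prod_topology (discrete_topology UNIV) (discrete_topology UNIV) =
   (discrete_topology UNIV :: ('k \<times> 'k) topology)"
  by (metis UNIV_Times_UNIV prod_topology_discrete_topology)
 ultimately have cm: "continuous_map Z (discrete_topology UNIV)
   (%z. (F ((fst (fst z))(i := fst (fst z) i \<otimes> snd z \<otimes> snd (fst z))),
   F ((fst (fst z))(i := fst (fst z) i \<otimes> snd (fst z)))))" by (simp only:)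
 have "closedin Z D"
  unfolding D_def
  by (rule closedin_continuous_map_preimage[OF cm]) (simp only: closedin_discrete_topology subset_UNIV)
 moreover
 have "compact_space Y"
  unfolding Y_def X_def by (simp add: compact_space_prod_topology compact_space_product_topology compact_T)
 then have "closed_map Z T snd" unfolding Z_def by (rule closed_map_snd)
 ultimately have "closedin T (snd ` D)" unfolding closed_map_def by blast
 then have "openin T (topspace T - snd ` D)" by (rule openin_diff[OF openin_topspace])
 moreover have "topspace T - snd ` D = ?N"
 proof (intro subset_antisym subsetI)
  fix g assume g: "g : topspace T - snd ` D"
  then have gc: "g : CG" by (simp add: topspace_T)
  have "F (x(i := x i \<otimes> g \<otimes> y)) = F (x(i := x i \<otimes> y))" if "x : topspace (X n)" "y : CG" for x y
  proof (rule ccontr)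
   assume "F (x(i := x i \<otimes> g \<otimes> y)) ~= F (x(i := x i \<otimes> y))"
   then have "((x, y), g) : D" using that gc by (simp add: D_def Z_def Y_def topspace_T)
   then have "g : snd ` D" by (metis imageI snd_conv)
   with g show False by blast
  qed
  with gc show "g : ?N" by blast
 next
  fix g assume g: "g : ?N"
  have "g \<notin> snd ` D"
  proof
   assume "g : snd ` D"
   then obtain x y where "((x, y), g) : D" by auto
   then have *: "x : topspace (X n)" "y : CG" "F (x(i := x i \<otimes> g \<otimes> y)) ~= F (x(i := x i \<otimes> y))"
    by (simp_all add: D_def Z_def Y_def topspace_T)
   from g have "\<forall>x\<in>topspace (X n). \<forall>y\<in>CG. F (x(i := x i \<otimes> g \<otimes> y)) = F (x(i := x i \<otimes> y))" by simp
   from bspec[OF bspec[OF this *(1)] *(2)] *(3) show False by contradiction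
  qed
  with g show "g : topspace T - snd ` D" by (simp add: topspace_T)
 qed
 ultimately show "openin T ?N" by simp
qed

text \<open>A subgroup inside the stabilizers of all \<open>n\<close> coordinates works: two lists
  with the same cosets are connected by changing one entry at a time.\<close>

lemma cochains_inv:
 fixes f :: "'g list => 'k::field"
 assumes f: "f : Ch n"
 shows "\<exists>U\<in>UU. cochain_inv U f"
proof -
 define F where "F x = f (map x [0..<n])" for x
 have sup: "\<And>xs. f xs ~= 0 ==> length xs = n \<and> over xs"
  and "continuous_map (product_topology (%_. T) {..<n}) (discrete_topology UNIV) F"
  using f by (simp_all add: cochains_def F_def[abs_def])
 note stab = coordinate_stabilizer[OF this(2)]
 define N where "N i = {g : CG. \<forall>x\<in>topspace (product_topology (%_. T) {..<n}). \<forall>y\<in>CG.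
   F (x(i := x i \<otimes> g \<otimes> y)) = F (x(i := x i \<otimes> y))}" for i
 have "\<exists>U\<in>UU. \<forall>i\<in>{..<n}. U <= N i" unfolding N_def using stab by (intro UU_finite_Int) simp_all
 then obtain U where U: "U : UU" "\<And>i. i < n ==> U <= N i" by blast
 have one: "f (xs[i := xs ! i \<otimes> u]) = f xs" if xs: "length xs = n" "over xs" and i: "i < n" and u: "u : U" for xs i u
 proof -
  define x where "x = (\<lambda>j\<in>{..<n}. xs ! j)"
  have xt: "x : topspace (product_topology (%_. T) {..<n})"
   using xs by (auto simp: x_def topspace_T)
  have uc: "u : CG" and xic: "xs ! i : CG" using u U UU_subset xs i by auto
  have "F (x(i := x i \<otimes> u \<otimes> \<one>)) = F (x(i := x i \<otimes> \<one>))" using U(2)[OF i] u xt by (auto simp: N_def)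
  moreover have "map (x(i := x i \<otimes> u \<otimes> \<one>)) [0..<n] = xs[i := xs ! i \<otimes> u]"
   using xs i uc xic by (intro nth_equalityI) (auto simp: x_def nth_list_update)
  moreover have "map (x(i := x i \<otimes> \<one>)) [0..<n] = xs"
   using xs i xic by (intro nth_equalityI) (auto simp: x_def)
  ultimately show ?thesis by (simp add: F_def)
 qed
 have "f xs = f ys" if r: "list_all2 (E U) xs ys" for xs ys
 proof (cases "length xs = n")
  case False
  then have "length ys ~= n" using r list_all2_lengthD by metis
  with False sup show ?thesis by metis
 next
  case True
  then have len: "length xs = n" "length ys = n" using list_all2_lengthD[OF r] by simp_all
  have e: "E U (xs ! i) (ys ! i)" if "i < n" for i using r that len by (simp add: list_all2_conv_all_nth)
  \<comment> \<open>Hybrid lists, whose first \<open>k\<close> entries already come from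
    \<open>ys\<close>.\<close>
  have "f (take k ys @ drop k xs) = f xs" if "k \<le> n" for k
   using that
  proof (induction k)
   case (Suc k)
   define zs where "zs = take k ys @ drop k xs"
   have zl: "length zs = n" using Suc len by (simp add: zs_def)
   have zn: "zs ! j = (if j < k then ys ! j else xs ! j)" if "j < n" for j
    using Suc len that by (simp add: zs_def nth_append)
   have "xs ! j : CG \<and> ys ! j : CG" if "j < n" for j by (rule E_carrier[OF U(1) e[OF that]])
   then have "over zs" using zl zn by (auto simp: set_conv_nth)
   obtain u where u: "u : U" "ys ! k = xs ! k \<otimes> u" using e[of k] Suc by (auto simp: E_def)
   have "take (Suc k) ys @ drop (Suc k) xs = zs[k := zs ! k \<otimes> u]"
    using Suc len zl zn u by (intro nth_equalityI) (auto simp: nth_append nth_list_update less_Suc_eq)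
   then show ?case
    using one[OF zl \<open>over zs\<close> _ u(1), of k] Suc by (simp add: zs_def)
  qed simp
  from this[of n] show ?thesis using len by simp
 qed
 with U(1) show ?thesis unfolding cochain_inv_def by blast
qed

lemma coset_open: "U : UU ==> x : CG ==> openin T {y : CG. inv x \<otimes> y : U}"
proof -
 assume U: "U : UU" and x: "x : CG"
 have "continuous_map T T (%y. inv x \<otimes> y)"
  using x by (intro mult_cont) (simp_all add: topspace_T)
 from openin_continuous_map_preimage[OF this UU_open[OF U]] show ?thesis by (simp add: topspace_T)
qed

text \<open>Products of cosets of \<open>U\<close> are open, so a function constant on them is
  continuous into the discrete field.\<close>

lemma cochainsI:
 fixes f :: "'g list => 'k::field"
 assumes sup: "\<And>xs. f xs ~= 0 ==> length xs = n \<and> over xs"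
  and U: "U : UU" "cochain_inv U f"
 shows "f : Ch n"
proof -
 let ?X = "product_topology (%_. T) {..<n}"
 have "openin ?X {x : topspace ?X. f (map x [0..<n]) : S}" for S
 proof (subst openin_subopen, intro ballI)
  fix x assume "x : {x : topspace ?X. f (map x [0..<n]) : S}"
  then have x: "x : PiE {..<n} (%_. CG)" and fx: "f (map x [0..<n]) : S" by (simp_all add: topspace_T)
  have xi: "x i : CG" if "i < n" for i using x that by auto
  define W where "W = PiE {..<n} (%i. {y : CG. inv (x i) \<otimes> y : U})"
  have "openin ?X W" unfolding W_def by (simp add: openin_PiE coset_open[OF U(1)] xi)
  moreover have "x : W"
   using x xi UU_subgroup[OF U(1)] by (auto simp: W_def PiE_iff subgroup.one_closed)
  moreover have fz: "f (map z [0..<n]) = f (map x [0..<n])" if z: "z : W" for z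
  proof -
   have "E U (x i) (z i)" if "i < n" for i
   proof -
    have zi: "z i : CG" "inv (x i) \<otimes> z i : U" using z that by (auto simp: W_def)
    then have "z i = x i \<otimes> (inv (x i) \<otimes> z i)" using xi[OF that] by (simp add: m_assoc[symmetric])
    then show ?thesis using zi xi[OF that] by (auto simp: E_def)
   qed
   then have "list_all2 (E U) (map x [0..<n]) (map z [0..<n])" by (simp add: list_all2_conv_all_nth)
   then show ?thesis using U(2) unfolding cochain_inv_def by metis
  qed
  moreover have "W <= topspace ?X" by (auto simp: W_def topspace_T PiE_iff)
  then have "W <= {x : topspace ?X. f (map x [0..<n]) : S}" using fz fx by (simp add: subset_iff)
  ultimately show "\<exists>W. openin ?X W \<and> x : W \<and> W <= {x : topspace ?X. f (map x [0..<n]) : S}"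
   by (intro exI[of _ W] conjI)
 qed
 then have "continuous_map ?X (discrete_topology UNIV) (%x. f (map x [0..<n]))"
  by (simp add: continuous_map_def)
 then show ?thesis using sup by (auto simp: cochains_def)
qed

lemma cochains_support: "f : Ch n ==> f xs ~= 0 ==> length xs = n \<and> over xs"
 by (simp add: cochains_def)

lemma cochains_inv2:
 assumes "f : Ch m" "g : Ch n"
 obtains U where "U : UU" "cochain_inv U f" "cochain_inv U g"
proof -
 obtain U V where "U : UU" "cochain_inv U f" "V : UU" "cochain_inv V g"
  using cochains_inv assms by metis
 then show ?thesis
  using that[OF UU_Int[of U V]] cochain_inv_mono[of "U \<inter> V" U f] cochain_inv_mono[of "U \<inter> V" V g] by simp
qed

end

section \<open>Coboundaries\<close>

context pro_p begin

text \<open>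
 The coboundary of cochains with values in an abelian group with a right action \<open>A\<close>, by recursion on
 the first arguments; for the trivial action it is \<open>coboundary G\<close> on lists over the carrier.
\<close>

fun tcob :: "('g => 'v => 'v) => ('g list => 'v) => 'g list => 'v::ab_group_add" where
 "tcob A Y [] = 0"
| "tcob A Y [x] = Y [] - A x (Y [])"
| "tcob A Y (x # y # zs) = Y (y # zs) - Y ((x \<otimes> y) # zs) + Y (x # zs) - tcob A (%us. Y (x # us)) (y # zs)"

abbreviation "tr \<equiv> tcob (%_ v. v)"

lemma tcob_cong:
 "(\<And>us. Suc (length us) = length zs ==> Y us = Y' us) ==> tcob A Y zs = tcob A Y' zs"
proof (induction A Y zs arbitrary: Y' rule: tcob.induct)
 case (3 A Y x y zs)
 have "tcob A (%us. Y (x # us)) (y # zs) = tcob A (%us. Y' (x # us)) (y # zs)"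
  by (rule 3(1)) (use 3(2) in simp)
 then show ?case using 3(2) by simp
qed simp_all

text \<open>The hypotheses are confined to \<open>V\<close> because the coefficient maps used later
  are linear only on locally constant functions.\<close>

lemma tcob_map:
 assumes V: "0 : V" "\<And>u v. u : V ==> v : V ==> u - v : V" "\<And>u v. u : V ==> v : V ==> u + v : V"
   "\<And>x v. x : CG ==> v : V ==> A x v : V"
  and \<theta>: "\<theta> 0 = 0" "\<And>u v. u : V ==> v : V ==> \<theta> (u - v) = \<theta> u - \<theta> v"
   "\<And>u v. u : V ==> v : V ==> \<theta> (u + v) = \<theta> u + \<theta> v"
   "\<And>x v. x : CG ==> v : V ==> \<theta> (A x v) = A' x (\<theta> v)"
  and "over zs" "\<And>us. Y us : V"
 shows "tcob A Y zs : V \<and> tcob A' (%us. \<theta> (Y us)) zs = \<theta> (tcob A Y zs)"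
 using assms(9,10)
proof (induction zs arbitrary: Y rule: induct_list012)
 case (3 x y zs)
 have *: "tcob A (%us. Y (x # us)) (y # zs) : V"
  "tcob A' (%us. \<theta> (Y (x # us))) (y # zs) = \<theta> (tcob A (%us. Y (x # us)) (y # zs))"
  using 3(2)[of "%us. Y (x # us)"] 3(3,4) by simp_all
 have "Y (y # zs) - Y ((x \<otimes> y) # zs) + Y (x # zs) : V" "Y (y # zs) - Y ((x \<otimes> y) # zs) : V"
  using V 3(4) by simp_all
 then show ?case using * V(2) \<theta>(2,3) 3(4) by simp
qed (use V \<theta> in simp_all)

lemma tcob_diff:
 assumes "\<And>x u v. A x (u - v) = A x u - A x v"
 shows "tcob A (%us. Y us - Y' us) zs = tcob A Y zs - tcob A Y' zs"
 by (induction zs arbitrary: Y Y' rule: induct_list012) (simp_all add: assms algebra_simps)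

lemma tcob_zero:
 assumes "\<And>x. A x 0 = 0"
 shows "tcob A (%_. 0) zs = 0"
 by (induction zs rule: induct_list012) (simp_all add: assms)

lemma tcob_length:
 assumes "\<And>x. A x 0 = 0" "\<And>us. Y us ~= 0 ==> length us = n" "length zs ~= Suc n"
 shows "tcob A Y zs = 0"
proof -
 have "tcob A Y zs = tcob A (%_. 0) zs" by (rule tcob_cong) (use assms in metis)
 then show ?thesis using tcob_zero[of A] assms(1) by simp
qed

text \<open>Expanded at the first argument, the inner coboundary splits into three cochains in the
  remaining arguments and a coboundary with that argument fixed. The induction hypothesis disposes
  of the latter and the rest cancels.\<close>

lemma tcob_tcob:
 assumes diff: "\<And>x u v. A x (u - v) = A x u - A x v"
  and act: "\<And>x y v. x : CG ==> y : CG ==> A y (A x v) = A (x \<otimes> y) v"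
  and "over zs"
 shows "tcob A (tcob A Y) zs = 0"
 using assms(3)
proof (induction "length zs" arbitrary: zs Y rule: less_induct)
 case less
 have A0: "A x 0 = 0" for x using diff[of x 0 0] by simp
 have add: "tcob A (%us. Y us + Y' us) zs = tcob A Y zs + tcob A Y' zs" for Y Y' zs
  using tcob_diff[of A "%us. Y us + Y' us" Y' zs] diff by (simp add: algebra_simps)
 consider "zs = []" | x where "zs = [x]" | x y where "zs = [x, y]" | x y z us where "zs = x # y # z # us"
  by (metis list.exhaust)
 then show ?case
 proof cases
  case (3 x y)
  then have "x : CG" "y : CG" using less(2) by simp_all
  then show ?thesis using 3 act by (simp add: diff)
 next
  case (4 x y z us)
  then have c: "x : CG" "y : CG" "z : CG" using less(2) by simp_all
  define Yx where "Yx = (%us. Y (x # us))"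
  \<comment> \<open>With \<open>hd\<close> and \<open>tl\<close> the term with merged first
    arguments becomes a cochain in the remaining list.\<close>
  define Ys where "Ys = (%us. Y ((x \<otimes> hd us) # tl us))"
  have "tcob A (%us. tcob A Y (x # us)) (y # z # us) =
    tcob A (%us. Y us - Ys us + Yx (tl us) - tcob A Yx us) (y # z # us)"
  proof (rule tcob_cong)
   fix vs :: "'g list" assume "Suc (length vs) = length (y # z # us)"
   then obtain v vs' where "vs = v # vs'" by (cases vs) auto
   then show "tcob A Y (x # vs) = Y vs - Ys vs + Yx (tl vs) - tcob A Yx vs" by (simp add: Yx_def Ys_def)
  qed
  also have "... = tcob A Y (y # z # us) - tcob A Ys (y # z # us) + tcob A (%us. Yx (tl us)) (y # z # us)
    - tcob A (tcob A Yx) (y # z # us)"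
   by (simp only: tcob_diff[of A, OF diff] add)
  also have "tcob A (tcob A Yx) (y # z # us) = 0"
   using 4 less(2) by (intro less(1)) simp_all
  finally have e: "tcob A (%us. tcob A Y (x # us)) (y # z # us) =
    tcob A Y (y # z # us) - tcob A Ys (y # z # us) + tcob A (%us. Yx (tl us)) (y # z # us)" by simp
  have s: "tcob A Ys (y # z # us) = Y ((x \<otimes> z) # us) - Y ((x \<otimes> y \<otimes> z) # us) + Y ((x \<otimes> y) # us)
    - tcob A (%us. Y ((x \<otimes> y) # us)) (z # us)"
   using c by (simp add: Ys_def m_assoc)
  have t: "tcob A (%us. Yx (tl us)) (y # z # us) = Yx us - tcob A Yx (z # us)" by simp
  have "tcob A (tcob A Y) zs = tcob A Y (y # z # us) - tcob A Y ((x \<otimes> y) # z # us) + tcob A Y (x # z # us)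
    - tcob A (%us. tcob A Y (x # us)) (y # z # us)"
   unfolding 4 by (rule tcob.simps(3))
  then show ?thesis unfolding e s t by (simp add: Yx_def)
 qed (simp_all add: A0)
qed

lemma coboundary_Cons:
 assumes "over (x # y # zs)"
 shows "coboundary G f (x # y # zs) =
  f (y # zs) - f ((x \<otimes> y) # zs) + f (x # zs) - coboundary G (%us. f (x # us)) (y # zs)"
proof -
 have "(\<Sum>i<Suc (length zs). (- 1) ^ Suc i * f (take i (x # y # zs) @ [(x # y # zs) ! i \<otimes> (x # y # zs) ! Suc i] @ drop (i + 2) (x # y # zs))) =
   - f ((x \<otimes> y) # zs) - (\<Sum>i<length zs. (- 1) ^ Suc i *
    f (x # take i (y # zs) @ [(y # zs) ! i \<otimes> (y # zs) ! Suc i] @ drop (i + 2) (y # zs)))"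
  by (subst sum.lessThan_Suc_shift) (simp add: sum_negf)
 moreover have "length (x # y # zs) - 1 = Suc (length zs)" "length (y # zs) - 1 = length zs" by simp_all
 ultimately show ?thesis using assms unfolding coboundary_def by (simp add: algebra_simps)
qed

lemma coboundary_tr: "over zs ==> coboundary G f zs = tr f zs"
proof (induction zs arbitrary: f rule: induct_list012)
 case (3 x y zs)
 then show ?case using coboundary_Cons[of x y zs f] by simp
qed (simp_all add: coboundary_def)

lemma coboundary_outside: "\<not> over zs ==> coboundary G f zs = 0"
 by (simp add: coboundary_def)

lemma tr_scale: "tr (%us. c * f us) zs = c * (tr f zs :: 'k::field)"
 by (induction zs arbitrary: f rule: induct_list012) (simp_all add: algebra_simps)

text \<open>The graded Leibniz rule, by induction on the degree of \<open>f\<close>: fixing the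
  first argument lowers the degree, and the recursion for the coboundary contributes one
  sign.\<close>

lemma tr_conc:
 fixes f g :: "'g list => 'k::field"
 assumes "\<And>us. f us ~= 0 ==> length us = m"
 shows "tr (conc f g) zs = conc (tr f) g zs + (- 1) ^ m * conc f (tr g) zs"
 using assms
proof (induction m arbitrary: f zs)
 case 0
 have f: "conc f h = (%us. f [] * h us)" for h :: "'g list => 'k"
  using conc_homogeneous[of f 0 h] 0 by (auto simp: fun_eq_iff)
 have "tr f zs = 0" for zs
 proof (cases "length zs = 1")
  case True
  then show ?thesis by (auto simp: length_Suc_conv)
 next
  case False
  then show ?thesis by (intro tcob_length[of _ f 0]) (use 0 in auto)
 qed
 then have "tr f = 0" by (simp add: fun_eq_iff)
 then have "conc (tr f) g zs = 0" by (simp only: conc_0_left zero_fun_apply)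
 then show ?case unfolding f by (simp add: tr_scale)
next
 case (Suc m)
 have f0: "f [] = 0" using Suc(2) by fastforce
 have hC: "conc f h (x # us) = conc (%vs. f (x # vs)) h us" for h x us by (simp add: conc_Cons f0)
 consider "zs = []" | x where "zs = [x]" | x y us where "zs = x # y # us" by (metis list.exhaust)
 then show ?case
 proof cases
  case 1
  then show ?thesis by (simp add: conc_Nil)
 next
  case (2 x)
  then show ?thesis by (simp add: conc_Nil conc_Cons f0)
 next
  case (3 x y us)
  define fx where "fx = (%vs. f (x # vs))"
  \<comment> \<open>Value 0 on the empty list makes the merged and the dropped argument into
    functions of the whole list, to which linearity of \<open>conc\<close> applies.\<close>
  define fs where "fs = (%vs. if vs = [] then 0 else f ((x \<otimes> hd vs) # tl vs))"
  define ft where "ft = (%vs. if vs = [] then 0 else fx (tl vs))"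
  have IH: "tr (conc fx g) (y # us) = conc (tr fx) g (y # us) + (- 1) ^ m * conc fx (tr g) (y # us)"
   by (rule Suc.IH) (use Suc(2) in \<open>fastforce simp: fx_def\<close>)
  have hx: "(%vs. conc f g (x # vs)) = conc fx g" by (simp add: fun_eq_iff hC fx_def)
  have L: "tr (conc f g) zs = conc f g (y # us) - conc f g ((x \<otimes> y) # us) + conc fx g us - tr (conc fx g) (y # us)"
   unfolding 3 tcob.simps(3) hx by (simp add: hC fx_def)
  have "(%vs. tr f (x # vs)) = f - fs + ft - tr fx"
  proof
   fix vs show "tr f (x # vs) = (f - fs + ft - tr fx) vs"
    by (cases vs) (simp_all add: fs_def ft_def fx_def f0)
  qed
  then have "conc (tr f) g zs = conc (f - fs + ft - tr fx) g (y # us)"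
   unfolding 3 by (simp add: conc_Cons[of "tr f"])
  also have "... = conc f g (y # us) - conc fs g (y # us) + conc ft g (y # us) - conc (tr fx) g (y # us)"
   by (simp add: conc_minus_left conc_add_left)
  also have "conc fs g (y # us) = conc f g ((x \<otimes> y) # us)"
   unfolding conc_Cons[of fs] hC by (simp add: fs_def)
  also have "conc ft g (y # us) = conc fx g us" unfolding conc_Cons[of ft] by (simp add: ft_def)
  finally have R: "conc (tr f) g zs = conc f g (y # us) - conc f g ((x \<otimes> y) # us) + conc fx g us - conc (tr fx) g (y # us)" .
  have "conc f (tr g) zs = conc fx (tr g) (y # us)" unfolding 3 by (simp add: hC fx_def)
  then show ?thesis unfolding L R IH by simp
 qed
qed

lemma tcob_cong_carrier:
 "over zs ==> (\<And>us. over us ==> F us = F' us) ==> tcob A F zs = tcob A F' zs"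
proof (induction zs arbitrary: F F' rule: induct_list012)
 case (3 x y zs)
 have "tcob A (%us. F (x # us)) (y # zs) = tcob A (%us. F' (x # us)) (y # zs)"
  by (rule 3(2)) (use 3(3,4) in simp_all)
 moreover have "F (y # zs) = F' (y # zs)" "F ((x \<otimes> y) # zs) = F' ((x \<otimes> y) # zs)" "F (x # zs) = F' (x # zs)"
  using 3(3) by (intro 3(4); simp)+
 ultimately show ?case by simp
qed simp_all

lemma list_all2_E_carrier:
 assumes "U : UU" "list_all2 (E U) xs ys"
 shows "over xs \<and> over ys"
 using assms(2) by (induction rule: list_all2_induct) (use E_carrier[OF assms(1)] in auto)

lemma list_all2_E_refl: "U : UU ==> over xs ==> list_all2 (E U) xs xs"
 using E_refl[of U] by (simp add: list_all2_same subset_iff)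

lemma tcob_inv:
 assumes U: "U : UU" and "\<And>us vs. list_all2 (E U) us vs ==> Y us = Y vs"
  and "\<And>x y us. E U x y ==> A x (Y us) = A y (Y us)" and "list_all2 (E U) zs zs'"
 shows "tcob A Y zs = tcob A Y zs'"
 using assms(2-4)
proof (induction zs arbitrary: zs' Y rule: induct_list012)
 case (2 x)
 then obtain x' where x': "zs' = [x']" "E U x x'" by (auto simp: list_all2_Cons1)
 have "A x (Y []) = A x' (Y [])" by (rule 2(2)[OF x'(2)])
 then show ?case unfolding x'(1) tcob.simps by (rule arg_cong)
next
 case (3 x y zs)
 then obtain x' y' ws where ws: "zs' = x' # y' # ws" and e: "E U x x'" "E U y y'" "list_all2 (E U) zs ws"
  by (auto simp: list_all2_Cons1)
 have "x : CG" using E_carrier[OF U e(1)] by blast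
 have c': "over (y' # ws)"
  using list_all2_E_carrier[OF U e(3)] E_carrier[OF U e(2)] by simp
 have "tcob A (%us. Y (x # us)) (y # zs) = tcob A (%us. Y (x # us)) (y' # ws)"
 proof (rule 3(2))
  show "Y (x # us) = Y (x # vs)" if "list_all2 (E U) us vs" for us vs
   using that \<open>x : CG\<close> E_refl[OF U] by (intro 3(3)) simp
  show "list_all2 (E U) (y # zs) (y' # ws)" using e by simp
 qed (rule 3(4))
 also have "... = tcob A (%us. Y (x' # us)) (y' # ws)"
  by (rule tcob_cong_carrier[OF c'], rule 3(3)) (simp add: e(1) list_all2_E_refl[OF U])
 finally show ?case
  unfolding ws using e 3(3)[of "y # zs" "y' # ws"] 3(3)[of "(x \<otimes> y) # zs" "(x' \<otimes> y') # ws"]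
   3(3)[of "x # zs" "x' # ws"] E_mult[OF U e(1,2)] by simp
qed simp

lemma coboundary_cochains:
 fixes f :: "'g list => 'k::field"
 assumes f: "f : Ch n"
 shows "coboundary G f : Ch (Suc n)"
proof -
 obtain U where U: "U : UU" "cochain_inv U f" using cochains_inv[OF f] by blast
 show ?thesis
 proof (rule cochainsI[OF _ U(1)])
  fix xs assume nz: "coboundary G f xs ~= 0"
  then have c: "over xs" using coboundary_outside by blast
  with nz have "tr f xs ~= 0" by (simp add: coboundary_tr)
  then have "length xs = Suc n"
   using tcob_length[of "%_ v. v" f n xs] cochains_support[OF f] by blast
  with c show "length xs = Suc n \<and> over xs" by blast
 next
  show "cochain_inv U (coboundary G f)"
   unfolding cochain_inv_def
  proof (intro allI impI)
   fix xs ys assume e: "list_all2 (E U) xs ys"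
   from list_all2_E_carrier[OF U(1) e] have "over xs" "over ys" by blast+
   moreover have "tr f xs = tr f ys"
    by (rule tcob_inv[OF U(1) _ _ e]) (use U(2) in \<open>auto simp: cochain_inv_def\<close>)
   ultimately show "coboundary G f xs = coboundary G f ys" by (simp add: coboundary_tr)
  qed
 qed
qed

lemma conc_cochains:
 fixes f g :: "'g list => 'k::field"
 assumes f: "f : Ch m" and g: "g : Ch n"
 shows "conc f g : Ch (m + n)"
proof -
 obtain U where U: "U : UU" "cochain_inv U f" "cochain_inv U g" using cochains_inv2[OF f g] .
 have c: "conc f g w = (if m \<le> length w then f (take m w) * g (drop m w) else 0)" for w
  using cochains_support[OF f] by (intro conc_homogeneous) blast
 show ?thesis
 proof (rule cochainsI[OF _ U(1)])
  fix w assume "conc f g w ~= 0"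
  then have nz: "m \<le> length w" "f (take m w) ~= 0" "g (drop m w) ~= 0" by (auto simp: c split: if_splits)
  have "set w = set (take m w) \<union> set (drop m w)" by (metis append_take_drop_id set_append)
  then show "length w = m + n \<and> over w"
   using cochains_support[OF f nz(2)] cochains_support[OF g nz(3)] nz(1) by auto
 next
  show "cochain_inv U (conc f g)" unfolding cochain_inv_def
  proof (intro allI impI)
   fix xs ys assume e: "list_all2 (E U) xs ys"
   then have "f (take m xs) = f (take m ys)" "g (drop m xs) = g (drop m ys)"
    using U list_all2_takeI[OF e] list_all2_dropI[OF e] unfolding cochain_inv_def by blast+
   then show "conc f g xs = conc f g ys" using list_all2_lengthD[OF e] by (simp add: c)
  qed
 qed
qed

lemma cochains_subspace: "fscale.subspace (Ch n :: ('g list => 'k::field) set)"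
proof (rule fscale.subspaceI)
 fix f g :: "'g list => 'k" and c
 show "(0 :: 'g list => 'k) : Ch n"
 proof (rule cochainsI[OF _ UU_carrier])
  show "cochain_inv (CG) (0 :: 'g list => 'k)" by (simp add: cochain_inv_def)
 qed simp
 assume f: "f : Ch n"
 obtain U where U: "U : UU" "cochain_inv U f" using cochains_inv[OF f] by blast
 show "fscale c f : Ch n"
 proof (rule cochainsI[OF _ U(1)])
  show "length xs = n \<and> over xs" if "fscale c f xs ~= 0" for xs
   by (rule cochains_support[OF f]) (use that in simp)
  show "cochain_inv U (fscale c f)" using U(2) by (simp add: cochain_inv_def)
 qed
 assume g: "g : Ch n"
 obtain V where V: "V : UU" "cochain_inv V f" "cochain_inv V g" using cochains_inv2[OF f g] .
 show "f + g : Ch n"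
 proof (rule cochainsI[OF _ V(1)])
  fix xs assume "(f + g) xs ~= 0"
  then have "f xs ~= 0 \<or> g xs ~= 0" by auto
  then show "length xs = n \<and> over xs" using cochains_support f g by blast
 next
  show "cochain_inv V (f + g)" using V(2,3) unfolding cochain_inv_def by (metis plus_fun_apply)
 qed
qed

lemma coboundary_add: "coboundary G (f + g) = coboundary G f + (coboundary G g :: 'g list => 'k::field)"
proof
 fix zs show "coboundary G (f + g) zs = (coboundary G f + coboundary G g) zs"
 proof (cases "over zs")
  case True
  have "tr (%us. (f us + g us) - g us) zs = tr (%us. f us + g us) zs - tr g zs" by (rule tcob_diff) simp
  moreover have "f + g = (%us. f us + g us)" by (simp add: fun_eq_iff)
  ultimately show ?thesis using True by (simp add: coboundary_tr algebra_simps)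
 qed (simp add: coboundary_outside)
qed

lemma coboundary_scale: "coboundary G (fscale c f) = fscale c (coboundary G f :: 'g list => 'k::field)"
proof
 fix zs show "coboundary G (fscale c f) zs = fscale c (coboundary G f) zs"
 proof (cases "over zs")
  case True
  then show ?thesis using tr_scale[of c f zs] by (simp add: coboundary_tr fscale_def)
 qed (simp add: coboundary_outside)
qed

lemma coboundary_coboundary: "coboundary G (coboundary G f) = (0 :: 'g list => 'k::field)"
proof
 fix zs show "coboundary G (coboundary G f) zs = 0 zs"
 proof (cases "over zs")
  case True
  have "coboundary G (coboundary G f) zs = tr (coboundary G f) zs" using True by (rule coboundary_tr)
  also have "... = tr (tr f) zs" using True by (rule tcob_cong_carrier) (rule coboundary_tr)
  also have "... = 0" by (rule tcob_tcob) (use True in simp_all)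
  finally show ?thesis by simp
 qed (simp add: coboundary_outside)
qed

lemma coboundary_conc:
 fixes f g :: "'g list => 'k::field"
 assumes f: "f : Ch m" and g: "g : Ch n"
 shows "coboundary G (conc f g) = conc (coboundary G f) g + fscale ((- 1) ^ m) (conc f (coboundary G g))"
proof
 fix zs
 have c: "conc h k w = (if j \<le> length w then h (take j w) * k (drop j w) else 0)"
  if "h : Ch j" for h k :: "'g list => 'k" and j w
  using cochains_support[OF that] by (intro conc_homogeneous) blast
 show "coboundary G (conc f g) zs = (conc (coboundary G f) g + fscale ((- 1) ^ m) (conc f (coboundary G g))) zs"
 proof (cases "over zs")
  case True
  have sub: "over (take i zs)" "over (drop i zs)" for i
   using True by (auto dest: in_set_takeD in_set_dropD)
  have "conc (coboundary G f) g zs = conc (tr f) g zs"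
   unfolding conc_def by (intro sum.cong refl) (simp only: coboundary_tr[OF sub(1)])
  moreover have "conc f (coboundary G g) zs = conc f (tr g) zs"
   unfolding conc_def by (intro sum.cong refl) (simp only: coboundary_tr[OF sub(2)])
  moreover have "tr (conc f g) zs = conc (tr f) g zs + (- 1) ^ m * conc f (tr g) zs"
   by (rule tr_conc) (use cochains_support[OF f] in blast)
  ultimately show ?thesis using True by (simp add: coboundary_tr)
 next
  case False
  have "conc (coboundary G f) g : Ch (Suc m + n)" "conc f (coboundary G g) : Ch (m + Suc n)"
   by (rule conc_cochains[OF coboundary_cochains[OF f] g], rule conc_cochains[OF f coboundary_cochains[OF g]])
  then have "conc (coboundary G f) g zs = 0" "conc f (coboundary G g) zs = 0"
   using False cochains_support by blast+
  with False show ?thesis by (simp add: coboundary_outside)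
 qed
qed

lemma cocycles_iff: "f : Cy n \<longleftrightarrow> f : Ch n \<and> coboundary G f = 0"
 by (simp add: cocycles_def)

lemma coboundary_0: "coboundary G (0 :: 'g list => 'k::field) = 0"
 using coboundary_scale[of 0 "0 :: 'g list => 'k"] by simp

lemma coboundaries_Suc: "Cb (Suc n) = coboundary G ` Ch n"
 and coboundaries_0: "Cb 0 = {0}"
 by (simp_all add: coboundaries_def)

lemma coboundaries_cocycles: "f : Cb n ==> f : Cy n"
proof (cases n)
 case 0
 assume "f : Cb n"
 then show ?thesis using 0 fscale.subspace_0[OF cochains_subspace]
  by (simp add: coboundaries_0 cocycles_iff coboundary_0)
next
 case (Suc k)
 assume "f : Cb n"
 then obtain g where "g : Ch k" "f = coboundary G g" unfolding Suc coboundaries_Suc by blast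
 then show ?thesis unfolding Suc cocycles_iff by (simp add: coboundary_cochains coboundary_coboundary)
qed

lemma cochains_0: "f : Ch 0 ==> f = fscale (f []) (monomial [])"
proof
 fix w assume f: "f : Ch 0"
 show "f w = fscale (f []) (monomial []) w"
  using cochains_support[OF f, of w] by (cases w) (auto simp: monomial_def)
qed

lemma one_cochain: "(monomial [] :: 'g list => 'k::field) : Ch 0"
proof (rule cochainsI[OF _ UU_carrier])
 show "length xs = 0 \<and> over xs" if "(monomial [] :: 'g list => 'k) xs ~= 0" for xs
 proof -
  have "xs = []" using that unfolding monomial_def by (cases "xs = []") simp_all
  then show ?thesis by simp
 qed
 show "cochain_inv (CG) (monomial [] :: 'g list => 'k)"
  unfolding cochain_inv_def monomial_def using list_all2_lengthD by fastforce
qed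

lemma coboundary_cochain_0: "f : Ch 0 ==> coboundary G f = (0 :: 'g list => 'k::field)"
proof
 fix w assume f: "f : Ch 0"
 show "coboundary G f w = 0 w"
 proof (rule ccontr)
  assume nz: "coboundary G f w ~= 0 w"
  then have "length w = 1 \<and> over w" using cochains_support[OF coboundary_cochains[OF f], of w] by simp
  then obtain x where "w = [x]" "x : CG" by (auto simp: length_Suc_conv)
  then show False using nz by (simp add: coboundary_tr)
 qed
qed

text \<open>The Leibniz rule makes the cocycles a ring and the coboundaries an ideal in it.\<close>

sublocale Co: subquotient conc "monomial []" "Cy :: nat => ('g list => 'k::field) set" "Cb"
proof
 show Z: "fscale.subspace (Cy n :: ('g list => 'k) set)" for n
 proof (rule fscale.subspaceI)
  show "0 : Cy n" unfolding cocycles_iff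
   by (intro conjI coboundary_0 fscale.subspace_0[OF cochains_subspace])
  fix f g :: "'g list => 'k" and c assume f: "f : Cy n"
  then show "fscale c f : Cy n" unfolding cocycles_iff coboundary_scale
   by (intro conjI fscale.subspace_scale[OF cochains_subspace]) simp_all
  assume "g : Cy n"
  with f show "f + g : Cy n" unfolding cocycles_iff coboundary_add
   by (intro conjI fscale.subspace_add[OF cochains_subspace]) simp_all
 qed
 show "fscale.subspace (Cb n :: ('g list => 'k) set)" for n
 proof (cases n)
  case 0
  then show ?thesis by (simp add: coboundaries_0 fscale.subspace_single_0)
 next
  case (Suc m)
  show ?thesis unfolding Suc coboundaries_Suc
  proof (rule fscale.subspaceI)
   show "0 : coboundary G ` Ch m"
    using coboundary_0 fscale.subspace_0[OF cochains_subspace] by (metis imageI)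
   fix f g :: "'g list => 'k" and c assume f: "f : coboundary G ` Ch m"
   then obtain f' where f': "f' : Ch m" "f = coboundary G f'" by blast
   have "fscale c f = coboundary G (fscale c f')" "fscale c f' : Ch m"
    using f' by (simp_all only: coboundary_scale fscale.subspace_scale[OF cochains_subspace])
   then show "fscale c f : coboundary G ` Ch m" by (rule image_eqI)
   assume "g : coboundary G ` Ch m"
   then obtain g' where g': "g' : Ch m" "g = coboundary G g'" by blast
   have "f + g = coboundary G (f' + g')" "f' + g' : Ch m"
    using f' g' by (simp_all only: coboundary_add fscale.subspace_add[OF cochains_subspace])
   then show "f + g : coboundary G ` Ch m" by (rule image_eqI)
  qed
 qed
 show "Cb n <= (Cy n :: ('g list => 'k) set)" for n
  using coboundaries_cocycles by blast
 fix m n :: nat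
 show "conc x y : Cy (m + n)" if "x : Cy m" "y : Cy n" for x y :: "'g list => 'k"
  using that coboundary_conc[of x m y n] conc_cochains[of x m y n] by (simp add: cocycles_iff)
 show "conc x y : Cb (m + n)" if x: "x : Cb m" and y: "y : Cy n" for x y :: "'g list => 'k"
 proof (cases m)
  case 0
  then show ?thesis using x fscale.subspace_0[OF cochains_subspace] coboundary_0
   by (cases n) (auto simp: coboundaries_0 coboundaries_Suc image_iff intro!: bexI[of _ 0])
 next
  case (Suc k)
  then obtain x' where x': "x' : Ch k" "x = coboundary G x'" using x unfolding Suc coboundaries_Suc by blast
  have "coboundary G (conc x' y) = conc x y"
   using coboundary_conc[OF x'(1), of y n] y x'(2) by (simp add: cocycles_iff)
  moreover have "conc x' y : Ch (k + n)" using x' y by (intro conc_cochains) (simp_all add: cocycles_iff)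
  ultimately show ?thesis unfolding Suc add_Suc coboundaries_Suc by (metis imageI)
 qed
 show "conc x y : Cb (m + n)" if x: "x : Cy m" and y: "y : Cb n" for x y :: "'g list => 'k"
 proof (cases n)
  case 0
  then show ?thesis using y fscale.subspace_0[OF cochains_subspace] coboundary_0
   by (cases m) (auto simp: coboundaries_0 coboundaries_Suc image_iff intro!: bexI[of _ 0])
 next
  case (Suc k)
  then obtain y' where y': "y' : Ch k" "y = coboundary G y'" using y unfolding Suc coboundaries_Suc by blast
  have "coboundary G (conc x y') = fscale ((- 1) ^ m) (conc x y)"
   using coboundary_conc[of x m y' k] x y' by (simp add: cocycles_iff)
  \<comment> \<open>The sign is its own inverse, so a rescaled cochain bounds the product.\<close>
  then have "coboundary G (fscale ((- 1) ^ m) (conc x y')) = fscale ((- 1) ^ m * (- 1) ^ m) (conc x y)"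
   by (simp only: coboundary_scale fscale.scale_scale)
  also have "(- 1) ^ m * (- 1) ^ m = (1 :: 'k)" by (simp flip: power_add mult_2)
  finally have "coboundary G (fscale ((- 1) ^ m) (conc x y')) = conc x y" by (simp only: fscale.scale_one)
  moreover have "fscale ((- 1) ^ m) (conc x y') : Ch (m + k)"
   using x y' by (intro fscale.subspace_scale[OF cochains_subspace] conc_cochains) (simp_all add: cocycles_iff)
  ultimately show ?thesis unfolding Suc add_Suc_right coboundaries_Suc by (metis imageI)
 qed
 show "monomial [] : (Cy 0 :: ('g list => 'k) set)"
  unfolding cocycles_iff by (intro conjI one_cochain coboundary_cochain_0)
 have "(monomial [] :: 'g list => 'k) [] ~= 0 []" by (simp add: monomial_def)
 then show "(monomial [] :: 'g list => 'k) \<notin> Cb 0" unfolding coboundaries_0 by (metis singletonD)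
 show "\<exists>c. x - fscale c (monomial []) : Cb 0" if "x : Cy 0" for x :: "'g list => 'k"
  using cochains_0[of x] that unfolding cocycles_iff coboundaries_0
  by (metis diff_self singletonI)
qed (simp_all add: conc_assoc conc_add_left conc_add_right conc_scale_left conc_scale_right)

end

section \<open>Unipotence of locally constant functions\<close>

text \<open>The class equation: an orbit that is not a fixed point has cardinality a positive power
  of \<open>p\<close>, and such orbits partition the complement of the fixed points. The action is
  arbitrary because two different ones are needed.\<close>

lemma fixed_points_mod_prime:
 fixes Q :: "('q, 'n) monoid_scheme" and a :: "'q => 'e => 'e"
 assumes Q: "group Q" and p: "prime p" and ord: "order Q = p ^ k" and X: "finite X"
  and closed: "\<And>g x. g : carrier Q ==> x : X ==> a g x : X"
  and one: "\<And>x. x : X ==> a \<one>\<^bsub>Q\<^esub> x = x"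
  and mult: "\<And>g h x. g : carrier Q ==> h : carrier Q ==> x : X ==> a (g \<otimes>\<^bsub>Q\<^esub> h) x = a g (a h x)"
 shows "p dvd card X \<longleftrightarrow> p dvd card {x : X. \<forall>g\<in>carrier Q. a g x = x}"
proof -
 interpret group Q by fact
 define \<phi> where "\<phi> g = (\<lambda>x\<in>X. a g x)" for g
 have inv: "a (inv\<^bsub>Q\<^esub> g) (a g x) = x" "a g (a (inv\<^bsub>Q\<^esub> g) x) = x" if "g : carrier Q" "x : X" for g x
  using that mult[of "inv\<^bsub>Q\<^esub> g" g x] mult[of g "inv\<^bsub>Q\<^esub> g" x] one by simp_all
 have bij: "\<phi> g : Bij X" if g: "g : carrier Q" for g
 proof -
  have "bij_betw (a g) X X"
   using g inv closed by (intro bij_betwI[of _ _ _ "a (inv\<^bsub>Q\<^esub> g)"]) auto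
  then have "bij_betw (\<phi> g) X X" unfolding \<phi>_def by (simp cong: bij_betw_cong)
  then show ?thesis by (simp add: Bij_def \<phi>_def)
 qed
 have "\<phi> : hom Q (BijGroup X)"
 proof (rule homI)
  show "\<phi> g : carrier (BijGroup X)" if "g : carrier Q" for g using bij[OF that] by (simp add: BijGroup_def)
  show "\<phi> (g \<otimes>\<^bsub>Q\<^esub> h) = \<phi> g \<otimes>\<^bsub>BijGroup X\<^esub> \<phi> h" if "g : carrier Q" "h : carrier Q" for g h
   using bij that mult closed by (auto simp: BijGroup_def \<phi>_def compose_def fun_eq_iff restrict_def)
 qed
 then interpret A: group_action Q X \<phi>
  by (intro group_action.intro group_hom.intro group_hom_axioms.intro group_BijGroup Q)
 define F where "F = {x : X. \<forall>g\<in>carrier Q. a g x = x}"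
 have orb: "orbit Q \<phi> x = (%g. a g x) ` carrier Q" if "x : X" for x
  using that by (auto simp: orbit_def \<phi>_def)
 have orbX: "orbit Q \<phi> x <= X" if "x : X" for x using that closed by (auto simp: orb)
 have dvd: "p dvd card (orbit Q \<phi> x)" if x: "x : X - F" for x
 proof -
  have "card (orbit Q \<phi> x) dvd p ^ k"
   using A.orbit_stabilizer_theorem[of x] x unfolding ord by (metis DiffD1 dvd_triv_left)
  then obtain i where i: "card (orbit Q \<phi> x) = p ^ i" using divides_primepow_nat[OF p] by blast
  have "i ~= 0"
  proof
   assume "i = 0"
   then obtain y where y: "orbit Q \<phi> x = {y}" using i by (metis card_1_singletonE power_0)
   have "a g x = x" if "g : carrier Q" for g
   proof -
    have "a g x : {y}" "a \<one>\<^bsub>Q\<^esub> x : {y}" unfolding y[symmetric] using x that by (auto simp: orb)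
    then show ?thesis using one x by simp
   qed
   then show False using x by (auto simp: F_def)
  qed
  then show ?thesis using i by (simp add: dvd_power)
 qed
 have eqv: "x' : orbit Q \<phi> x ==> orbit Q \<phi> x' = orbit Q \<phi> x" if x: "x : X" for x x'
 proof -
  assume "x' : orbit Q \<phi> x"
  then obtain g where g: "g : carrier Q" "x' = a g x" using x by (auto simp: orb)
  then have x'X: "x' : X" using closed x by simp
  have "a h x' : orbit Q \<phi> x" if "h : carrier Q" for h
   using mult[OF that g(1) x] g(2) that g(1) x by (auto simp: orb intro!: image_eqI[of _ _ "h \<otimes>\<^bsub>Q\<^esub> g"])
  moreover have "a h x : orbit Q \<phi> x'" if h: "h : carrier Q" for h
  proof -
   have "a h x = a h (a (inv\<^bsub>Q\<^esub> g) x')" using inv(1)[OF g(1) x] g(2) by simp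
   also have "... = a (h \<otimes>\<^bsub>Q\<^esub> inv\<^bsub>Q\<^esub> g) x'" using h g x'X by (intro mult[symmetric]) simp_all
   finally show ?thesis using h g(1) x'X by (auto simp: orb)
  qed
  ultimately show ?thesis using x x'X by (auto simp: orb)
 qed
 have "\<Union> (orbit Q \<phi> ` (X - F)) = X - F"
 proof (intro subset_antisym subsetI)
  fix y assume "y : \<Union> (orbit Q \<phi> ` (X - F))"
  then obtain x where x: "x : X" "x \<notin> F" "y : orbit Q \<phi> x" by blast
  have "y \<notin> F"
  proof
   assume y: "y : F"
   have "x : orbit Q \<phi> x" using x(1) one by (auto simp: orb intro!: image_eqI[of _ _ "\<one>\<^bsub>Q\<^esub>"])
   then have "x : orbit Q \<phi> y" using eqv[OF x(1) x(3)] by simp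
   then have "x = y" using y by (auto simp: orb F_def)
   then show False using x y by simp
  qed
  then show "y : X - F" using x orbX by blast
 next
  fix x assume x: "x : X - F"
  then have "x : orbit Q \<phi> x" using one by (auto simp: orb intro!: image_eqI[of _ _ "\<one>\<^bsub>Q\<^esub>"])
  with x show "x : \<Union> (orbit Q \<phi> ` (X - F))" by blast
 qed
 moreover have "p dvd card (\<Union> (orbit Q \<phi> ` (X - F)))"
 proof (rule dvd_partition)
  show "finite (\<Union> (orbit Q \<phi> ` (X - F)))" unfolding calculation using X by simp
  show "\<forall>c\<in>orbit Q \<phi> ` (X - F). p dvd card c" using dvd by blast
  show "\<forall>c1\<in>orbit Q \<phi> ` (X - F). \<forall>c2\<in>orbit Q \<phi> ` (X - F). c1 ~= c2 --> c1 \<inter> c2 = {}"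
   using eqv by blast
 qed
 ultimately have d: "p dvd card (X - F)" by simp
 have "card X = card (X - F) + card F"
  using card_Diff_subset[of F X] card_mono[of X F] X by (simp add: F_def finite_subset)
 then show ?thesis unfolding F_def[symmetric] using d by (simp add: dvd_add_right_iff)
qed

context pro_p begin

definition lc :: "('g => 'k::field) set" where
 "lc = {f. (\<forall>x. f x ~= 0 --> x : CG) \<and> (\<exists>U\<in>UU. \<forall>x y. E U x y --> f x = f y)}"

text \<open>Translation is a right action: \<open>lt_lt\<close> composes in the order of the
  product. The cut-off outside the carrier keeps a function determined by its values on the
  group.\<close>

definition lt :: "'g => ('g => 'k::field) => 'g => 'k" where
 "lt g f = (%y. if y : CG then f (g \<otimes> y) else 0)"

definition kc :: "'k::field => 'g => 'k" where
 "kc c = (%y. if y : CG then c else 0)"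

lemma lc_support: "f : lc ==> x \<notin> CG ==> f x = 0"
 unfolding lc_def by blast

lemma lc_inv: "f : lc ==> \<exists>U\<in>UU. \<forall>x y. E U x y --> f x = f y"
 unfolding lc_def by blast

lemma lcI:
 assumes "\<And>x. x \<notin> CG ==> f x = 0" "U : UU" "\<And>x y. E U x y ==> f x = f y"
 shows "f : lc"
 using assms unfolding lc_def by blast

lemma lc_subspace: "fscale.subspace (lc :: ('g => 'k::field) set)"
proof (rule fscale.subspaceI)
 show "(0 :: 'g => 'k) : lc" by (rule lcI[OF _ UU_carrier]) simp_all
 fix f g :: "'g => 'k" and c assume f: "f : lc"
 obtain U where U: "U : UU" "\<And>x y. E U x y ==> f x = f y" using lc_inv[OF f] by blast
 show "fscale c f : lc"
 proof (rule lcI[OF _ U(1)])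
  show "fscale c f x = fscale c f y" if "E U x y" for x y using U(2)[OF that] by simp
 qed (simp add: lc_support[OF f])
 assume g: "g : lc"
 obtain V where V: "V : UU" "\<And>x y. E V x y ==> g x = g y" using lc_inv[OF g] by blast
 show "f + g : lc"
 proof (rule lcI[OF _ UU_Int[OF U(1) V(1)]])
  fix x y assume "E (U \<inter> V) x y"
  then have "E U x y" "E V x y" by (auto simp: E_def)
  then show "(f + g) x = (f + g) y" using U(2) V(2) by (metis plus_fun_apply)
 qed (simp add: lc_support[OF f] lc_support[OF g])
qed

lemmas lc_intros = fscale.subspace_add[OF lc_subspace] fscale.subspace_diff[OF lc_subspace]
 fscale.subspace_scale[OF lc_subspace] fscale.subspace_neg[OF lc_subspace]
 fscale.subspace_0[OF lc_subspace] fscale.subspace_sum[OF lc_subspace]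

lemma kc_lc: "kc c : lc"
 by (rule lcI[OF _ UU_carrier]) (use E_carrier[OF UU_carrier] in \<open>auto simp: kc_def\<close>)

lemma lt_inv:
 assumes "U : UU" "g : CG" "\<And>x y. E U x y ==> f x = f y" "E U x y"
 shows "lt g f x = lt g f y"
 using assms(3)[OF E_mult[OF assms(1) E_refl[OF assms(1,2)] assms(4)]] E_carrier[OF assms(1,4)]
 by (simp add: lt_def)

lemma lt_lc: "g : CG ==> f : lc ==> lt g f : lc"
proof -
 assume g: "g : CG" and f: "f : lc"
 obtain U where U: "U : UU" "\<And>x y. E U x y ==> f x = f y" using lc_inv[OF f] by blast
 show ?thesis by (rule lcI[OF _ U(1) lt_inv[OF U(1) g U(2)]]) (simp_all add: lt_def)
qed

lemma lt_add: "lt g (u + v) = lt g u + lt g v"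
 and lt_diff: "lt g (u - v) = lt g u - lt g v"
 and lt_scale: "lt g (fscale c u) = fscale c (lt g u)"
 and lt_0: "lt g 0 = 0"
 by (simp_all add: lt_def fun_eq_iff)

lemma lt_lt: "x : CG ==> y : CG ==> lt y (lt x f) = lt (x \<otimes> y) f"
 by (simp add: lt_def fun_eq_iff m_assoc)

lemma lt_one: "f : lc ==> lt \<one> f = f"
 using lc_support[of f] by (auto simp: lt_def fun_eq_iff)

lemma lt_kc: "g : CG ==> lt g (kc c) = kc c"
 by (simp add: lt_def kc_def fun_eq_iff)

lemma lt_E: "U : UU ==> (\<And>x y. E U x y ==> f x = f y) ==> E U g h ==> lt g f = lt h f"
 using E_mult[of U g h] E_refl[of U] by (auto simp: lt_def fun_eq_iff)

text \<open>The socle filtration: \<open>lev n\<close> consists of the functions that all products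
  of \<open>n\<close> differences \<open>g - 1\<close> annihilate.\<close>

primrec lev :: "nat => ('g => 'k::field) set" where
 "lev 0 = {0}"
| "lev (Suc n) = {f : lc. \<forall>g\<in>CG. lt g f - f : lev n}"

lemma lev_lc: "lev n <= lc"
 using lc_intros(5) by (cases n) auto

lemma lev_subspace: "fscale.subspace (lev n :: ('g => 'k::field) set)"
proof (induction n)
 case 0
 show ?case unfolding lev.simps by (rule fscale.subspace_single_0)
next
 case (Suc n)
 show ?case
 proof (rule fscale.subspaceI)
  show "(0 :: 'g => 'k) : lev (Suc n)"
   unfolding lev.simps mem_Collect_eq lt_0 using fscale.subspace_0[OF Suc] lc_intros(5) by simp
  fix f g :: "'g => 'k" and c assume f: "f : lev (Suc n)"
  have "lt x (fscale c f) - fscale c f : lev n" if "x : CG" for x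
   unfolding lt_scale fscale.scale_right_diff_distrib[symmetric]
   using f that by (intro fscale.subspace_scale[OF Suc]) simp
  moreover have "fscale c f : lc" using f by (intro lc_intros) simp
  ultimately show "fscale c f : lev (Suc n)" by simp
  assume g: "g : lev (Suc n)"
  have "lt x (f + g) - (f + g) : lev n" if "x : CG" for x
  proof -
   have "lt x (f + g) - (f + g) = (lt x f - f) + (lt x g - g)" unfolding lt_add by simp
   also have "... : lev n" using f g that by (intro fscale.subspace_add[OF Suc]) simp_all
   finally show ?thesis .
  qed
  moreover have "f + g : lc" using f g by (intro lc_intros) simp_all
  ultimately show "f + g : lev (Suc n)" by simp
 qed
qed

lemma lev_Suc: "lev n <= lev (Suc n)"
proof (induction n)
 case 0
 show ?case using lc_intros(5) by (auto simp: lt_0)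
next
 case (Suc n)
 then show ?case unfolding lev.simps(2)[of "Suc n"] using lev_lc[of "Suc n"] by auto
qed

lemma lt_lev: "x : CG ==> f : lev n ==> lt x f : lev n"
proof (cases n)
 case 0
 assume "f : lev n"
 with 0 show ?thesis by (simp add: lt_0)
next
 case (Suc m)
 assume x: "x : CG" and f: "f : lev n"
 have "lt x f - f : lev n" using f x lev_Suc[of m] unfolding Suc by auto
 from fscale.subspace_add[OF lev_subspace this f] show ?thesis by simp
qed

text \<open>The functions invariant under one \<open>U\<close> form a finite space \<open>W\<close>
  on which the p-group \<open>G / U\<close> acts. The filtration becomes stationary on
  \<open>W\<close>; if it stopped at a proper subspace \<open>S\<close>, the nonzero quotient
  \<open>W / S\<close> would contain a nonzero fixed vector, and this vector belongs to the next
  step.\<close>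

lemma lc_unipotent:
 fixes f :: "'g => 'k::{field,finite}"
 assumes char: "of_nat p = (0 :: 'k)" and f: "f : lc"
 shows "\<exists>n. f : lev n"
proof -
 obtain U where U: "U : UU" "\<And>x y. E U x y ==> f x = f y" using lc_inv[OF f] by blast
 define W where "W = {f :: 'g => 'k. (\<forall>x. x \<notin> CG --> f x = 0) \<and> (\<forall>x y. E U x y --> f x = f y)}"
 have Wlc: "W <= lc" using lcI[OF _ U(1)] by (auto simp: W_def)
 have fW: "f : W" using U(2) lc_support[OF f] by (auto simp: W_def)
 have Wadd: "u + c : W" if "u : W" "c : W" for u c
  unfolding W_def
 proof (intro CollectI conjI allI impI)
  fix x y assume "E U x y"
  with that have "u x = u y" "c x = c y" unfolding W_def by blast+
  then show "(u + c) x = (u + c) y" by simp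
 qed (use that in \<open>simp add: W_def\<close>)
 have Wscale: "fscale c u : W" if "u : W" for u c
  unfolding W_def
 proof (intro CollectI conjI allI impI)
  fix x y assume "E U x y"
  with that have "u x = u y" unfolding W_def by blast
  then show "fscale c u x = fscale c u y" by simp
 qed (use that in \<open>simp add: W_def\<close>)
 have Wlt: "lt g u : W" if "g : CG" "u : W" for g u
 proof -
  have "\<And>x y. E U x y ==> u x = u y" using that(2) by (simp add: W_def)
  then have "lt g u x = lt g u y" if "E U x y" for x y using that \<open>g : CG\<close> by (intro lt_inv[OF U(1), of g u]) simp_all
  then show ?thesis unfolding W_def by (intro CollectI conjI allI impI) (simp_all add: lt_def)
 qed
 have finW: "finite W"
 proof -
  define rp where "rp C = (SOME x. x : C)" for C :: "'g set"
  have rpE: "E U x (rp (U #> x))" if x: "x : CG" for x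
  proof -
   have "x : U #> x" by (rule rcos_self[OF x UU_subgroup[OF U(1)]])
   then have "rp (U #> x) : U #> x" unfolding rp_def by (rule someI[of "%y. y : U #> x"])
   then obtain u where "u : U" "rp (U #> x) = u \<otimes> x" by (auto simp: r_coset_def)
   then show ?thesis using E_left[OF U(1) x] by simp
  qed
  have "inj_on (%u. \<lambda>C\<in>rcosets U. u (rp C)) W"
  proof (rule inj_onI)
   fix u v assume uv: "u : W" "v : W" "(\<lambda>C\<in>rcosets U. u (rp C)) = (\<lambda>C\<in>rcosets U. v (rp C))"
   show "u = v"
   proof
    fix x show "u x = v x"
    proof (cases "x : CG")
     case True
     then have "U #> x : rcosets U" by (auto simp: RCOSETS_def)
     then have "u (rp (U #> x)) = v (rp (U #> x))" using fun_cong[OF uv(3), of "U #> x"] by simp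
     moreover have "u x = u (rp (U #> x))" "v x = v (rp (U #> x))"
      using uv(1,2) rpE[OF True] by (simp_all add: W_def)
     ultimately show ?thesis by simp
    qed (use uv in \<open>simp add: W_def\<close>)
   qed
  qed
  moreover have "(%u. \<lambda>C\<in>rcosets U. u (rp C)) ` W <= rcosets U \<rightarrow>\<^sub>E UNIV" by auto
  moreover have "finite (rcosets U \<rightarrow>\<^sub>E (UNIV :: 'k set))" by (intro finite_PiE finite_rcosets U(1)) simp
  ultimately show ?thesis by (metis finite_imageD finite_subset)
 qed
 have "\<exists>n. lev n \<inter> W = lev (Suc n) \<inter> W"
 proof (rule ccontr)
  assume "\<nexists>n. lev n \<inter> W = lev (Suc n) \<inter> W"
  then have "lev n \<inter> W \<subset> lev (Suc n) \<inter> W" for n using lev_Suc[of n] by blast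
  then have lt: "card (lev n \<inter> W) < card (lev (Suc n) \<inter> W)" for n
   using finW by (intro psubset_card_mono) simp_all
  have "n \<le> card (lev n \<inter> W)" for n
  proof (induction n)
   case (Suc n)
   then show ?case using lt[of n] by linarith
  qed simp
  moreover have "card (lev n \<inter> W) \<le> card W" for n using finW by (intro card_mono) simp_all
  ultimately have "Suc (card W) \<le> card W" using le_trans by blast
  then show False by simp
 qed
 then obtain n where n: "lev n \<inter> W = lev (Suc n) \<inter> W" by blast
 define S where "S = lev n \<inter> W"
 have Ssub: "fscale.subspace S"
  unfolding S_def
 proof (rule fscale.subspaceI)
  have "(0 :: 'g => 'k) : W" by (simp add: W_def)
  then show "0 : lev n \<inter> W" using fscale.subspace_0[OF lev_subspace] by blast
 qed (use Wadd Wscale fscale.subspace_add[OF lev_subspace] fscale.subspace_scale[OF lev_subspace] in blast)+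
 note Ss = fscale.subspace_add[OF Ssub] fscale.subspace_diff[OF Ssub] fscale.subspace_0[OF Ssub] fscale.subspace_neg[OF Ssub]
 have Slt: "lt g u : S" if "g : CG" "u : S" for g u
  using that lt_lev[of g u n] Wlt[of g u] unfolding S_def by blast
 have "S = W"
 proof (rule ccontr)
  assume "S ~= W"
  then obtain f0 where f0: "f0 : W" "f0 \<notin> S" by (auto simp: S_def)
  \<comment> \<open>The quotient \<open>W / S\<close> is modelled by chosen representatives;
    \<open>r_eq\<close> says that \<open>r\<close> depends on the class alone.\<close>
  define r where "r u = (SOME v. v : W \<and> v - u : S)" for u
  have r: "r u : W \<and> r u - u : S" if "u : W" for u
   unfolding r_def by (rule someI[of _ u], simp only: that diff_self Ss(3) simp_thms)
  have r_eq: "r u = r v" if "u - v : S" for u v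
  proof -
   have "w - u : S \<longleftrightarrow> w - v : S" for w
    using Ss(1)[of "w - u" "u - v"] Ss(2)[of "w - v" "u - v"] that by auto
   then show ?thesis unfolding r_def by simp
  qed
  have r_r: "r (r u) = r u" if "u : W" for u using r[OF that] by (intro r_eq) simp
  define X where "X = r ` W"
  have XW: "X <= W" and finX: "finite X" using r finW by (auto simp: X_def)
  have Xr: "r x = x" if "x : X" for x using that r_r by (auto simp: X_def)
  \<comment> \<open>The order of \<open>W / S\<close> is divisible by p because translation by
    \<open>f0\<close>, which is not in \<open>S\<close>, gives an action of the integers modulo p
    without fixed points.\<close>
  define tf where "tf c x = r (x + fscale (of_int c) f0)" for c :: int and x
  have p0: "0 < p" using p by (simp add: prime_gt_0_nat)
  have pm: "of_int (c mod int p) = (of_int c :: 'k)" for c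
  proof -
   have "of_int c = of_int (c div int p * int p + c mod int p)" by simp
   also have "... = (of_int (c mod int p) :: 'k)"
    unfolding of_int_add of_int_mult of_int_of_nat_eq char by simp
   finally show ?thesis by simp
  qed
  have "p dvd card {x : X. \<forall>c\<in>carrier (integer_mod_group p). tf c x = x} \<longleftrightarrow> p dvd card X"
  proof (rule fixed_points_mod_prime[OF group_integer_mod_group p _ finX, symmetric])
   show "order (integer_mod_group p) = p ^ 1"
    using p0 by (simp add: order_def carrier_integer_mod_group)
   show "tf c x : X" if "x : X" for c x using that XW f0 by (auto simp: tf_def X_def intro!: imageI Wadd Wscale)
   show "tf \<one>\<^bsub>integer_mod_group p\<^esub> x = x" if "x : X" for x
    using Xr[OF that] by (simp add: tf_def)
   show "tf (c \<otimes>\<^bsub>integer_mod_group p\<^esub> c') x = tf c (tf c' x)" if "x : X" for c c' x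
   proof -
    have xW: "x + fscale (of_int c') f0 : W" by (intro Wadd Wscale) (use that XW f0 in auto)
    have "tf (c \<otimes>\<^bsub>integer_mod_group p\<^esub> c') x = r (x + fscale (of_int (c + c')) f0)"
     using p0 by (simp only: tf_def mult_integer_mod_group pm)
    also have "x + fscale (of_int (c + c')) f0 = (x + fscale (of_int c') f0) + fscale (of_int c) f0"
     by (simp add: fscale.scale_left_distrib fun_eq_iff algebra_simps)
    also have "r ... = tf c (tf c' x)"
     unfolding tf_def
    proof (rule r_eq)
     have "- (r (x + fscale (of_int c') f0) - (x + fscale (of_int c') f0)) : S"
      by (rule Ss(4)) (use r[OF xW] in blast)
     then show "x + fscale (of_int c') f0 + fscale (of_int c) f0 - (r (x + fscale (of_int c') f0) + fscale (of_int c) f0) : S"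
      by simp
    qed
    finally show ?thesis .
   qed
  qed
  moreover have "{x : X. \<forall>c\<in>carrier (integer_mod_group p). tf c x = x} = {}"
  proof -
   have False if x: "x : X" and fx: "\<forall>c\<in>carrier (integer_mod_group p). tf c x = x" for x
   proof -
    have "1 : carrier (integer_mod_group p)"
     using prime_gt_1_nat[OF p] by (simp add: carrier_integer_mod_group)
    from bspec[OF fx this] have "r (x + f0) = x" by (simp only: tf_def of_int_1 fscale.scale_one)
    moreover have "x + f0 : W" using x XW f0 by (intro Wadd) auto
    ultimately have "x - (x + f0) : S" using r by metis
    then have "- (x - (x + f0)) : S" by (rule Ss(4))
    then show False using f0 by simp
   qed
   then show ?thesis by blast
  qed
  ultimately have pX: "p dvd card X" by simp
  define Q where "Q = G Mod U"
  interpret UN: normal U G by (rule UU_normal[OF U(1)])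
  define rp where "rp C = (SOME x. x : C)" for C :: "'g set"
  have rp: "rp C : CG \<and> U #> rp C = C" if C: "C : carrier Q" for C
  proof -
   obtain x where x: "x : CG" "C = U #> x" using C by (auto simp: Q_def carrier_FactGroup)
   then have "x : C" using rcos_self[OF x(1) UU_subgroup[OF U(1)]] by simp
   then have "rp C : C" unfolding rp_def by (rule someI[of "%y. y : C"])
   then show ?thesis
    using x repr_independence[of "rp C" U x] UU_subgroup[OF U(1)] r_coset_subset_G[OF UN.subset x(1)] by auto
  qed
  \<comment> \<open>The inverse turns the right action by translation into a left action, as the
    fixed point count expects.\<close>
  define ac where "ac C x = r (lt (inv (rp C)) x)" for C x
  have lt_cong: "lt g u = lt h u" if "u : W" "g : CG" "h : CG" "U #> g = U #> h" for g h u
  proof -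
   have "\<And>x y. E U x y ==> u x = u y" using that(1) by (simp add: W_def)
   moreover have "E U g h" using E_rcoset[OF U(1) that(2,3)] that(4) by blast
   ultimately show ?thesis by (intro lt_E[OF U(1)])
  qed
  have r_lt: "r (lt g (r u)) = r (lt g u)" if "g : CG" "u : W" for g u
  proof (rule r_eq)
   show "lt g (r u) - lt g u : S" unfolding lt_diff[symmetric] using r[OF that(2)] Slt[OF that(1)] by blast
  qed
  have "p dvd card X \<longleftrightarrow> p dvd card {x : X. \<forall>C\<in>carrier Q. ac C x = x}"
  proof (rule fixed_points_mod_prime[OF _ p _ finX])
   show "group Q" unfolding Q_def by (rule UN.factorgroup_is_group)
   show "order Q = p ^ (SOME k. card (rcosets U) = p ^ k)"
    unfolding order_def Q_def FactGroup_def partial_object.simps by (rule someI_ex[OF card_rcosets[OF U(1)]])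
   show "ac C x : X" if "C : carrier Q" "x : X" for C x
    using that rp[OF that(1)] XW by (auto simp: ac_def X_def intro!: imageI Wlt)
   show "ac \<one>\<^bsub>Q\<^esub> x = x" if x: "x : X" for x
   proof -
    have "\<one>\<^bsub>Q\<^esub> : carrier Q" unfolding Q_def by (intro group.is_monoid[OF UN.factorgroup_is_group] monoid.one_closed)
    then have "rp \<one>\<^bsub>Q\<^esub> : CG" "U #> rp \<one>\<^bsub>Q\<^esub> = U" using rp[of "\<one>\<^bsub>Q\<^esub>"] by (simp_all add: Q_def)
    then have "rp \<one>\<^bsub>Q\<^esub> : U" using rcos_self[of "rp \<one>\<^bsub>Q\<^esub>" U] UU_subgroup[OF U(1)] by simp
    then have "inv (rp \<one>\<^bsub>Q\<^esub>) : U" by (rule subgroup.m_inv_closed[OF UU_subgroup[OF U(1)]])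
    then have "U #> inv (rp \<one>\<^bsub>Q\<^esub>) = U #> \<one>" using UN.rcos_const UU_subset[OF U(1)] by (simp add: UN.subset coset_mult_one)
    moreover have "x : W" using x XW by blast
    ultimately have "lt (inv (rp \<one>\<^bsub>Q\<^esub>)) x = lt \<one> x"
     using \<open>rp \<one>\<^bsub>Q\<^esub> : CG\<close> by (intro lt_cong) simp_all
    also have "... = x" using \<open>x : W\<close> Wlc by (intro lt_one) blast
    finally show ?thesis using Xr[OF x] by (simp add: ac_def)
   qed
   show "ac (C \<otimes>\<^bsub>Q\<^esub> D) x = ac C (ac D x)" if C: "C : carrier Q" and D: "D : carrier Q" and x: "x : X" for C D x
   proof -
    have c: "rp C : CG" "rp D : CG" "U #> rp C = C" "U #> rp D = D" using rp C D by blast+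
    have "C \<otimes>\<^bsub>Q\<^esub> D : carrier Q" using group.is_monoid[OF UN.factorgroup_is_group] C D unfolding Q_def by (intro monoid.m_closed)
    then have cd: "rp (C \<otimes>\<^bsub>Q\<^esub> D) : CG" "U #> rp (C \<otimes>\<^bsub>Q\<^esub> D) = C \<otimes>\<^bsub>Q\<^esub> D" using rp by blast+
    have "C \<otimes>\<^bsub>Q\<^esub> D = U #> (rp C \<otimes> rp D)"
     using UN.rcos_sum[OF c(1,2)] c by (simp add: Q_def)
    then have "U #> inv (rp (C \<otimes>\<^bsub>Q\<^esub> D)) = U #> inv (rp C \<otimes> rp D)"
     using cd c UN.rcos_inv[of "rp (C \<otimes>\<^bsub>Q\<^esub> D)"] UN.rcos_inv[of "rp C \<otimes> rp D"] by simp
    moreover have xW: "x : W" using x XW by blast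
    ultimately have "lt (inv (rp (C \<otimes>\<^bsub>Q\<^esub> D))) x = lt (inv (rp C \<otimes> rp D)) x"
     using c cd by (intro lt_cong) simp_all
    also have "... = lt (inv (rp C)) (lt (inv (rp D)) x)"
     using c by (simp add: inv_mult_group lt_lt)
    finally show ?thesis using r_lt[of "inv (rp C)" "lt (inv (rp D)) x"] c Wlt[of "inv (rp D)" x] xW
     by (simp add: ac_def)
   qed
  qed
  with pX have "p dvd card {x : X. \<forall>C\<in>carrier Q. ac C x = x}" by blast
  moreover have "r 0 : {x : X. \<forall>C\<in>carrier Q. ac C x = x}"
  proof -
   have "0 : W" using Ss(3) by (simp add: S_def)
   then show ?thesis using r_lt[of _ 0] rp by (auto simp: X_def ac_def lt_0)
  qed
  moreover have "finite {x : X. \<forall>C\<in>carrier Q. ac C x = x}" using finX by simp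
  ultimately have "\<exists>x\<in>{x : X. \<forall>C\<in>carrier Q. ac C x = x}. x ~= r 0"
  proof -
   assume d: "p dvd card {x : X. \<forall>C\<in>carrier Q. ac C x = x}" and m: "r 0 : {x : X. \<forall>C\<in>carrier Q. ac C x = x}"
    and "finite {x : X. \<forall>C\<in>carrier Q. ac C x = x}"
   show ?thesis
   proof (rule ccontr)
    assume "\<not> ?thesis"
    with m have "{x : X. \<forall>C\<in>carrier Q. ac C x = x} = {r 0}" by blast
    with d have "p dvd 1" by simp
    then show False using p by simp
   qed
  qed
  then obtain x where x: "x : X" "\<And>C. C : carrier Q ==> ac C x = x" "x ~= r 0" by blast
  have xW: "x : W" using x XW by blast
  \<comment> \<open>A fixed class means that translates differ from \<open>x\<close> by elements of
    \<open>S\<close>, so \<open>x\<close> lies one step higher, against stationarity.\<close>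
  have "lt g x - x : lev n" if g: "g : CG" for g
  proof -
   have CQ: "U #> inv g : carrier Q" using g by (auto simp: Q_def carrier_FactGroup)
   have "U #> inv (rp (U #> inv g)) = U #> g"
    using rp[OF CQ] UN.rcos_inv[of "rp (U #> inv g)"] UN.rcos_inv[of "inv g"] g by simp
   then have "lt (inv (rp (U #> inv g))) x = lt g x" using rp[OF CQ] xW g by (intro lt_cong) simp_all
   then have "r (lt g x) = x" using x(2)[OF CQ] by (simp add: ac_def)
   moreover have "r (lt g x) - lt g x : S" using r[OF Wlt[OF g xW]] by blast
   ultimately have "x - lt g x : S" by simp
   then have "- (x - lt g x) : S" by (rule Ss(4))
   then show ?thesis by (simp add: S_def)
  qed
  then have "x : lev (Suc n)" using xW Wlc by auto
  then have "x : S" using xW n by (auto simp: S_def)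
  then have "r x = r 0" by (intro r_eq) simp
  then show False using Xr[OF x(1)] x(3) by simp
 qed
 then have "f : lev n" using fW by (auto simp: S_def)
 then show ?thesis by blast
qed

end

section \<open>The complete group algebra as the dual of the locally constant functions\<close>

context pro_p begin

abbreviation "Q U \<equiv> carrier (G Mod U)"
abbreviation "cga \<equiv> complete_group_algebra G T"

definition rc :: "'g set => 'g" where
 "rc C = (SOME x. x : C)"

lemma Q_iff: "C : Q U \<longleftrightarrow> (\<exists>x\<in>CG. C = U #> x)"
 by (auto simp: carrier_FactGroup)

lemma Q_I: "x : CG ==> U #> x : Q U"
 by (auto simp: Q_iff)

lemma finite_Q: "U : UU ==> finite (Q U)"
 using finite_rcosets[of U] by (simp add: FactGroup_def)

lemma rc_in: "U : UU ==> C : Q U ==> rc C : C"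
proof -
 assume U: "U : UU" and "C : Q U"
 then obtain x where "x : CG" "C = U #> x" by (auto simp: Q_iff)
 then have "x : C" using rcos_self UU_subgroup[OF U] by simp
 then show ?thesis unfolding rc_def by (rule someI[of "%y. y : C"])
qed

lemma Q_mem: "U : UU ==> C : Q U ==> y : C ==> y : CG \<and> U #> y = C"
proof -
 assume U: "U : UU" and "C : Q U" and y: "y : C"
 then obtain x where x: "x : CG" "C = U #> x" by (auto simp: Q_iff)
 then show ?thesis
  using y repr_independence[of y U x] UU_subgroup[OF U]
   r_coset_subset_G[OF subgroup.subset[OF UU_subgroup[OF U]] x(1)] by auto
qed

lemma rc: "U : UU ==> C : Q U ==> rc C : CG"
 and coset_rc: "U : UU ==> C : Q U ==> U #> rc C = C"
 using Q_mem rc_in by blast+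

lemma E_rc: "U : UU ==> x : CG ==> E U (rc (U #> x)) x"
 using E_rcoset[of U "rc (U #> x)" x] rc[OF _ Q_I] coset_rc[OF _ Q_I] by simp

lemma Q_subset:
 assumes "U : UU" "V : UU" "U <= V" "B : Q U" "C : Q V"
 shows "B <= C \<longleftrightarrow> V #> rc B = C"
proof
 assume "B <= C"
 then show "V #> rc B = C" using Q_mem[OF assms(2,5)] rc_in[OF assms(1,4)] by blast
next
 assume *: "V #> rc B = C"
 have "U #> rc B <= V #> rc B" using assms(3) by (auto simp: r_coset_def)
 then show "B <= C" using coset_rc[OF assms(1,4)] * by simp
qed

definition inv_under :: "'g set => ('g => 'k) => bool" where
 "inv_under U f \<longleftrightarrow> U : UU \<and> (\<forall>x y. E U x y --> f x = f y)"

lemma inv_under_UU: "inv_under U f ==> U : UU"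
 and inv_underD: "inv_under U f ==> E U x y ==> f x = f y"
 unfolding inv_under_def by blast+

lemma inv_under_Int: "inv_under U f ==> V : UU ==> inv_under (U \<inter> V) f"
 unfolding inv_under_def using UU_Int E_mono[of "U \<inter> V" U] by blast

lemma lc_inv_under: "f : lc ==> \<exists>U. inv_under U f"
 unfolding inv_under_def using lc_inv by blast

lemma inv_under2:
 assumes "f : lc" "g : lc"
 obtains U where "inv_under U f" "inv_under U g"
proof -
 obtain U V where *: "inv_under U f" "inv_under V g" using assms lc_inv_under by metis
 show ?thesis
  using that[of "U \<inter> V"] inv_under_Int[OF *(1) inv_under_UU[OF *(2)]]
   inv_under_Int[OF *(2) inv_under_UU[OF *(1)]] by (simp add: Int_commute)
qed

text \<open>The pairing of L with C. Any \<open>U\<close> under which \<open>f\<close> is invariant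
  gives the same value: \<open>pr_eq\<close> passes to an intersection, where the compatibility of
  the family applies.\<close>

definition pr :: "('g set \<times> 'g set => 'k) => ('g => 'k) => 'k::field" where
 "pr x f = (let U = (SOME U. inv_under U f) in \<Sum>C\<in>Q U. x (U, C) * f (rc C))"

lemma cga_support: "x : cga ==> x (U, C) ~= 0 ==> U : UU \<and> C : Q U"
 and cga_compatible: "x : cga ==> U : UU ==> V : UU ==> U <= V ==> C : Q V ==>
  x (V, C) = (\<Sum>B\<in>{B : Q U. B <= C}. x (U, B))"
 unfolding complete_group_algebra_def by blast+

lemma sum_Q_refine:
 assumes "U : UU" "V : UU" "U <= V"
 shows "(\<Sum>C\<in>Q V. \<Sum>B\<in>{B : Q U. B <= C}. h B) = (\<Sum>B\<in>Q U. h B :: 'k::field)"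
proof -
 have "{B : Q U. B <= C} = {B : Q U. V #> rc B = C}" if "C : Q V" for C
  using Q_subset[OF assms _ that] by blast
 then have "(\<Sum>C\<in>Q V. \<Sum>B\<in>{B : Q U. B <= C}. h B) = (\<Sum>C\<in>Q V. \<Sum>B\<in>{B : Q U. V #> rc B = C}. h B)"
  by (intro sum.cong) simp_all
 also have "... = (\<Sum>B\<in>Q U. h B)"
  by (rule sum.group) (use assms finite_Q rc Q_I in auto)
 finally show ?thesis .
qed

lemma pr_refine:
 assumes x: "x : cga" and U: "U : UU" "U <= V" and f: "inv_under V f"
 shows "(\<Sum>C\<in>Q V. x (V, C) * f (rc C)) = (\<Sum>B\<in>Q U. x (U, B) * f (rc B))"
proof -
 note V = inv_under_UU[OF f]
 have "x (V, C) * f (rc C) = (\<Sum>B\<in>{B : Q U. B <= C}. x (U, B) * f (rc B))" if C: "C : Q V" for C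
 proof -
  have "f (rc B) = f (rc C)" if "B : Q U" "B <= C" for B
  proof -
   have "rc B : C" using that rc_in[OF U(1)] by blast
   then have "E V (rc B) (rc C)"
    using E_rcoset[OF V] Q_mem[OF V C] rc_in[OF V C] by metis
   then show ?thesis by (rule inv_underD[OF f])
  qed
  then show ?thesis
   unfolding cga_compatible[OF x U(1) V U(2) C] sum_distrib_right by (intro sum.cong) simp_all
 qed
 then show ?thesis using sum_Q_refine[OF U(1) V U(2), of "%B. x (U, B) * f (rc B)"] by simp
qed

lemma pr_eq:
 assumes x: "x : cga" and f: "inv_under U f"
 shows "pr x f = (\<Sum>C\<in>Q U. x (U, C) * f (rc C))"
proof -
 define V where "V = (SOME U. inv_under U f)"
 have V: "inv_under V f" unfolding V_def by (rule someI[of "%U. inv_under U f" U, OF f])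
 note UU = inv_under_UU[OF f] inv_under_UU[OF V]
 show ?thesis
  using pr_refine[OF x UU_Int[OF UU] _ f] pr_refine[OF x UU_Int[OF UU] _ V]
  by (simp add: pr_def V_def[symmetric])
qed

lemma inv_under_add: "inv_under U f ==> inv_under U g ==> inv_under U (f + g)"
 and inv_under_scale: "inv_under U f ==> inv_under U (fscale c f)"
 unfolding inv_under_def by (metis plus_fun_apply, metis fscale_apply)

lemma pr_lin: "x : cga ==> lin_on lc (pr x)"
proof (rule lin_onI)
 assume x: "x : cga"
 fix f :: "'g => 'a" assume f: "f : lc"
 show "pr x (fscale c f) = c * pr x f" for c
 proof -
  obtain U where U: "inv_under U f" using lc_inv_under[OF f] by blast
  show ?thesis unfolding pr_eq[OF x U] pr_eq[OF x inv_under_scale[OF U]] sum_distrib_left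
   by (simp add: mult.left_commute)
 qed
 fix g :: "'g => 'a" assume g: "g : lc"
 show "pr x (f + g) = pr x f + pr x g"
 proof -
  obtain U where U: "inv_under U f" "inv_under U g" using inv_under2[OF f g] by blast
  show ?thesis
   unfolding pr_eq[OF x U(1)] pr_eq[OF x U(2)] pr_eq[OF x inv_under_add[OF U]] sum.distrib[symmetric]
   by (simp add: algebra_simps)
 qed
qed

lemmas pr_add = lin_on_add[OF pr_lin] and pr_scale = lin_on_scale[OF pr_lin]
 and pr_diff = lin_on_diff[OF lc_subspace pr_lin]
 and pr_sum = lin_on_sum[OF lc_subspace pr_lin]

lemma pr_0: "x : cga ==> pr x 0 = 0"
 by (rule lin_on_0[OF pr_lin lc_intros(5)])

lemma cga_subspace: "fscale.subspace (cga :: ('g set \<times> 'g set => 'k::field) set)"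
proof (rule fscale.subspaceI)
 show "(0 :: 'g set \<times> 'g set => 'k) : cga" by (simp add: complete_group_algebra_def)
 fix x y :: "'g set \<times> 'g set => 'k" and c assume x: "x : cga"
 show "fscale c x : cga"
  unfolding complete_group_algebra_def
 proof (intro CollectI conjI allI ballI impI)
  show "fscale c x (V, C) = (\<Sum>B\<in>{B : Q U. B <= C}. fscale c x (U, B))"
   if "U : UU" "V : UU" "U <= V" "C : Q V" for U V C
   by (simp only: fscale_apply cga_compatible[OF x that] sum_distrib_left)
 qed (use cga_support[OF x] in auto)
 assume y: "y : cga"
 show "x + y : cga"
  unfolding complete_group_algebra_def
 proof (intro CollectI conjI allI ballI impI)
  show "(x + y) (V, C) = (\<Sum>B\<in>{B : Q U. B <= C}. (x + y) (U, B))"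
   if "U : UU" "V : UU" "U <= V" "C : Q V" for U V C
   by (simp only: plus_fun_apply cga_compatible[OF x that] cga_compatible[OF y that] sum.distrib)
  show "U : UU" "C : Q U" if "(x + y) (U, C) ~= 0" for U C
   using that cga_support[OF x] cga_support[OF y] by (metis add.right_neutral plus_fun_apply)+
 qed
qed

lemmas cga_intros = fscale.subspace_add[OF cga_subspace] fscale.subspace_diff[OF cga_subspace]
 fscale.subspace_scale[OF cga_subspace] fscale.subspace_neg[OF cga_subspace]
 fscale.subspace_0[OF cga_subspace] fscale.subspace_sum[OF cga_subspace]

lemma pr_lin_left: "f : lc ==> lin_on cga (%x. pr x f)"
proof (rule lin_onI)
 assume "f : lc"
 then obtain U where U: "inv_under U f" using lc_inv_under by blast
 show "pr (x + y) f = pr x f + pr y f" if "x : cga" "y : cga" for x y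
  unfolding pr_eq[OF that(1) U] pr_eq[OF that(2) U] pr_eq[OF cga_intros(1)[OF that] U] sum.distrib[symmetric]
  by (simp add: algebra_simps)
 show "pr (fscale c x) f = c * pr x f" if "x : cga" for c x
  unfolding pr_eq[OF that(1) U] pr_eq[OF cga_intros(3)[OF that] U] sum_distrib_left by (simp add: mult.assoc)
qed

lemmas pr_add_left = lin_on_add[OF pr_lin_left] and pr_scale_left = lin_on_scale[OF pr_lin_left]
 and pr_diff_left = lin_on_diff[OF cga_subspace pr_lin_left]
 and pr_sum_left = lin_on_sum[OF cga_subspace pr_lin_left]

definition ind :: "'g set => 'g set => 'g => 'k::field" where
 "ind U C = (%y. if y : CG \<and> U #> y = C then 1 else 0)"

lemma inv_under_ind: "U : UU ==> inv_under U (ind U C :: 'g => 'k::field)"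
proof -
 assume U: "U : UU"
 have "ind U C x = (ind U C y :: 'k)" if "E U x y" for x y
  using E_carrier[OF U that] E_rcoset[OF U, of x y] that by (simp add: ind_def)
 then show ?thesis using U by (simp add: inv_under_def)
qed

lemma inv_under_lc: "inv_under U f ==> (\<And>x. x \<notin> CG ==> f x = 0) ==> f : lc"
 unfolding inv_under_def by (rule lcI[of f U]) auto

lemma ind_lc: "U : UU ==> ind U C : lc"
 by (rule inv_under_lc[OF inv_under_ind]) (simp_all add: ind_def)

lemma pr_ind: "x : cga ==> U : UU ==> C : Q U ==> pr x (ind U C) = x (U, C)"
proof -
 assume x: "x : cga" and U: "U : UU" and C: "C : Q U"
 have "x (U, D) * ind U C (rc D) = (if D = C then x (U, D) else 0)" if "D : Q U" for D
  using rc[OF U that] coset_rc[OF U that] by (simp add: ind_def)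
 then have "pr x (ind U C) = (\<Sum>D\<in>Q U. if D = C then x (U, D) else 0)"
  unfolding pr_eq[OF x inv_under_ind[OF U]] by (rule sum.cong[OF refl])
 then show ?thesis using finite_Q[OF U] C by simp
qed

lemma cga_eqI:
 assumes "x : cga" "y : cga" "\<And>f. f : lc ==> pr x f = pr y f"
 shows "x = y"
proof
 fix z :: "'g set \<times> 'g set"
 obtain U C where z: "z = (U, C)" by (cases z)
 show "x z = y z"
 proof (cases "U : UU \<and> C : Q U")
  case True
  then show ?thesis using pr_ind[of x U C] pr_ind[of y U C] assms(3)[OF ind_lc] assms(1,2) z by metis
 next
  case False
  then have "x z = 0" "y z = 0" unfolding z using cga_support[OF assms(1)] cga_support[OF assms(2)] by metis+
  then show ?thesis by simp
 qed
qed

lemma inv_under_lt: "inv_under U f ==> g : CG ==> inv_under U (lt g f)"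
 unfolding inv_under_def using lt_inv[of U g f] by blast

text \<open>Inverse to the pairing. The values of a functional on indicators of cosets form a
  compatible family, because the indicator of a coset of \<open>V\<close> is the sum of those of the
  smaller cosets inside it. Hence L is the full linear dual of C.\<close>

definition of_fun :: "(('g => 'k::field) => 'k) => 'g set \<times> 'g set => 'k" where
 "of_fun l = (%(U, C). if U : UU \<and> C : Q U then l (ind U C) else 0)"

lemma of_fun_cga:
 fixes l :: "('g => 'k::field) => 'k"
 assumes l: "lin_on lc l"
 shows "of_fun l : cga"
 unfolding complete_group_algebra_def
proof (intro CollectI conjI allI ballI impI)
 fix U V C assume U: "U : UU" and V: "V : UU" and UV: "U <= V" and C: "C : Q V"
 have "(ind V C :: 'g => 'k) = (\<Sum>B\<in>{B : Q U. B <= C}. ind U B)"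
 proof
  fix y
  show "(ind V C :: 'g => 'k) y = (\<Sum>B\<in>{B : Q U. B <= C}. ind U B) y"
  proof (cases "y : CG")
   case True
   have *: "U #> y <= C \<longleftrightarrow> V #> y = C"
   proof -
    have "E V (rc (U #> y)) y" using E_mono[OF UV E_rc[OF U True]] .
    then have "V #> rc (U #> y) = V #> y" using E_rcoset[OF V] E_carrier[OF V] by blast
    then show ?thesis using Q_subset[OF U V UV Q_I[OF True] C] by simp
   qed
   have "(\<Sum>B\<in>{B : Q U. B <= C}. ind U B :: 'g => 'k) y = (\<Sum>B\<in>{B : Q U. B <= C}. if B = U #> y then 1 else 0)"
    unfolding sum_apply by (rule sum.cong) (use True in \<open>auto simp: ind_def\<close>)
   also have "... = (if V #> y = C then 1 else 0)"
    using finite_Q[OF U] Q_I[OF True, of U] * by simp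
   finally show ?thesis using True by (simp add: ind_def[of V])
  qed (simp add: sum_apply ind_def)
 qed
 from arg_cong[OF this, of l] have "l (ind V C) = l (\<Sum>B\<in>{B : Q U. B <= C}. ind U B)" .
 also have "... = (\<Sum>B\<in>{B : Q U. B <= C}. l (ind U B))"
  by (rule lin_on_sum[OF lc_subspace l]) (rule ind_lc[OF U])
 finally have "l (ind V C) = (\<Sum>B\<in>{B : Q U. B <= C}. l (ind U B))" .
 then show "of_fun l (V, C) = (\<Sum>B\<in>{B : Q U. B <= C}. of_fun l (U, B))"
  using U V C by (simp add: of_fun_def)
qed (auto simp: of_fun_def split: if_splits)

lemma lc_ind_sum:
 assumes f: "f : lc" and U: "inv_under U f"
 shows "f = (\<Sum>C\<in>Q U. fscale (f (rc C)) (ind U C))"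
proof
 fix y
 show "f y = (\<Sum>C\<in>Q U. fscale (f (rc C)) (ind U C)) y"
 proof (cases "y : CG")
  case True
  have "(\<Sum>C\<in>Q U. fscale (f (rc C)) (ind U C)) y = (\<Sum>C\<in>Q U. if C = U #> y then f (rc C) else 0)"
   unfolding sum_apply by (rule sum.cong) (use True in \<open>auto simp: ind_def\<close>)
  also have "... = f (rc (U #> y))" using finite_Q[OF inv_under_UU[OF U]] Q_I[OF True] by simp
  also have "... = f y" by (rule inv_underD[OF U E_rc[OF inv_under_UU[OF U] True]])
  finally show ?thesis by simp
 qed (simp add: sum_apply ind_def lc_support[OF f])
qed

lemma pr_of_fun:
 assumes l: "lin_on lc l" and f: "f : lc"
 shows "pr (of_fun l) f = l f"
proof -
 obtain U where U: "inv_under U f" using lc_inv_under[OF f] by blast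
 have "l f = l (\<Sum>C\<in>Q U. fscale (f (rc C)) (ind U C))" using lc_ind_sum[OF f U] by simp
 also have "... = (\<Sum>C\<in>Q U. l (fscale (f (rc C)) (ind U C)))"
  by (rule lin_on_sum[OF lc_subspace l]) (intro lc_intros(3) ind_lc[OF inv_under_UU[OF U]])
 also have "... = (\<Sum>C\<in>Q U. of_fun l (U, C) * f (rc C))"
  using lin_on_scale[OF l ind_lc[OF inv_under_UU[OF U]]] inv_under_UU[OF U]
  by (intro sum.cong) (simp_all add: of_fun_def)
 finally show ?thesis unfolding pr_eq[OF of_fun_cga[OF l] U] by simp
qed

text \<open>The operator commutes with translation and gives back the pairing at the identity; so
  operators of this form compose as the elements multiply.\<close>

definition act :: "('g set \<times> 'g set => 'k::field) => ('g => 'k) => 'g => 'k" where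
 "act x f = (%y. if y : CG then pr x (lt y f) else 0)"

lemma inv_under_act: "inv_under U f ==> inv_under U (act x f)"
proof -
 assume U: "inv_under U f"
 have "act x f y = act x f z" if "E U y z" for y z
  using lt_E[OF inv_under_UU[OF U], of f y z] inv_underD[OF U] that E_carrier[OF inv_under_UU[OF U] that]
  by (simp add: act_def)
 then show ?thesis using inv_under_UU[OF U] by (simp add: inv_under_def)
qed

lemma act_lc: "f : lc ==> act x f : lc"
 using lc_inv_under[of f] inv_under_lc[OF inv_under_act] by (auto simp: act_def)

lemma lt_act: "g : CG ==> lt g (act x f) = act x (lt g f)"
proof
 fix y assume g: "g : CG"
 show "lt g (act x f) y = act x (lt g f) y"
 proof (cases "y : CG")
  case True
  then have "lt g (act x f) y = act x f (g \<otimes> y)" by (simp add: lt_def)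
  also have "... = act x (lt g f) y" using g True by (simp add: act_def lt_lt)
  finally show ?thesis .
 next
  case False
  then show ?thesis unfolding lt_def[of g "act x f"] by (simp add: act_def)
 qed
qed

lemma act_one: "f : lc ==> act x f \<one> = pr x f"
 by (simp add: act_def lt_one)

lemma act_add: "x : cga ==> f : lc ==> f' : lc ==> act x (f + f') = act x f + act x f'"
 and act_diff: "x : cga ==> f : lc ==> f' : lc ==> act x (f - f') = act x f - act x f'"
 and act_scale: "x : cga ==> f : lc ==> act x (fscale c f) = fscale c (act x f)"
 by (auto simp: act_def fun_eq_iff lt_add lt_diff lt_scale pr_add pr_diff pr_scale lt_lc)

lemma act_0: "x : cga ==> act x 0 = 0"
 by (auto simp: act_def fun_eq_iff lt_0 pr_0)

lemma act_kc: "x : cga ==> act x (kc c) = kc (c * pr x (kc 1))"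
proof -
 assume x: "x : cga"
 have "kc c = fscale c (kc 1)" by (simp add: kc_def fun_eq_iff)
 then have "pr x (kc c) = c * pr x (kc 1)" using pr_scale[OF x kc_lc] by metis
 then show ?thesis by (simp add: act_def lt_kc kc_def[of "c * _"] fun_eq_iff)
qed

text \<open>Multiplication is adjoint to the action: \<open>x y\<close> pairs with \<open>f\<close>
  as \<open>x\<close> does with \<open>y f\<close>. Together with \<open>cga_eqI\<close> this
  reduces the ring axioms to properties of the pairing.\<close>

lemma cga_mult_eq:
 assumes x: "x : cga" and y: "y : cga"
 shows "lin_on lc (%f. pr x (act y f))" and "cga_mult G x y = of_fun (%f. pr x (act y f))"
proof -
 show "lin_on lc (%f. pr x (act y f))"
  by (rule lin_onI) (simp_all add: act_add act_scale x y pr_add pr_scale act_lc)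
 show "cga_mult G x y = of_fun (%f. pr x (act y f))"
 proof
  fix z :: "'g set \<times> 'g set"
  obtain U C where z: "z = (U, C)" by (cases z)
  show "cga_mult G x y z = of_fun (%f. pr x (act y f)) z"
  proof (cases "U : UU")
   case False
   then have "x (U, A) = 0" for A using cga_support[OF x] by metis
   then show ?thesis using False by (simp add: z cga_mult_def of_fun_def cong: if_cong)
  next
   case U: True
   interpret UN: normal U G by (rule UU_normal[OF U])
   have m: "A \<otimes>\<^bsub>G Mod U\<^esub> B = U #> (rc A \<otimes> rc B)" if "A : Q U" "B : Q U" for A B
    using UN.rcos_sum[OF rc[OF U that(1)] rc[OF U that(2)]] coset_rc[OF U] that by simp
   show ?thesis
   proof (cases "C : Q U")
    case False
    then have "A \<otimes>\<^bsub>G Mod U\<^esub> B ~= C" if "A : Q U" "B : Q U" for A B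
     using m[OF that] Q_I[of "rc A \<otimes> rc B" U] rc[OF U] that by auto
    then show ?thesis using False by (simp add: z cga_mult_def of_fun_def)
   next
    case C: True
    have "pr x (act y (ind U C)) = (\<Sum>A\<in>Q U. x (U, A) * act y (ind U C) (rc A))"
     by (rule pr_eq[OF x inv_under_act[OF inv_under_ind[OF U]]])
    also have "... = (\<Sum>A\<in>Q U. \<Sum>B\<in>Q U. if A \<otimes>\<^bsub>G Mod U\<^esub> B = C then x (U, A) * y (U, B) else 0)"
    proof (rule sum.cong[OF refl])
     fix A assume A: "A : Q U"
     have iu: "inv_under U (lt (rc A) (ind U C) :: 'g => 'a)"
      by (rule inv_under_lt[OF inv_under_ind[OF U] rc[OF U A]])
     have "act y (ind U C) (rc A) = (\<Sum>B\<in>Q U. y (U, B) * lt (rc A) (ind U C) (rc B))"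
      using rc[OF U A] pr_eq[OF y iu] by (simp add: act_def)
     also have "... = (\<Sum>B\<in>Q U. if A \<otimes>\<^bsub>G Mod U\<^esub> B = C then y (U, B) else 0)"
      using m[OF A] rc[OF U A] rc[OF U] by (intro sum.cong) (simp_all add: lt_def ind_def)
     finally show "x (U, A) * act y (ind U C) (rc A) =
       (\<Sum>B\<in>Q U. if A \<otimes>\<^bsub>G Mod U\<^esub> B = C then x (U, A) * y (U, B) else 0)"
      by (simp only: sum_distrib_left if_distrib[of "%t. x (U, A) * t"] mult_zero_right)
    qed
    finally show ?thesis using U C by (simp add: z cga_mult_def of_fun_def)
   qed
  qed
 qed
qed

lemma cga_mult_closed: "x : cga ==> y : cga ==> cga_mult G x y : cga"
 unfolding cga_mult_eq(2) by (rule of_fun_cga[OF cga_mult_eq(1)])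

lemma pr_mult: "x : cga ==> y : cga ==> f : lc ==> pr (cga_mult G x y) f = pr x (act y f)"
 unfolding cga_mult_eq(2) by (rule pr_of_fun[OF cga_mult_eq(1)])

lemma act_mult: "x : cga ==> y : cga ==> f : lc ==> act (cga_mult G x y) f = act x (act y f)"
 by (auto simp: act_def[of "cga_mult G x y"] act_def[of x] fun_eq_iff pr_mult lt_lc lt_act)

lemma cga_one_eq: "(cga_one G T :: _ => 'k::field) = of_fun (%f. f \<one>)"
 and lin_on_at_one: "lin_on lc (%f :: 'g => 'k. f \<one>)"
proof -
 show "lin_on lc (%f :: 'g => 'k. f \<one>)" by (rule lin_onI) simp_all
 have "U #> \<one> = U" if "U : UU" for U using that UU_subset by (intro coset_mult_one) blast
 then have "of_fun (%f. f \<one>) (U, C) = (cga_one G T (U, C) :: 'k)" for U C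
  using Q_I[of \<one> U] by (auto simp: of_fun_def cga_one_def ind_def)
 then show "(cga_one G T :: _ => 'k) = of_fun (%f. f \<one>)" by (simp add: fun_eq_iff)
qed

lemma cga_one_closed: "cga_one G T : cga"
 and pr_one: "f : lc ==> pr (cga_one G T) f = f \<one>"
 unfolding cga_one_eq by (rule of_fun_cga[OF lin_on_at_one], rule pr_of_fun[OF lin_on_at_one])

lemma act_cga_one: "f : lc ==> act (cga_one G T) f = f"
 using lc_support[of f] by (auto simp: act_def fun_eq_iff pr_one lt_lc) (simp add: lt_def)

abbreviation "aug \<equiv> augmentation_ideal G T"
abbreviation "apow \<equiv> augmentation_power G T"

text \<open>The augmentation is the pairing with the constant function 1, which is invariant under
  every \<open>U\<close>.\<close>

lemma aug_iff: "x : aug \<longleftrightarrow> x : cga \<and> pr x (kc 1) = 0"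
proof -
 have "pr x (kc 1) = (\<Sum>C\<in>Q U. x (U, C))" if x: "x : cga" and U: "U : UU" for U
 proof -
  have "inv_under U (kc 1 :: 'g => 'a)" using U E_carrier[OF U] by (auto simp: inv_under_def kc_def)
  from pr_eq[OF x this] show ?thesis using rc[OF U] by (simp add: kc_def)
 qed
 then show ?thesis unfolding augmentation_ideal_def using UU_carrier by auto
qed

lemma cga_mult_assoc: "x : cga ==> y : cga ==> z : cga ==>
  cga_mult G (cga_mult G x y) z = cga_mult G x (cga_mult G y z)"
 by (rule cga_eqI) (simp_all add: cga_mult_closed pr_mult act_mult act_lc)

lemma cga_mult_add_left: "x : cga ==> x' : cga ==> y : cga ==>
  cga_mult G (x + x') y = cga_mult G x y + cga_mult G x' y"
 by (rule cga_eqI) (simp_all add: cga_mult_closed cga_intros(1) pr_mult pr_add_left act_lc)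

lemma act_add_left: "x : cga ==> x' : cga ==> f : lc ==> act (x + x') f = act x f + act x' f"
 and act_scale_left: "x : cga ==> f : lc ==> act (fscale c x) f = fscale c (act x f)"
 by (auto simp: act_def fun_eq_iff pr_add_left pr_scale_left lt_lc)

lemma cga_mult_add_right: "x : cga ==> y : cga ==> y' : cga ==>
  cga_mult G x (y + y') = cga_mult G x y + cga_mult G x y'"
 by (rule cga_eqI) (simp_all add: cga_mult_closed cga_intros(1) pr_mult act_add_left pr_add pr_add_left act_lc)

lemma cga_mult_scale_left: "x : cga ==> y : cga ==>
  cga_mult G (fscale c x) y = fscale c (cga_mult G x y)"
 by (rule cga_eqI) (simp_all only: cga_mult_closed cga_intros(3) pr_mult pr_scale_left act_lc)

lemma cga_mult_scale_right: "x : cga ==> y : cga ==>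
  cga_mult G x (fscale c y) = fscale c (cga_mult G x y)"
 by (rule cga_eqI) (simp_all only: cga_mult_closed cga_intros(3) pr_mult act_scale_left pr_scale pr_scale_left act_lc)

lemma cga_one_mult: "x : cga ==> cga_mult G (cga_one G T) x = x"
 by (rule cga_eqI) (simp_all only: cga_mult_closed cga_one_closed pr_mult pr_one act_lc act_one)

lemma cga_mult_one: "x : cga ==> cga_mult G x (cga_one G T) = x"
 by (rule cga_eqI) (simp_all only: cga_mult_closed cga_one_closed pr_mult act_cga_one)

lemma aug_subspace: "fscale.subspace (aug :: ('g set \<times> 'g set => 'k::field) set)"
 by (rule fscale.subspaceI)
  (simp_all only: aug_iff cga_intros lin_on_0[OF pr_lin_left[OF kc_lc]] pr_add_left[OF kc_lc] pr_scale_left[OF kc_lc]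
   add_0 mult_zero_right simp_thms)

lemma aug_mult: "x : cga ==> y : aug ==> cga_mult G x y : aug"
 unfolding aug_iff by (simp add: cga_mult_closed pr_mult kc_lc act_kc) (simp add: kc_def pr_0[unfolded zero_fun_def])

lemma aug_mult_right: "x : aug ==> y : cga ==> cga_mult G x y : aug"
 unfolding aug_iff using pr_scale[of x "kc 1"] 
 by (simp add: cga_mult_closed pr_mult kc_lc act_kc) (simp add: kc_def fscale_def if_distrib cong: if_cong)

lemma apow_subspace: "fscale.subspace (apow n :: ('g set \<times> 'g set => 'k::field) set)"
 by (cases n) (simp_all only: augmentation_power.simps cga_subspace fscale.subspace_span)

lemmas apow_intros = fscale.subspace_add[OF apow_subspace] fscale.subspace_diff[OF apow_subspace]
 fscale.subspace_scale[OF apow_subspace] fscale.subspace_neg[OF apow_subspace]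
 fscale.subspace_0[OF apow_subspace] fscale.subspace_sum[OF apow_subspace]

lemma apow_minimal:
 assumes "fscale.subspace S" "\<And>x y. x : apow n ==> y : aug ==> cga_mult G x y : S" "z : apow (Suc n)"
 shows "z : S"
proof -
 have "apow (Suc n) <= S"
  unfolding augmentation_power.simps by (rule fscale.span_minimal) (use assms(1,2) in blast)+
 then show ?thesis using assms(3) by blast
qed

lemma apow_gen: "x : apow n ==> y : aug ==> cga_mult G x y : apow (Suc n)"
 unfolding augmentation_power.simps by (rule fscale.span_base) blast

lemma apow_cga: "z : apow n ==> z : cga"
proof (induction n arbitrary: z)
 case (Suc n)
 show ?case
  by (rule apow_minimal[OF cga_subspace _ Suc.prems])
   (simp only: cga_mult_closed Suc.IH aug_iff)
qed simp

lemma apow_1: "apow (Suc 0) = aug"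
proof (intro subset_antisym subsetI)
 show "x : aug" if "x : apow (Suc 0)" for x
  by (rule apow_minimal[OF aug_subspace _ that]) (simp add: aug_mult)
 show "x : apow (Suc 0)" if "x : aug" for x
  using apow_gen[of "cga_one G T" 0 x] that cga_one_closed cga_one_mult[of x] by (simp add: aug_iff)
qed

text \<open>Powers grow on the right by definition, so the induction is on \<open>n\<close>; the
  start \<open>n = 0\<close> uses that I is also a right ideal.\<close>

lemma apow_mult: "x : apow m ==> y : apow n ==> cga_mult G x y : apow (m + n)"
proof (induction n arbitrary: y)
 case 0
 show ?case
 proof (cases m)
  case 0
  with \<open>x : apow m\<close> \<open>y : apow 0\<close> show ?thesis by (simp add: cga_mult_closed)
 next
  case (Suc j)
  define S where "S = {z : cga. cga_mult G z y : apow (Suc j)}"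
  have y: "y : cga" using 0 by simp
  have "fscale.subspace S"
  proof (rule fscale.subspaceI)
   have "cga_mult G 0 y = 0" using cga_mult_scale_left[OF cga_intros(5) y, of 0] by simp
   then show "0 : S" unfolding S_def by (simp only: mem_Collect_eq cga_intros(5) apow_intros(5) simp_thms)
  qed (simp_all only: S_def mem_Collect_eq cga_intros(1,3) cga_mult_add_left[OF _ _ y] cga_mult_scale_left[OF _ y] apow_intros(1,3) simp_thms)
  then have "x : S"
  proof (rule apow_minimal)
   show "x : apow (Suc j)" using 0 Suc by simp
   show "cga_mult G u v : S" if "u : apow j" "v : aug" for u v
    using apow_gen[OF that(1) aug_mult_right[OF that(2) y]] that apow_cga[OF that(1)] y
    by (simp only: S_def mem_Collect_eq cga_mult_closed cga_mult_assoc aug_iff simp_thms)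
  qed
  then show ?thesis using Suc by (simp add: S_def)
 qed
next
 case (Suc n)
 define S where "S = {z : cga. cga_mult G x z : apow (m + Suc n)}"
 have x: "x : cga" using Suc(2) by (rule apow_cga)
 have "fscale.subspace S"
 proof (rule fscale.subspaceI)
  have "cga_mult G x 0 = 0" using cga_mult_scale_right[OF x cga_intros(5), of 0] by simp
  then show "0 : S" unfolding S_def by (simp only: mem_Collect_eq cga_intros(5) apow_intros(5) simp_thms)
 qed (simp_all only: S_def mem_Collect_eq cga_intros(1,3) cga_mult_add_right[OF x] cga_mult_scale_right[OF x] apow_intros(1,3) simp_thms)
 then have "y : S"
 proof (rule apow_minimal[OF _ _ Suc(3)])
  show "cga_mult G u v : S" if "u : apow n" "v : aug" for u v
   using apow_gen[OF Suc(1)[OF Suc(2) that(1)] that(2)] that apow_cga[OF that(1)] x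
   by (simp only: S_def mem_Collect_eq cga_mult_closed cga_mult_assoc aug_iff simp_thms add_Suc_right)
 qed
 then show ?case by (simp add: S_def)
qed

lemma apow_Suc: "z : apow (Suc n) ==> z : apow n"
proof (rule apow_minimal[OF apow_subspace])
 show "cga_mult G x y : apow n" if "x : apow n" "y : aug" for x y
  using apow_mult[of x n y 0] that by (simp add: aug_iff)
qed

lemma apow_add: "z : apow (n + j) ==> z : apow n"
 by (induction j) (use apow_Suc in auto)

lemma apow_mono: "n \<le> m ==> z : apow m ==> z : apow n"
 using apow_add[of z n "m - n"] by simp

sublocale Gr: subquotient "cga_mult G" "cga_one G T :: _ => 'k::field" apow "%n. apow (Suc n)"
proof
 show "apow (Suc n) <= (apow n :: ('g set \<times> 'g set => 'k) set)" for n using apow_Suc by blast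
 show "cga_mult G x y : apow (m + n)" if "x : apow m" "y : apow n" for x y :: "_ => 'k" and m n
  using that by (rule apow_mult)
 show "cga_mult G x y : apow (Suc (m + n))" if "x : apow (Suc m)" "y : apow n" for x y :: "_ => 'k" and m n
  using apow_mult[OF that] by simp
 show "cga_mult G x y : apow (Suc (m + n))" if "x : apow m" "y : apow (Suc n)" for x y :: "_ => 'k" and m n
  using apow_mult[OF that] by simp
 show "cga_one G T : (apow 0 :: ('g set \<times> 'g set => 'k) set)" by (simp add: cga_one_closed)
 show "cga_one G T \<notin> (apow (Suc 0) :: ('g set \<times> 'g set => 'k) set)"
  unfolding apow_1 aug_iff by (simp add: pr_one kc_lc) (simp add: kc_def)
 show "\<exists>c. x - fscale c (cga_one G T) : apow (Suc 0)" if "x : apow 0" for x :: "_ => 'k"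
 proof
  have x: "x : cga" using that by simp
  have "pr (x - fscale (pr x (kc 1)) (cga_one G T)) (kc 1) = pr x (kc 1) - pr x (kc 1) * (kc 1 \<one>)"
   by (simp only: pr_diff_left[OF kc_lc] pr_scale_left[OF kc_lc] x cga_intros(3) cga_one_closed pr_one[OF kc_lc])
  also have "... = 0" by (simp add: kc_def)
  finally show "x - fscale (pr x (kc 1)) (cga_one G T) : apow (Suc 0)"
   unfolding apow_1 aug_iff using cga_intros(2)[OF x cga_intros(3)[OF cga_one_closed]] by blast
 qed
qed (simp_all only: apow_subspace apow_cga cga_mult_assoc cga_mult_add_left cga_mult_add_right cga_mult_scale_left cga_mult_scale_right
  cga_one_mult cga_mult_one)

end

section \<open>Presentation of the augmentation ideal\<close>

context pro_p begin

lemma lin_on_subset: "lin_on V f ==> W <= V ==> lin_on W f"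
 unfolding lin_on_def by blast

definition c1 :: "('g => 'k::field) => 'g list => 'k" where
 "c1 f = (%zs. if length zs = 1 then f (hd zs) else 0)"

definition c2 :: "('g => 'g => 'k::field) => 'g list => 'k" where
 "c2 F = (%zs. if length zs = 2 \<and> over zs then F (zs ! 0) (zs ! 1) else 0)"

lemma c1_cochain: "f : lc ==> c1 f : Ch 1"
proof -
 assume f: "f : lc"
 obtain U where U: "inv_under U f" using lc_inv_under[OF f] by blast
 show ?thesis
 proof (rule cochainsI[OF _ inv_under_UU[OF U]])
  fix xs assume nz: "c1 f xs ~= 0"
  then have "length xs = 1" by (auto simp: c1_def split: if_splits)
  then obtain x where x: "xs = [x]" by (auto simp: length_Suc_conv)
  with nz have "f x ~= 0" by (simp add: c1_def)
  then show "length xs = 1 \<and> over xs" using x lc_support[OF f] by auto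
 next
  show "cochain_inv U (c1 f)"
   unfolding cochain_inv_def
  proof (intro allI impI)
   fix xs ys assume l: "list_all2 (E U) xs ys"
   show "c1 f xs = c1 f ys"
   proof (cases "length xs = 1")
    case True
    then obtain x where x: "xs = [x]" by (auto simp: length_Suc_conv)
    then obtain y where "ys = [y]" "E U x y" using l by (auto simp: list_all2_Cons1)
    then show ?thesis using x inv_underD[OF U] by (simp add: c1_def)
   next
    case False
    then show ?thesis using list_all2_lengthD[OF l] by (simp add: c1_def)
   qed
  qed
 qed
qed

lemma cochain_1_lc:
 assumes z: "z : Ch 1"
 shows "(%x. z [x]) : lc" and "z = c1 (%x. z [x])"
proof -
 obtain U where U: "U : UU" "cochain_inv U z" using cochains_inv[OF z] by blast
 show "(%x. z [x]) : lc"
 proof (rule lcI[OF _ U(1)])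
  show "z [x] = 0" if "x \<notin> CG" for x using cochains_support[OF z, of "[x]"] that by auto
  show "z [x] = z [y]" if "E U x y" for x y using U(2) that unfolding cochain_inv_def by simp
 qed
 show "z = c1 (%x. z [x])"
 proof
  fix zs show "z zs = c1 (%x. z [x]) zs"
  proof (cases "length zs = 1")
   case True
   then obtain x where x: "zs = [x]" by (auto simp: length_Suc_conv)
   then show ?thesis by (simp add: c1_def)
  next
   case False
   then show ?thesis using cochains_support[OF z, of zs] by (auto simp: c1_def)
  qed
 qed
qed

lemma coboundary_c1:
 "coboundary G (c1 f) = c2 (%x y. f y - f (x \<otimes> y) + f x)"
proof
 fix zs
 show "coboundary G (c1 f) zs = c2 (%x y. f y - f (x \<otimes> y) + f x) zs"
 proof (cases "over zs")
  case True
  show ?thesis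
  proof (cases "length zs = 2")
   case l: True
   then obtain x y where zs: "zs = [x, y]" by (auto simp: length_Suc_conv numeral_2_eq_2)
   then show ?thesis using True unfolding coboundary_tr[OF True] by (simp add: c1_def c2_def)
  next
   case False
   have "tr (c1 f) zs = 0" by (rule tcob_length[of _ _ 1]) (use False in \<open>auto simp: c1_def split: if_splits\<close>)
   then show ?thesis using False unfolding coboundary_tr[OF True] by (simp add: c2_def)
  qed
 qed (simp add: coboundary_outside c2_def)
qed

lemma coboundary_c2:
 assumes "over [x, y, z]"
 shows "coboundary G (c2 F) [x, y, z] = F y z - F (x \<otimes> y) z + F x (y \<otimes> z) - F x y"
 using assms unfolding coboundary_tr[OF assms] by (simp add: c2_def algebra_simps)

lemma c2_cocycle:
 assumes U: "U : UU" "\<And>x x' y y'. E U x x' ==> E U y y' ==> F x y = F x' y'"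
  and F: "\<And>x y z. over [x, y, z] ==> F y z - F (x \<otimes> y) z + F x (y \<otimes> z) - F x y = 0"
 shows "c2 F : Cy 2"
 unfolding cocycles_iff
proof
 show c: "c2 F : Ch 2"
 proof (rule cochainsI[OF _ U(1)])
  show "length xs = 2 \<and> over xs" if "c2 F xs ~= 0" for xs
   using that by (auto simp: c2_def split: if_splits)
  show "cochain_inv U (c2 F)"
   unfolding cochain_inv_def
  proof (intro allI impI)
   fix xs ys assume l: "list_all2 (E U) xs ys"
   show "c2 F xs = c2 F ys"
   proof (cases "length xs = 2")
    case True
    then obtain x x' where x: "xs = [x, x']" by (auto simp: length_Suc_conv numeral_2_eq_2)
    then obtain y y' where "ys = [y, y']" "E U x y" "E U x' y'" using l by (auto simp: list_all2_Cons1)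
    then show ?thesis using x U(2)[of x y x' y'] E_carrier[OF U(1), of x y] E_carrier[OF U(1), of x' y']
     by (simp add: c2_def)
   next
    case False
    then show ?thesis using list_all2_lengthD[OF l] by (simp add: c2_def)
   qed
  qed
 qed
 show "coboundary G (c2 F) = 0"
 proof
  fix zs
  show "coboundary G (c2 F) zs = 0 zs"
  proof (cases "length zs = 3 \<and> over zs")
   case True
   then obtain x y z where zs: "zs = [x, y, z]" by (auto simp: length_Suc_conv numeral_3_eq_3)
   then have "over [x, y, z]" using True by simp
   from coboundary_c2[OF this, of F] F[OF this] show ?thesis by (simp add: zs)
  next
   case False
   then show ?thesis using cochains_support[OF coboundary_cochains[OF c], of zs] by auto
  qed
 qed
qed

lemma cup_c1: "conc (c1 f) (c1 g) = c2 (%x y. f x * g y)" if "f : lc" "g : lc"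
proof
 fix zs
 have "conc (c1 f) (c1 g) zs = (if 1 \<le> length zs then c1 f (take 1 zs) * c1 g (drop 1 zs) else 0)"
  by (rule conc_homogeneous) (simp add: c1_def split: if_splits)
 also have "... = c2 (%x y. f x * g y) zs"
 proof (cases "length zs = 2")
  case True
  then obtain x y where zs: "zs = [x, y]" by (auto simp: length_Suc_conv numeral_2_eq_2)
  then show ?thesis using lc_support that by (auto simp: c1_def c2_def)
 qed (auto simp: c1_def c2_def)
 finally show "conc (c1 f) (c1 g) zs = c2 (%x y. f x * g y) zs" .
qed

text \<open>\<open>C^d\<close> is realized as functions on pairs of an index and a group element, so
  that extension and factorization of functionals apply to it as to any function space;
  \<open>slot\<close> and \<open>comp\<close> are its injections and projections.\<close>

definition slot :: "nat => ('g => 'k) => nat \<times> 'g => 'k::field" where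
 "slot j f = (%(i, y). if i = j then f y else 0)"

definition comp :: "(nat \<times> 'g => 'k) => nat => 'g => 'k::field" where
 "comp F j = (%y. F (j, y))"

lemma comp_slot: "comp (slot j f) i = (if i = j then f else 0)"
 and comp_add: "comp (F + F') i = comp F i + comp F' i"
 and comp_diff: "comp (F - F') i = comp F i - comp F' i"
 and comp_scale: "comp (fscale c F) i = fscale c (comp F i)"
 and comp_0: "comp 0 i = 0"
 by (auto simp: comp_def slot_def fun_eq_iff)

lemma comp_sum: "comp (\<Sum>j\<in>J. F j) i = (\<Sum>j\<in>J. comp (F j) i)"
 by (simp add: comp_def sum_apply fun_eq_iff)

lemma comp_eqI: "(\<And>i. comp F i = comp F' i) ==> F = F'"
 by (auto simp: comp_def fun_eq_iff)

lemma slot_add: "slot j (f + g) = slot j f + slot j g"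
 and slot_scale: "slot j (fscale c f) = fscale c (slot j f)"
 by (auto simp: slot_def fun_eq_iff)

definition lcd :: "nat => (nat \<times> 'g => 'k::field) set" where
 "lcd d = {F. \<forall>j. comp F j : lc \<and> (d \<le> j --> comp F j = 0)}"

lemma lcd_subspace: "fscale.subspace (lcd d :: (nat \<times> 'g => 'k::field) set)"
 unfolding lcd_def
 by (rule fscale.subspaceI; simp only: mem_Collect_eq comp_add comp_scale comp_0 lc_intros(1,3,5) simp_thms; simp)

lemma lcd_comp: "F : lcd d ==> comp F j : lc"
 and lcd_comp_0: "F : lcd d ==> d \<le> j ==> comp F j = 0"
 by (simp_all add: lcd_def)

lemma slot_lcd: "f : lc ==> j < d ==> slot j f : lcd d"
 unfolding lcd_def mem_Collect_eq comp_slot using lc_intros(5) by auto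

lemma sum_slot: "F : lcd d ==> F = (\<Sum>j<d. slot j (comp F j))"
proof (rule comp_eqI)
 fix i assume F: "F : lcd d"
 have "comp (\<Sum>j<d. slot j (comp F j)) i = (\<Sum>j<d. if j = i then comp F j else 0)"
  unfolding comp_sum comp_slot by (rule sum.cong) auto
 then show "comp F i = comp (\<Sum>j<d. slot j (comp F j)) i" using lcd_comp_0[OF F, of i] by simp
qed

lemma sum_slot_lcd: "(\<And>j. j < d ==> f j : lc) ==> (\<Sum>j<d. slot j (f j)) : lcd d"
 by (rule fscale.subspace_sum[OF lcd_subspace]) (simp add: slot_lcd)

lemma comp_sum_slot: "i < d ==> comp (\<Sum>j<d. slot j (f j)) i = f i"
proof -
 assume i: "i < d"
 have "comp (\<Sum>j<d. slot j (f j)) i = (\<Sum>j<d. if j = i then f j else 0)"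
  unfolding comp_sum comp_slot by (rule sum.cong) auto
 then show ?thesis using i by simp
qed

text \<open>A functional on \<open>C^d\<close> is a tuple of elements of L, namely its restrictions
  to the summands.\<close>

definition part :: "((nat \<times> 'g => 'k::field) => 'k) => nat => 'g set \<times> 'g set => 'k" where
 "part L j = of_fun (%f. L (slot j f))"

lemma part_cga: "lin_on UNIV L ==> part L j : cga"
 and pr_part: "lin_on UNIV L ==> f : lc ==> pr (part L j) f = L (slot j f)"
proof -
 assume L: "lin_on UNIV L"
 have "lin_on lc (%f. L (slot j f))"
  by (rule lin_onI) (simp_all only: slot_add slot_scale lin_on_add[OF L UNIV_I UNIV_I] lin_on_scale[OF L UNIV_I])
 from of_fun_cga[OF this] pr_of_fun[OF this] show "part L j : cga" "f : lc ==> pr (part L j) f = L (slot j f)"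
  by (simp_all add: part_def)
qed

lemma part_sum: "lin_on UNIV L ==> F : lcd d ==> (\<Sum>j<d. pr (part L j) (comp F j)) = L F"
proof -
 assume L: "lin_on UNIV L" and F: "F : lcd d"
 have "L F = L (\<Sum>j<d. slot j (comp F j))" using sum_slot[OF F] by simp
 also have "... = (\<Sum>j<d. L (slot j (comp F j)))" by (rule lin_on_sum[OF fscale.subspace_UNIV L]) simp
 finally show ?thesis using pr_part[OF L lcd_comp[OF F]] by simp
qed

text \<open>The map from C to \<open>C^d\<close> dual to
  \<open>(v_j) \<mapsto> \<Sum> v_j x_j\<close>; \<open>cod\<close> below is dual to
  \<open>a \<mapsto> (a r_j)\<close>.\<close>

definition opd :: "nat => (nat => 'g set \<times> 'g set => 'k::field) => ('g => 'k) => nat \<times> 'g => 'k" where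
 "opd d x f = (\<Sum>j<d. slot j (act (x j) f))"

lemma opd_lcd: "f : lc ==> opd d x f : lcd d"
 unfolding opd_def by (rule sum_slot_lcd) (rule act_lc)

lemma comp_opd: "i < d ==> comp (opd d x f) i = act (x i) f"
 unfolding opd_def by (rule comp_sum_slot)

lemma lcd_eqI: "F : lcd d ==> F' : lcd d ==> (\<And>i. i < d ==> comp F i = comp F' i) ==> F = F'"
 by (rule comp_eqI) (metis lcd_comp_0 not_less)

lemma opd_add: "(\<And>j. j < d ==> x j : cga) ==> f : lc ==> g : lc ==> opd d x (f + g) = opd d x f + opd d x g"
 by (rule lcd_eqI[OF opd_lcd fscale.subspace_add[OF lcd_subspace opd_lcd opd_lcd]])
  (simp_all only: lc_intros comp_add comp_opd act_add)

lemma opd_scale: "(\<And>j. j < d ==> x j : cga) ==> f : lc ==> opd d x (fscale c f) = fscale c (opd d x f)"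
 by (rule lcd_eqI[OF opd_lcd fscale.subspace_scale[OF lcd_subspace opd_lcd]])
  (simp_all only: lc_intros comp_scale comp_opd act_scale)

definition ltd :: "'g => (nat \<times> 'g => 'k::field) => nat \<times> 'g => 'k" where
 "ltd g F = (%(j, y). lt g (comp F j) y)"

lemma comp_ltd: "comp (ltd g F) j = lt g (comp F j)"
 by (simp add: comp_def ltd_def)

lemma ltd_lcd: "g : CG ==> F : lcd d ==> ltd g F : lcd d"
 unfolding lcd_def mem_Collect_eq comp_ltd by (simp add: lt_lc lt_0)

lemma ltd_add: "ltd g (F + F') = ltd g F + ltd g F'"
 and ltd_diff: "ltd g (F - F') = ltd g F - ltd g F'"
 and ltd_scale: "ltd g (fscale c F) = fscale c (ltd g F)"
 by (rule comp_eqI; simp only: comp_ltd comp_add comp_diff comp_scale lt_add lt_diff lt_scale)+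

lemma ltd_0: "ltd g 0 = 0"
 using ltd_scale[of g 0 0] by simp

lemma ltd_ltd: "x : CG ==> y : CG ==> ltd y (ltd x F) = ltd (x \<otimes> y) F"
 by (rule comp_eqI) (simp only: comp_ltd lt_lt)

lemma ltd_opd: "g : CG ==> f : lc ==> ltd g (opd d x f) = opd d x (lt g f)"
 by (rule lcd_eqI[OF ltd_lcd opd_lcd]) (simp_all only: opd_lcd lt_lc comp_ltd comp_opd lt_act)

definition cod :: "nat => (nat => 'g set \<times> 'g set => 'k::field) => (nat \<times> 'g => 'k) => 'g => 'k" where
 "cod d r F = (\<Sum>j<d. act (r j) (comp F j))"

lemma cod_lc: "F : lcd d ==> cod d r F : lc"
 unfolding cod_def by (rule lc_intros(6)) (simp add: act_lc lcd_comp)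

lemma cod_add: "(\<And>j. j < d ==> r j : cga) ==> F : lcd d ==> F' : lcd d ==> cod d r (F + F') = cod d r F + cod d r F'"
 unfolding cod_def sum.distrib[symmetric] comp_add
 by (rule sum.cong) (simp_all only: act_add lcd_comp lessThan_iff)

lemma cod_diff: "(\<And>j. j < d ==> r j : cga) ==> F : lcd d ==> F' : lcd d ==> cod d r (F - F') = cod d r F - cod d r F'"
 unfolding cod_def sum_subtractf[symmetric] comp_diff
 by (rule sum.cong) (simp_all only: act_diff lcd_comp lessThan_iff)

lemma cod_scale: "(\<And>j. j < d ==> r j : cga) ==> F : lcd d ==> cod d r (fscale c F) = fscale c (cod d r F)"
 unfolding cod_def fscale.scale_sum_right comp_scale
 by (rule sum.cong) (simp_all only: act_scale lcd_comp lessThan_iff)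

lemma lt_sum: "lt g (\<Sum>i\<in>I. f i) = (\<Sum>i\<in>I. lt g (f i))"
 by (auto simp: lt_def sum_apply fun_eq_iff)

lemma cod_ltd: "g : CG ==> cod d r (ltd g F) = lt g (cod d r F)"
 unfolding cod_def comp_ltd lt_sum by (simp add: lt_act)

text \<open>Actions commute with translation, so the value at \<open>y\<close> is the value at the
  identity after translating by \<open>y\<close>, and there the parts recombine to
  \<open>L\<close>.\<close>

lemma cod_part: "lin_on UNIV L ==> F : lcd d ==> y : CG ==> cod d (part L) F y = L (ltd y F)"
 unfolding part_sum[OF _ ltd_lcd, symmetric]
 by (simp add: cod_def sum_apply act_def comp_ltd)

lemma cod_slot: "(\<And>j. j < d ==> r j : cga) ==> i < d ==> cod d r (slot i f) = act (r i) f"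
proof -
 assume r: "\<And>j. j < d ==> r j : cga" and i: "i < d"
 have "cod d r (slot i f) = (\<Sum>j<d. if j = i then act (r j) f else 0)"
  unfolding cod_def comp_slot by (rule sum.cong) (simp_all add: r act_0)
 then show ?thesis using i by simp
qed

lemma sum_mult_0_cod:
 assumes "\<And>j. j < d ==> v j : cga" "\<And>j. j < d ==> x j : cga" "f : lc"
 shows "pr (\<Sum>j<d. cga_mult G (v j) (x j)) f = (\<Sum>j<d. pr (v j) (comp (opd d x f) j))"
proof -
 have "pr (\<Sum>j<d. cga_mult G (v j) (x j)) f = (\<Sum>j<d. pr (cga_mult G (v j) (x j)) f)"
  by (rule pr_sum_left[OF assms(3)]) (simp add: assms cga_mult_closed)
 also have "... = (\<Sum>j<d. pr (v j) (comp (opd d x f) j))"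
  by (rule sum.cong) (simp_all only: assms pr_mult comp_opd lessThan_iff)
 finally show ?thesis .
qed

lemma lev_mono: "n \<le> m ==> lev n <= lev m"
 using lev_Suc by (rule lift_Suc_mono_le)

end

text \<open>The \<open>\<psi> i\<close> with \<open>i < d\<close> form a basis of the continuous
  homomorphisms to k, that is of H^1, and \<open>\<beta>\<close> embeds H^2 into k. Nondegeneracy of
  the cup product is expressed later, through entries of its matrix \<open>b\<close>.\<close>

locale demushkin_data = pro_p p G T for p and G :: "('g, 'm) monoid_scheme" (structure) and T +
 fixes d :: nat and \<psi> :: "nat => 'g => 'k::{field,finite}" and \<beta> :: "('g list => 'k) => 'k"
 assumes char: "of_nat p = (0 :: 'k)"
  and \<psi>_lc: "\<psi> i : lc"
  and \<psi>_hom: "x : CG ==> y : CG ==> \<psi> i (x \<otimes> y) = \<psi> i x + \<psi> i y"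
  and \<psi>_span: "f : lc ==> (\<And>x y. x : CG ==> y : CG ==> f (x \<otimes> y) = f x + f y) ==>
   \<exists>c. f = (\<Sum>i<d. fscale (c i) (\<psi> i))"
  and \<psi>_indep: "(\<Sum>i<d. fscale (c i) (\<psi> i)) = 0 ==> i < d ==> c i = 0"
  and \<beta>_lin: "lin_on (Cy 2) \<beta>"
  and \<beta>_ker: "z : Cy 2 ==> \<beta> z = 0 \<longleftrightarrow> z : Cb 2"
begin

definition b :: "nat => nat => 'k" where
 "b i j = \<beta> (conc (c1 (\<psi> i)) (c1 (\<psi> j)))"

lemma \<psi>_one: "\<psi> i \<one> = 0"
 using \<psi>_hom[OF one_closed one_closed, of i] unfolding l_one[OF one_closed] by (metis add_cancel_right_right)

lemma lt_\<psi>: "g : CG ==> lt g (\<psi> i) = \<psi> i + kc (\<psi> i g)"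
 using lc_support[OF \<psi>_lc] by (auto simp: lt_def kc_def fun_eq_iff \<psi>_hom)

text \<open>The \<open>\<psi> i\<close> vanish at the identity, so together with the constant 1 they
  are independent and values on them may be prescribed; the value 0 on the constant puts the element
  into I.\<close>

lemma dual_exists: "j < d ==> \<exists>x\<in>cga. pr x (kc 1) = 0 \<and> (\<forall>i<d. pr x (\<psi> i) = (if i = j then 1 else 0))"
proof -
 assume j: "j < d"
 define V where "V = {c :: nat => 'k. True}"
 \<comment> \<open>Position \<open>d\<close> of the coefficient vector carries the coefficient of
   the constant function.\<close>
 define A where "A c = (\<Sum>i<d. fscale (c i) (\<psi> i)) + fscale (c d) (kc 1)" for c
 obtain g where g: "lin_on UNIV g" "\<And>c. c : V ==> g (A c) = c j"
 proof (rule linear_factor[of V "%c. c j" A])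
  show "fscale.subspace V" by (simp add: V_def fscale.subspace_UNIV[unfolded UNIV_def])
  show "lin_on V (%c. c j)" by (rule lin_onI) simp_all
  show "A (c + c') = A c + A c'" for c c'
   by (simp add: A_def fun_eq_iff sum_apply sum.distrib algebra_simps)
  show "A (fscale a c) = fscale a (A c)" for a c
   by (simp add: A_def fun_eq_iff sum_apply sum_distrib_left algebra_simps)
  show "c j = 0" if "A c = 0" for c
  proof -
   have "A c \<one> = c d" by (simp add: A_def sum_apply \<psi>_one kc_def)
   then have "c d = 0" using that by simp
   then have "(\<Sum>i<d. fscale (c i) (\<psi> i)) = 0" using that by (simp add: A_def fscale_def[of 0] zero_fun_def[symmetric])
   then show ?thesis using \<psi>_indep j by blast
  qed
 qed blast
 have g': "lin_on lc g" by (rule lin_on_subset[OF g(1)]) simp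
 show ?thesis
 proof (intro bexI[of _ "of_fun g"] conjI allI impI)
  show "of_fun g : cga" by (rule of_fun_cga[OF g'])
  have "A (%i. if i = d then 1 else 0) = kc 1" by (simp add: A_def fun_eq_iff sum_apply)
  then show "pr (of_fun g) (kc 1) = 0"
   using g(2)[of "%i. if i = d then 1 else 0"] j unfolding pr_of_fun[OF g' kc_lc] by (simp add: V_def)
  fix i assume i: "i < d"
  have "(\<Sum>k<d. (if k = i then 1 else 0) * \<psi> k y) = (\<Sum>k<d. if k = i then \<psi> k y else 0)" for y
   by (rule sum.cong) auto
  then have "A (%k. if k = i then 1 else 0) = \<psi> i" using i by (simp add: A_def fun_eq_iff sum_apply)
  then show "pr (of_fun g) (\<psi> i) = (if i = j then 1 else 0)"
   using g(2)[of "%k. if k = i then 1 else 0"] unfolding pr_of_fun[OF g' \<psi>_lc] by (auto simp: V_def)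
 qed
qed

definition xi :: "nat => 'g set \<times> 'g set => 'k" where
 "xi j = (SOME x. x : cga \<and> pr x (kc 1) = 0 \<and> (\<forall>i<d. pr x (\<psi> i) = (if i = j then 1 else 0)))"

lemma xi: assumes "j < d" shows "xi j : cga \<and> pr (xi j) (kc 1) = 0 \<and> (\<forall>i<d. pr (xi j) (\<psi> i) = (if i = j then 1 else 0))"
 unfolding xi_def by (rule someI_ex[of "%x. x : cga \<and> pr x (kc 1) = 0 \<and> (\<forall>i<d. pr x (\<psi> i) = (if i = j then 1 else 0))"])
  (use dual_exists[OF assms] in blast)

lemma xi_cga: "j < d ==> xi j : cga"
 and xi_kc: "j < d ==> pr (xi j) (kc 1) = 0"
 and xi_\<psi>: "j < d ==> i < d ==> pr (xi j) (\<psi> i) = (if i = j then 1 else 0)"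
 using xi by blast+

lemma xi_aug: "j < d ==> xi j : aug"
 by (simp add: aug_iff xi_cga xi_kc)

lemma kc_0: "kc 0 = 0"
 by (simp add: kc_def fun_eq_iff)

lemma act_xi_kc: "j < d ==> act (xi j) (kc c) = 0"
 by (simp only: act_kc xi_cga xi_kc mult_zero_right kc_0)

lemma pr_aug_kc: "x : aug ==> pr x (kc c) = 0"
proof -
 assume "x : aug"
 then have x: "x : cga" "pr x (kc 1) = 0" by (simp_all add: aug_iff)
 have "pr x (kc c) = act x (kc c) \<one>" by (rule act_one[OF kc_lc, symmetric])
 also have "... = 0" unfolding act_kc[OF x(1)] x(2) by (simp add: kc_def)
 finally show ?thesis .
qed

lemma act_aug_\<psi>: "x : aug ==> act x (\<psi> i) = kc (pr x (\<psi> i))"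
proof
 fix y assume x: "x : aug"
 then have c: "x : cga" by (simp add: aug_iff)
 show "act x (\<psi> i) y = kc (pr x (\<psi> i)) y"
  using pr_aug_kc[OF x] by (simp add: act_def kc_def[of "pr x (\<psi> i)"] lt_\<psi> pr_add[OF c \<psi>_lc kc_lc])
qed

lemma act_xi_sum:
 assumes j: "j < d"
 shows "act (xi j) (\<Sum>i<d. fscale (c i) (\<psi> i)) = kc (c j)"
proof -
 have "pr (xi j) (lt y (\<Sum>i<d. fscale (c i) (\<psi> i))) = c j" if y: "y : CG" for y
 proof -
  have "pr (xi j) (lt y (\<Sum>i<d. fscale (c i) (\<psi> i))) = (\<Sum>i<d. pr (xi j) (fscale (c i) (lt y (\<psi> i))))"
   unfolding lt_sum lt_scale by (rule pr_sum[OF xi_cga[OF j]]) (intro lc_intros(3) lt_lc y \<psi>_lc)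
  also have "... = (\<Sum>i<d. if i = j then c i else 0)"
  proof (rule sum.cong[OF refl])
   fix i assume "i : {..<d}"
   have "pr (xi j) (fscale (c i) (lt y (\<psi> i))) = c i * pr (xi j) (lt y (\<psi> i))"
    by (rule pr_scale[OF xi_cga[OF j] lt_lc[OF y \<psi>_lc]])
   also have "pr (xi j) (lt y (\<psi> i)) = pr (xi j) (\<psi> i) + pr (xi j) (kc (\<psi> i y))"
    unfolding lt_\<psi>[OF y] by (rule pr_add[OF xi_cga[OF j] \<psi>_lc kc_lc])
   finally have e: "pr (xi j) (fscale (c i) (lt y (\<psi> i))) = c i * (pr (xi j) (\<psi> i) + pr (xi j) (kc (\<psi> i y)))" .
   show "pr (xi j) (fscale (c i) (lt y (\<psi> i))) = (if i = j then c i else 0)"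
    unfolding e using xi_\<psi>[OF j, of i] pr_aug_kc[OF xi_aug[OF j]] \<open>i : {..<d}\<close> by simp
  qed
  finally show ?thesis using j by simp
 qed
 then show ?thesis by (auto simp: act_def kc_def fun_eq_iff)
qed

lemma act_xi_\<psi>: "j < d ==> i < d ==> act (xi j) (\<psi> i) = kc (if i = j then 1 else 0)"
 by (simp only: act_aug_\<psi> xi_aug xi_\<psi>)

abbreviation "\<Delta> \<equiv> opd d xi"

lemma \<Delta>_add: "f : lc ==> g : lc ==> \<Delta> (f + g) = \<Delta> f + \<Delta> g"
 by (rule opd_add[of d xi]) (simp_all only: xi_cga)

lemma \<Delta>_scale: "f : lc ==> \<Delta> (fscale c f) = fscale c (\<Delta> f)"
 by (rule opd_scale[of d xi]) (simp_all only: xi_cga)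

lemma pr_sum_xi:
 "(\<And>j. j < d ==> v j : cga) ==> f : lc ==>
  pr (\<Sum>j<d. cga_mult G (v j) (xi j)) f = (\<Sum>j<d. pr (v j) (comp (\<Delta> f) j))"
 by (rule sum_mult_0_cod) (simp_all only: xi_cga)

lemma \<Delta>_0: "\<Delta> 0 = 0"
 using \<Delta>_scale[OF lc_intros(5), of 0] by simp

lemma \<Delta>_diff: "f : lc ==> g : lc ==> \<Delta> (f - g) = \<Delta> f - \<Delta> g"
 using \<Delta>_add[of "f - g" g] lc_intros(2)[of f g] by (simp add: algebra_simps)

lemma \<Delta>_kc: "\<Delta> (kc c) = 0"
 by (rule lcd_eqI[OF opd_lcd[OF kc_lc] fscale.subspace_0[OF lcd_subspace]]) (simp add: comp_opd act_xi_kc comp_0)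

text \<open>By induction along the unipotent filtration each difference \<open>lt g f - f\<close> is
  constant, so \<open>f\<close> minus its value at the identity is a homomorphism. It is a
  combination of the \<open>\<psi> i\<close>, and \<open>x_j\<close> reads off its coefficients,
  which are all 0.\<close>

lemma \<Delta>_kernel:
 assumes "f : lc" "\<Delta> f = 0"
 shows "f = kc (f \<one>)"
proof -
 have "f = kc (f \<one>)" if "f : lev n" "\<Delta> f = 0" for n f
  using that
 proof (induction n arbitrary: f)
  case 0
  then show ?case by (simp add: kc_def fun_eq_iff)
 next
  case (Suc n)
  have f: "f : lc" using Suc.prems(1) by simp
  have sh: "f (g \<otimes> y) - f y = f g - f \<one>" if g: "g : CG" and y: "y : CG" for g y
  proof -
   have h: "lt g f - f : lev n" using Suc.prems(1) g by simp
   have "\<Delta> (lt g f - f) = ltd g (\<Delta> f) - \<Delta> f"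
    by (simp only: \<Delta>_diff lt_lc[OF g f] f ltd_opd[OF g f])
   also have "... = 0" unfolding Suc.prems(2) using ltd_scale[of g 0 0] by simp
   finally have "lt g f - f = kc ((lt g f - f) \<one>)" by (rule Suc.IH[OF h])
   from fun_cong[OF this, of y] show ?thesis using g y by (simp add: lt_def kc_def)
  qed
  define \<phi> where "\<phi> = f - kc (f \<one>)"
  have \<phi>: "\<phi> : lc" unfolding \<phi>_def by (rule lc_intros(2)[OF f kc_lc])
  have "\<phi> (x \<otimes> y) = \<phi> x + \<phi> y" if "x : CG" "y : CG" for x y
   using sh[OF that] that by (simp add: \<phi>_def kc_def algebra_simps)
  from \<psi>_span[OF \<phi> this] obtain c where c: "\<phi> = (\<Sum>i<d. fscale (c i) (\<psi> i))" by blast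
  have "\<Delta> \<phi> = 0" unfolding \<phi>_def by (simp only: \<Delta>_diff f kc_lc Suc.prems(2) \<Delta>_kc diff_self)
  have "c j = 0" if "j < d" for j
  proof -
   have "kc (c j) = comp (\<Delta> \<phi>) j" unfolding comp_opd[OF that] unfolding c by (simp only: act_xi_sum[OF that])
   also have "... = 0" unfolding \<open>\<Delta> \<phi> = 0\<close> comp_0 ..
   finally have "kc (c j) \<one> = 0" by simp
   then show ?thesis by (simp add: kc_def)
  qed
  then have "\<phi> = 0" unfolding c by (intro sum.neutral ballI) (simp only: lessThan_iff fscale.scale_zero_left)
  then show ?case by (simp add: \<phi>_def)
 qed
 then show ?thesis using lc_unipotent[OF char assms(1)] assms(2) by blast
qed

text \<open>Dual to \<open>\<Delta>_kernel\<close>: an element of I kills the constants, which are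
  the kernel of \<open>\<Delta>\<close>, and so factors through \<open>\<Delta>\<close>; the
  components of the factor are the coefficients.\<close>

lemma aug_span:
 assumes x: "x : aug"
 obtains v where "\<And>j. v j : cga" "x = (\<Sum>j<d. cga_mult G (v j) (xi j))"
proof -
 have c: "x : cga" using x by (simp add: aug_iff)
 obtain L where L: "lin_on UNIV L" "\<And>f. f : lc ==> L (\<Delta> f) = pr x f"
 proof (rule linear_factor[OF lc_subspace pr_lin[OF c] \<Delta>_add \<Delta>_scale])
  show "pr x f = 0" if "f : lc" "\<Delta> f = 0" for f
   using \<Delta>_kernel[OF that] pr_aug_kc[OF x] by metis
 qed blast+
 show ?thesis
 proof (rule that)
  show "part L j : cga" for j by (rule part_cga[OF L(1)])
  show "x = (\<Sum>j<d. cga_mult G (part L j) (xi j))"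
  proof (rule cga_eqI[OF c])
   show "(\<Sum>j<d. cga_mult G (part L j) (xi j)) : cga"
    by (rule cga_intros(6)) (simp add: cga_mult_closed part_cga[OF L(1)] xi_cga)
   show "pr x f = pr (\<Sum>j<d. cga_mult G (part L j) (xi j)) f" if "f : lc" for f
    unfolding pr_sum_xi[of "part L", OF part_cga[OF L(1)] that] part_sum[OF L(1) opd_lcd[OF that]]
    by (rule L(2)[OF that, symmetric])
  qed
 qed
qed

text \<open>Vectors whose class in \<open>C^d\<close> modulo the image of \<open>\<Delta>\<close> is
  fixed by G. They are the domain of the connecting map to H^2 that comes from
  \<open>0 \<rightarrow> k \<rightarrow> C \<rightarrow> C^d\<close>.\<close>

definition MM :: "(nat \<times> 'g => 'k) set" where
 "MM = {F : lcd d. \<forall>g\<in>CG. ltd g F - F : \<Delta> ` lc}"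

text \<open>A preimage under \<open>\<Delta>\<close> is unique up to a constant, hence unique once
  it vanishes at the identity. Uniqueness makes \<open>pt\<close> linear in \<open>F\<close> and
  turns it into a crossed homomorphism up to constants.\<close>

definition pt :: "(nat \<times> 'g => 'k) => 'g => 'g => 'k" where
 "pt F g = (SOME f. f : lc \<and> f \<one> = 0 \<and> \<Delta> f = ltd g F - F)"

lemma pt: "F : MM ==> g : CG ==> pt F g : lc \<and> pt F g \<one> = 0 \<and> \<Delta> (pt F g) = ltd g F - F"
proof -
 assume F: "F : MM" and g: "g : CG"
 have "ltd g F - F : \<Delta> ` lc" using F g unfolding MM_def by blast
 then obtain f where f: "f : lc" "\<Delta> f = ltd g F - F" by auto
 have "f - kc (f \<one>) : lc \<and> (f - kc (f \<one>)) \<one> = 0 \<and> \<Delta> (f - kc (f \<one>)) = ltd g F - F"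
  using f lc_intros(2)[OF f(1) kc_lc] by (simp add: \<Delta>_diff kc_lc \<Delta>_kc) (simp add: kc_def)
 then show ?thesis unfolding pt_def by (rule someI[of "%f. f : lc \<and> f \<one> = 0 \<and> \<Delta> f = ltd g F - F"])
qed

lemma pt_unique:
 assumes "F : MM" "g : CG" "f : lc" "f \<one> = 0" "\<Delta> f = ltd g F - F"
 shows "pt F g = f"
proof -
 note p = pt[OF assms(1,2)]
 have "pt F g - f : lc" using p assms(3) by (intro lc_intros) simp_all
 moreover have "\<Delta> (pt F g - f) = 0" using p assms by (simp add: \<Delta>_diff)
 ultimately have "pt F g - f = kc ((pt F g - f) \<one>)" by (rule \<Delta>_kernel)
 also have "(pt F g - f) \<one> = 0" using p assms(4) by simp
 finally have "pt F g - f = 0" unfolding kc_0 .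
 then show ?thesis by (simp only: right_minus_eq)
qed

lemma MM_lcd: "F : MM ==> F : lcd d"
 by (simp add: MM_def)

lemma MM_I: "F : lcd d ==> (\<And>g. g : CG ==> f g : lc \<and> \<Delta> (f g) = ltd g F - F) ==> F : MM"
proof -
 assume F: "F : lcd d" and f: "\<And>g. g : CG ==> f g : lc \<and> \<Delta> (f g) = ltd g F - F"
 have "ltd g F - F : \<Delta> ` lc" if "g : CG" for g using f[OF that] by (metis imageI)
 then show ?thesis using F by (simp add: MM_def)
qed

lemma MM_subspace: "fscale.subspace MM"
 and pt_add: "F : MM ==> F' : MM ==> g : CG ==> pt (F + F') g = pt F g + pt F' g"
 and pt_scale: "F : MM ==> g : CG ==> pt (fscale c F) g = fscale c (pt F g)"
proof -
 have add: "pt F g + pt F' g : lc \<and> \<Delta> (pt F g + pt F' g) = ltd g (F + F') - (F + F')"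
  if "F : MM" "F' : MM" "g : CG" for F F' g
  using pt[OF that(1,3)] pt[OF that(2,3)] lc_intros(1)[of "pt F g" "pt F' g"] by (simp add: \<Delta>_add ltd_add)
 have scale: "fscale c (pt F g) : lc \<and> \<Delta> (fscale c (pt F g)) = ltd g (fscale c F) - fscale c F"
  if "F : MM" "g : CG" for F g c
  using pt[OF that] lc_intros(3)[of "pt F g" c] by (simp add: \<Delta>_scale ltd_scale fscale.scale_right_diff_distrib)
 show sub: "fscale.subspace MM"
 proof (rule fscale.subspaceI)
  show "0 : MM"
   by (rule MM_I[of 0 "%_. 0", OF fscale.subspace_0[OF lcd_subspace]])
    (simp only: lc_intros(5) \<Delta>_0 ltd_0 diff_self simp_thms)
  show "F + F' : MM" if "F : MM" "F' : MM" for F F'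
   by (rule MM_I[OF fscale.subspace_add[OF lcd_subspace MM_lcd[OF that(1)] MM_lcd[OF that(2)]] add[OF that]])
  show "fscale c F : MM" if "F : MM" for c F
   by (rule MM_I[OF fscale.subspace_scale[OF lcd_subspace MM_lcd[OF that]] scale[OF that]])
 qed
 show "pt (F + F') g = pt F g + pt F' g" if "F : MM" "F' : MM" "g : CG"
  using add[OF that] pt[OF that(1,3)] pt[OF that(2,3)]
  by (intro pt_unique fscale.subspace_add[OF sub] that) simp_all
 show "pt (fscale c F) g = fscale c (pt F g)" if "F : MM" "g : CG"
  using scale[OF that] pt[OF that] by (intro pt_unique fscale.subspace_scale[OF sub] that) simp_all
qed

text \<open>Both sides have the same image under \<open>\<Delta>\<close> and vanish at the identity;
  the constant is the defect that defines the 2-cocycle.\<close>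

lemma pt_mult:
 assumes F: "F : MM" and g: "g : CG" and h: "h : CG"
 shows "pt F (g \<otimes> h) = lt h (pt F g) + pt F h - kc (pt F g h)"
proof (rule pt_unique[OF F m_closed[OF g h]])
 note pg = pt[OF F g] and ph = pt[OF F h]
 have l: "lt h (pt F g) : lc" "lt h (pt F g) + pt F h : lc" using pg ph h by (simp_all add: lt_lc lc_intros(1))
 show "lt h (pt F g) + pt F h - kc (pt F g h) : lc" by (rule lc_intros(2)[OF l(2) kc_lc])
 show "(lt h (pt F g) + pt F h - kc (pt F g h)) \<one> = 0" using ph h by (simp add: lt_def kc_def)
 have "\<Delta> (lt h (pt F g) + pt F h - kc (pt F g h)) = ltd h (\<Delta> (pt F g)) + \<Delta> (pt F h)"
  unfolding ltd_opd[OF h conjunct1[OF pg]] using ph by (simp add: \<Delta>_diff l kc_lc \<Delta>_add \<Delta>_kc)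
 also have "... = ltd (g \<otimes> h) F - F" using pg ph by (simp add: ltd_diff ltd_ltd g h)
 finally show "\<Delta> (lt h (pt F g) + pt F h - kc (pt F g h)) = ltd (g \<otimes> h) F - F" .
qed

lemma lcd_inv: "F : lcd d ==> \<exists>U\<in>UU. \<forall>g h. E U g h --> ltd g F = ltd h F"
proof -
 assume F: "F : lcd d"
 define N where "N j = (SOME U. inv_under U (comp F j))" for j
 have N: "inv_under (N j) (comp F j)" for j
  unfolding N_def by (rule someI_ex[OF lc_inv_under[OF lcd_comp[OF F]]])
 have "\<exists>U\<in>UU. \<forall>j\<in>{..<d}. U <= N j" using inv_under_UU[OF N] by (intro UU_finite_Int) auto
 then obtain U where U: "U : UU" "\<And>j. j < d ==> U <= N j" by blast
 have "ltd g F = ltd h F" if gh: "E U g h" for g h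
 proof (rule comp_eqI)
  fix j show "comp (ltd g F) j = comp (ltd h F) j"
  proof (cases "j < d")
   case True
   have "lt g (comp F j) = lt h (comp F j)"
    by (rule lt_E[OF inv_under_UU[OF N] inv_underD[OF N] E_mono[OF U(2)[OF True] gh]])
   then show ?thesis by (simp only: comp_ltd)
  next
   case False
   then show ?thesis using lcd_comp_0[OF F, of j] by (simp add: comp_ltd lt_0)
  qed
 qed
 with U(1) show ?thesis by blast
qed

text \<open>Evaluating \<open>pt_mult\<close> at a further argument gives the cocycle identity. For
  continuity, local constancy in the first variable leaves finitely many functions of the second,
  and one subgroup serves for all of them.\<close>

lemma pt_cocycle:
 assumes F: "F : MM"
 shows "c2 (pt F) : Cy 2"
proof -
 obtain U where U: "U : UU" "\<And>g h. E U g h ==> ltd g F = ltd h F" using lcd_inv[OF MM_lcd[OF F]] by blast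
 have Eq: "pt F g = pt F h" if "E U g h" for g h unfolding pt_def U(2)[OF that] ..
 define N where "N C = (SOME V. inv_under V (pt F (rc C)))" for C
 have N: "inv_under (N C) (pt F (rc C))" if "C : Q U" for C
  unfolding N_def using pt[OF F rc[OF U(1) that]] by (intro someI_ex[OF lc_inv_under]) simp
 have "\<exists>V\<in>UU. \<forall>C\<in>Q U. V <= N C" using inv_under_UU[OF N] by (intro UU_finite_Int finite_Q U(1)) auto
 then obtain V where V: "V : UU" "\<And>C. C : Q U ==> V <= N C" by blast
 show ?thesis
 proof (rule c2_cocycle[OF UU_Int[OF U(1) V(1)]])
  fix x x' y y' assume e: "E (U \<inter> V) x x'" "E (U \<inter> V) y y'"
  then have e': "E U x x'" "E V y y'" using E_mono[of "U \<inter> V" U] E_mono[of "U \<inter> V" V] by blast+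
  then have x: "x : CG" using E_carrier U(1) by blast
  have "E U (rc (U #> x)) x" by (rule E_rc[OF U(1) x])
  then have "pt F x = pt F (rc (U #> x))" using Eq by metis
  moreover have "pt F (rc (U #> x)) y = pt F (rc (U #> x)) y'"
   by (rule inv_underD[OF N[OF Q_I[OF x]] E_mono[OF V(2)[OF Q_I[OF x]] e'(2)]])
  ultimately show "pt F x y = pt F x' y'" using Eq[OF e'(1)] by simp
 next
  fix x y z assume "over [x, y, z]"
  then have c: "x : CG" "y : CG" "z : CG" by simp_all
  show "pt F y z - pt F (x \<otimes> y) z + pt F x (y \<otimes> z) - pt F x y = 0"
   unfolding pt_mult[OF F c(1,2)] using c by (simp add: lt_def kc_def)
 qed
qed

text \<open>The connecting map to H^2 followed by \<open>\<beta>\<close>; within \<open>MM\<close>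
  it vanishes exactly on the image of \<open>\<Delta>\<close>.\<close>

definition ell :: "(nat \<times> 'g => 'k) => 'k" where
 "ell F = \<beta> (c2 (pt F))"

lemma ell_lin: "lin_on MM ell"
proof (rule lin_onI)
 fix F F' assume F: "F : MM" and F': "F' : MM"
 have "c2 (pt (F + F')) = c2 (pt F) + c2 (pt F')"
 proof
  fix zs show "c2 (pt (F + F')) zs = (c2 (pt F) + c2 (pt F')) zs"
  proof (cases "length zs = 2 \<and> over zs")
   case True
   then have "zs ! 0 : CG" using nth_mem[of 0 zs] by auto
   from pt_add[OF F F' this] show ?thesis by (simp add: c2_def)
  qed (auto simp: c2_def)
 qed
 then show "ell (F + F') = ell F + ell F'"
  using lin_on_add[OF \<beta>_lin pt_cocycle[OF F] pt_cocycle[OF F']] by (simp add: ell_def)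
next
 fix c F assume F: "F : MM"
 have "c2 (pt (fscale c F)) = fscale c (c2 (pt F))"
 proof
  fix zs show "c2 (pt (fscale c F)) zs = fscale c (c2 (pt F)) zs"
  proof (cases "length zs = 2 \<and> over zs")
   case True
   then have "zs ! 0 : CG" using nth_mem[of 0 zs] by auto
   from pt_scale[OF F this] show ?thesis by (simp add: c2_def)
  qed (auto simp: c2_def)
 qed
 then show "ell (fscale c F) = c * ell F"
  using lin_on_scale[OF \<beta>_lin pt_cocycle[OF F]] by (simp add: ell_def)
qed

lemma c2_cong: "(\<And>x y. x : CG ==> y : CG ==> F x y = F' x y) ==> c2 F = c2 F'"
proof
 fix zs assume *: "\<And>x y. x : CG ==> y : CG ==> F x y = F' x y"
 show "c2 F zs = c2 F' zs"
 proof (cases "length zs = 2 \<and> over zs")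
  case True
  then have "zs ! 0 : CG" "zs ! 1 : CG" using nth_mem[of 0 zs] nth_mem[of 1 zs] by auto
  then show ?thesis using * by (simp add: c2_def)
 qed (auto simp: c2_def)
qed

lemma \<Delta>_MM: "f : lc ==> \<Delta> f : MM"
 by (rule MM_I[of _ "%g. lt g f - f"]) (simp_all add: opd_lcd lt_lc lc_intros(2) \<Delta>_diff ltd_opd)

lemma ell_\<Delta>: "f : lc ==> ell (\<Delta> f) = 0"
proof -
 assume f: "f : lc"
 have p: "pt (\<Delta> f) g = lt g f - f - kc (f g - f \<one>)" if g: "g : CG" for g
 proof (rule pt_unique[OF \<Delta>_MM[OF f] g])
  have l: "lt g f - f : lc" by (rule lc_intros(2)[OF lt_lc[OF g f] f])
  show "lt g f - f - kc (f g - f \<one>) : lc" by (rule lc_intros(2)[OF l kc_lc])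
  show "(lt g f - f - kc (f g - f \<one>)) \<one> = 0" using g by (simp add: lt_def kc_def)
  show "\<Delta> (lt g f - f - kc (f g - f \<one>)) = ltd g (\<Delta> f) - \<Delta> f"
   by (simp only: \<Delta>_diff l kc_lc \<Delta>_kc lt_lc[OF g f] f ltd_opd[OF g f] diff_0_right)
 qed
 \<comment> \<open>The cocycle attached to \<open>\<Delta> f\<close> is
   \<open>f(g h) - f(h) - f(g) + f(1)\<close>, the coboundary of \<open>f(1) - f\<close>.\<close>
 define f' where "f' = kc (f \<one>) - f"
 have f': "f' : lc" unfolding f'_def by (rule lc_intros(2)[OF kc_lc f])
 have "c2 (pt (\<Delta> f)) = c2 (%x y. f' y - f' (x \<otimes> y) + f' x)"
  by (rule c2_cong) (simp add: p f'_def lt_def kc_def)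
 also have "... = coboundary G (c1 f')" by (rule coboundary_c1[symmetric])
 also have "... : Cb 2" unfolding numeral_2_eq_2 coboundaries_Suc
  using c1_cochain[OF f'] by simp
 finally show ?thesis using \<beta>_ker[OF pt_cocycle[OF \<Delta>_MM[OF f]]] by (simp add: ell_def)
qed

text \<open>If the class in H^2 vanishes, adding a suitable \<open>\<Delta> f\<close> makes the
  vector invariant under translation. Its components are then constant, and constant vectors are
  images under \<open>\<Delta>\<close> of combinations of the \<open>\<psi> i\<close>.\<close>

lemma ell_kernel:
 assumes F: "F : MM" and e: "ell F = 0"
 shows "F : \<Delta> ` lc"
proof -
 have "c2 (pt F) : Cb 2" using e \<beta>_ker[OF pt_cocycle[OF F]] by (simp add: ell_def)
 then obtain u where u: "u : Ch 1" "c2 (pt F) = coboundary G u"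
  unfolding numeral_2_eq_2 coboundaries_Suc by auto
 define f where "f = (%x. u [x])"
 have f: "f : lc" and uf: "u = c1 f" unfolding f_def using cochain_1_lc[OF u(1)] by blast+
 have c: "pt F g h = f h - f (g \<otimes> h) + f g" if "g : CG" "h : CG" for g h
  using fun_cong[OF u(2), of "[g, h]"] that unfolding uf coboundary_c1 by (simp add: c2_def)
 have pg: "pt F g = f - lt g f + kc (f g)" if g: "g : CG" for g
 proof
  fix h show "pt F g h = (f - lt g f + kc (f g)) h"
   using c[OF g, of h] pt[OF F g] lc_support[of "pt F g" h] lc_support[OF f, of h]
   by (cases "h : CG") (simp_all add: lt_def kc_def)
 qed
 define H where "H = F + \<Delta> f"
 have H: "H : lcd d" unfolding H_def by (rule fscale.subspace_add[OF lcd_subspace MM_lcd[OF F] opd_lcd[OF f]])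
 have inv: "ltd g H = H" if g: "g : CG" for g
 proof -
  have "ltd g F - F = \<Delta> (pt F g)" using pt[OF F g] by simp
  also have "... = \<Delta> f - ltd g (\<Delta> f)"
   unfolding pg[OF g] by (simp add: \<Delta>_add \<Delta>_diff lc_intros(2) lt_lc g f kc_lc \<Delta>_kc ltd_opd)
  finally show ?thesis unfolding H_def ltd_add by (simp add: algebra_simps)
 qed
 have const: "comp H j = kc (comp H j \<one>)" for j
 proof
  fix y
  have "lt y (comp H j) \<one> = comp H j \<one>" if "y : CG"
   using inv[OF that] comp_ltd[of y H j] by simp
  then show "comp H j y = kc (comp H j \<one>) y"
   using lc_support[OF lcd_comp[OF H], of y j] by (auto simp: lt_def kc_def)
 qed
 define s where "s = (\<Sum>i<d. fscale (comp H i \<one>) (\<psi> i))"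
 have s: "s : lc" unfolding s_def by (intro lc_intros(6) lc_intros(3) \<psi>_lc)
 have "\<Delta> s = H"
 proof (rule lcd_eqI[OF opd_lcd[OF s] H])
  fix i assume "i < d"
  then have "comp (\<Delta> s) i = kc (comp H i \<one>)" unfolding s_def by (simp only: comp_opd act_xi_sum)
  then show "comp (\<Delta> s) i = comp H i" using const[of i] by simp
 qed
 then have "F = \<Delta> (s - f)" by (simp add: \<Delta>_diff s f H_def)
 then show ?thesis using lc_intros(2)[OF s f] by blast
qed

text \<open>Any extension of \<open>ell\<close> from \<open>MM\<close> to \<open>C^d\<close> will
  do; its components are the relation elements. By \<open>rr_\<psi>\<close> their linear parts do
  not depend on the choice.\<close>

definition LL :: "(nat \<times> 'g => 'k) => 'k" where
 "LL = (SOME L. lin_on UNIV L \<and> (\<forall>F\<in>MM. L F = ell F))"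

lemma LL: "lin_on UNIV LL" "F : MM ==> LL F = ell F"
proof -
 obtain L where "lin_on UNIV L" "\<And>F. F : MM ==> L F = ell F" by (rule linear_extend[OF MM_subspace ell_lin]) blast
 then have "\<exists>L. lin_on UNIV L \<and> (\<forall>F\<in>MM. L F = ell F)" by blast
 then have "lin_on UNIV LL \<and> (\<forall>F\<in>MM. LL F = ell F)" unfolding LL_def by (rule someI_ex)
 then show "lin_on UNIV LL" "F : MM ==> LL F = ell F" by blast+
qed

definition rr :: "nat => 'g set \<times> 'g set => 'k" where
 "rr = part LL"

lemma rr_cga: "rr j : cga"
 unfolding rr_def by (rule part_cga[OF LL(1)])

abbreviation "\<Phi> \<equiv> cod d rr"

lemmas \<Phi>_add = cod_add[of d rr, OF rr_cga] and \<Phi>_diff = cod_diff[of d rr, OF rr_cga]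
 and \<Phi>_scale = cod_scale[of d rr, OF rr_cga] and \<Phi>_slot = cod_slot[of d rr, OF rr_cga]

lemma \<Phi>_\<Delta>: "f : lc ==> \<Phi> (\<Delta> f) = 0"
proof
 fix y assume f: "f : lc"
 show "\<Phi> (\<Delta> f) y = 0 y"
 proof (cases "y : CG")
  case True
  then show ?thesis
   unfolding rr_def cod_part[OF LL(1) opd_lcd[OF f] True] ltd_opd[OF True f]
   using LL(2)[OF \<Delta>_MM] ell_\<Delta> lt_lc[OF True f] by simp
 next
  case False
  then show ?thesis using lc_support[OF cod_lc[OF opd_lcd[OF f]]] by simp
 qed
qed

text \<open>The induction of \<open>\<Delta>_kernel\<close> one step further: translates minus
  \<open>F\<close> have lower level and lie in the kernel, hence in the image of
  \<open>\<Delta>\<close>, so \<open>F\<close> is in \<open>MM\<close>. Then \<open>ell F\<close> is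
  the value of \<open>\<Phi> F\<close> at the identity and \<open>ell_kernel\<close>
  applies.\<close>

lemma \<Phi>_kernel:
 assumes F: "F : lcd d" "\<Phi> F = 0"
 shows "F : \<Delta> ` lc"
proof -
 have main: "F : \<Delta> ` lc" if "F : lcd d" "\<Phi> F = 0" "\<And>j. comp F j : lev n" for n F
  using that
 proof (induction n arbitrary: F)
  case 0
  then have "F = \<Delta> 0" unfolding \<Delta>_0 by (intro comp_eqI) (simp add: comp_0)
  then show ?case using lc_intros(5) by blast
 next
  case (Suc n)
  have "ltd g F - F : \<Delta> ` lc" if g: "g : CG" for g
  proof (rule Suc.IH)
   show "ltd g F - F : lcd d" by (rule fscale.subspace_diff[OF lcd_subspace ltd_lcd[OF g Suc(2)] Suc(2)])
   show "\<Phi> (ltd g F - F) = 0"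
    unfolding \<Phi>_diff[OF ltd_lcd[OF g Suc(2)] Suc(2)] cod_ltd[OF g] Suc(3) by (simp add: lt_0)
   show "comp (ltd g F - F) j : lev n" for j unfolding comp_diff comp_ltd using Suc(4)[of j] g by simp
  qed
  then have F: "F : MM" using Suc(2) by (simp add: MM_def)
  have "LL F = LL (ltd \<one> F)"
  proof -
   have "ltd \<one> F = F" by (rule comp_eqI) (simp add: comp_ltd lt_one lcd_comp[OF Suc(2)])
   then show ?thesis by simp
  qed
  also have "... = \<Phi> F \<one>" unfolding rr_def by (rule cod_part[OF LL(1) Suc(2) one_closed, symmetric])
  also have "... = 0" by (simp add: Suc(3))
  finally show ?case using ell_kernel[OF F] LL(2)[OF F] by simp
 qed
 define N where "N j = (SOME n. comp F j : lev n)" for j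
 have N: "comp F j : lev (N j)" for j unfolding N_def by (rule someI_ex[OF lc_unipotent[OF char lcd_comp[OF F(1)]]])
 \<comment> \<open>One level for all components is needed; the sum is an upper bound.\<close>
 have "comp F j : lev (\<Sum>j<d. N j)" for j
 proof (cases "j < d")
  case True
  then have "N j \<le> (\<Sum>j<d. N j)" by (intro member_le_sum) simp_all
  then show ?thesis using N lev_mono by blast
 next
  case False
  then show ?thesis using lcd_comp_0[OF F(1), of j] fscale.subspace_0[OF lev_subspace] by simp
 qed
 then show ?thesis using main[OF F] by blast
qed

lemma slot_\<psi>:
 assumes "j < d"
 shows "slot j (kc c) = \<Delta> (fscale c (\<psi> j))"
proof -
 have "comp (slot j (kc c)) k = comp (\<Delta> (fscale c (\<psi> j))) k" if k: "k < d" for k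
 proof -
  have "comp (\<Delta> (fscale c (\<psi> j))) k = fscale c (kc (if j = k then 1 else 0))"
   by (simp only: comp_opd[OF k] act_scale[OF xi_cga[OF k] \<psi>_lc] act_xi_\<psi>[OF k \<open>j < d\<close>])
  then show ?thesis by (auto simp: comp_slot kc_def fun_eq_iff)
 qed
 then show ?thesis by (intro lcd_eqI[OF slot_lcd[OF kc_lc assms] opd_lcd[OF lc_intros(3)[OF \<psi>_lc]]]) blast
qed

lemma rr_kc: "j < d ==> pr (rr j) (kc c) = 0"
 unfolding rr_def pr_part[OF LL(1) kc_lc]
 by (simp only: slot_\<psi> LL(2) \<Delta>_MM lc_intros(3) \<psi>_lc ell_\<Delta>)

lemma rr_aug: "j < d ==> rr j : aug"
 by (simp add: aug_iff rr_cga rr_kc)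

text \<open>For the vector with \<open>\<psi> i\<close> in place \<open>j\<close>, the translation
  defect is the constant \<open>\<psi> i g\<close> in place \<open>j\<close>, and its preimage is
  \<open>\<psi> i g\<close> times \<open>\<psi> j\<close>. The resulting cocycle is a cup product,
  which is how the matrix \<open>b\<close> gets into the relations.\<close>

lemma rr_\<psi>:
 assumes i: "i < d" and j: "j < d"
 shows "pr (rr j) (\<psi> i) = b i j"
proof -
 define F where "F = slot j (\<psi> i)"
 have Fl: "F : lcd d" unfolding F_def by (rule slot_lcd[OF \<psi>_lc j])
 have s: "fscale (\<psi> i g) (\<psi> j) : lc \<and> \<Delta> (fscale (\<psi> i g) (\<psi> j)) = ltd g F - F" if g: "g : CG" for g
 proof
  have "ltd g F - F = slot j (kc (\<psi> i g))"
   by (rule comp_eqI) (simp add: F_def comp_diff comp_ltd comp_slot lt_\<psi>[OF g] lt_0)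
  then show "\<Delta> (fscale (\<psi> i g) (\<psi> j)) = ltd g F - F" using slot_\<psi>[OF j] by simp
 qed (rule lc_intros(3)[OF \<psi>_lc])
 have F: "F : MM" by (rule MM_I[OF Fl s])
 have "pt F g = fscale (\<psi> i g) (\<psi> j)" if "g : CG" for g
  using s[OF that] by (intro pt_unique[OF F that]) (simp_all add: \<psi>_one)
 then have "c2 (pt F) = c2 (%x y. \<psi> i x * \<psi> j y)" by (intro c2_cong) simp
 then show ?thesis
  unfolding rr_def pr_part[OF LL(1) \<psi>_lc] F_def[symmetric] LL(2)[OF F] ell_def b_def cup_c1[OF \<psi>_lc \<psi>_lc] by simp
qed

text \<open>Paired with \<open>f\<close>, the sum gives
  \<open>LL (\<Delta> f) = ell (\<Delta> f)\<close>, and \<open>ell\<close> vanishes on the image of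
  \<open>\<Delta>\<close>.\<close>

lemma rr_xi: "(\<Sum>j<d. cga_mult G (rr j) (xi j)) = 0"
proof (rule cga_eqI[OF _ cga_intros(5)])
 show "(\<Sum>j<d. cga_mult G (rr j) (xi j)) : cga"
  by (rule cga_intros(6)) (simp add: cga_mult_closed rr_cga xi_cga)
 fix f :: "'g => 'k" assume f: "f : lc"
 have "pr (\<Sum>j<d. cga_mult G (rr j) (xi j)) f = LL (\<Delta> f)"
  unfolding pr_sum_xi[of rr, OF rr_cga f] unfolding rr_def by (rule part_sum[OF LL(1) opd_lcd[OF f]])
 also have "... = pr 0 f"
  using LL(2)[OF \<Delta>_MM[OF f]] ell_\<Delta>[OF f] lin_on_0[OF pr_lin_left[OF f] cga_intros(5)] by simp
 finally show "pr (\<Sum>j<d. cga_mult G (rr j) (xi j)) f = pr 0 f" .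
qed

text \<open>Dual to \<open>\<Phi>_kernel\<close>: a relation among the \<open>x_j\<close> is a
  functional on \<open>C^d\<close> that kills the image of \<open>\<Delta>\<close>, hence the kernel
  of \<open>\<Phi>\<close>, and so factors through \<open>\<Phi>\<close>.\<close>

lemma relations:
 assumes v: "\<And>j. j < d ==> v j : cga" and 0: "(\<Sum>j<d. cga_mult G (v j) (xi j)) = 0"
 obtains a where "a : cga" "\<And>j. j < d ==> v j = cga_mult G a (rr j)"
proof -
 define V where "V F = (\<Sum>j<d. pr (v j) (comp F j))" for F
 have lin: "lin_on (lcd d) V"
 proof (rule lin_onI)
  show "V (F + F') = V F + V F'" if "F : lcd d" "F' : lcd d" for F F'
   unfolding V_def sum.distrib[symmetric] comp_add
   by (rule sum.cong) (simp_all add: pr_add v lcd_comp[OF that(1)] lcd_comp[OF that(2)])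
  show "V (fscale c F) = c * V F" if "F : lcd d" for c F
   unfolding V_def sum_distrib_left comp_scale
   by (rule sum.cong) (simp_all only: pr_scale v lcd_comp[OF that] lessThan_iff)
 qed
 obtain g where g: "lin_on UNIV g" "\<And>F. F : lcd d ==> g (\<Phi> F) = V F"
 proof (rule linear_factor[OF lcd_subspace lin \<Phi>_add \<Phi>_scale])
  fix F assume "F : lcd d" "\<Phi> F = 0"
  then obtain f where f: "f : lc" "F = \<Delta> f" using \<Phi>_kernel by blast
  have "V F = pr (\<Sum>j<d. cga_mult G (v j) (xi j)) f"
   unfolding V_def f(2) by (rule pr_sum_xi[of v, OF v f(1), symmetric])
  then show "V F = 0" unfolding 0 using lin_on_0[OF pr_lin_left[OF f(1)] cga_intros(5)] by simp
 qed blast+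
 have g': "lin_on lc g" by (rule lin_on_subset[OF g(1)]) simp
 show ?thesis
 proof (rule that[OF of_fun_cga[OF g']])
  fix j assume j: "j < d"
  show "v j = cga_mult G (of_fun g) (rr j)"
  proof (rule cga_eqI[OF v[OF j] cga_mult_closed[OF of_fun_cga[OF g'] rr_cga]])
   fix f :: "'g => 'k" assume f: "f : lc"
   have "pr (cga_mult G (of_fun g) (rr j)) f = g (act (rr j) f)"
    unfolding pr_mult[OF of_fun_cga[OF g'] rr_cga f] by (rule pr_of_fun[OF g' act_lc[OF f]])
   also have "... = g (\<Phi> (slot j f))" by (simp only: \<Phi>_slot[OF j])
   also have "... = V (slot j f)" by (rule g(2)[OF slot_lcd[OF f j]])
   also have "... = (\<Sum>i<d. if i = j then pr (v i) f else 0)"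
    unfolding V_def comp_slot by (rule sum.cong) (simp_all add: pr_0 v)
   also have "... = pr (v j) f" using j by simp
   finally show "pr (v j) f = pr (cga_mult G (of_fun g) (rr j)) f" by simp
  qed
 qed
qed

text \<open>An element of I lowers the level by one when it acts, since it kills constants and its
  action commutes with translation.\<close>

lemma apow_kills_lev:
 assumes "x : apow n" "f : lev n"
 shows "pr x f = (0 :: 'k)"
proof -
 have act_lev: "act y f : lev n" if "y : aug" "f : lev (Suc n)" for y n and f :: "'g => 'k"
  using that(2)
 proof (induction n arbitrary: f)
  case 0
  have f: "f : lc" "\<And>g. g : CG ==> lt g f = f" using 0 by simp_all
  have "f = kc (f \<one>)"
  proof
   fix y show "f y = kc (f \<one>) y"
    using f(2)[of y, THEN fun_cong, of \<one>] lc_support[OF f(1), of y] by (auto simp: lt_def kc_def)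
  qed
  then have "pr y f = 0" using pr_aug_kc[OF that(1)] by metis
  then have "act y f = 0" by (intro ext) (simp add: act_def f(2))
  then show ?case by (simp only: lev.simps singleton_iff)
 next
  case (Suc n)
  have y: "y : cga" using that(1) by (simp add: aug_iff)
  have f: "f : lc" using Suc(2) by simp
  have "lt g (act y f) - act y f : lev n" if g: "g : CG" for g
  proof -
   have "lt g f - f : lev (Suc n)" using Suc(2) g unfolding lev.simps(2)[of "Suc n"] by blast
   then have "act y (lt g f - f) : lev n" by (rule Suc(1))
   then show ?thesis by (simp only: act_diff[OF y lt_lc[OF g f] f] lt_act[OF g])
  qed
  then show ?case using act_lc[OF f] by simp
 qed
 show ?thesis
  using assms
 proof (induction n arbitrary: x f)
  case 0
  then have "f = 0" by simp
  then show ?case by (simp only: pr_0 apow_cga[OF 0(1)])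
 next
  case (Suc n)
  have f: "f : lc" using Suc(3) by simp
  define S where "S = {x : cga. pr x f = 0}"
  have "x : S"
  proof (rule apow_minimal[OF _ _ Suc(2)])
   show "fscale.subspace S"
    unfolding S_def by (rule fscale.subspaceI) (simp_all only: mem_Collect_eq cga_intros(1,3,5) pr_add_left[OF f] pr_scale_left[OF f]
     lin_on_0[OF pr_lin_left[OF f]] mult_zero_right add_0 simp_thms)
   show "cga_mult G x y : S" if "x : apow n" "y : aug" for x y
    using that apow_cga[OF that(1)] Suc(1)[OF that(1) act_lev[OF that(2) Suc(3)]] f
    by (simp only: S_def mem_Collect_eq cga_mult_closed aug_iff pr_mult simp_thms)
  qed
  then show ?case by (simp add: S_def)
 qed
qed

lemma apow_separated: "(\<And>n. x : apow n) ==> x = (0 :: _ => 'k)"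
proof -
 assume x: "\<And>n. x : apow n"
 show ?thesis
 proof (rule cga_eqI[OF apow_cga[OF x] cga_intros(5)])
  fix f :: "'g => 'k" assume f: "f : lc"
  obtain n where "f : lev n" using lc_unipotent[OF char f] by blast
  then show "pr x f = pr 0 f" using apow_kills_lev[OF x] lin_on_0[OF pr_lin_left[OF f] cga_intros(5)] by simp
 qed
qed

end

section \<open>Evaluating tensors in a graded algebra\<close>

locale letter_map = subquotient mul e Z B
 for mul :: "('x => 'k::field) => ('x => 'k) => 'x => 'k" and e Z B +
 fixes d :: nat and y :: "nat => 'x => 'k"
 assumes y: "j < d ==> y j : Z (Suc 0)"
begin

text \<open>Substitution of the \<open>y j\<close> for the letters, by recursion on the last letter.
  It takes values in representatives and is multiplicative there, so no choice of representatives is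
  involved.\<close>

primrec ev :: "nat => (nat list => 'k) => 'x => 'k" where
 "ev 0 f = fscale (f []) e"
| "ev (Suc n) f = (\<Sum>j<d. mul (ev n (last_cut j f)) (y j))"

lemma mul_y: "x : Z n ==> j < d ==> mul x (y j) : Z (Suc n)"
 and mul_y_B: "x : B n ==> j < d ==> mul x (y j) : B (Suc n)"
 using mul_Z[of x n "y j" "Suc 0"] mul_B_left[of x n "y j" "Suc 0"] y by simp_all

lemma ev_Z: "ev n f : Z n"
proof (induction n arbitrary: f)
 case 0
 show ?case unfolding ev.simps by (rule Zs(3)[OF e_Z])
next
 case (Suc n)
 show ?case unfolding ev.simps by (rule Zs(6)) (simp add: mul_y Suc)
qed

lemma ev_add: "ev n (f + g) = ev n f + ev n g"
proof (induction n arbitrary: f g)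
 case 0
 show ?case unfolding ev.simps by (simp add: fscale.scale_left_distrib)
next
 case (Suc n)
 show ?case
  unfolding ev.simps last_cut_add Suc sum.distrib[symmetric]
  by (rule sum.cong) (simp_all add: mul_add_left[OF ev_Z ev_Z y])
qed

lemma last_cut_scale: "last_cut j (fscale c f) = fscale c (last_cut j f)"
 by (simp add: last_cut_def fun_eq_iff)

lemma ev_scale: "ev n (fscale c f) = fscale c (ev n f)"
proof (induction n arbitrary: f)
 case 0
 show ?case by (simp only: ev.simps fscale_apply[of c f "[]"] fscale.scale_scale)
next
 case (Suc n)
 show ?case
  unfolding ev.simps last_cut_scale Suc fscale.scale_sum_right
  by (rule sum.cong) (simp_all add: mul_scale_left[OF ev_Z y])
qed

lemma ev_lin_0: "ev n 0 = 0"
 using ev_scale[of n 0 0] by simp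

lemma ev_diff: "ev n (f - g) = ev n f - ev n g"
 using ev_add[of n "f - g" g] by (simp add: algebra_simps)

lemma ev_mult:
 assumes "f : tensors d m" "g : tensors d n"
 shows "ev (m + n) (conc f g) = mul (ev m f) (ev n g)"
 using assms(2)
proof (induction n arbitrary: g)
 case 0
 have "conc f g = conc f (fscale (g []) (monomial []))" by (rule arg_cong[OF tensors_0[OF 0], of "conc f"])
 also have "... = fscale (g []) f" by (simp only: conc_scale_right conc_one_right)
 finally have e: "conc f g = fscale (g []) f" .
 show ?case unfolding e add_0_right ev.simps(1) ev_scale mul_scale_right[OF ev_Z e_Z] mul_e[OF ev_Z] ..
next
 case (Suc n)
 have "g [] = 0" using tensor_zero[OF Suc(2), of "[]"] by simp
 then have "ev (m + Suc n) (conc f g) = (\<Sum>j<d. mul (ev (m + n) (conc f (last_cut j g))) (y j))"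
  by (simp add: last_cut_conc)
 also have "... = (\<Sum>j<d. mul (ev m f) (mul (ev n (last_cut j g)) (y j)))"
  by (rule sum.cong) (simp_all add: Suc.IH[OF last_cut_tensors[OF Suc(2)]] assoc[OF ev_Z ev_Z y])
 also have "... = mul (ev m f) (\<Sum>j<d. mul (ev n (last_cut j g)) (y j))"
  by (rule mul_sum_right[OF ev_Z, symmetric]) (rule mul_y[OF ev_Z], simp)
 finally show ?case by simp
qed

lemma ev_letters: "ev (Suc 0) f = (\<Sum>j<d. fscale (f [j]) (y j))"
 unfolding ev.simps by (rule sum.cong) (simp_all add: mul_scale_left[OF e_Z y] e_mul[OF y] last_cut_def)

lemma ev_conc_letters: "ev (Suc n) (\<Sum>j<d. conc (u j) (monomial [j])) = (\<Sum>j<d. mul (ev n (u j)) (y j))"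
 unfolding ev.simps by (rule sum.cong) (simp_all add: last_cut_conc_sum)

lemma ev_surj:
 assumes gen: "\<And>n z. z : Z (Suc n) ==> \<exists>v. (\<forall>j<d. v j : Z n) \<and> z - (\<Sum>j<d. mul (v j) (y j)) : B (Suc n)"
  and z: "z : Z n"
 shows "\<exists>f\<in>tensors d n. z - ev n f : B n"
 using z
proof (induction n arbitrary: z)
 case 0
 then obtain c where "z - fscale c e : B 0" using Z_0 by blast
 moreover have "ev 0 (fscale c (monomial [])) = fscale c e" by (simp add: monomial_def)
 moreover have "fscale c (monomial []) : tensors d 0" by (intro tensors_intros(3) monomial_tensors) simp_all
 ultimately show ?case by metis
next
 case (Suc n)
 obtain v where v: "\<And>j. j < d ==> v j : Z n" and zv: "z - (\<Sum>j<d. mul (v j) (y j)) : B (Suc n)"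
  using gen[OF Suc(2)] by blast
 define f where "f j = (SOME f. f : tensors d n \<and> v j - ev n f : B n)" for j
 have f: "f j : tensors d n \<and> v j - ev n (f j) : B n" if "j < d" for j
 proof -
  have "\<exists>f. f : tensors d n \<and> v j - ev n f : B n" using Suc.IH[OF v[OF that]] by blast
  from someI_ex[OF this] show ?thesis unfolding f_def .
 qed
 have "(\<Sum>j<d. mul (v j) (y j)) - ev (Suc n) (\<Sum>j<d. conc (f j) (monomial [j])) =
   (\<Sum>j<d. mul (v j - ev n (f j)) (y j))"
  unfolding ev_conc_letters sum_subtractf[symmetric]
  by (rule sum.cong) (simp_all add: mul_diff_left[OF v ev_Z y])
 also have "... : B (Suc n)" by (rule Bs(6)) (simp add: mul_y_B f)
 finally have "(z - (\<Sum>j<d. mul (v j) (y j))) + ((\<Sum>j<d. mul (v j) (y j)) - ev (Suc n) (\<Sum>j<d. conc (f j) (monomial [j]))) : B (Suc n)"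
  by (rule Bs(1)[OF zv])
 then have "z - ev (Suc n) (\<Sum>j<d. conc (f j) (monomial [j])) : B (Suc n)" by simp
 moreover have "conc (f j) (monomial [j]) : tensors d (Suc n)" if "j < d" for j
  using conc_tensors[of "f j" d n "monomial [j]" 1] f[OF that] monomial_tensors[of "[j]" 1 d] that by simp
 then have "(\<Sum>j<d. conc (f j) (monomial [j])) : tensors d (Suc n)" by (intro tensors_intros(6)) simp
 ultimately show ?case by blast
qed

lemma ev_ideal:
 assumes \<Omega>: "relation_space d \<Omega>" "\<And>\<omega>. \<omega> : \<Omega> ==> ev 2 \<omega> : B 2" and f: "f : ideal_comp d \<Omega> n"
 shows "ev n f : B n"
proof -
 define W where "W = {f. ev n f : B n}"
 have "ideal_comp d \<Omega> n <= W"
 proof (rule ideal_comp_least)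
  show "fscale.subspace W"
   unfolding W_def by (rule fscale.subspaceI) (simp_all only: mem_Collect_eq ev_add ev_scale ev_lin_0 Bs(1,3,5))
  fix f \<omega> g :: "nat list => 'k" and i j assume *: "f : tensors d i" "\<omega> : \<Omega>" "g : tensors d j" "n = i + 2 + j"
  have \<omega>: "\<omega> : tensors d 2" using \<Omega>(1) *(2) by (auto simp: relation_space_def)
  have "ev (i + (2 + j)) (conc f (conc \<omega> g)) = mul (ev i f) (mul (ev 2 \<omega>) (ev j g))"
   unfolding ev_mult[OF *(1) conc_tensors[OF \<omega> *(3)]] ev_mult[OF \<omega> *(3)] ..
  also have "... : B (i + (2 + j))" by (intro mul_B_right mul_B_left ev_Z \<Omega>(2) *(2))
  finally show "conc f (conc \<omega> g) : W" using *(4) by (simp add: W_def add.assoc)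
 qed
 then show ?thesis using f by (auto simp: W_def)
qed

text \<open>Generation in degree 1 gives surjectivity, and the relations in degree 2 give one
  inclusion of kernels, so injectivity modulo the ideal is the substantial hypothesis.\<close>

lemma ev_morphism:
 assumes gen: "\<And>n z. z : Z (Suc n) ==> \<exists>v. (\<forall>j<d. v j : Z n) \<and> z - (\<Sum>j<d. mul (v j) (y j)) : B (Suc n)"
  and \<Omega>: "relation_space d \<Omega>" "\<And>\<omega>. \<omega> : \<Omega> ==> ev 2 \<omega> : B 2"
  and inj: "\<And>n f. f : tensors d n ==> ev n f : B n ==> f : ideal_comp d \<Omega> n"
 shows "subquotient_morphism conc (monomial []) (tensors d) (ideal_comp d \<Omega>) mul e Z B ev"
proof (intro subquotient_morphism.intro quadratic_subquotient \<Omega>(1) subquotient_morphism_axioms.intro)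
 show "subquotient mul e Z B" by unfold_locales
 show "ev 0 (monomial []) = e" by (simp add: monomial_def)
 show "\<exists>x\<in>tensors d n. z - ev n x : B n" if "z : Z n" for z n by (rule ev_surj[OF gen that])
 show "ev n x : B n \<longleftrightarrow> x : ideal_comp d \<Omega> n" if "x : tensors d n" for x n
  using inj[OF that] ev_ideal[OF \<Omega>] by blast
qed (simp_all only: ev_Z ev_add ev_scale ev_mult)

end

section \<open>The graded group algebra of a Demushkin group\<close>

context demushkin_data begin

sublocale X: letter_map "cga_mult G" "cga_one G T" apow "%n. apow (Suc n)" d xi
 by unfold_locales (simp only: apow_1 xi_aug)

text \<open>I is generated by the \<open>x_j\<close> as a left ideal, so a product
  \<open>x y\<close> with \<open>y = \<Sum> v_j x_j\<close> has coefficients \<open>x v_j\<close>,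
  which stay in the power that contains \<open>x\<close>.\<close>

lemma apow_letters:
 assumes "z : apow (Suc n)"
 shows "\<exists>v. (\<forall>j<d. v j : apow n) \<and> z = (\<Sum>j<d. cga_mult G (v j) (xi j))"
proof -
 define S where "S = {z. \<exists>v. (\<forall>j<d. v j : apow n) \<and> z = (\<Sum>j<d. cga_mult G (v j) (xi j))}"
 have "z : S"
 proof (rule apow_minimal[OF _ _ assms])
  show "fscale.subspace S"
  proof (rule fscale.subspaceI)
   have "(\<Sum>j<d. cga_mult G 0 (xi j)) = 0"
    using cga_mult_scale_left[OF cga_intros(5) xi_cga, of _ 0] by (intro sum.neutral) simp
   then show "0 : S" unfolding S_def mem_Collect_eq
    by (intro exI[of _ "%_. 0"] conjI allI impI apow_intros(5)) (rule sym)
   fix x y assume "x : S" "y : S"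
   then obtain v w where v: "\<And>j. j < d ==> v j : apow n" "x = (\<Sum>j<d. cga_mult G (v j) (xi j))"
    and w: "\<And>j. j < d ==> w j : apow n" "y = (\<Sum>j<d. cga_mult G (w j) (xi j))" by (auto simp: S_def)
   have "x + y = (\<Sum>j<d. cga_mult G (v j + w j) (xi j))"
    unfolding v(2) w(2) sum.distrib[symmetric]
    by (rule sum.cong) (simp_all add: cga_mult_add_left apow_cga[OF v(1)] apow_cga[OF w(1)] xi_cga)
   then show "x + y : S" unfolding S_def mem_Collect_eq
    by (intro exI[of _ "%j. v j + w j"] conjI allI impI apow_intros(1) v w)
  next
   fix c x assume "x : S"
   then obtain v where v: "\<And>j. j < d ==> v j : apow n" "x = (\<Sum>j<d. cga_mult G (v j) (xi j))"
    by (auto simp: S_def)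
   have "fscale c x = (\<Sum>j<d. cga_mult G (fscale c (v j)) (xi j))"
    unfolding v(2) fscale.scale_sum_right
    by (rule sum.cong) (simp_all only: lessThan_iff cga_mult_scale_left apow_cga[OF v(1)] xi_cga)
   then show "fscale c x : S" unfolding S_def mem_Collect_eq
    by (intro exI[of _ "%j. fscale c (v j)"] conjI allI impI apow_intros(3) v)
  qed
  fix x y :: "'g set \<times> 'g set => 'k" assume x: "x : apow n" and y: "y : aug"
  obtain v where v: "\<And>j. v j : cga" "y = (\<Sum>j<d. cga_mult G (v j) (xi j))" by (rule aug_span[OF y]) (rule that)
  have "cga_mult G x y = (\<Sum>j<d. cga_mult G x (cga_mult G (v j) (xi j)))"
   unfolding v(2) using x v(1) by (intro Gr.mul_sum_right[of x n _ _ 0]) (simp_all add: cga_mult_closed xi_cga)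
  also have "... = (\<Sum>j<d. cga_mult G (cga_mult G x (v j)) (xi j))"
   by (rule sum.cong) (simp_all add: cga_mult_assoc apow_cga[OF x] v(1) xi_cga)
  finally show "cga_mult G x y : S"
   unfolding S_def mem_Collect_eq
   using apow_mult[OF x, of _ 0] v(1) by (intro exI[of _ "%j. cga_mult G x (v j)"]) simp
 qed
 then show ?thesis by (simp add: S_def)
qed

lemma \<psi>_lev: "\<psi> i : lev 2"
proof -
 have "kc c : lev (Suc 0)" for c :: 'k by (simp add: kc_lc lt_kc)
 then show ?thesis unfolding numeral_2_eq_2 lev.simps(2)[of "Suc 0"] using \<psi>_lc by (simp add: lt_\<psi> del: lev.simps)
qed

text \<open>For \<open>x = \<Sum> v_j x_j\<close> the pairing with \<open>\<psi> i\<close> is the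
  augmentation of \<open>v_i\<close>, so vanishing pairings put every coefficient into I. Conversely
  \<open>\<psi> i\<close> has level 2 and is killed by I^2.\<close>

lemma apow_2_iff: "x : aug ==> x : apow 2 \<longleftrightarrow> (\<forall>i<d. pr x (\<psi> i) = (0 :: 'k))"
proof
 show "\<forall>i<d. pr x (\<psi> i) = 0" if "x : apow 2" using apow_kills_lev[OF that \<psi>_lev] by blast
 assume x: "x : aug" and 0: "\<forall>i<d. pr x (\<psi> i) = (0 :: 'k)"
 obtain v where v: "\<And>j. v j : cga" "x = (\<Sum>j<d. cga_mult G (v j) (xi j))" by (rule aug_span[OF x]) (rule that)
 have "v i : aug" if i: "i < d" for i
 proof -
  have "pr x (\<psi> i) = (\<Sum>j<d. pr (v j) (comp (\<Delta> (\<psi> i)) j))"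
   unfolding v(2) by (rule pr_sum_xi[of v, OF v(1) \<psi>_lc])
  also have "... = (\<Sum>j<d. if j = i then pr (v j) (kc 1) else 0)"
   by (rule sum.cong) (use i in \<open>auto simp: comp_opd act_xi_\<psi> kc_0 pr_0 v(1)\<close>)
  also have "... = pr (v i) (kc 1)" using i by simp
  finally show ?thesis using 0 i v(1) by (simp add: aug_iff)
 qed
 then have "cga_mult G (v j) (xi j) : apow (Suc (Suc 0))" if "j < d" for j
  using apow_gen[of "v j" "Suc 0" "xi j"] xi_aug that unfolding apow_1 by blast
 then show "x : apow 2" unfolding v(2) numeral_2_eq_2 by (intro apow_intros(6)) simp
qed

definition rho :: "nat => nat list => 'k" where
 "rho j = last_cut j (form_tensor d b)"

lemma rho_tensors: "rho j : tensors d (Suc 0)"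
 unfolding rho_def by (rule last_cut_tensors) (use form_tensor_tensors in \<open>simp add: numeral_2_eq_2\<close>)

lemma rho_letter: "i < d ==> j < d ==> rho j [i] = b i j"
 by (simp add: rho_def last_cut_def form_tensor_pair)

lemma pr_ev_\<psi>: "i < d ==> pr (X.ev (Suc 0) f) (\<psi> i) = f [i]"
proof -
 assume i: "i < d"
 have "pr (X.ev (Suc 0) f) (\<psi> i) = (\<Sum>j<d. pr (fscale (f [j]) (xi j)) (\<psi> i))"
  unfolding X.ev_letters by (rule pr_sum_left[OF \<psi>_lc]) (simp add: cga_intros(3) xi_cga del: fscale_apply)
 also have "... = (\<Sum>j<d. if j = i then f [j] else 0)"
  by (rule sum.cong[OF refl]) (use i xi_cga in \<open>auto simp: pr_scale_left[OF \<psi>_lc] xi_\<psi>\<close>)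
 finally show ?thesis using i by simp
qed

lemma ev_1_aug: "X.ev (Suc 0) f : aug"
 using X.ev_Z[of "Suc 0" f] unfolding apow_1 .

lemma rr_rho: "j < d ==> rr j - X.ev (Suc 0) (rho j) : apow 2"
proof -
 assume j: "j < d"
 have a: "rr j - X.ev (Suc 0) (rho j) : aug"
  by (rule fscale.subspace_diff[OF aug_subspace rr_aug[OF j] ev_1_aug])
 have c: "X.ev (Suc 0) (rho j) : cga" using ev_1_aug[of "rho j"] unfolding aug_iff by blast
 show ?thesis
  unfolding apow_2_iff[OF a] pr_diff_left[OF \<psi>_lc rr_cga c]
  using j by (simp add: rr_\<psi> pr_ev_\<psi> rho_letter del: X.ev.simps)
qed

text \<open>In L the exact relation is \<open>\<Sum> r_j x_j = 0\<close>; replacing each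
  \<open>r_j\<close> by its linear part changes the sum by an element of I^3.\<close>

lemma ev_relation: "X.ev 2 (form_tensor d b) : apow 3"
proof -
 have "X.ev 2 (form_tensor d b) = (\<Sum>j<d. cga_mult G (X.ev (Suc 0) (rho j)) (xi j)) - (\<Sum>j<d. cga_mult G (rr j) (xi j))"
  unfolding rr_xi by (simp only: numeral_2_eq_2 rho_def X.ev.simps(2)[of "Suc 0"] diff_0_right)
 also have "... = (\<Sum>j<d. cga_mult G (X.ev (Suc 0) (rho j) - rr j) (xi j))"
  unfolding sum_subtractf[symmetric]
  by (rule sum.cong) (simp_all add: Gr.mul_diff_left[of _ 0 _ _ 0] rr_cga xi_cga apow_cga[OF X.ev_Z] del: X.ev.simps)
 also have "... : apow (Suc 2)"
 proof (rule apow_intros(6))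
  fix j assume "j : {..<d}"
  then have j: "j < d" by simp
  have "- (rr j - X.ev (Suc 0) (rho j)) : apow 2" by (rule apow_intros(4)[OF rr_rho[OF j]])
  then have "X.ev (Suc 0) (rho j) - rr j : apow 2" by simp
  then show "cga_mult G (X.ev (Suc 0) (rho j) - rr j) (xi j) : apow (Suc 2)" by (rule apow_gen[OF _ xi_aug[OF j]])
 qed
 finally show ?thesis by simp
qed

lemma ev_form_rel: "\<omega> : form_rel d b ==> X.ev 2 \<omega> : apow (Suc 2)"
 using ev_relation apow_intros(3) unfolding form_rel_iff by (auto simp: X.ev_scale simp del: augmentation_power.simps)

lemma ev_form_ideal: "f : ideal_comp d (form_rel d b) n ==> X.ev n f : apow (Suc n)"
 using X.ev_ideal[OF form_rel_relation_space, of b] ev_form_rel by blast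

lemma cga_mult_diff_left: "x : cga ==> x' : cga ==> y : cga ==>
  cga_mult G (x - x') y = cga_mult G x y - (cga_mult G x' y :: _ => 'k)"
 by (rule Gr.mul_diff_left[of x 0 x' y 0]) simp_all

text \<open>Degree 0 is decided by the augmentation and degree 1 by the pairings with the
  \<open>\<psi> i\<close>.\<close>

lemma ev_low:
 assumes "f : tensors d n" "X.ev n f : apow (Suc n)" "n < 2"
 shows "f = 0"
proof (cases n)
 case 0
 have "f [] = 0"
 proof (rule ccontr)
  assume nz: "f [] ~= 0"
  have "fscale (inverse (f [])) (X.ev 0 f) : apow (Suc 0)" using assms(2) unfolding 0 by (rule apow_intros(3))
  then have "cga_one G T : (apow (Suc 0) :: (_ => 'k) set)"
   unfolding X.ev.simps(1) fscale.scale_scale left_inverse[OF nz] fscale.scale_one .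
  then show False by (rule notE[OF Gr.e_B])
 qed
 then show ?thesis using tensors_0[of f d] assms(1) 0 by simp
next
 case (Suc k)
 then have n: "n = Suc 0" using assms(3) by simp
 have "f [i] = 0" if "i < d" for i
  using apow_2_iff[OF ev_1_aug] assms(2) pr_ev_\<psi>[OF that] that unfolding n numeral_2_eq_2 by metis
 then have "f w = 0" for w
  using tensor_nonzero[OF assms(1), of w] n by (cases w) auto
 then show ?thesis by (simp add: fun_eq_iff)
qed

lemma ev_conc_rho:
 assumes a: "a : apow i" "\<alpha> : tensors d i" "a - X.ev i \<alpha> : apow (Suc i)" and j: "j < d"
 shows "cga_mult G a (rr j) - X.ev (Suc i) (conc \<alpha> (rho j)) : apow (Suc (Suc i))"
proof -
 have c: "a : cga" "X.ev i \<alpha> : cga" "X.ev (Suc 0) (rho j) : cga"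
  using apow_cga[OF a(1)] apow_cga[OF X.ev_Z] by blast+
 have "X.ev (Suc i) (conc \<alpha> (rho j)) = cga_mult G (X.ev i \<alpha>) (X.ev (Suc 0) (rho j))"
  using X.ev_mult[OF a(2) rho_tensors] by simp
 then have "cga_mult G a (rr j) - X.ev (Suc i) (conc \<alpha> (rho j)) =
   cga_mult G a (rr j - X.ev (Suc 0) (rho j)) + cga_mult G (a - X.ev i \<alpha>) (X.ev (Suc 0) (rho j))"
  using c Gr.mul_diff_left[of a 0 "X.ev i \<alpha>" "X.ev (Suc 0) (rho j)" 0]
   Gr.mul_diff_right[of a 0 "rr j" 0 "X.ev (Suc 0) (rho j)"] rr_cga by simp
 also have "... : apow (Suc (Suc i))"
 proof (rule apow_intros(1))
  show "cga_mult G a (rr j - X.ev (Suc 0) (rho j)) : apow (Suc (Suc i))"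
   using apow_mult[OF a(1) rr_rho[OF j]] by (simp del: augmentation_power.simps)
  show "cga_mult G (a - X.ev i \<alpha>) (X.ev (Suc 0) (rho j)) : apow (Suc (Suc i))"
   using apow_mult[OF a(3) X.ev_Z[of "Suc 0" "rho j"]] by (simp del: augmentation_power.simps)
 qed
 finally show ?thesis .
qed

lemma ev_surj: "z : apow n ==> \<exists>f\<in>tensors d n. z - X.ev n f : apow (Suc n)"
proof (rule X.ev_surj)
 fix n z assume "z : (apow (Suc n) :: (_ => 'k) set)"
 then obtain v where "\<forall>j<d. v j : apow n" "z = (\<Sum>j<d. cga_mult G (v j) (xi j))" using apow_letters by blast
 then show "\<exists>v. (\<forall>j<d. v j : apow n) \<and> z - (\<Sum>j<d. cga_mult G (v j) (xi j)) : apow (Suc (Suc n))"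
  using apow_intros(5) by (intro exI[of _ v]) (simp del: augmentation_power.simps)
qed

text \<open>Cancellation of \<open>\<rho> l\<close> carried from tensors to the filtration: pass to
  leading forms, use injectivity of evaluation in degree \<open>Suc i\<close> to reach the ideal,
  cancel there and evaluate again.\<close>

lemma rr_cancel:
 assumes "isotropic_form d b m l"
  and inj: "\<And>f. f : tensors d (Suc i) ==> X.ev (Suc i) f : apow (Suc (Suc i)) ==> f : ideal_comp d (form_rel d b) (Suc i)"
  and a: "a : apow i" "cga_mult G a (rr l) : apow (Suc (Suc i))"
 shows "a : apow (Suc i)"
proof -
 interpret F: isotropic_form d b m l by fact
 obtain \<alpha> where \<alpha>: "\<alpha> : tensors d i" "a - X.ev i \<alpha> : apow (Suc i)" using ev_surj[OF a(1)] by blast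
 have t: "conc \<alpha> (rho l) : tensors d (Suc i)" using conc_tensors[OF \<alpha>(1) rho_tensors] by simp
 have "cga_mult G a (rr l) - (cga_mult G a (rr l) - X.ev (Suc i) (conc \<alpha> (rho l))) : apow (Suc (Suc i))"
  by (rule apow_intros(2)[OF a(2) ev_conc_rho[OF a(1) \<alpha> F.l]])
 then have "X.ev (Suc i) (conc \<alpha> (rho l)) : apow (Suc (Suc i))" by (simp del: augmentation_power.simps X.ev.simps)
 then have "\<alpha> : F.I i" using F.cancel_right_\<rho>[OF \<alpha>(1)] inj[OF t] by (simp add: rho_def)
 then have "X.ev i \<alpha> : apow (Suc i)" by (rule ev_form_ideal)
 then have "a - X.ev i \<alpha> + X.ev i \<alpha> : apow (Suc i)" by (rule apow_intros(1)[OF \<alpha>(2)])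
 then show ?thesis by (simp del: augmentation_power.simps X.ev.simps)
qed

text \<open>The evaluation of \<open>f\<close> is rewritten with deeper coefficients, and the
  difference is a relation \<open>\<Sum> v_j x_j = 0\<close> in L, so \<open>v_j = a r_j\<close>.
  Once \<open>a\<close> is known to lie in I^k, its leading form \<open>\<alpha>\<close> satisfies
  \<open>f_j = \<alpha> \<rho>_j\<close> modulo the ideal by induction, and then \<open>f\<close> is
  \<open>\<alpha> \<omega>\<close> modulo the ideal.\<close>

lemma ev_injective:
 assumes iso: "isotropic_form d b m l" and "f : tensors d n" "X.ev n f : apow (Suc n)"
 shows "f : ideal_comp d (form_rel d b) n"
 using assms(2,3)
proof (induction n arbitrary: f rule: less_induct)
 case (less n)
 interpret F: isotropic_form d b m l by (rule iso)
 show ?case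
 proof (cases "n < 2")
  case True
  show ?thesis unfolding ev_low[OF less(2,3) True] by (rule F.Is(5))
 next
  case False
  then obtain k where n: "n = Suc (Suc k)" by (metis One_nat_def Suc_1 Suc_pred not_less_eq not_less_zero zero_less_Suc gr0_conv_Suc less_2_cases_iff neq0_conv not0_implies_Suc)
  define g where "g j = last_cut j f" for j
  have g: "g j : tensors d (Suc k)" for j unfolding g_def using less(2) n by (intro last_cut_tensors) simp
  obtain u where u: "\<And>j. j < d ==> u j : apow (Suc (Suc k))"
   and fu: "X.ev (Suc (Suc k)) f = (\<Sum>j<d. cga_mult G (u j) (xi j))"
   using apow_letters[OF less(3)[unfolded n]] by blast
  define v where "v j = X.ev (Suc k) (g j) - u j" for j
  have v: "v j : apow (Suc k)" if "j < d" for j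
   unfolding v_def by (rule apow_intros(2)[OF X.ev_Z apow_Suc[OF u[OF that]]])
  have "(\<Sum>j<d. cga_mult G (v j) (xi j)) = (\<Sum>j<d. cga_mult G (X.ev (Suc k) (g j)) (xi j)) - (\<Sum>j<d. cga_mult G (u j) (xi j))"
   unfolding v_def sum_subtractf[symmetric]
  proof (rule sum.cong[OF refl])
   fix j assume "j : {..<d}"
   then have j: "j < d" by simp
   show "cga_mult G (X.ev (Suc k) (g j) - u j) (xi j) = cga_mult G (X.ev (Suc k) (g j)) (xi j) - cga_mult G (u j) (xi j)"
    by (rule cga_mult_diff_left[OF apow_cga[OF X.ev_Z] apow_cga[OF u[OF j]] xi_cga[OF j]])
  qed
  also have "... = 0" unfolding fu[symmetric] g_def by simp
  finally have "(\<Sum>j<d. cga_mult G (v j) (xi j)) = 0" .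
  from relations[OF apow_cga[OF v] this]
  obtain a where a: "a : cga" "\<And>j. j < d ==> v j = cga_mult G a (rr j)" by blast
  \<comment> \<open>\<open>relations\<close> gives \<open>a\<close> only in L; each cancellation of
    \<open>r_l\<close>, justified by injectivity in the smaller degree \<open>Suc i\<close>, raises
    its depth by one.\<close>
  have "a : apow i" if "i \<le> k" for i
   using that
  proof (induction i)
   case 0
   then show ?case using a(1) by simp
  next
   case (Suc i)
   have ar: "cga_mult G a (rr l) : apow (Suc (Suc i))"
    using apow_mono[OF _ v[OF F.l], of "Suc (Suc i)"] Suc(2) a(2)[OF F.l] by (simp del: augmentation_power.simps)
   have ai: "a : apow i" using Suc by simp
   have "Suc i < n" using Suc(2) n by simp
   from less(1)[OF this] show ?case by (rule rr_cancel[OF iso _ ai ar])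
  qed
  then have ak: "a : apow k" by simp
  obtain \<alpha> where \<alpha>: "\<alpha> : tensors d k" "a - X.ev k \<alpha> : apow (Suc k)" using ev_surj[OF ak] by blast
  have t: "conc \<alpha> (rho j) : tensors d (Suc k)" for j using conc_tensors[OF \<alpha>(1) rho_tensors] by simp
  have I: "g j - conc \<alpha> (rho j) : F.I (Suc k)" if j: "j < d" for j
  proof (rule less(1))
   show "Suc k < n" using n by simp
   show "g j - conc \<alpha> (rho j) : tensors d (Suc k)" by (rule tensors_intros(2)[OF g t])
   have e: "X.ev (Suc k) (g j) = u j + cga_mult G a (rr j)"
    using a(2)[OF j] unfolding v_def diff_eq_eq by (simp only: add.commute)
   have "X.ev (Suc k) (g j - conc \<alpha> (rho j)) = u j + (cga_mult G a (rr j) - X.ev (Suc k) (conc \<alpha> (rho j)))"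
    unfolding X.ev_diff e by (simp only: add_diff_eq)
   also have "... : apow (Suc (Suc k))" by (rule apow_intros(1)[OF u[OF j] ev_conc_rho[OF ak \<alpha> j]])
   finally show "X.ev (Suc k) (g j - conc \<alpha> (rho j)) : apow (Suc (Suc k))" .
  qed
  have "f = (\<Sum>j<d. conc (g j) (monomial [j]))" unfolding g_def using less(2) n by (intro sum_last_cut) simp
  \<comment> \<open>The subtracted terms add up to \<open>\<alpha> \<omega>\<close> since
    \<open>\<omega> = \<Sum> \<rho>_j x_j\<close>.\<close>
  also have "... = (\<Sum>j<d. conc (g j - conc \<alpha> (rho j)) (monomial [j])) + conc \<alpha> (form_tensor d b)"
  proof -
   have "conc \<alpha> (form_tensor d b) = (\<Sum>j<d. conc \<alpha> (conc (rho j) (monomial [j])))"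
    using arg_cong[OF form_tensor_decomp[of d b], of "conc \<alpha>"] unfolding conc_sum_right rho_def[symmetric] .
   then show ?thesis
    unfolding sum.distrib[symmetric] by (simp only: sum.distrib[symmetric] conc_minus_left conc_assoc diff_add_cancel)
  qed
  also have "... : F.I n"
  proof (rule F.Is(1))
   show "(\<Sum>j<d. conc (g j - conc \<alpha> (rho j)) (monomial [j])) : F.I n"
   proof (rule F.Is(6))
    fix j assume "j : {..<d}"
    then show "conc (g j - conc \<alpha> (rho j)) (monomial [j]) : F.I n"
     using ideal_comp_conc_right[OF I, of j "monomial [j]" 1] monomial_tensors[of "[j]" 1 d] n by simp
   qed
   have "form_tensor d b : F.I 2" by (rule ideal_comp_relation) (rule fscale.span_base, simp)
   then show "conc \<alpha> (form_tensor d b) : F.I n"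
    using ideal_comp_conc_left[OF \<alpha>(1)] n by (metis add_2_eq_Suc')
  qed
  finally show ?thesis .
 qed
qed

text \<open>From degree 2 on every tensor lies in the ideal generated by \<open>x^2\<close>, so only
  the degrees below 2 involve the group.\<close>

lemma ev_injective_unary:
 assumes d: "d = 1" and b: "b 0 0 ~= 0" and f: "f : tensors d n" "X.ev n f : apow (Suc n)"
 shows "f : ideal_comp d (form_rel d b) n"
proof (cases "n < 2")
 case True
 show ?thesis unfolding ev_low[OF f True] by (rule fscale.subspace_0[OF ideal_comp_subspace])
next
 case False
 interpret F: unary_form b by unfold_locales (rule b)
 have "n = Suc (Suc (n - 2))" using False by simp
 then show ?thesis using F.tensors_I[of f "n - 2"] f(1) d by simp
qed

lemma gr_morphism:
 assumes "(\<exists>m l. isotropic_form d b m l) \<or> d = 1 \<and> b 0 0 ~= 0"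
 shows "subquotient_morphism conc (monomial []) (tensors d) (ideal_comp d (form_rel d b))
  (cga_mult G) (cga_one G T) apow (%n. apow (Suc n)) X.ev"
proof (rule X.ev_morphism[OF _ form_rel_relation_space ev_form_rel])
 fix n z assume "z : (apow (Suc n) :: (_ => 'k) set)"
 then obtain v where "\<forall>j<d. v j : apow n" "z = (\<Sum>j<d. cga_mult G (v j) (xi j))" using apow_letters by blast
 then show "\<exists>v. (\<forall>j<d. v j : apow n) \<and> z - (\<Sum>j<d. cga_mult G (v j) (xi j)) : apow (Suc (Suc n))"
  using apow_intros(5) by (intro exI[of _ v]) (simp del: augmentation_power.simps)
next
 show "f : ideal_comp d (form_rel d b) n" if "f : tensors d n" "X.ev n f : apow (Suc n)" for f n
  using assms that ev_injective ev_injective_unary by blast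
qed

text \<open>A functional vanishing on the image is an element \<open>a\<close> with
  \<open>a r_l = 0\<close>; cancellation pushes it into every power of I, and these meet in
  0.\<close>

lemma \<Phi>_surj:
 assumes iso: "isotropic_form d b m l" and f: "f : lc"
 shows "\<exists>F\<in>lcd d. \<Phi> F = f"
proof (rule ccontr)
 interpret F: isotropic_form d b m l by (rule iso)
 assume no: "\<not> (\<exists>F\<in>lcd d. \<Phi> F = f)"
 have sub: "fscale.subspace (\<Phi> ` lcd d)"
 proof (rule fscale.subspaceI)
  have "\<Phi> 0 = 0" using \<Phi>_scale[OF fscale.subspace_0[OF lcd_subspace], of 0] by simp
  then show "0 : \<Phi> ` lcd d" using fscale.subspace_0[OF lcd_subspace] by (metis imageI)
  show "x + y : \<Phi> ` lcd d" if x: "x : \<Phi> ` lcd d" and y: "y : \<Phi> ` lcd d" for x y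
  proof -
   obtain F where F: "x = \<Phi> F" "F : lcd d" using x by (rule imageE)
   obtain F' where F': "y = \<Phi> F'" "F' : lcd d" using y by (rule imageE)
   have "x + y = \<Phi> (F + F')" unfolding F(1) F'(1) by (rule \<Phi>_add[OF F(2) F'(2), symmetric])
   then show ?thesis using fscale.subspace_add[OF lcd_subspace F(2) F'(2)] by (rule image_eqI)
  qed
  show "fscale c x : \<Phi> ` lcd d" if x: "x : \<Phi> ` lcd d" for c x
  proof -
   obtain F where F: "x = \<Phi> F" "F : lcd d" using x by (rule imageE)
   have "fscale c x = \<Phi> (fscale c F)" unfolding F(1) by (rule \<Phi>_scale[OF F(2), symmetric])
   then show ?thesis using fscale.subspace_scale[OF lcd_subspace F(2)] by (rule image_eqI)
  qed
 qed
 have "f \<notin> \<Phi> ` lcd d" using no by blast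
 from separating_functional[OF sub this]
 obtain g where g: "lin_on UNIV g" "\<And>x. x : \<Phi> ` lcd d ==> g x = 0" "g f = 1" by blast
 have g': "lin_on lc g" by (rule lin_on_subset[OF g(1)]) simp
 define a where "a = of_fun g"
 have a: "a : cga" unfolding a_def by (rule of_fun_cga[OF g'])
 have "cga_mult G a (rr l) = 0"
 proof (rule cga_eqI[OF cga_mult_closed[OF a rr_cga] cga_intros(5)])
  fix h :: "'g => 'k" assume h: "h : lc"
  have "pr (cga_mult G a (rr l)) h = g (act (rr l) h)"
   unfolding pr_mult[OF a rr_cga h] unfolding a_def by (rule pr_of_fun[OF g' act_lc[OF h]])
  also have "... = g (\<Phi> (slot l h))" by (simp only: \<Phi>_slot[OF F.l])
  also have "... = 0" using slot_lcd[OF h F.l] by (intro g(2)) blast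
  finally show "pr (cga_mult G a (rr l)) h = pr 0 h" using lin_on_0[OF pr_lin_left[OF h] cga_intros(5)] by simp
 qed
 then have 0: "cga_mult G a (rr l) : apow n" for n using apow_intros(5) by simp
 have "a : apow n" for n
 proof (induction n)
  case (Suc n)
  show ?case by (rule rr_cancel[OF iso ev_injective[OF iso] Suc 0])
 qed (simp add: a)
 then have "a = 0" by (rule apow_separated)
 then have "pr a f = 0" using lin_on_0[OF pr_lin_left[OF f] cga_intros(5)] by simp
 moreover have "pr a f = 1" unfolding a_def pr_of_fun[OF g' f] by (rule g(3))
 ultimately show False by simp
qed

end

section \<open>Cohomology of a Demushkin group\<close>

context pro_p begin

lemma tcob_cong2:
 "over zs ==> (\<And>us. over us ==> Suc (length us) = length zs ==> Y us = Y' us) ==>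
  tcob A Y zs = tcob A Y' zs"
proof (induction zs arbitrary: Y Y' rule: induct_list012)
 case (3 x y zs)
 have "tcob A (%us. Y (x # us)) (y # zs) = tcob A (%us. Y' (x # us)) (y # zs)"
  by (rule 3(2)) (use 3(3,4) in simp_all)
 moreover have "Y (y # zs) = Y' (y # zs)" "Y ((x \<otimes> y) # zs) = Y' ((x \<otimes> y) # zs)" "Y (x # zs) = Y' (x # zs)"
  using 3(3,4) by simp_all
 ultimately show ?case by simp
qed simp_all

text \<open>Values at lists of the wrong length or outside the carrier never enter, so they are
  replaced by 0 and \<open>tcob_map\<close> applies.\<close>

lemma tcob_map2:
 assumes V: "0 : V" "\<And>u v. u : V ==> v : V ==> u - v : V" "\<And>u v. u : V ==> v : V ==> u + v : V"
   "\<And>x v. x : CG ==> v : V ==> A x v : V"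
  and \<theta>: "\<theta> 0 = 0" "\<And>u v. u : V ==> v : V ==> \<theta> (u - v) = \<theta> u - \<theta> v"
   "\<And>u v. u : V ==> v : V ==> \<theta> (u + v) = \<theta> u + \<theta> v"
   "\<And>x v. x : CG ==> v : V ==> \<theta> (A x v) = A' x (\<theta> v)"
  and zs: "over zs"
  and Y: "\<And>us. over us ==> Suc (length us) = length zs ==> Y us : V"
 shows "tcob A Y zs : V" and "tcob A' (%us. \<theta> (Y us)) zs = \<theta> (tcob A Y zs)"
proof -
 define Z where "Z us = (if over us \<and> Suc (length us) = length zs then Y us else 0)" for us
 have ZV: "Z us : V" for us
 proof (cases "over us \<and> Suc (length us) = length zs")
  case True
  then show ?thesis using Y[of us] by (simp add: Z_def)
 next
  case False
  show ?thesis unfolding Z_def if_not_P[OF False] by (rule V(1))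
 qed
 have "tcob A Z zs : V \<and> tcob A' (%us. \<theta> (Z us)) zs = \<theta> (tcob A Z zs)"
  by (rule tcob_map[where V = V and A = A and \<theta> = \<theta> and A' = A' and zs = zs and Y = Z]) (simp_all only: V \<theta> zs ZV)
 moreover have "tcob A Z zs = tcob A Y zs" by (rule tcob_cong2[OF zs]) (simp add: Z_def)
 moreover have "tcob A' (%us. \<theta> (Z us)) zs = tcob A' (%us. \<theta> (Y us)) zs"
  by (rule tcob_cong2[OF zs]) (simp add: Z_def)
 ultimately show "tcob A Y zs : V" "tcob A' (%us. \<theta> (Y us)) zs = \<theta> (tcob A Y zs)" by simp_all
qed

text \<open>Uniform local constancy for cochains with values of any type. It survives composition
  with an arbitrary function of the values (\<open>li_map\<close>), so pointwise choices of
  preimages remain continuous.\<close>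

definition li :: "'g set => nat => ('g list => 'v) => bool" where
 "li U n Y \<longleftrightarrow> U : UU \<and> (\<forall>us vs. length us = n --> list_all2 (E U) us vs --> Y us = Y vs)"

lemma li_UU: "li U n Y ==> U : UU"
 and liD: "li U n Y ==> length us = n ==> list_all2 (E U) us vs ==> Y us = Y vs"
 unfolding li_def by blast+

lemma li_mono: "li U n Y ==> V : UU ==> V <= U ==> li V n Y"
 unfolding li_def using list_all2_mono[of "E V" _ _ "E U"] E_mono[of V U] by blast

lemma li_map: "li U n Y ==> li U n (%us. \<theta> (Y us))"
 unfolding li_def by metis

lemma li_map2: "li U n Y ==> li V n Y' ==> li (U \<inter> V) n (%us. \<theta> (Y us) (Y' us))"
proof -
 assume *: "li U n Y" "li V n Y'"
 have W: "U \<inter> V : UU" by (rule UU_Int[OF li_UU[OF *(1)] li_UU[OF *(2)]])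
 have "li (U \<inter> V) n Y" "li (U \<inter> V) n Y'" by (rule li_mono[OF *(1) W], simp, rule li_mono[OF *(2) W], simp)
 then show ?thesis unfolding li_def by metis
qed

text \<open>In the coboundary the last argument acts on a value of \<open>Y\<close>. Representatives
  of the cosets of \<open>U\<close> leave only finitely many values to consider, so one subgroup
  makes all these actions locally constant.\<close>

lemma li_tcob:
 fixes Y :: "'g list => 'v::ab_group_add"
 assumes Y: "li U n Y" and A: "\<And>g. A g 0 = (0 :: 'v)"
  and good: "\<And>us. over us ==> length us = n ==> \<exists>V\<in>UU. \<forall>g h. E V g h --> A g (Y us) = A h (Y us)"
 shows "\<exists>W. li W (Suc n) (tcob A Y)"
proof -
 note U = li_UU[OF Y]
 define R where "R = {us. set us <= rc ` Q U \<and> length us = n}"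
 have R: "over us \<and> length us = n" if "us : R" for us using that rc[OF U] by (auto simp: R_def)
 have "finite R" unfolding R_def by (intro finite_lists_length_eq finite_imageI finite_Q U)
 define N where "N us = (SOME V. V : UU \<and> (\<forall>g h. E V g h --> A g (Y us) = A h (Y us)))" for us
 have N: "N us : UU \<and> (\<forall>g h. E (N us) g h --> A g (Y us) = A h (Y us))" if "us : R" for us
 proof -
  have "\<exists>V. V : UU \<and> (\<forall>g h. E V g h --> A g (Y us) = A h (Y us))" using good R[OF that] by blast
  from someI_ex[OF this] show ?thesis unfolding N_def .
 qed
 have "\<exists>W\<in>UU. \<forall>us\<in>R. W <= N us" by (rule UU_finite_Int[OF \<open>finite R\<close>]) (use N in blast)
 then obtain W0 where W0: "W0 : UU" "\<And>us. us : R ==> W0 <= N us" by blast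
 define W where "W = U \<inter> W0"
 have W: "W : UU" unfolding W_def by (rule UU_Int[OF U W0(1)])
 define Y' where "Y' us = (if over us \<and> length us = n then Y us else 0)" for us
 have "tcob A Y zs = tcob A Y zs'" if zs: "length zs = Suc n" "list_all2 (E W) zs zs'" for zs zs'
 proof -
  have c: "over zs" "over zs'" using list_all2_E_carrier[OF W zs(2)] by blast+
  have l: "length zs' = Suc n" using list_all2_lengthD[OF zs(2)] zs(1) by simp
  have "tcob A Y zs = tcob A Y' zs" by (rule tcob_cong2[OF c(1)]) (use zs(1) in \<open>simp add: Y'_def\<close>)
  also have "... = tcob A Y' zs'"
  proof (rule tcob_inv[OF W _ _ zs(2)])
   fix us vs assume uv: "list_all2 (E W) us vs"
   have "list_all2 (E U) us vs" by (rule list_all2_mono[OF uv]) (use E_mono[of W U] in \<open>auto simp: W_def\<close>)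
   then show "Y' us = Y' vs"
    using liD[OF Y, of us vs] list_all2_lengthD[OF uv] list_all2_E_carrier[OF W uv] by (auto simp: Y'_def)
  next
   fix x y us assume xy: "E W x y"
   show "A x (Y' us) = A y (Y' us)"
   proof (cases "over us \<and> length us = n")
    case True
    define vs where "vs = map (%x. rc (U #> x)) us"
    have vR: "vs : R" using True Q_I by (auto simp: vs_def R_def)
    have "us ! i : CG" if "i < length us" for i using True nth_mem[OF that] by blast
    then have "list_all2 (E U) us vs"
     using E_sym[OF U E_rc[OF U]] by (simp add: vs_def list_all2_conv_all_nth)
    then have "Y us = Y vs" using liD[OF Y] True by blast
    moreover have "E (N vs) x y" by (rule E_mono[OF _ xy]) (use W0(2)[OF vR] in \<open>auto simp: W_def\<close>)
    ultimately show ?thesis using N[OF vR] True by (simp add: Y'_def)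
   qed (auto simp: Y'_def A)
  qed
  also have "... = tcob A Y zs'" by (rule tcob_cong2[OF c(2)]) (use l in \<open>simp add: Y'_def\<close>)
  finally show ?thesis .
 qed
 then show ?thesis using W unfolding li_def by blast
qed

lemma lc_good: "v : lc ==> \<exists>V\<in>UU. \<forall>g h. E V g h --> lt g v = lt h v"
proof -
 assume "v : lc"
 then obtain U where U: "inv_under U v" using lc_inv_under by blast
 then show ?thesis using lt_E[OF inv_under_UU[OF U], of v] inv_underD[OF U] inv_under_UU[OF U] by blast
qed

lemma li_cochain:
 fixes e :: "'g list => 'k::field"
 assumes "li U n e"
 shows "(%us. if length us = n \<and> over us then e us else 0) : Ch n"
proof (rule cochainsI[OF _ li_UU[OF assms]])
 show "cochain_inv U (%us. if length us = n \<and> over us then e us else 0)"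
  unfolding cochain_inv_def
 proof (intro allI impI)
  fix us vs assume uv: "list_all2 (E U) us vs"
  show "(if length us = n \<and> over us then e us else 0) = (if length vs = n \<and> over vs then e vs else 0)"
   using liD[OF assms, of us vs] uv list_all2_lengthD[OF uv] list_all2_E_carrier[OF li_UU[OF assms] uv] by auto
 qed
qed (auto split: if_splits)

text \<open>A cochain of degree n + 1 read as a cochain of degree n with values in C. By
  \<open>tr_lastf\<close> the coboundaries of the two readings differ by one term.\<close>

definition lastf :: "('g list => 'k) => 'g list => 'g => 'k::field" where
 "lastf f us = (%x. if x : CG then f (us @ [x]) else 0)"

lemma lastf_lc:
 assumes "li U (Suc n) f" "over us" "length us = n"
 shows "lastf f us : lc"
proof (rule lcI[OF _ li_UU[OF assms(1)]])
 fix x y assume xy: "E U x y"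
 have "list_all2 (E U) (us @ [x]) (us @ [y])"
  using xy list_all2_E_refl[OF li_UU[OF assms(1)] assms(2)] by (simp add: list_all2_appendI)
 then show "lastf f us x = lastf f us y"
  using liD[OF assms(1), of "us @ [x]" "us @ [y]"] E_carrier[OF li_UU[OF assms(1)] xy] assms(3) by (simp add: lastf_def)
qed (simp add: lastf_def)

lemma li_lastf: "li U (Suc n) f ==> li U n (lastf f)"
proof -
 assume f: "li U (Suc n) f"
 have "lastf f us = lastf f vs" if "length us = n" "list_all2 (E U) us vs" for us vs
 proof
  fix x
  have "list_all2 (E U) (us @ [x]) (vs @ [x])" if "x : CG"
   using \<open>list_all2 (E U) us vs\<close> E_refl[OF li_UU[OF f] that] by (simp add: list_all2_appendI)
  then show "lastf f us x = lastf f vs x" using liD[OF f, of "us @ [x]" "vs @ [x]"] that(1) by (auto simp: lastf_def)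
 qed
 then show ?thesis using li_UU[OF f] by (simp add: li_def)
qed

lemma cochain_li: "f : Ch n ==> \<exists>U. li U n f"
 using cochains_inv[of f n] unfolding li_def cochain_inv_def by blast

lemma tr_lastf:
 "zs ~= [] ==> over zs ==> x : CG ==>
  tr f (zs @ [x]) = tcob lt (lastf f) zs x - (- 1) ^ length zs * f zs"
proof (induction zs arbitrary: f rule: induct_list012)
 case (2 a)
 then show ?case by (simp add: lastf_def lt_def)
next
 case (3 a b zs)
 have "tr (%us. f (a # us)) ((b # zs) @ [x]) =
   tcob lt (lastf (%us. f (a # us))) (b # zs) x - (- 1) ^ length (b # zs) * f (a # b # zs)"
  by (rule 3(2)) (use 3(4,5) in simp_all)
 moreover have "lastf (%us. f (a # us)) = (%us. lastf f (a # us))" by (simp add: lastf_def fun_eq_iff)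
 ultimately show ?case using 3(4,5) by (simp add: lastf_def algebra_simps)
qed simp

text \<open>C is coinduced, so cochains with values in C have a contracting homotopy: evaluate at
  the identity and let the last argument become the variable of C.\<close>

lemma contraction:
 assumes "zs ~= []" "over zs" "x : CG"
 shows "(- 1) ^ length zs * Y zs x = tcob lt (lastf (%us. Y us \<one>)) zs x - tcob lt Y (zs @ [x]) \<one>"
 using assms
proof (induction zs arbitrary: Y rule: induct_list012)
 case (2 a)
 then show ?case by (simp add: lastf_def lt_def)
next
 case (3 a b zs)
 have "(- 1) ^ length (b # zs) * Y (a # b # zs) x =
   tcob lt (lastf (%us. Y (a # us) \<one>)) (b # zs) x - tcob lt (%us. Y (a # us)) ((b # zs) @ [x]) \<one>"
  by (rule 3(2)) (use 3(4,5) in simp_all)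
 moreover have "lastf (%us. Y (a # us) \<one>) = (%us. lastf (%us. Y us \<one>) (a # us))" by (simp add: lastf_def fun_eq_iff)
 ultimately show ?case using 3(4,5) by (simp add: lastf_def algebra_simps)
qed simp

lemma lc_eqI: "f : lc ==> g : lc ==> (\<And>x. x : CG ==> f x = g x) ==> f = g"
 by (rule ext) (metis lc_support)

lemmas tcob_lc_map = tcob_map2[of lc lt, OF lc_intros(5) lc_intros(2) lc_intros(1) lt_lc]

lemma tcob_lc:
 "over zs ==> (\<And>us. over us ==> Suc (length us) = length zs ==> Y us : lc) ==> tcob lt Y zs : lc"
 by (rule tcob_lc_map(1)[where \<theta> = "%v. v" and A' = lt]) simp_all

lemma contraction_cocycle:
 assumes zs: "zs ~= []" "over zs"
  and Y: "li U (length zs) Y" "\<And>us. over us ==> length us = length zs ==> Y us : lc"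
  and 0: "\<And>x. x : CG ==> tcob lt Y (zs @ [x]) = 0"
 shows "Y zs = fscale ((- 1) ^ length zs) (tcob lt (lastf (%us. Y us \<one>)) zs)"
proof (rule lc_eqI[OF Y(2)[OF zs(2) refl] lc_intros(3)])
 have l: "li U (length zs) (%us. Y us \<one>)" by (rule li_map[OF Y(1)])
 show "tcob lt (lastf (%us. Y us \<one>)) zs : lc"
  by (rule tcob_lc[OF zs(2)]) (rule lastf_lc, use l in auto)
 fix x assume x: "x : CG"
 have "(- 1) ^ length zs * ((- 1) ^ length zs * Y zs x) = Y zs x"
  unfolding mult.assoc[symmetric] power_add[symmetric] by (simp flip: mult_2)
 then show "Y zs x = fscale ((- 1) ^ length zs) (tcob lt (lastf (%us. Y us \<one>)) zs) x"
  using contraction[OF zs x, of Y] 0[OF x] by simp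
qed

lemma kc_diff: "kc (c - c') = kc c - kc c'" and kc_add: "kc (c + c') = kc c + kc c'" and kc_0': "kc 0 = 0"
 and kc_scale: "fscale c (kc c') = kc (c * c')"
 by (simp_all add: kc_def fun_eq_iff)

lemma kc_eq: "kc c = kc c' ==> c = c'"
 by (drule fun_cong[of _ _ \<one>]) (simp add: kc_def)

lemma tcob_kc: "over zs ==> tcob lt (%us. kc (w us)) zs = kc (tr w zs)"
 by (rule tcob_map2(2)[of UNIV "%_ v. v" kc]) (simp_all only: UNIV_I kc_diff kc_add kc_0' lt_kc)

lemma tcob_lt_diff: "tcob lt (%us. Y us - Y' us) zs = tcob lt Y zs - tcob lt Y' zs"
 by (rule tcob_diff) (rule lt_diff)

lemma tcob_scale:
 assumes "over zs" "\<And>us. over us ==> Suc (length us) = length zs ==> Y us : lc"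
 shows "tcob lt (%us. fscale c (Y us)) zs = fscale c (tcob lt Y zs)"
 by (rule tcob_lc_map(2)) (simp_all only: assms fscale.scale_zero_right fscale.scale_right_diff_distrib fscale.scale_right_distrib lt_scale)

text \<open>The primitive may be given by a formula that is meaningful only on lists of the right
  length over the carrier, and \<open>c\<close> absorbs the signs of the contraction.\<close>

lemma coboundaryI:
 fixes z :: "'g list => 'k::field"
 assumes z: "z : Ch (Suc n)" and w: "li U n w"
  and tr: "\<And>zs. length zs = Suc n ==> over zs ==> z zs = c * tr w zs"
 shows "z : Cb (Suc n)"
proof -
 define w' where "w' = (%us. if length us = n \<and> over us then w us else 0)"
 have w': "w' : Ch n" unfolding w'_def by (rule li_cochain[OF w])
 have "z = coboundary G (fscale c w')"
 proof
  fix zs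
  show "z zs = coboundary G (fscale c w') zs"
  proof (cases "length zs = Suc n \<and> over zs")
   case True
   then have "tr w' zs = tr w zs" by (intro tcob_cong2) (simp_all add: w'_def)
   then show ?thesis using True tr[of zs] by (simp add: coboundary_scale coboundary_tr)
  next
   case False
   have "coboundary G (fscale c w') : Ch (Suc n)"
    by (rule coboundary_cochains[OF fscale.subspace_scale[OF cochains_subspace w']])
   then show ?thesis using cochains_support[OF z, of zs] cochains_support[of _ "Suc n" zs] False by metis
  qed
 qed
 then show ?thesis
  unfolding coboundaries_Suc using fscale.subspace_scale[OF cochains_subspace w', of c] by blast
qed

text \<open>Under the inclusion of constants into C, a cocycle of positive degree becomes up to sign
  the coboundary of its own reading in the last variable.\<close>

lemma cocycle_lastf:
 fixes z :: "'g list => 'k::field"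
 assumes z: "z : Cy n" and zs: "zs ~= []" "over zs" "length zs = n"
 shows "tcob lt (lastf z) zs = kc ((- 1) ^ n * z zs)"
proof (rule lc_eqI[OF _ kc_lc])
 have "z : Ch n" using z by (simp add: cocycles_iff)
 then obtain U where U: "li U n z" using cochain_li by blast
 have n: "n = Suc (n - 1)" using zs by (cases zs) auto
 show "tcob lt (lastf z) zs : lc"
  by (rule tcob_lc[OF zs(2)], rule lastf_lc[of U "n - 1"]) (use U n zs(3) in auto)
 fix x assume x: "x : CG"
 then have c: "over (zs @ [x])" using zs by simp
 have "tr z (zs @ [x]) = 0" using z coboundary_tr[OF c, of z] by (simp add: cocycles_iff)
 then show "tcob lt (lastf z) zs x = kc ((- 1) ^ n * z zs) x"
  using tr_lastf[OF zs(1,2) x, of z] x zs(3) by (simp add: kc_def)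
qed

end

section \<open>Vanishing above degree two and the presentation of cohomology\<close>

context demushkin_data begin

abbreviation "ps i \<equiv> c1 (\<psi> i)"

lemma ps_cocycle: "ps i : Cy (Suc 0)"
 unfolding cocycles_iff
proof
 show "ps i : Ch (Suc 0)" using c1_cochain[OF \<psi>_lc] by simp
 have "c2 (%x y. \<psi> i y - \<psi> i (x \<otimes> y) + \<psi> i x) = c2 (%_ _. 0)" by (rule c2_cong) (simp add: \<psi>_hom)
 then show "coboundary G (ps i) = 0" unfolding coboundary_c1 by (simp add: c2_def fun_eq_iff)
qed

sublocale K: letter_map conc "monomial []" "Cy" "Cb" d "%i. ps i"
 by unfold_locales (rule ps_cocycle)

lemma act_\<theta>:
 assumes j: "j < d" and zs: "over zs"
  and Y: "\<And>us. over us ==> Suc (length us) = length zs ==> Y us : lc"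
 shows "tcob lt (%us. act (xi j) (Y us)) zs = act (xi j) (tcob lt Y zs)"
 by (rule tcob_lc_map(2)) (simp_all only: act_0 act_diff act_add xi_cga[OF j] lt_act zs Y)

lemma ltd_0': "ltd g 0 = 0"
 by (rule ltd_0)

lemmas tcob_lcd_map = tcob_map2[of "lcd d" ltd, OF fscale.subspace_0[OF lcd_subspace] fscale.subspace_diff[OF lcd_subspace]
 fscale.subspace_add[OF lcd_subspace] ltd_lcd]

lemma tcob_lcd:
 "over zs ==> (\<And>us. over us ==> Suc (length us) = length zs ==> Y us : lcd d) ==> tcob ltd Y zs : lcd d"
 by (rule tcob_lcd_map(1)[where \<theta> = "%v. v" and A' = ltd]) simp_all

lemma tcob_comp:
 "over zs ==> (\<And>us. over us ==> Suc (length us) = length zs ==> Y us : lcd d) ==>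
  comp (tcob ltd Y zs) j = tcob lt (%us. comp (Y us) j) zs"
 by (rule tcob_lcd_map(2)[symmetric]) (simp_all only: comp_0 comp_diff comp_add comp_ltd)

lemma \<Phi>_0: "\<Phi> 0 = 0"
 using \<Phi>_scale[OF fscale.subspace_0[OF lcd_subspace], of 0] by simp

lemma tcob_\<Phi>:
 "over zs ==> (\<And>us. over us ==> Suc (length us) = length zs ==> Y us : lcd d) ==>
  tcob lt (%us. \<Phi> (Y us)) zs = \<Phi> (tcob ltd Y zs)"
 by (rule tcob_lcd_map(2)) (simp_all only: \<Phi>_0 \<Phi>_diff \<Phi>_add cod_ltd)

lemma tcob_\<Delta>:
 "over zs ==> (\<And>us. over us ==> Suc (length us) = length zs ==> Y us : lc) ==>
  tcob ltd (%us. \<Delta> (Y us)) zs = \<Delta> (tcob lt Y zs)"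
 by (rule tcob_lc_map(2)) (simp_all only: \<Delta>_0 \<Delta>_diff \<Delta>_add ltd_opd)

lemma sg_sq: "(- 1) ^ n * (- 1) ^ n = (1 :: 'k)"
 by (simp flip: power_add mult_2)

lemma sg_cancel: "fscale ((- 1) ^ n) (fscale ((- 1) ^ n) v) = (v :: _ => 'k)"
 by (simp only: fscale.scale_scale sg_sq fscale.scale_one)

text \<open>
 The total complex of the constant, locally constant and \<open>d\<close>-fold locally constant coefficients along
 \<open>k \<rightarrow> C \<rightarrow> C^d \<rightarrow> C \<rightarrow> 0\<close> is chased with the contraction that exists for coefficients \<open>C\<close>.
\<close>

lemma cohomology_vanishes:
 fixes z :: "'g list => 'k"
 assumes iso: "isotropic_form d b M L" and z: "z : Cy (Suc m)" and m: "m = Suc (Suc k)"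
 shows "z : Cb (Suc m)"
proof -
 define s :: 'k where "s = (- 1) ^ m"
 define s' :: 'k where "s' = (- 1) ^ Suc k"
 have zc: "z : Ch (Suc m)" using z by (simp add: cocycles_iff)
 then obtain U where U: "li U (Suc m) z" using cochain_li by blast
 \<comment> \<open>With values in C the cocycle \<open>z\<close> is, up to sign, the coboundary of
   \<open>y1\<close>.\<close>
 define y1 where "y1 = lastf z"
 have y1: "y1 us : lc" if "over us" "length us = m" for us
  unfolding y1_def by (rule lastf_lc[OF U that])
 have y1l: "li U m y1" unfolding y1_def by (rule li_lastf[OF U])
 have d1: "tcob lt y1 zs = kc ((- 1) ^ Suc m * z zs)" if "over zs" "length zs = Suc m" for zs
  unfolding y1_def by (rule cocycle_lastf[OF z]) (use that in auto)
 \<comment> \<open>The \<open>x_j\<close> kill constants, so the components of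
   \<open>\<Delta> y1\<close> are cocycles with values in C and have a primitive, up to sign the
   vector \<open>y2\<close> below.\<close>
 define Y where "Y j us = act (xi j) (y1 us)" for j us
 have Ylc: "Y j us : lc" if "over us" "length us = m" for j us
  unfolding Y_def by (rule act_lc[OF y1[OF that]])
 have Yl: "li U m (Y j)" for j unfolding Y_def by (rule li_map[OF y1l])
 have dY: "tcob lt (Y j) zs = 0" if "j < d" "over zs" "length zs = Suc m" for j zs
 proof -
  have "tcob lt (Y j) zs = act (xi j) (tcob lt y1 zs)"
   unfolding Y_def by (rule act_\<theta>[OF that(1,2)]) (use y1 that(3) in simp)
  then show ?thesis unfolding d1[OF that(2,3)] act_xi_kc[OF that(1)] .
 qed
 define y2j where "y2j j = lastf (%us. Y j us \<one>)" for j
 have y2jl: "li U (Suc k) (y2j j)" for j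
  unfolding y2j_def using li_lastf[OF li_map[OF Yl[unfolded m]]] .
 have y2j: "y2j j us : lc" if "over us" "length us = Suc k" for j us
  unfolding y2j_def using lastf_lc[OF li_map[OF Yl[unfolded m]] that] .
 have c2j: "Y j zs = fscale s (tcob lt (y2j j) zs)" if "j < d" "over zs" "length zs = m" for j zs
 proof -
  have "Y j zs = fscale ((- 1) ^ length zs) (tcob lt (lastf (%us. Y j us \<one>)) zs)"
   by (rule contraction_cocycle[of zs U]) (use that m Yl Ylc dY in auto)
  then show ?thesis by (simp only: s_def y2j_def that(3))
 qed
 define y2 where "y2 us = (\<Sum>j<d. slot j (y2j j us))" for us
 have y2: "y2 us : lcd d" if "over us" "length us = Suc k" for us
  unfolding y2_def by (rule sum_slot_lcd) (rule y2j[OF that])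
 have y2l: "li U (Suc k) y2" unfolding y2_def li_def using li_UU[OF U] liD[OF y2jl] by (metis (no_types, lifting) sum.cong)
 have d2: "\<Delta> (y1 zs) = fscale s (tcob ltd y2 zs)" if zs: "over zs" "length zs = m" for zs
 proof -
  have y2': "y2 us : lcd d" if "over us" "Suc (length us) = length zs" for us
   using y2 that zs m by simp
  show ?thesis
  proof (rule lcd_eqI[OF opd_lcd[OF y1[OF zs]] fscale.subspace_scale[OF lcd_subspace tcob_lcd[OF zs(1) y2']]])
   fix j assume j: "j < d"
   have "comp (tcob ltd y2 zs) j = tcob lt (%us. comp (y2 us) j) zs" by (rule tcob_comp[OF zs(1) y2'])
   also have "(%us. comp (y2 us) j) = y2j j" unfolding y2_def by (simp only: comp_sum_slot[OF j])
   finally have "comp (fscale s (tcob ltd y2 zs)) j = Y j zs" by (simp only: comp_scale c2j[OF j zs])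
   then show "comp (\<Delta> (y1 zs)) j = comp (fscale s (tcob ltd y2 zs)) j" by (simp only: comp_opd[OF j] Y_def)
  qed
 qed
 have d2': "tcob ltd y2 zs = fscale s (\<Delta> (y1 zs))" if "over zs" "length zs = m" for zs
  unfolding d2[OF that] s_def sg_cancel ..
 \<comment> \<open>Its coboundary is a multiple of \<open>\<Phi> (\<Delta> y1) = 0\<close>, so
   \<open>\<Phi> y2\<close> has in turn a primitive, \<open>y3\<close> up to sign.\<close>
 define P where "P us = \<Phi> (y2 us)" for us
 have Plc: "P us : lc" if "over us" "length us = Suc k" for us unfolding P_def by (rule cod_lc[OF y2[OF that]])
 have Pl: "li U (Suc k) P" unfolding P_def by (rule li_map[OF y2l])
 have dP: "tcob lt P zs = 0" if zs: "over zs" "length zs = m" for zs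
 proof -
  have "tcob lt P zs = \<Phi> (tcob ltd y2 zs)" unfolding P_def by (rule tcob_\<Phi>[OF zs(1)]) (use y2 zs(2) m in simp)
  also have "... = fscale s (\<Phi> (\<Delta> (y1 zs)))" unfolding d2'[OF zs] by (rule \<Phi>_scale[OF opd_lcd[OF y1[OF zs]]])
  also have "... = 0" unfolding \<Phi>_\<Delta>[OF y1[OF zs]] by (rule fscale.scale_zero_right)
  finally show ?thesis .
 qed
 define y3 where "y3 = lastf (%us. P us \<one>)"
 have y3: "y3 us : lc" if "over us" "length us = k" for us
  unfolding y3_def using lastf_lc[OF li_map[OF Pl] that] .
 have y3l: "li U k y3" unfolding y3_def using li_lastf[OF li_map[OF Pl]] .
 have c3: "P us = fscale s' (tcob lt y3 us)" if "over us" "length us = Suc k" for us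
 proof -
  have "P us = fscale ((- 1) ^ length us) (tcob lt (lastf (%us. P us \<one>)) us)"
   by (rule contraction_cocycle[of us U]) (use that m Pl Plc dP in auto)
  then show ?thesis by (simp only: s'_def y3_def that(2))
 qed
 \<comment> \<open>A pointwise section of \<open>\<Phi>\<close>, available by
   \<open>\<Phi>_surj\<close>. The lift \<open>w\<close> stays locally constant because it is a
   function of the value of \<open>y3\<close>.\<close>
 define \<sigma> where "\<sigma> f = (SOME F. F : lcd d \<and> \<Phi> F = f)" for f
 have \<sigma>: "\<sigma> f : lcd d \<and> \<Phi> (\<sigma> f) = f" if "f : lc" for f
 proof -
  have "\<exists>F. F : lcd d \<and> \<Phi> F = f" using \<Phi>_surj[OF iso that] by blast
  from someI_ex[OF this] show ?thesis unfolding \<sigma>_def .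
 qed
 define w where "w us = \<sigma> (fscale s' (y3 us))" for us
 have w: "w us : lcd d \<and> \<Phi> (w us) = fscale s' (y3 us)" if "over us" "length us = k" for us
  unfolding w_def by (rule \<sigma>[OF lc_intros(3)[OF y3[OF that]]])
 have wl: "li U k w" unfolding w_def by (rule li_map[OF y3l])
 \<comment> \<open>Subtracting the coboundary of \<open>w\<close> moves \<open>y2\<close> into the
   kernel of \<open>\<Phi>\<close>, hence into the image of \<open>\<Delta>\<close>.\<close>
 define D where "D us = y2 us - tcob ltd w us" for us
 have dw: "tcob ltd w us : lcd d" if "over us" "length us = Suc k" for us
  by (rule tcob_lcd[OF that(1)]) (use w that(2) in simp)
 have D: "D us : lcd d" if "over us" "length us = Suc k" for us
  unfolding D_def by (rule fscale.subspace_diff[OF lcd_subspace y2[OF that] dw[OF that]])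
 have "D us : \<Delta> ` lc" if us: "over us" "length us = Suc k" for us
 proof (rule \<Phi>_kernel[OF D[OF us]])
  have "\<Phi> (tcob ltd w us) = tcob lt (%v. \<Phi> (w v)) us" by (rule tcob_\<Phi>[OF us(1), symmetric]) (use w us(2) in simp)
  also have "... = tcob lt (%v. fscale s' (y3 v)) us" by (rule tcob_cong2[OF us(1)]) (use w us(2) in simp)
  also have "... = fscale s' (tcob lt y3 us)" by (rule tcob_scale[OF us(1)]) (use y3 us(2) in simp)
  also have "... = \<Phi> (y2 us)" using c3[OF us] by (simp only: P_def)
  finally show "\<Phi> (D us) = 0" unfolding D_def \<Phi>_diff[OF y2[OF us] dw[OF us]] by (simp only: diff_self)
 qed
 then have ex: "\<exists>f. f : lc \<and> \<Delta> f = D us" if "over us" "length us = Suc k" for us using that by (metis imageE)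
 define u where "u us = (SOME f. f : lc \<and> \<Delta> f = D us)" for us
 have u: "u us : lc \<and> \<Delta> (u us) = D us" if "over us" "length us = Suc k" for us
  using someI_ex[OF ex[OF that]] unfolding u_def .
 obtain W where W: "li W (Suc k) (tcob ltd w)"
  using li_tcob[of U k w ltd, OF wl ltd_0'] lcd_inv w by blast
 have ul: "li (U \<inter> W) (Suc k) u"
 proof -
  have "li (U \<inter> W) (Suc k) D" unfolding D_def by (rule li_map2[OF y2l W])
  then show ?thesis unfolding u_def by (rule li_map[where \<theta> = "%F. SOME f. f : lc \<and> \<Delta> f = F"])
 qed
 obtain W' where W': "li W' m (tcob lt u)"
  using li_tcob[of "U \<inter> W" "Suc k" u lt, OF ul lt_0] lc_good u unfolding m by blast
 have du: "tcob lt u zs : lc" if "over zs" "length zs = m" for zs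
  by (rule tcob_lc[OF that(1)]) (use u that(2) m in simp)
 have \<Delta>u: "\<Delta> (tcob lt u zs) = fscale s (\<Delta> (y1 zs))" if zs: "over zs" "length zs = m" for zs
 proof -
  have "\<Delta> (tcob lt u zs) = tcob ltd (%us. \<Delta> (u us)) zs" by (rule tcob_\<Delta>[OF zs(1), symmetric]) (use u zs(2) m in simp)
  also have "... = tcob ltd D zs" by (rule tcob_cong2[OF zs(1)]) (use u zs(2) m in simp)
  also have "... = tcob ltd y2 zs - tcob ltd (tcob ltd w) zs" unfolding D_def by (rule tcob_diff) (rule ltd_diff)
  also have "tcob ltd (tcob ltd w) zs = 0" by (rule tcob_tcob[OF ltd_diff ltd_ltd zs(1)])
  finally show ?thesis unfolding d2'[OF zs] by (simp only: diff_0_right)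
 qed
 \<comment> \<open>\<open>\<Delta>\<close> takes the same value on both terms, so the values of
   \<open>v\<close> are constant. Its coboundary equals that of \<open>y1\<close>, which makes it a
   primitive of \<open>z\<close> over k up to sign.\<close>
 define v where "v us = y1 us - fscale s (tcob lt u us)" for us
 have v: "v us : lc \<and> v us = kc (v us \<one>)" if us: "over us" "length us = m" for us
 proof
  show vl: "v us : lc" unfolding v_def by (intro lc_intros(2) lc_intros(3) y1[OF us] du[OF us])
  have "\<Delta> (v us) = \<Delta> (y1 us) - fscale s (fscale s (\<Delta> (y1 us)))"
   unfolding v_def by (simp only: \<Delta>_diff y1[OF us] lc_intros(3) du[OF us] \<Delta>_scale \<Delta>u[OF us])
  also have "... = 0" by (simp only: s_def sg_cancel diff_self)
  finally show "v us = kc (v us \<one>)" by (rule \<Delta>_kernel[OF vl])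
 qed
 have vl: "li (U \<inter> W') m (%us. v us \<one>)"
  unfolding v_def by (rule li_map[OF li_map2[OF y1l W']])
 show ?thesis
 proof (rule coboundaryI[OF zc vl])
  fix zs assume zs: "length zs = Suc m" "over zs"
  have "kc (tr (%us. v us \<one>) zs) = tcob lt (%us. kc (v us \<one>)) zs" by (rule tcob_kc[OF zs(2), symmetric])
  also have "... = tcob lt v zs" by (rule tcob_cong2[OF zs(2)]) (use v zs(1) in auto)
  also have "... = tcob lt y1 zs - tcob lt (%us. fscale s (tcob lt u us)) zs"
   unfolding v_def by (rule tcob_lt_diff)
  also have "tcob lt (%us. fscale s (tcob lt u us)) zs = fscale s (tcob lt (tcob lt u) zs)"
   by (rule tcob_scale[OF zs(2)]) (use du zs(1) in simp)
  also have "tcob lt (tcob lt u) zs = 0" by (rule tcob_tcob[OF lt_diff lt_lt zs(2)])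
  finally have "kc (tr (%us. v us \<one>) zs) = kc ((- 1) ^ Suc m * z zs)"
   by (simp only: fscale.scale_zero_right diff_0_right d1[OF zs(2,1)])
  then have "tr (%us. v us \<one>) zs = (- 1) ^ Suc m * z zs" by (rule kc_eq)
  then show "z zs = (- 1) ^ Suc m * tr (%us. v us \<one>) zs"
   by (simp only: mult.assoc[symmetric] sg_sq mult_1_left)
 qed
qed

lemma cocycle_1_letters:
 assumes z: "z : Cy (Suc 0)"
 shows "\<exists>c. z = (\<Sum>j<d. fscale (c j) (ps j))"
proof -
 have zc: "z : Ch 1" using z by (simp add: cocycles_iff)
 define f where "f = (%x. z [x])"
 have f: "f : lc" "z = c1 f" unfolding f_def by (rule cochain_1_lc[OF zc])+
 have "f (x \<otimes> y) = f x + f y" if "x : CG" "y : CG" for x y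
 proof -
  have "coboundary G (c1 f) [x, y] = 0" using z f(2) by (simp add: cocycles_iff)
  then show ?thesis unfolding coboundary_c1 using that by (simp add: c2_def algebra_simps)
 qed
 then obtain c where "f = (\<Sum>i<d. fscale (c i) (\<psi> i))" using \<psi>_span[OF f(1)] by blast
 then have "z = (\<Sum>j<d. fscale (c j) (ps j))" unfolding f(2) by (simp add: c1_def fun_eq_iff sum_apply)
 then show ?thesis by blast
qed

lemma gen_0:
 assumes z: "z : Cy (Suc 0)"
 shows "\<exists>v. (\<forall>j<d. v j : Cy 0) \<and> z - (\<Sum>j<d. conc (v j) (ps j)) : Cb (Suc 0)"
proof -
 obtain c where c: "z = (\<Sum>j<d. fscale (c j) (ps j))" using cocycle_1_letters[OF z] by blast
 have e: "z - (\<Sum>j<d. conc (fscale (c j) (monomial [])) (ps j)) = 0"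
  unfolding c conc_scale_left conc_one_left by (rule diff_self)
 show ?thesis
 proof (intro exI[of _ "%j. fscale (c j) (monomial [])"] conjI allI impI)
  show "fscale (c j) (monomial []) : Cy 0" for j by (rule Co.Zs(3)[OF Co.e_Z])
  show "z - (\<Sum>j<d. conc (fscale (c j) (monomial [])) (ps j)) : Cb (Suc 0)"
   unfolding e by (rule Co.Bs(5))
 qed
qed

lemma \<beta>_ev: "\<beta> (K.ev 2 f) = form_eval d b f"
proof -
 have cup: "conc (ps i) (ps j) : Cy 2" for i j
  using Co.mul_Z[OF ps_cocycle ps_cocycle] by (simp add: numeral_2_eq_2)
 have e: "K.ev 2 f = (\<Sum>j<d. \<Sum>i<d. fscale (f [i, j]) (conc (ps i) (ps j)))"
  by (simp only: numeral_2_eq_2 K.ev.simps(2)[of "Suc 0"] K.ev_letters conc_sum_left conc_scale_left last_cut_def append.simps)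
 have "\<beta> (K.ev 2 f) = (\<Sum>j<d. \<beta> (\<Sum>i<d. fscale (f [i, j]) (conc (ps i) (ps j))))"
  unfolding e by (rule lin_on_sum[OF Co.Z \<beta>_lin]) (intro Co.Zs(6) Co.Zs(3) cup)
 also have "... = (\<Sum>j<d. \<Sum>i<d. f [i, j] * b i j)"
 proof (rule sum.cong[OF refl])
  fix j
  have "\<beta> (\<Sum>i<d. fscale (f [i, j]) (conc (ps i) (ps j))) = (\<Sum>i<d. \<beta> (fscale (f [i, j]) (conc (ps i) (ps j))))"
   by (rule lin_on_sum[OF Co.Z \<beta>_lin]) (intro Co.Zs(3) cup)
  also have "... = (\<Sum>i<d. f [i, j] * b i j)" by (simp only: lin_on_scale[OF \<beta>_lin cup] b_def)
  finally show "\<beta> (\<Sum>i<d. fscale (f [i, j]) (conc (ps i) (ps j))) = (\<Sum>i<d. f [i, j] * b i j)" .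
 qed
 also have "... = form_eval d b f" unfolding form_eval_def by (rule sum.swap)
 finally show ?thesis .
qed

lemma K_orth: "\<eta> : orth d (form_rel d b) ==> K.ev 2 \<eta> : Cb 2"
 unfolding orth_form_rel using \<beta>_ker[OF K.ev_Z] by (simp add: \<beta>_ev)

lemma K_low:
 assumes "f : tensors d n" "K.ev n f : Cb n" "n < 2"
 shows "f = 0"
proof (cases n)
 case 0
 have "f [] = 0"
 proof (rule ccontr)
  assume nz: "f [] ~= 0"
  have "fscale (inverse (f [])) (K.ev 0 f) : Cb 0" using assms(2) unfolding 0 by (rule Co.Bs(3))
  then have "(monomial [] :: 'g list => 'k) : Cb 0"
   unfolding K.ev.simps(1) fscale.scale_scale left_inverse[OF nz] fscale.scale_one .
  then show False by (rule notE[OF Co.e_B])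
 qed
 then show ?thesis using tensors_0[of f d] assms(1) 0 by simp
next
 case (Suc k)
 then have n: "n = Suc 0" using assms(3) by simp
 have "K.ev (Suc 0) f = 0"
 proof -
  obtain u where "u : Ch 0" "K.ev (Suc 0) f = coboundary G u"
   using assms(2) unfolding n coboundaries_Suc by blast
  then show ?thesis using coboundary_cochain_0 by metis
 qed
 then have "(\<Sum>j<d. fscale (f [j]) (ps j)) [x] = 0" for x unfolding K.ev_letters by simp
 then have s: "(\<Sum>j<d. fscale (f [j]) (\<psi> j)) = 0" by (simp add: c1_def fun_eq_iff sum_apply)
 have "f [i] = 0" if "i < d" for i by (rule \<psi>_indep[of "%j. f [j]", OF s that])
 then have "f w = 0" for w
  using tensor_nonzero[OF assms(1), of w] n by (cases w) auto
 then show ?thesis by (simp add: fun_eq_iff)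
qed

text \<open>One cup product with \<open>b m l ~= 0\<close> already spans H^2, because
  \<open>\<beta>\<close> embeds H^2 into k; from degree 3 on both sides vanish, by
  \<open>cohomology_vanishes\<close> and \<open>tensors_J\<close>.\<close>

lemma H_morphism_isotropic:
 assumes iso: "isotropic_form d b m l"
 shows "subquotient_morphism conc (monomial []) (tensors d) (ideal_comp d (orth d (form_rel d b)))
  conc (monomial []) (Cy) (Cb) K.ev"
proof (rule K.ev_morphism[OF _ orth_relation_space K_orth])
 interpret F: isotropic_form d b m l by (rule iso)
 fix n z assume z: "z : (Cy (Suc n) :: ('g list => 'k) set)"
 consider "n = 0" | "n = 1" | k where "n = Suc (Suc k)" by (metis One_nat_def not0_implies_Suc)
 then show "\<exists>v. (\<forall>j<d. v j : Cy n) \<and> z - (\<Sum>j<d. conc (v j) (ps j)) : Cb (Suc n)"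
 proof cases
  case 1
  then show ?thesis using gen_0 z by simp
 next
  case 2
  then have z2: "z : Cy 2" using z by (simp add: numeral_2_eq_2)
  define v where "v j = fscale (if j = l then \<beta> z / b m l else 0) (ps m)" for j
  have v: "v j : Cy (Suc 0)" for j unfolding v_def by (rule Co.Zs(3)[OF ps_cocycle])
  have cup: "conc (ps m) (ps l) : Cy 2"
   using Co.mul_Z[OF ps_cocycle ps_cocycle] by (simp add: numeral_2_eq_2)
  have "(\<Sum>j<d. conc (v j) (ps j)) = (\<Sum>j<d. if j = l then fscale (\<beta> z / b m l) (conc (ps m) (ps l)) else 0)"
   unfolding v_def conc_scale_left by (rule sum.cong) (simp_all add: fun_eq_iff)
  also have "... = fscale (\<beta> z / b m l) (conc (ps m) (ps l))" using F.l by simp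
  finally have e: "(\<Sum>j<d. conc (v j) (ps j)) = fscale (\<beta> z / b m l) (conc (ps m) (ps l))" .
  have "\<beta> (z - fscale (\<beta> z / b m l) (conc (ps m) (ps l))) = \<beta> z - \<beta> z / b m l * b m l"
   unfolding lin_on_diff[OF Co.Z \<beta>_lin z2 Co.Zs(3)[OF cup]] lin_on_scale[OF \<beta>_lin cup] b_def ..
  also have "... = 0" using F.nonzero by simp
  finally have "z - (\<Sum>j<d. conc (v j) (ps j)) : Cb 2"
   unfolding e using \<beta>_ker[OF Co.Zs(2)[OF z2 Co.Zs(3)[OF cup]]] by blast
  then show ?thesis using v 2 by (intro exI[of _ v]) (simp add: numeral_2_eq_2)
 next
  case 3
  have "z : Cb (Suc n)" by (rule cohomology_vanishes[OF iso z 3])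
  moreover have "(\<Sum>j<d. conc 0 (ps j)) = 0" by (simp only: conc_0_left sum.neutral_const)
  ultimately show ?thesis using Co.Zs(5)
   by (intro exI[of _ "%_. 0"] conjI allI impI) (simp_all only: diff_0_right)
 qed
next
 interpret F: isotropic_form d b m l by (rule iso)
 fix n f assume f: "f : tensors d n" "K.ev n f : Cb n"
 consider "n < 2" | "n = 2" | k where "n = k + 3"
  by (metis add.commute le_Suc_ex linorder_less_linear not_less_eq_eq numeral_2_eq_2 numeral_3_eq_3 Suc_leI)
 then show "f : ideal_comp d (orth d (form_rel d b)) n"
 proof cases
  case 1
  show ?thesis unfolding K_low[OF f 1] by (rule fscale.subspace_0[OF ideal_comp_subspace])
 next
  case 2
  have "form_eval d b f = 0" using \<beta>_ker[OF K.ev_Z[of 2 f]] f(2) \<beta>_ev[of f] 2 by simp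
  then have "f : orth d (form_rel d b)" using f(1) 2 by (simp add: orth_form_rel)
  then show ?thesis unfolding 2 by (rule ideal_comp_relation)
 next
  case 3
  show ?thesis unfolding 3 by (rule F.tensors_J) (use f(1) 3 in simp)
 qed
qed

section \<open>One generator with nonzero cup square\<close>

context
 assumes d1: "d = 1" and b0: "b 0 0 ~= 0"
begin

text \<open>All tensors of degree at least 2 lie in the ideal, so each power of I from the second on
  is contained in the next; separatedness finishes.\<close>

lemma apow_2_unary:
 assumes x: "x : (apow 2 :: (_ => 'k) set)"
 shows "x = 0"
proof (rule apow_separated)
 interpret F: unary_form b by unfold_locales (rule b0)
 have step: "x : apow (n + 2)" for n
 proof (induction n)
  case 0
  show ?case using x by (simp only: add_0)
 next
  case (Suc n)
  obtain f where f: "f : tensors d (n + 2)" "x - X.ev (n + 2) f : apow (Suc (n + 2))" using ev_surj[OF Suc] by blast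
  have "f : ideal_comp d (form_rel d b) (n + 2)" using F.tensors_I[of f n] f(1) d1 by simp
  then have "X.ev (n + 2) f : apow (Suc (n + 2))" by (rule ev_form_ideal)
  from apow_intros(1)[OF f(2) this] show ?case by (simp only: diff_add_cancel add_Suc)
 qed
 show "x : apow n" for n using apow_mono[OF _ step[of n], of n] by simp
qed

text \<open>\<open>x_0\<close> squares to 0, so \<open>x_0 f\<close> is killed by \<open>x_0\<close>
  and therefore constant.\<close>

lemma act_xi_unary: "f : lc ==> act (xi 0) f = kc (pr (xi 0) f)"
proof -
 assume f: "f : lc"
 have d0: "0 < d" using d1 by simp
 have "cga_mult G (xi 0) (xi 0) : apow 2"
  using apow_gen[of "xi 0" "Suc 0" "xi 0"] xi_aug[OF d0] unfolding apow_1 numeral_2_eq_2 by blast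
 then have "cga_mult G (xi 0) (xi 0) = 0" by (rule apow_2_unary)
 moreover have "act (0 :: _ => 'k) f = 0" using act_scale_left[OF cga_intros(5) f, of 0] by simp
 ultimately have "act (xi 0) (act (xi 0) f) = 0" using act_mult[OF xi_cga[OF d0] xi_cga[OF d0] f] by simp
 then have "\<Delta> (act (xi 0) f) = 0"
  by (intro lcd_eqI[OF opd_lcd[OF act_lc[OF f]] fscale.subspace_0[OF lcd_subspace]]) (use d1 in \<open>simp add: comp_opd comp_0\<close>)
 from \<Delta>_kernel[OF act_lc[OF f] this] show ?thesis unfolding act_one[OF f] .
qed

text \<open>Removing the multiple \<open>pr (xi 0) f\<close> of \<open>\<psi> 0\<close> leaves a
  function that \<open>x_0\<close> kills, hence a constant.\<close>

lemma lc_unary: "f : lc ==> f = kc (f \<one>) + fscale (pr (xi 0) f) (\<psi> 0)"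
proof -
 assume f: "f : lc"
 have d0: "0 < d" using d1 by simp
 define g where "g = f - fscale (pr (xi 0) f) (\<psi> 0)"
 have g: "g : lc" unfolding g_def by (intro lc_intros(2) lc_intros(3) f \<psi>_lc)
 have "act (xi 0) g = kc (pr (xi 0) f) - fscale (pr (xi 0) f) (kc (if (0::nat) = 0 then 1 else 0))"
  unfolding g_def by (simp only: act_diff[OF xi_cga[OF d0] f lc_intros(3)[OF \<psi>_lc]] act_scale[OF xi_cga[OF d0] \<psi>_lc]
   act_xi_unary[OF f] act_xi_\<psi>[OF d0 d0])
 also have "... = 0" by (simp only: simp_thms if_True kc_scale mult_1_right diff_self)
 finally have a: "act (xi 0) g = 0" .
 have 0: "\<Delta> g = 0"
 proof (rule lcd_eqI[OF opd_lcd[OF g] fscale.subspace_0[OF lcd_subspace]])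
  fix i assume i: "i < d"
  then have i0: "i = 0" using d1 by simp
  show "comp (\<Delta> g) i = comp 0 i" using comp_opd[OF i, of xi g] a unfolding i0 comp_0 by (rule trans)
 qed
 have g1: "g \<one> = f \<one>" by (simp add: g_def \<psi>_one)
 have gk: "g = kc (f \<one>)" using \<Delta>_kernel[OF g 0] unfolding g1 .
 have "f = g + fscale (pr (xi 0) f) (\<psi> 0)" unfolding g_def by (simp only: diff_add_cancel)
 then show ?thesis unfolding gk .
qed

text \<open>By \<open>lc_unary\<close> a cochain is, in its last variable, a constant plus a
  multiple of \<open>\<psi> 0\<close>; this is the multiple. It serves to invert the cup product
  with \<open>\<psi> 0\<close> on cohomology.\<close>

definition last_coeff :: "nat => ('g list => 'k) => 'g list => 'k" where
 "last_coeff n f = (%us. if length us = n \<and> over us then pr (xi 0) (lastf f us) else 0)"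

lemma last_coeff_cochain: "f : Ch (Suc n) ==> last_coeff n f : Ch n"
proof -
 assume "f : Ch (Suc n)"
 then obtain U where "li U (Suc n) f" using cochain_li by blast
 then have "li U n (%us. pr (xi 0) (lastf f us))" by (intro li_map[where \<theta> = "pr (xi 0)"] li_lastf)
 then show ?thesis unfolding last_coeff_def by (rule li_cochain)
qed

lemma lastf_cochain_lc: "f : Ch (Suc n) ==> over us ==> length us = n ==> lastf f us : lc"
 using cochain_li lastf_lc by blast

lemma tr_last_coeff:
 assumes f: "f : Ch (Suc n)" and zs: "length zs = Suc n" "over zs"
 shows "kc (tr (last_coeff n f) zs) = act (xi 0) (tcob lt (lastf f) zs)"
proof -
 have d0: "0 < d" using d1 by simp
 have "kc (tr (last_coeff n f) zs) = tcob lt (%us. kc (last_coeff n f us)) zs" by (rule tcob_kc[OF zs(2), symmetric])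
 also have "... = tcob lt (%us. act (xi 0) (lastf f us)) zs"
  by (rule tcob_cong2[OF zs(2)]) (use zs(1) lastf_cochain_lc[OF f] in \<open>simp add: last_coeff_def act_xi_unary\<close>)
 also have "... = act (xi 0) (tcob lt (lastf f) zs)"
  by (rule act_\<theta>[OF d0 zs(2)]) (use zs(1) lastf_cochain_lc[OF f] in simp)
 finally show ?thesis .
qed

lemma last_coeff_cocycle:
 assumes z: "z : Cy (Suc n)"
 shows "last_coeff n z : Cy n"
 unfolding cocycles_iff
proof
 have d0: "0 < d" using d1 by simp
 have zc: "z : Ch (Suc n)" using z by (simp add: cocycles_iff)
 show c: "last_coeff n z : Ch n" by (rule last_coeff_cochain[OF zc])
 show "coboundary G (last_coeff n z) = 0"
 proof
  fix zs
  show "coboundary G (last_coeff n z) zs = 0 zs"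
  proof (cases "length zs = Suc n \<and> over zs")
   case True
   have "tcob lt (lastf z) zs = kc ((- 1) ^ Suc n * z zs)"
    by (rule cocycle_lastf[OF z]) (use True in auto)
   then have "kc (tr (last_coeff n z) zs) = kc 0" using tr_last_coeff[OF zc, of zs] True by (simp only: act_xi_kc[OF d0] kc_0)
   then have "tr (last_coeff n z) zs = 0" by (rule kc_eq)
   then show ?thesis using True by (simp add: coboundary_tr)
  next
   case False
   then show ?thesis using cochains_support[OF coboundary_cochains[OF c], of zs] by auto
  qed
 qed
qed

lemma cup_ps: "c : Ch n ==> over us ==> length us = n ==>
  lastf (conc c (ps i)) us = fscale (c us) (\<psi> i)"
proof
 fix x assume c: "c : Ch n" and us: "over us" "length us = n"
 have "conc c (ps i) (us @ [x]) = (if n \<le> length (us @ [x]) then c (take n (us @ [x])) * ps i (drop n (us @ [x])) else 0)"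
  by (rule conc_homogeneous) (use cochains_support[OF c] in blast)
 then show "lastf (conc c (ps i)) us x = fscale (c us) (\<psi> i) x"
  using us lc_support[OF \<psi>_lc, of x i] by (simp add: lastf_def c1_def)
qed

text \<open>Once the multiple of \<open>\<psi> 0\<close> is removed, the last variable contributes
  only its constant part \<open>e\<close>, and comparing coboundaries with values in C shows that
  \<open>e\<close> is a primitive up to sign.\<close>

lemma gen_unary:
 assumes z: "z : Cy (Suc (Suc n))"
 shows "z - conc (last_coeff (Suc n) z) (ps 0) : Cb (Suc (Suc n))"
proof -
 define c where "c = last_coeff (Suc n) z"
 define z' where "z' = conc c (ps 0)"
 have zc: "z : Ch (Suc (Suc n))" using z by (simp add: cocycles_iff)
 have c: "c : Cy (Suc n)" unfolding c_def by (rule last_coeff_cocycle[OF z])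
 have cc: "c : Ch (Suc n)" using c by (simp add: cocycles_iff)
 have z': "z' : Cy (Suc (Suc n))" unfolding z'_def using K.mul_y[OF c, of 0] d1 by simp
 obtain U where U: "li U (Suc (Suc n)) z" using cochain_li[OF zc] by blast
 define e where "e us = lastf z us \<one>" for us
 have el: "li U (Suc n) e" unfolding e_def by (rule li_map[OF li_lastf[OF U]])
 have dec: "lastf z us = kc (e us) + lastf z' us" if us: "over us" "length us = Suc n" for us
  unfolding z'_def cup_ps[OF cc us] e_def using lc_unary[OF lastf_cochain_lc[OF zc us]] us
  by (simp add: c_def last_coeff_def)
 show ?thesis
  unfolding c_def[symmetric] z'_def[symmetric]
 proof (rule coboundaryI[OF _ el])
  show "z - z' : Ch (Suc (Suc n))"
   using fscale.subspace_diff[OF cochains_subspace zc, of z'] z' by (simp add: cocycles_iff)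
  fix zs assume zs: "length zs = Suc (Suc n)" "over zs"
  have "tcob lt (%us. lastf z us - lastf z' us) zs = tcob lt (%us. kc (e us)) zs"
   by (rule tcob_cong2[OF zs(2)]) (use dec zs(1) in simp)
  then have "kc (tr e zs) = tcob lt (lastf z) zs - tcob lt (lastf z') zs"
   unfolding tcob_lt_diff tcob_kc[OF zs(2)] by simp
  also have "... = kc ((- 1) ^ Suc (Suc n) * (z - z') zs)"
  proof -
   have ne: "zs ~= []" using zs(1) by auto
   show ?thesis
    unfolding cocycle_lastf[OF z ne zs(2,1)] cocycle_lastf[OF z' ne zs(2,1)] kc_diff[symmetric]
    by (simp add: algebra_simps)
  qed
  finally have "tr e zs = (- 1) ^ Suc (Suc n) * (z - z') zs" by (rule kc_eq)
  then show "(z - z') zs = (- 1) ^ Suc (Suc n) * tr e zs"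
   by (simp only: mult.assoc[symmetric] sg_sq mult_1_left)
 qed
qed

text \<open>For a primitive \<open>v\<close> of the product, the coboundary of its reading in C is
  \<open>c\<close> times \<open>\<psi> 0\<close> plus a constant; applying \<open>x_0\<close> leaves
  \<open>c\<close> as the coboundary of \<open>last_coeff n v\<close>.\<close>

lemma cup_ps_injective:
 assumes c: "c : Cy (Suc n)" and cob: "conc c (ps 0) : Cb (Suc (Suc n))"
 shows "c : Cb (Suc n)"
proof -
 have d0: "0 < d" using d1 by simp
 have cc: "c : Ch (Suc n)" using c by (simp add: cocycles_iff)
 obtain v where v: "v : Ch (Suc n)" "conc c (ps 0) = coboundary G v"
  using cob unfolding coboundaries_Suc[of "Suc n"] by blast
 have "c = coboundary G (last_coeff n v)"
 proof
  fix zs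
  show "c zs = coboundary G (last_coeff n v) zs"
  proof (cases "length zs = Suc n \<and> over zs")
   case True
   then have ne: "zs ~= []" by auto
   have lv: "tcob lt (lastf v) zs : lc"
    by (rule tcob_lc) (use True lastf_cochain_lc[OF v(1)] in auto)
   have "tcob lt (lastf v) zs = fscale (c zs) (\<psi> 0) + kc ((- 1) ^ length zs * v zs)"
   proof (rule lc_eqI[OF lv])
    show "fscale (c zs) (\<psi> 0) + kc ((- 1) ^ length zs * v zs) : lc" by (intro lc_intros(1) lc_intros(3) \<psi>_lc kc_lc)
    fix x assume x: "x : CG"
    have "tr v (zs @ [x]) = conc c (ps 0) (zs @ [x])"
     unfolding v(2) using True x by (intro coboundary_tr[symmetric]) simp
    also have "... = lastf (conc c (ps 0)) zs x" using x by (simp add: lastf_def)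
    also have "... = c zs * \<psi> 0 x" using cup_ps[OF cc, of zs 0] True by simp
    finally show "tcob lt (lastf v) zs x = (fscale (c zs) (\<psi> 0) + kc ((- 1) ^ length zs * v zs)) x"
     using tr_lastf[OF ne _ x, of v] True x by (simp add: kc_def eq_diff_eq)
   qed
   then have "act (xi 0) (tcob lt (lastf v) zs) = fscale (c zs) (kc 1)"
    by (simp only: act_add[OF xi_cga[OF d0] lc_intros(3)[OF \<psi>_lc] kc_lc] act_scale[OF xi_cga[OF d0] \<psi>_lc]
     act_xi_kc[OF d0] act_xi_\<psi>[OF d0 d0] if_True simp_thms add_0_right)
   also have "... = kc (c zs)" by (simp only: kc_scale mult_1_right)
   finally have "kc (tr (last_coeff n v) zs) = kc (c zs)" using tr_last_coeff[OF v(1), of zs] True by simp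
   then have "tr (last_coeff n v) zs = c zs" by (rule kc_eq)
   then show ?thesis using True by (simp add: coboundary_tr)
  next
   case False
   have "coboundary G (last_coeff n v) zs = 0"
    using cochains_support[OF coboundary_cochains[OF last_coeff_cochain[OF v(1)]], of zs] False by metis
   moreover have "c zs = 0" using cochains_support[OF cc, of zs] False by metis
   ultimately show ?thesis by simp
  qed
 qed
 then show ?thesis unfolding coboundaries_Suc using last_coeff_cochain[OF v(1)] by blast
qed

lemma K_injective_unary: "f : tensors d n ==> K.ev n f : Cb n ==> f = 0"
proof (induction n arbitrary: f rule: less_induct)
 case (less n)
 show ?case
 proof (cases "n < 2")
  case True
  show ?thesis by (rule K_low[OF less(2,3) True])
 next
  case False
  then have "n = Suc (Suc (n - 2))" by simp
  then obtain k where n: "n = Suc (Suc k)" by blast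
  have s: "{..<d} = {0}" using d1 by auto
  have e: "K.ev (Suc (Suc k)) f = conc (K.ev (Suc k) (last_cut 0 f)) (ps 0)"
   unfolding K.ev.simps(2)[of "Suc k"] s by (simp del: K.ev.simps)
  have c: "K.ev (Suc k) (last_cut 0 f) : Cb (Suc k)"
   by (rule cup_ps_injective[OF K.ev_Z less(3)[unfolded n e]])
  have t: "last_cut 0 f : tensors d (Suc k)" using less(2) n by (intro last_cut_tensors) simp
  have "Suc k < n" using n by simp
  from less(1)[OF this t c] have l: "last_cut 0 f = 0" .
  have "f = (\<Sum>j<d. conc (last_cut j f) (monomial [j]))" by (rule sum_last_cut[of f d "Suc k"]) (use less(2) n in simp)
  also have "... = conc (last_cut 0 f) (monomial [0])" unfolding s by simp
  finally show ?thesis unfolding l conc_0_left .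
 qed
qed

lemma H_morphism_unary:
 "subquotient_morphism conc (monomial []) (tensors d) (ideal_comp d (orth d (form_rel d b)))
  conc (monomial []) (Cy) (Cb) K.ev"
proof (rule K.ev_morphism[OF _ orth_relation_space K_orth])
 fix n z assume z: "z : (Cy (Suc n) :: ('g list => 'k) set)"
 show "\<exists>v. (\<forall>j<d. v j : Cy n) \<and> z - (\<Sum>j<d. conc (v j) (ps j)) : Cb (Suc n)"
 proof (cases n)
  case 0
  then show ?thesis using gen_0 z by simp
 next
  case (Suc k)
  have "(\<Sum>j<d. conc (last_coeff n z) (ps j)) = conc (last_coeff n z) (ps 0)" unfolding d1 by simp
  moreover have "z - conc (last_coeff n z) (ps 0) : Cb (Suc n)"
   unfolding Suc by (rule gen_unary[OF z[unfolded Suc]])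
  ultimately show ?thesis using last_coeff_cocycle[OF z] by (intro exI[of _ "%_. last_coeff n z"]) simp
 qed
next
 fix n f assume f: "f : tensors d n" "K.ev n f : Cb n"
 show "f : ideal_comp d (orth d (form_rel d b)) n"
  unfolding K_injective_unary[OF f] by (rule fscale.subspace_0[OF ideal_comp_subspace])
qed

end

end

section \<open>Isotropic bases\<close>

context demushkin_data begin

text \<open>Without homomorphisms to k every locally constant function is constant by
  \<open>\<Delta>_kernel\<close>, so a 2-cocycle does not vary with its last argument and bounds.
  This rules out \<open>d = 0\<close> when H^2 is a line.\<close>

lemma d_pos:
 fixes z :: "'g list => 'k"
 assumes "d = 0" and z: "z : Cy 2"
 shows "z : Cb 2"
proof -
 have zc: "z : Ch (Suc (Suc 0))" using z by (simp add: cocycles_iff numeral_2_eq_2)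
 obtain U where U: "li U (Suc (Suc 0)) z" using cochain_li[OF zc] by blast
 define e where "e us = lastf z us \<one>" for us
 have el: "li U (Suc 0) e" unfolding e_def by (rule li_map[where \<theta> = "%v. v \<one>", OF li_lastf[OF U]])
 have const: "lastf z us = kc (e us)" if us: "over us" "length us = Suc 0" for us
 proof -
  have l: "lastf z us : lc" by (rule lastf_lc[OF U us])
  have "\<Delta> (lastf z us) = 0" unfolding opd_def assms(1) by simp
  from \<Delta>_kernel[OF l this] show ?thesis by (simp only: e_def)
 qed
 have "z : Cb (Suc (Suc 0))"
 proof (rule coboundaryI[OF zc el])
  fix zs assume zs: "length zs = Suc (Suc 0)" "over zs"
  have "kc (tr e zs) = tcob lt (%us. kc (e us)) zs" by (rule tcob_kc[OF zs(2), symmetric])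
  also have "... = tcob lt (lastf z) zs" by (rule tcob_cong2[OF zs(2)]) (use const zs(1) in simp)
  also have "... = kc ((- 1) ^ Suc (Suc 0) * z zs)"
   by (rule cocycle_lastf) (use z zs in \<open>auto simp: numeral_2_eq_2\<close>)
  finally have "tr e zs = (- 1) ^ Suc (Suc 0) * z zs" by (rule kc_eq)
  then show "z zs = 1 * tr e zs" by simp
 qed
 then show ?thesis by (simp add: numeral_2_eq_2)
qed

abbreviation "HH \<equiv> Co.alg :: ('k, ('g list => 'k) set) graded_algebra"
abbreviation "RR \<equiv> Gr.alg :: ('k, ('g set \<times> 'g set => 'k) set) graded_algebra"

text \<open>The two relation spaces are \<open>form_rel d b\<close> and its orthogonal; double
  orthogonality gives the duality in both directions.\<close>

lemma duality:
 assumes c: "(\<exists>m l. isotropic_form d b m l) \<or> d = 1 \<and> b 0 0 ~= 0"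
 shows "galg_isomorphic RR (quadratic_algebra d (form_rel d b))"
  and "galg_isomorphic HH (quadratic_algebra d (orth d (form_rel d b)))"
  and "is_quadratic_dual_of RR HH" and "is_quadratic_dual_of HH RR"
  and "koszul_algebra RR" and "koszul_algebra HH"
proof -
 interpret MR: subquotient_morphism conc "monomial []" "tensors d" "ideal_comp d (form_rel d b)"
  "cga_mult G" "cga_one G T" apow "%n. apow (Suc n)" X.ev
  by (rule gr_morphism[OF c])
 have "subquotient_morphism conc (monomial []) (tensors d) (ideal_comp d (orth d (form_rel d b)))
   conc (monomial []) (Cy) (Cb) K.ev"
  using c H_morphism_isotropic H_morphism_unary by blast
 then interpret MH: subquotient_morphism conc "monomial []" "tensors d" "ideal_comp d (orth d (form_rel d b))"
  conc "monomial []" "Cy" "Cb" K.ev .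
 show R: "galg_isomorphic RR (quadratic_algebra d (form_rel d b))"
  unfolding quadratic_algebra_def by (rule MR.isomorphic_sym)
 show H: "galg_isomorphic HH (quadratic_algebra d (orth d (form_rel d b)))"
  unfolding quadratic_algebra_def by (rule MH.isomorphic_sym)
 obtain i j where ij: "i < d" "j < d" "b i j ~= 0"
 proof -
  have "\<exists>i j. i < d \<and> j < d \<and> b i j ~= 0"
   using c
  proof
   assume "\<exists>m l. isotropic_form d b m l"
   then obtain m l where "isotropic_form d b m l" by blast
   then show ?thesis unfolding isotropic_form_def by blast
  next
   assume "d = 1 \<and> b 0 0 ~= 0"
   then show ?thesis by (intro exI[of _ 0]) simp
  qed
  then show ?thesis using that by blast
 qed
 show "is_quadratic_dual_of RR HH"
  unfolding is_quadratic_dual_of_def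
 proof (intro exI conjI)
  show "relation_space d (orth d (form_rel d b))" by (rule orth_relation_space)
  show "galg_isomorphic RR (quadratic_algebra d (orth d (orth d (form_rel d b))))"
   unfolding orth_orth_form_rel[of i d j b, OF ij] by (rule R)
 qed (rule H)
 show "is_quadratic_dual_of HH RR"
  unfolding is_quadratic_dual_of_def
  by (intro exI[of _ d] exI[of _ "form_rel d b"] conjI form_rel_relation_space R H)
 have "\<exists>rk c. MR.S.linear_resolution rk c"
  using c
 proof
  assume "\<exists>m l. isotropic_form d b m l"
  then obtain m l where "isotropic_form d b m l" by blast
  then interpret F: isotropic_form d b m l .
  show ?thesis using F.R_linear_resolution by blast
 next
  assume u: "d = 1 \<and> b 0 0 ~= 0"
  then interpret F: unary_form b by unfold_locales simp
  show ?thesis using F.R_linear_resolution conjunct1[OF u] by metis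
 qed
 then obtain rk c' where "MR.S.linear_resolution rk c'" by blast
 from Gr.koszul[OF MR.linear_resolution_map[OF this]] show "koszul_algebra RR" .
 have "\<exists>rk c. MH.S.linear_resolution rk c"
  using c
 proof
  assume "\<exists>m l. isotropic_form d b m l"
  then obtain m l where "isotropic_form d b m l" by blast
  then interpret F: isotropic_form d b m l .
  show ?thesis by (rule F.H_linear_resolution)
 next
  assume u: "d = 1 \<and> b 0 0 ~= 0"
  then interpret F: unary_form b by unfold_locales simp
  show ?thesis using F.H_linear_resolution conjunct1[OF u] by metis
 qed
 then obtain rk' c'' where "MH.S.linear_resolution rk' c''" by blast
 from Co.koszul[OF MH.linear_resolution_map[OF this]] show "koszul_algebra HH" .
qed

end

text \<open>The situation without a basis, so that the orderings needed for the PBW property can be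
  chosen afterwards. In degree 1 cocycles and classes coincide, which is why finiteness and
  nondegeneracy are stated for cocycles.\<close>

locale demushkin_pairing = pro_p p G T for p and G :: "('g, 'm) monoid_scheme" (structure) and T +
 fixes \<beta> :: "('g list => 'k::{field,finite}) => 'k"
 assumes char: "of_nat p = (0 :: 'k)"
  and finite_cocycles: "finite (Cy 1 :: ('g list => 'k) set)"
  and \<beta>_lin: "lin_on (Cy 2) \<beta>"
  and \<beta>_ker: "z : Cy 2 ==> \<beta> z = 0 \<longleftrightarrow> z : Cb 2"
  and \<beta>_nonzero: "\<exists>z\<in>Cy 2. \<beta> z ~= 0"
  and nondegenerate: "u : Cy 1 ==> (\<And>v. v : Cy 1 ==> \<beta> (conc u v) = 0) ==> u = 0"
begin

abbreviation "Z1 \<equiv> Cy 1 :: ('g list => 'k) set"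

lemma cup_Z: "u : Z1 ==> v : Z1 ==> conc u v : Cy 2"
 using Co.mul_Z[of u 1 v 1] by (simp add: numeral_2_eq_2)

lemma cup_add_left: "u : Z1 ==> u' : Z1 ==> v : Z1 ==> \<beta> (conc (u + u') v) = \<beta> (conc u v) + \<beta> (conc u' v)"
 and cup_add_right: "u : Z1 ==> v : Z1 ==> v' : Z1 ==> \<beta> (conc u (v + v')) = \<beta> (conc u v) + \<beta> (conc u v')"
 and cup_scale_left: "u : Z1 ==> v : Z1 ==> \<beta> (conc (fscale c u) v) = c * \<beta> (conc u v)"
 and cup_scale_right: "u : Z1 ==> v : Z1 ==> \<beta> (conc u (fscale c v)) = c * \<beta> (conc u v)"
 by (simp_all only: conc_add_left conc_add_right conc_scale_left conc_scale_right cup_Z lin_on_add[OF \<beta>_lin] lin_on_scale[OF \<beta>_lin])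

lemma Z1_fun:
 assumes u: "u : Z1"
 shows "(%x. u [x]) : lc" and "u = c1 (%x. u [x])"
  and "x : CG ==> y : CG ==> u [x \<otimes> y] = u [x] + u [y]"
proof -
 have c: "u : Ch 1" "coboundary G u = 0" using u by (simp_all add: cocycles_iff)
 show "(%x. u [x]) : lc" and e: "u = c1 (%x. u [x])" by (rule cochain_1_lc[OF c(1)])+
 assume xy: "x : CG" "y : CG"
 have "coboundary G (c1 (%x. u [x])) [x, y] = 0" using c(2) e by simp
 then show "u [x \<otimes> y] = u [x] + u [y]" unfolding coboundary_c1 using xy by (simp add: c2_def algebra_simps)
qed

lemma cup_antisym:
 assumes u: "u : Z1" and v: "v : Z1"
 shows "\<beta> (conc u v) + \<beta> (conc v u) = 0"
proof -
 define f where "f = (%x. u [x])"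
 define g where "g = (%x. v [x])"
 have f: "f : lc" "u = c1 f" "\<And>x y. x : CG ==> y : CG ==> f (x \<otimes> y) = f x + f y"
  unfolding f_def by (rule Z1_fun[OF u])+
 have g: "g : lc" "v = c1 g" "\<And>x y. x : CG ==> y : CG ==> g (x \<otimes> y) = g x + g y"
  unfolding g_def by (rule Z1_fun[OF v])+
 \<comment> \<open>For homomorphisms \<open>f\<close> and \<open>g\<close> the coboundary of minus
   their product is \<open>f x * g y + g x * f y\<close>.\<close>
 define h where "h = (%x. - (f x * g x))"
 have h: "h : lc"
 proof -
  obtain U where U: "inv_under U f" "inv_under U g" using inv_under2[OF f(1) g(1)] by blast
  show ?thesis
  proof (rule lcI[OF _ inv_under_UU[OF U(1)]])
   show "h x = 0" if "x \<notin> CG" for x using lc_support[OF f(1) that] by (simp add: h_def)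
   show "h x = h y" if "E U x y" for x y using inv_underD[OF U(1) that] inv_underD[OF U(2) that] by (simp add: h_def)
  qed
 qed
 have "conc u v + conc v u = coboundary G (c1 h)"
  unfolding coboundary_c1 f(2) g(2) cup_c1[OF f(1) g(1)] cup_c1[OF g(1) f(1)]
 proof
  fix zs
  show "(c2 (%x y. f x * g y) + c2 (%x y. g x * f y)) zs = c2 (%x y. h y - h (x \<otimes> y) + h x) zs"
  proof (cases "length zs = 2 \<and> over zs")
   case True
   then have "zs ! 0 : CG" "zs ! 1 : CG" using nth_mem[of 0 zs] nth_mem[of 1 zs] by auto
   then show ?thesis using True by (simp add: c2_def h_def f(3) g(3) algebra_simps)
  qed (auto simp: c2_def)
 qed
 also have "... : Cb 2" unfolding numeral_2_eq_2 coboundaries_Suc using c1_cochain[OF h] by simp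
 finally have "conc u v + conc v u : Cb 2" .
 then have "\<beta> (conc u v + conc v u) = 0" using \<beta>_ker[OF Co.Zs(1)[OF cup_Z[OF u v] cup_Z[OF v u]]] by blast
 then show ?thesis by (simp only: lin_on_add[OF \<beta>_lin cup_Z[OF u v] cup_Z[OF v u]])
qed

definition psi :: "('g list => 'k) list => nat => 'g => 'k" where
 "psi bs i = (%x. if i < length bs then (bs ! i) [x] else 0)"

lemma basis_data:
 assumes bs: "distinct bs" "set bs <= Z1" "\<not> fscale.dependent (set bs)" "Z1 <= fscale.span (set bs)"
 shows "demushkin_data p G T (length bs) (psi bs) \<beta>"
proof unfold_locales
 have nth: "bs ! i : Z1" if "i < length bs" for i using bs(2) nth_mem[OF that] by blast
 have psi0: "psi bs i = 0" if "\<not> i < length bs" for i using that by (simp add: psi_def fun_eq_iff)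
 have psi1: "psi bs i = (%x. (bs ! i) [x])" if "i < length bs" for i using that by (simp add: psi_def)
 have bij: "bij_betw ((!) bs) {..<length bs} (set bs)" by (rule bij_betw_nth[OF bs(1) refl refl])
 show "psi bs i : lc" for i
  by (cases "i < length bs") (simp_all only: psi0 psi1 lc_intros(5) Z1_fun(1)[OF nth] simp_thms)
 show "psi bs i (x \<otimes> y) = psi bs i x + psi bs i y" if "x : CG" "y : CG" for x y i
  using Z1_fun(3)[OF nth that] by (simp add: psi_def)
 show "\<exists>c. f = (\<Sum>i<length bs. fscale (c i) (psi bs i))"
  if f: "f : lc" and hom: "\<And>x y. x : CG ==> y : CG ==> f (x \<otimes> y) = f x + f y" for f :: "'g => 'k"
 proof -
  have "c1 f : Z1"
   unfolding cocycles_iff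
  proof
   show "c1 f : Ch 1" by (rule c1_cochain[OF f])
   show "coboundary G (c1 f) = 0"
   proof
    fix zs
    show "coboundary G (c1 f) zs = 0 zs"
    proof (cases "length zs = 2 \<and> over zs")
     case True
     then have "zs ! 0 : CG" "zs ! 1 : CG" using nth_mem[of 0 zs] nth_mem[of 1 zs] by auto
     then show ?thesis unfolding coboundary_c1 using True by (simp add: c2_def hom)
    qed (auto simp: coboundary_c1 c2_def)
   qed
  qed
  then have "c1 f : fscale.span (set bs)" using bs(4) by blast
  then obtain u where u: "c1 f = (\<Sum>v\<in>set bs. fscale (u v) v)"
   unfolding fscale.span_finite[OF finite_set] by blast
  have "c1 f = (\<Sum>i<length bs. fscale (u (bs ! i)) (bs ! i))"
   unfolding u by (rule sum.reindex_bij_betw[OF bij, symmetric])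
  then have "c1 f [x] = (\<Sum>i<length bs. fscale (u (bs ! i)) (bs ! i)) [x]" for x by simp
  then have "f x = (\<Sum>i<length bs. fscale (u (bs ! i)) (psi bs i)) x" for x
   by (simp add: c1_def sum_apply psi_def)
  then show ?thesis by (intro exI[of _ "%i. u (bs ! i)"] ext)
 qed
 show "c i = 0" if 0: "(\<Sum>i<length bs. fscale (c i) (psi bs i)) = 0" and i: "i < length bs" for c i
 proof -
  have z0: "(\<Sum>i<length bs. fscale (c i) (bs ! i)) = 0"
  proof
   fix zs
   show "(\<Sum>i<length bs. fscale (c i) (bs ! i)) zs = 0 zs"
   proof (cases "length zs = 1")
    case True
    then obtain x where x: "zs = [x]" by (auto simp: length_Suc_conv)
    then show ?thesis using fun_cong[OF 0, of x] by (simp add: sum_apply psi_def)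
   next
    case False
    have "(bs ! i) zs = 0" if "i < length bs" for i
     using cochains_support[of "bs ! i" 1 zs] nth[OF that] False by (auto simp: cocycles_iff)
    then show ?thesis by (simp add: sum_apply)
   qed
  qed
  define u where "u = (%v. c (the_inv_into {..<length bs} ((!) bs) v))"
  have ub: "u (bs ! i) = c i" if "i < length bs" for i
   using the_inv_into_f_f[OF bij_betw_imp_inj_on[OF bij], of i] that by (simp add: u_def)
  have "(\<Sum>v\<in>set bs. fscale (u v) v) = (\<Sum>i<length bs. fscale (u (bs ! i)) (bs ! i))"
   by (rule sum.reindex_bij_betw[OF bij, symmetric])
  also have "... = (\<Sum>i<length bs. fscale (c i) (bs ! i))" by (rule sum.cong) (simp_all only: ub lessThan_iff)
  also note z0
  finally have "(\<Sum>v\<in>set bs. fscale (u v) v) = 0" .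
  then have "\<forall>v\<in>set bs. u v = 0" using bs(3) unfolding fscale.dependent_finite[OF finite_set] by blast
  then show ?thesis using ub[OF i] nth_mem[OF i] by metis
 qed
qed (use char \<beta>_lin \<beta>_ker in blast)+

lemma c1_psi: "set bs <= Z1 ==> i < length bs ==> c1 (psi bs i) = bs ! i"
 using Z1_fun(2)[of "bs ! i"] nth_mem[of i bs] unfolding psi_def by (simp add: subset_iff)

text \<open>If row \<open>i\<close> were zero, that cocycle would be orthogonal to a spanning set,
  hence 0 by nondegeneracy, which independence excludes.\<close>

lemma basis_row:
 assumes bs: "set bs <= Z1" "\<not> fscale.dependent (set bs)" "Z1 <= fscale.span (set bs)" and i: "i < length bs"
 shows "\<exists>j<length bs. \<beta> (conc (bs ! i) (bs ! j)) ~= 0"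
proof (rule ccontr)
 assume no: "\<not> ?thesis"
 have u: "bs ! i : Z1" using bs(1) nth_mem[OF i] by blast
 define S where "S = {v : Z1. \<beta> (conc (bs ! i) v) = 0}"
 have "set bs <= S" using no bs(1) by (auto simp: S_def in_set_conv_nth)
 moreover have "fscale.subspace S"
 proof (rule fscale.subspaceI)
  have "\<beta> (conc (bs ! i) 0) = 0" unfolding conc_0_right by (rule lin_on_0[OF \<beta>_lin Co.Zs(5)])
  then show "0 : S" using Co.Zs(5) by (simp only: S_def mem_Collect_eq simp_thms)
 qed (simp_all only: S_def mem_Collect_eq cup_add_right[OF u] cup_scale_right[OF u] Co.Zs(1,3) add_0 mult_zero_right simp_thms)
 ultimately have "fscale.span (set bs) <= S" by (rule fscale.span_minimal)
 then have "\<beta> (conc (bs ! i) v) = 0" if "v : Z1" for v using bs(3) that by (auto simp: S_def)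
 from nondegenerate[OF u this] have "bs ! i = 0" .
 then show False using bs(2) nth_mem[OF i] fscale.dependent_zero by metis
qed

text \<open>By antisymmetry twice the value on \<open>(u, u)\<close> is 0, so a vector that is not
  isotropic forces characteristic 2. Squaring is then injective on the finite field, hence
  surjective, and a square root of the quotient of the two values provides an isotropic combination
  of \<open>u\<close> and \<open>v\<close>.\<close>

lemma isotropic_exists:
 assumes uv: "u : Z1" "v : Z1" "u ~= v" "\<not> fscale.dependent {u, v}"
 shows "\<exists>a\<in>Z1. a ~= 0 \<and> \<beta> (conc a a) = 0"
proof -
 have nz: "u ~= 0" "v ~= 0" using uv(4) fscale.dependent_zero[of "{u, v}"] by auto
 show ?thesis
 proof (cases "\<beta> (conc u u) = 0 \<or> \<beta> (conc v v) = 0")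
  case True
  then show ?thesis using nz uv by blast
 next
  case False
  have "\<beta> (conc u u) + \<beta> (conc u u) = 0" by (rule cup_antisym[OF uv(1,1)])
  then have "2 * \<beta> (conc u u) = 0" by simp
  then have two: "(2 :: 'k) = 0" using False by simp
  have neg: "- x = x" for x :: 'k
  proof -
   have "x + x = 2 * x" by simp
   then have "x + x = 0" unfolding two by simp
   then show ?thesis by (simp only: neg_eq_iff_add_eq_0)
  qed
  have "inj (%c :: 'k. c * c)"
  proof (rule injI)
   fix c c' :: 'k assume "c * c = c' * c'"
   moreover have "(c + c') * (c - c') = c * c - c' * c'" by (simp add: algebra_simps)
   ultimately have "(c + c') * (c - c') = 0" by simp
   moreover have "c + c' = c - c'" using neg[of c'] by (metis diff_minus_eq_add)
   ultimately show "c = c'" by simp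
  qed
  then have "surj (%c :: 'k. c * c)" by (rule finite_UNIV_inj_surj[OF finite])
  from surjD[OF this, of "\<beta> (conc v v) / \<beta> (conc u u)"]
  obtain c where c: "\<beta> (conc v v) / \<beta> (conc u u) = c * c" by blast
  define a where "a = fscale c u + v"
  have cu: "fscale c u : Z1" by (rule Co.Zs(3)[OF uv(1)])
  have aZ: "a : Z1" unfolding a_def by (rule Co.Zs(1)[OF cu uv(2)])
  have "\<beta> (conc a a) = c * (c * \<beta> (conc u u)) + (\<beta> (conc (fscale c u) v) + \<beta> (conc v (fscale c u))) + \<beta> (conc v v)"
   unfolding a_def cup_add_left[OF cu uv(2) aZ[unfolded a_def]] cup_add_right[OF cu cu uv(2)] cup_add_right[OF uv(2) cu uv(2)]
    cup_scale_left[OF uv(1) cu] cup_scale_right[OF uv(1,1)]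
   by (simp only: add.assoc)
  \<comment> \<open>The mixed terms cancel by antisymmetry, and \<open>c * c\<close> turns the first
    term into a second copy of the last.\<close>
  also have "... = \<beta> (conc v v) + \<beta> (conc v v)"
   unfolding cup_antisym[OF cu uv(2)] mult.assoc[symmetric] c[symmetric] using False by simp
  also have "... = 0" by (rule cup_antisym[OF uv(2,2)])
  finally have q: "\<beta> (conc a a) = 0" .
  have "a ~= 0"
  proof
   assume "a = 0"
   then have "v = fscale (- c) u" unfolding a_def by (simp add: fun_eq_iff eq_neg_iff_add_eq_0 add.commute)
   then have "v : fscale.span {u}" using fscale.span_base[of u "{u}"] fscale.span_scale[of u "{u}" "- c"] by simp
   moreover have "{u, v} - {v} = {u}" using uv(3) by auto
   ultimately have "v : fscale.span ({u, v} - {v})" by simp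
   then have "\<exists>x\<in>{u, v}. x : fscale.span ({u, v} - {x})" by (intro bexI[of _ v]) simp_all
   then show False using uv(4) unfolding fscale.dependent_def by contradiction
  qed
  with q aZ show ?thesis by blast
 qed
qed

abbreviation "HH \<equiv> Co.alg :: ('k, ('g list => 'k) set) graded_algebra"
abbreviation "RR \<equiv> Gr.alg :: ('k, ('g set \<times> 'g set => 'k) set) graded_algebra"

theorem Koszul_duality:
 "is_quadratic_dual_of RR HH \<and> is_quadratic_dual_of HH RR \<and> PBW_algebra HH \<and> PBW_algebra RR \<and>
  koszul_algebra HH \<and> koszul_algebra RR"
proof -
 have extend: "\<exists>B. S <= B \<and> B <= Z1 \<and> \<not> fscale.dependent B \<and> Z1 <= fscale.span B \<and> finite B"
  if "S <= Z1" "\<not> fscale.dependent S" for S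
  using fscale.maximal_independent_subset_extend[OF that] finite_subset[OF _ finite_cocycles] by metis
 show ?thesis
 proof (cases "\<exists>a\<in>Z1. a ~= 0 \<and> \<beta> (conc a a) = 0")
  case True
  then obtain a where a: "a : Z1" "a ~= 0" "\<beta> (conc a a) = 0" by blast
  have "\<not> fscale.dependent {a}" using a(2) by (simp add: fscale.independent_insert fscale.independent_empty del: fscale.dependent_single)
  from extend[OF _ this] a(1) obtain B where B: "a : B" "B <= Z1" "\<not> fscale.dependent B" "Z1 <= fscale.span B" "finite B"
   by auto
  obtain xs where xs: "set xs = B - {a}" "distinct xs" using finite_distinct_list[of "B - {a}"] B(5) by blast
  define bs where "bs = a # xs"
  have bs: "distinct bs" "set bs = B" using xs B(1) by (auto simp: bs_def)
  have L: "0 < length bs" by (simp add: bs_def)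
  note fwd = bs(1) B(2)[folded bs(2)] B(3)[folded bs(2)] B(4)[folded bs(2)]
  interpret D: demushkin_data p G T "length bs" "psi bs" \<beta> by (rule basis_data[OF fwd])
  have Db: "D.b i j = \<beta> (conc (bs ! i) (bs ! j))" if "i < length bs" "j < length bs" for i j
   unfolding D.b_def by (simp only: c1_psi[OF fwd(2)] that)
  obtain l where l: "l < length bs" "\<beta> (conc (bs ! 0) (bs ! l)) ~= 0" using basis_row[OF fwd(2-4) L] by blast
  have iso: "isotropic_form (length bs) D.b 0 l"
   by unfold_locales (use L l a(3) in \<open>simp_all add: Db\<close>, simp add: bs_def)
  \<comment> \<open>In \<open>bs\<close> the isotropic cocycle comes first, as the PBW basis of
    cohomology requires; in the reversed list it comes last, as the one of the graded group algebra
    requires.\<close>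
  define cs where "cs = rev bs"
  have cs: "distinct cs" "set cs = B" "length cs = length bs" using bs by (simp_all add: cs_def)
  note bwd = cs(1) B(2)[folded cs(2)] B(3)[folded cs(2)] B(4)[folded cs(2)]
  interpret D': demushkin_data p G T "length cs" "psi cs" \<beta> by (rule basis_data[OF bwd])
  have Db': "D'.b i j = \<beta> (conc (cs ! i) (cs ! j))" if "i < length cs" "j < length cs" for i j
   unfolding D'.b_def by (simp only: c1_psi[OF bwd(2)] that)
  have L': "length cs - 1 < length cs" using L cs(3) by simp
  have last: "cs ! (length cs - 1) = a" using L by (simp add: cs_def rev_nth bs_def nth_append)
  obtain l' where l': "l' < length cs" "\<beta> (conc (cs ! (length cs - 1)) (cs ! l')) ~= 0"
   using basis_row[OF bwd(2-4) L'] by blast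
  have iso': "isotropic_form (length cs) D'.b (length cs - 1) l'"
   by unfold_locales (use L' l' a(3) last in \<open>simp_all add: Db'\<close>)
  have c: "(\<exists>m l. isotropic_form (length bs) D.b m l) \<or> length bs = 1 \<and> D.b 0 0 ~= 0" using iso by blast
  have c': "(\<exists>m l. isotropic_form (length cs) D'.b m l) \<or> length cs = 1 \<and> D'.b 0 0 ~= 0" using iso' by blast
  show ?thesis
   using D.duality[OF c] isotropic_form.PBW_H[OF iso refl D.duality(2)[OF c]]
    isotropic_form.PBW_R[OF iso' refl D'.duality(1)[OF c']] by blast
 next
  case no: False
  from extend[of "{}"] fscale.independent_empty
  obtain B where B: "B <= Z1" "\<not> fscale.dependent B" "Z1 <= fscale.span B" "finite B" by auto
  obtain bs where bs: "set bs = B" "distinct bs" using finite_distinct_list[OF B(4)] by blast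
  note fwd = bs(2) B(1)[folded bs(1)] B(2)[folded bs(1)] B(3)[folded bs(1)]
  interpret D: demushkin_data p G T "length bs" "psi bs" \<beta> by (rule basis_data[OF fwd])
  have "length bs ~= 0"
   using D.d_pos \<beta>_nonzero \<beta>_ker by blast
  \<comment> \<open>Two independent cocycles would already produce an isotropic one.\<close>
  moreover have "\<not> 2 \<le> length bs"
  proof
   assume "2 \<le> length bs"
   then obtain u v xs where uv: "bs = u # v # xs" by (metis Suc_le_length_iff numeral_2_eq_2)
   have "\<not> fscale.dependent {u, v}"
    using fscale.dependent_mono[of "{u, v}" "set bs"] fwd(3) uv by auto
   moreover have "u : Z1" "v : Z1" "u ~= v" using fwd(1,2) uv by auto
   ultimately show False using isotropic_exists no by blast
  qed
  ultimately have d1: "length bs = 1" by linarith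
  have Z: "bs ! 0 : Z1" using fwd(2) d1 nth_mem[of 0 bs] by auto
  have "bs ! 0 ~= 0" using fwd(3) d1 nth_mem[of 0 bs] fscale.dependent_zero by (metis less_numeral_extra(1))
  then have "\<beta> (conc (bs ! 0) (bs ! 0)) ~= 0" using no Z by blast
  then have b0: "D.b 0 0 ~= 0" unfolding D.b_def using d1 by (simp add: c1_psi[OF fwd(2)])
  have c: "(\<exists>m l. isotropic_form (length bs) D.b m l) \<or> length bs = 1 \<and> D.b 0 0 ~= 0" using d1 b0 by blast
  interpret F: unary_form D.b by unfold_locales (rule b0)
  show ?thesis
   using D.duality[OF c] F.PBW_H[OF D.duality(2)[OF c, unfolded d1]] F.PBW_R[OF D.duality(1)[OF c, unfolded d1]] by blast
 qed
qed

end

theorem theorem5p2: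
  fixes G :: "('g, 'm) monoid_scheme" and T :: "'g topology"
  assumes "demushkin_group TYPE('p::prime_card) G T"
    and "topologically_fin_gen G T"
  shows "let H = cohomology_algebra TYPE('p mod_ring) G T;
             R = gr_complete_group_algebra TYPE('p mod_ring) G T
         in is_quadratic_dual_of R H \<and> is_quadratic_dual_of H R \<and>
            PBW_algebra H \<and> PBW_algebra R \<and> koszul_algebra H \<and> koszul_algebra R"
proof -
 let ?H = "cohomology_algebra TYPE('p mod_ring) G T"
 interpret P: pro_p "CARD('p)" G T
  by unfold_locales (use assms(1) prime_card in \<open>simp_all add: demushkin_group_def\<close>)
 have H: "?H = P.Co.alg" by (simp add: cohomology_algebra_def)
 note dg = assms(1)[unfolded demushkin_group_def Let_def]
 obtain d where "comp_dim ?H 1 d" using conjunct1[OF conjunct2[OF dg]] by (rule exE)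
 then obtain \<theta> where \<theta>: "bij_betw \<theta> (gcomp ?H 1) {v :: nat => 'p mod_ring. \<forall>i\<ge>d. v i = 0}"
  unfolding comp_dim_def by (elim exE conjE) (rule that)
 obtain \<phi> where \<phi>: "bij_betw \<phi> (gcomp ?H 2) (UNIV :: 'p mod_ring set)"
  and \<phi>_add: "\<forall>x\<in>gcomp ?H 2. \<forall>y\<in>gcomp ?H 2. \<phi> (gadd ?H 2 x y) = \<phi> x + \<phi> y"
  and \<phi>_scale: "\<forall>c. \<forall>x\<in>gcomp ?H 2. \<phi> (gsmult ?H 2 c x) = c * \<phi> x"
  and \<phi>_nd: "\<forall>a\<in>gcomp ?H 1. (\<forall>b\<in>gcomp ?H 1. \<phi> (gmult ?H 1 1 a b) = 0) --> a = gzero ?H 1"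
  using conjunct2[OF conjunct2[OF dg]] by (elim exE conjE) (rule that)
 define \<beta> where "\<beta> z = \<phi> (z +o coboundaries G T 2)" for z
 \<comment> \<open>With trivial coefficients a cochain of degree 0 has coboundary 0, so statements
   about H^1 transfer literally to cocycles.\<close>
 have B1: "coboundaries G T 1 = {0 :: 'g list => 'p mod_ring}"
  unfolding One_nat_def P.coboundaries_Suc
  using P.coboundary_cochain_0 fscale.subspace_0[OF P.cochains_subspace] by force
 interpret D: demushkin_pairing "CARD('p)" G T \<beta>
 proof unfold_locales
  show "of_nat CARD('p) = (0 :: 'p mod_ring)" by simp
  \<comment> \<open>\<open>comp_dim\<close> identifies H^1 with the vectors supported below
    \<open>d\<close> over a finite field, so H^1 is finite as a set.\<close>
  have "finite {v :: nat => 'p mod_ring. \<forall>x. (x : {..<d} --> v x : UNIV) \<and> (x \<notin> {..<d} --> v x = 0)}"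
   by (rule finite_set_of_finite_funs) simp_all
  moreover have "{v :: nat => 'p mod_ring. \<forall>x. (x : {..<d} --> v x : UNIV) \<and> (x \<notin> {..<d} --> v x = 0)} = {v. \<forall>i\<ge>d. v i = 0}"
   by auto
  ultimately have "finite (gcomp ?H 1)" using bij_betw_finite[OF \<theta>] by simp
  moreover have "inj_on (%z. z +o coboundaries G T 1) (cocycles G T 1 :: ('g list => 'p mod_ring) set)"
  proof (rule inj_onI)
   fix x y :: "'g list => 'p mod_ring" assume "x +o coboundaries G T 1 = y +o coboundaries G T 1"
   then have "x - y : coboundaries G T 1" by (simp only: P.Co.coset_eq_iff)
   then show "x = y" unfolding B1 by simp
  qed
  ultimately show "finite (cocycles G T 1 :: ('g list => 'p mod_ring) set)"
   unfolding H P.Co.alg_comp by (rule finite_imageD)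
  show lin: "lin_on (cocycles G T 2) \<beta>"
  proof (rule lin_onI)
   show "\<beta> (x + y) = \<beta> x + \<beta> y" if "x : cocycles G T 2" "y : cocycles G T 2" for x y
    using bspec[OF bspec[OF \<phi>_add[unfolded H] P.Co.comp_coset[OF that(1)]] P.Co.comp_coset[OF that(2)]]
    unfolding P.Co.alg_add \<beta>_def .
   show "\<beta> (fscale c x) = c * \<beta> x" if "x : cocycles G T 2" for c x
    using bspec[OF spec[OF \<phi>_scale[unfolded H], of c] P.Co.comp_coset[OF that]] unfolding P.Co.alg_scale \<beta>_def .
  qed
  show "\<beta> z = 0 \<longleftrightarrow> z : coboundaries G T 2" if z: "z : cocycles G T 2" for z
  proof -
   have "\<beta> z = 0 \<longleftrightarrow> \<beta> z = \<beta> 0" using lin_on_0[OF lin P.Co.Zs(5)] by simp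
   also have "... \<longleftrightarrow> z +o coboundaries G T 2 = 0 +o coboundaries G T 2"
    unfolding \<beta>_def
    using inj_on_eq_iff[OF bij_betw_imp_inj_on[OF \<phi>[unfolded H]] P.Co.comp_coset[OF z] P.Co.comp_coset[OF P.Co.Zs(5)]] .
   also have "... \<longleftrightarrow> z : coboundaries G T 2" unfolding P.Co.coset_eq_iff by simp
   finally show ?thesis .
  qed
  show "\<exists>z\<in>cocycles G T 2. \<beta> z ~= 0"
  proof -
   have "1 : \<phi> ` gcomp P.Co.alg 2" using bij_betw_imp_surj_on[OF \<phi>] unfolding H by simp
   then obtain X where X: "X : gcomp P.Co.alg 2" "\<phi> X = 1" by auto
   obtain z where "z : cocycles G T 2" "X = z +o coboundaries G T 2" using X(1) by (rule P.Co.compE)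
   then show ?thesis using X(2) by (intro bexI[of _ z]) (simp_all add: \<beta>_def)
  qed
  show "u = 0" if u: "u : cocycles G T 1" and 0: "\<And>v. v : cocycles G T 1 ==> \<beta> (conc u v) = 0" for u
  proof -
   have "u +o coboundaries G T 1 = gzero ?H 1"
   proof (rule mp[OF bspec[OF \<phi>_nd] ballI])
    show "u +o coboundaries G T 1 : gcomp ?H 1" unfolding H by (rule P.Co.comp_coset[OF u])
    fix X assume "X : gcomp ?H 1"
    then obtain v where v: "v : cocycles G T 1" "X = v +o coboundaries G T 1" unfolding H by (rule P.Co.compE)
    show "\<phi> (gmult ?H 1 1 (u +o coboundaries G T 1) X) = 0"
     unfolding H v(2) P.Co.alg_mult[OF u v(1)] using 0[OF v(1)] by (simp only: \<beta>_def one_add_one)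
   qed
   also have "... = 0 +o coboundaries G T 1" unfolding H P.Co.alg_zero by simp
   finally have "u - 0 : coboundaries G T 1" by (simp only: P.Co.coset_eq_iff)
   then show ?thesis unfolding B1 by simp
  qed
 qed
 show ?thesis
  unfolding Let_def H gr_complete_group_algebra_def using D.Koszul_duality by blast
qed

end
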